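(* Let $\Bbbk$ be a field of characteristic $0$ and $V$ an $n$-dimensional $\Bbbk$-vector space. For $x\in U_{\mathrm{Comm}}$, the algebra $V_x$ is finite étale and satisfies $HH^m(V_x,V_x)=0$ and $\mathrm{Harr}^m(V_x,V_x)=0$ for $m>0$. Consequently, $$T_x\mathrm{Comm}(V)=T_x(\mathrm{GL}(V)\cdot x)\quad\text{and}\quad T_{[x]}[\mathrm{Comm}(V)/\mathrm{GL}(V)]=0.$$ Thus each $\mathrm{GL}(V)$-orbit in $U_{\mathrm{Comm}}$ is Zariski open, and $[x]$ is isolated in the coarse moduli space $\mathrm{Comm}(V)/\!/\mathrm{GL}(V)$.
   Context: Fix a basis $(e_i)_{i=1}^n$ of $V$. $V^{2,1}=\mathrm{Hom}(V\otimes V,V)\cong\Bbbk^{n^3}$; each $x\in V^{2,1}$ has structure constants $x_{i,j}^\ell$ and determines the product $\mu_x(e_i,e_j)=\sum_\ell x_{i,j}^\ell e_\ell$; $V_x=(V,\mu_x)$. $\mathrm{Alg}(V)$ is the closed subscheme of $V^{2,1}$ of associative products, cut out by the $n^4$ quadratic polynomials expressing associativity. $\mathrm{Comm}(V)$ is the closed subscheme of $\mathrm{Alg}(V)$ cut out by the linear equations $x_{i,j}^\ell=x_{j,i}^\ell$. $\mathrm{GL}(V)$ acts by $(g\cdot\mu)(a,b)=g\,\mu(g^{-1}a,g^{-1}b)$. Let $L_z$ be left multiplication by $z$ in $V_x$ and $\Delta(x)=\det(\mathrm{Tr}(L_{e_ie_j}))_{i,j}$. Then $U_{\mathrm{Comm}}=\{x\in\mathrm{Comm}(V):\Delta(x)\neq0\}$.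 $HH^m$ is Hochschild cohomology and $\mathrm{Harr}^m$ is Harrison cohomology of the commutative algebra $V_x$ with coefficients in itself (computed by Hochschild cochains satisfying the shuffle relations, i.e. vanishing on proper shuffles; in degree $2$ these are the symmetric cochains). A finite étale $\Bbbk$-algebra is a finite product of finite separable field extensions of $\Bbbk$. $[\mathrm{Comm}(V)/\mathrm{GL}(V)]$ is the quotient stack, with tangent space at $[x]$ equal to $T_x\mathrm{Comm}(V)/T_x(\mathrm{GL}(V)\cdot x)$. $\mathrm{Comm}(V)/\!/\mathrm{GL}(V)$ is the coarse GIT quotient. *)

theory Defs
  imports
    "HOL-Library.Poly_Mapping"
    "HOL-Combinatorics.Permutations"
    "HOL-Computational_Algebra.Polynomial_Factorial"
    "HOL-Algebra.Embedded_Algebras"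
    "Jordan_Normal_Form.Determinant"
begin

text \<open>
  \<open>V\<close> is the whole type \<open>'v\<close>, with scalar multiplication \<open>scale\<close>, and \<open>e 0, \<dots>, e (n - 1)\<close> is
  a basis of it (\<open>n = 0\<close> is allowed). A product is given by its array \<open>x i j l\<close> of structure
  constants, where \<open>i, j, l < n\<close>.
\<close>

definition is_basis ::
    "('k::field \<Rightarrow> 'v::ab_group_add \<Rightarrow> 'v) \<Rightarrow> nat \<Rightarrow> (nat \<Rightarrow> 'v) \<Rightarrow> bool" where
  "is_basis scale n e \<longleftrightarrow>
     inj_on e {..<n} \<and>
     \<not> Modules.module.dependent scale (e ` {..<n}) \<and>
     Modules.module.span scale (e ` {..<n}) = UNIV"

definition coordinate ::
    "('k::field \<Rightarrow> 'v::ab_group_add \<Rightarrow> 'v) \<Rightarrow> nat \<Rightarrow> (nat \<Rightarrow> 'v) \<Rightarrow> 'v \<Rightarrow> nat \<Rightarrow> 'k" where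
  "coordinate scale n e v i = Modules.module.representation scale (e ` {..<n}) v (e i)"

definition endo_trace ::
    "('k::field \<Rightarrow> 'v::ab_group_add \<Rightarrow> 'v) \<Rightarrow> nat \<Rightarrow> (nat \<Rightarrow> 'v) \<Rightarrow> ('v \<Rightarrow> 'v) \<Rightarrow> 'k" where
  "endo_trace scale n e T = (\<Sum>i<n. coordinate scale n e (T (e i)) i)"

text \<open>Entries outside the index range are required to be zero, so that arrays are \<open>n\<^sup>3\<close>-tuples.\<close>

definition V21 :: "nat \<Rightarrow> (nat \<Rightarrow> nat \<Rightarrow> nat \<Rightarrow> 'k::zero) set" where
  "V21 n = {x. \<forall>i j l. \<not> (i < n \<and> j < n \<and> l < n) \<longrightarrow> x i j l = 0}"

definition alg_mult ::
    "('k::field \<Rightarrow> 'v::ab_group_add \<Rightarrow> 'v) \<Rightarrow> nat \<Rightarrow> (nat \<Rightarrow> 'v) \<Rightarrow>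
     (nat \<Rightarrow> nat \<Rightarrow> nat \<Rightarrow> 'k) \<Rightarrow> 'v \<Rightarrow> 'v \<Rightarrow> 'v" where
  "alg_mult scale n e x a b =
     (\<Sum>i<n. \<Sum>j<n. \<Sum>l<n.
        scale (coordinate scale n e a i * coordinate scale n e b j * x i j l) (e l))"

definition discr ::
    "('k::field \<Rightarrow> 'v::ab_group_add \<Rightarrow> 'v) \<Rightarrow> nat \<Rightarrow> (nat \<Rightarrow> 'v) \<Rightarrow>
     (nat \<Rightarrow> nat \<Rightarrow> nat \<Rightarrow> 'k) \<Rightarrow> 'k" where
  "discr scale n e x =
     (let \<mu> = alg_mult scale n e x in
      Determinant.det (mat n n (\<lambda>(i, j). endo_trace scale n e (\<mu> (\<mu> (e i) (e j))))))"

definition type_ring :: "'r::{times,plus,one,zero} ring" where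
  "type_ring = \<lparr>carrier = UNIV, monoid.mult = (*), one = 1, zero = 0, add = (+)\<rparr>"

text \<open>The ring \<open>F\<close> is a finite separable field extension of \<open>'k\<close> via the embedding \<open>\<iota>\<close>:
  each element is a root of an irreducible polynomial (its minimal polynomial up to a unit)
  that is coprime to its derivative.\<close>

definition finite_separable_extension :: "'f ring \<Rightarrow> ('k::field \<Rightarrow> 'f) \<Rightarrow> bool" where
  "finite_separable_extension F \<iota> \<longleftrightarrow>
     field F \<and> \<iota> \<in> Ring.ring_hom type_ring F \<and>
     ring.finite_dimension F (range \<iota>) (carrier F) \<and>
     (\<forall>a\<in>carrier F. \<exists>p :: 'k poly. irreducible p \<and> coprime p (pderiv p) \<and>
        (\<Oplus>\<^bsub>F\<^esub>i\<in>{..degree p}. \<iota> (poly.coeff p i) \<otimes>\<^bsub>F\<^esub> a [^]\<^bsub>F\<^esub> i) = \<zero>\<^bsub>F\<^esub>)"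

text \<open>The \<open>'k\<close>-algebra \<open>'v\<close> with product \<open>\<mu>\<close> is isomorphic to the product of
  finite separable field extensions \<open>F 0, \<dots>, F (r - 1)\<close> of \<open>'k\<close>. Taking the carriers of the
  factors inside \<open>'v\<close> loses nothing, as each factor of a product embeds linearly in the product.\<close>

definition finite_etale ::
    "('k::field \<Rightarrow> 'v::ab_group_add \<Rightarrow> 'v) \<Rightarrow> ('v \<Rightarrow> 'v \<Rightarrow> 'v) \<Rightarrow> bool" where
  "finite_etale scale \<mu> \<longleftrightarrow>
     (\<exists>(r::nat) (F :: nat \<Rightarrow> 'v ring) (\<iota> :: nat \<Rightarrow> 'k \<Rightarrow> 'v) (\<psi> :: 'v \<Rightarrow> nat \<Rightarrow> 'v).
        (\<forall>s<r. finite_separable_extension (F s) (\<iota> s)) \<and>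
        bij_betw \<psi> UNIV (\<Pi>\<^sub>E s\<in>{..<r}. carrier (F s)) \<and>
        (\<forall>a b. \<forall>s<r. \<psi> (a + b) s = \<psi> a s \<oplus>\<^bsub>F s\<^esub> \<psi> b s) \<and>
        (\<forall>c a. \<forall>s<r. \<psi> (scale c a) s = \<iota> s c \<otimes>\<^bsub>F s\<^esub> \<psi> a s) \<and>
        (\<forall>a b. \<forall>s<r. \<psi> (\<mu> a b) s = \<psi> a s \<otimes>\<^bsub>F s\<^esub> \<psi> b s))"

text \<open>The quotient \<open>W / U\<close> as the set of cosets; it is the zero space iff \<open>U\<close> is the only coset.\<close>

definition quotient_space :: "'w::minus set \<Rightarrow> 'w set \<Rightarrow> 'w set set" where
  "quotient_space W U = W // {(w, w'). w \<in> W \<and> w' \<in> W \<and> w - w' \<in> U}"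

text \<open>An \<open>m\<close>-cochain is a multilinear function of \<open>m\<close> arguments, passed as a list of length \<open>m\<close>;
  by convention it is zero on lists of any other length.\<close>

definition cochains ::
    "('k::field \<Rightarrow> 'v::ab_group_add \<Rightarrow> 'v) \<Rightarrow> nat \<Rightarrow> ('v list \<Rightarrow> 'v) set" where
  "cochains scale m =
     {f. (\<forall>as. length as \<noteq> m \<longrightarrow> f as = 0) \<and>
         (\<forall>as i. length as = m \<and> i < m \<longrightarrow>
            Vector_Spaces.linear scale scale (\<lambda>v. f (as[i := v])))}"

definition hochschild_d ::
    "('k::field \<Rightarrow> 'v::ab_group_add \<Rightarrow> 'v) \<Rightarrow> ('v \<Rightarrow> 'v \<Rightarrow> 'v) \<Rightarrow> nat \<Rightarrow>
     ('v list \<Rightarrow> 'v) \<Rightarrow> 'v list \<Rightarrow> 'v" where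
  "hochschild_d scale \<mu> m f as =
     (if length as = m + 1 then
        \<mu> (hd as) (f (tl as))
        + (\<Sum>i<m. scale ((- 1) ^ (i + 1))
             (f (take i as @ [\<mu> (as ! i) (as ! (i + 1))] @ drop (i + 2) as)))
        + scale ((- 1) ^ (m + 1)) (\<mu> (f (butlast as)) (last as))
      else 0)"

text \<open>Cohomology in degree \<open>m\<close> of a subcomplex \<open>C\<close> of the Hochschild complex.\<close>

definition cocycles where
  "cocycles scale \<mu> C m = {f \<in> C m. hochschild_d scale \<mu> m f = (\<lambda>_. 0)}"

definition coboundaries where
  "coboundaries scale \<mu> C m =
     (if m = 0 then {\<lambda>_. 0} else hochschild_d scale \<mu> (m - 1) ` C (m - 1))"

definition HH ::
    "('k::field \<Rightarrow> 'v::ab_group_add \<Rightarrow> 'v) \<Rightarrow> ('v \<Rightarrow> 'v \<Rightarrow> 'v) \<Rightarrow> nat \<Rightarrow> ('v list \<Rightarrow> 'v) set set" where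
  "HH scale \<mu> m =
     quotient_space (cocycles scale \<mu> (cochains scale) m)
                    (coboundaries scale \<mu> (cochains scale) m)"

text \<open>\<open>\<sigma>\<close> moves the argument in position \<open>i\<close> to position \<open>\<sigma> i\<close>, keeping the order within the
  first \<open>p\<close> and within the last \<open>m - p\<close> arguments.\<close>

definition shuffle_perms :: "nat \<Rightarrow> nat \<Rightarrow> (nat \<Rightarrow> nat) set" where
  "shuffle_perms p m =
     {\<sigma>. \<sigma> permutes {..<m} \<and> strict_mono_on {..<p} \<sigma> \<and> strict_mono_on {p..<m} \<sigma>}"

text \<open>In degree 0 there is no shuffle condition; for a commutative algebra the differential on
  degree 0 is zero, so this does not affect positive degrees.\<close>

definition harrison_cochains ::
    "('k::field \<Rightarrow> 'v::ab_group_add \<Rightarrow> 'v) \<Rightarrow> nat \<Rightarrow> ('v list \<Rightarrow> 'v) set" where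
  "harrison_cochains scale m =
     {f \<in> cochains scale m.
        \<forall>p as. 0 < p \<and> p < m \<and> length as = m \<longrightarrow>
          (\<Sum>\<sigma>\<in>shuffle_perms p m.
             scale (of_int (sign \<sigma>)) (f (permute_list (inv_into UNIV \<sigma>) as))) = 0}"

definition Harr ::
    "('k::field \<Rightarrow> 'v::ab_group_add \<Rightarrow> 'v) \<Rightarrow> ('v \<Rightarrow> 'v \<Rightarrow> 'v) \<Rightarrow> nat \<Rightarrow> ('v list \<Rightarrow> 'v) set set" where
  "Harr scale \<mu> m =
     quotient_space (cocycles scale \<mu> (harrison_cochains scale) m)
                    (coboundaries scale \<mu> (harrison_cochains scale) m)"

text \<open>\<open>Xc i j l\<close> is the coordinate \<open>x\<^bsub>i,j\<^esub>\<^sup>l\<close> on \<open>V\<^bsup>2,1\<^esup>\<close>. \<open>Gc i j\<close> and \<open>Hc i j\<close> are the entries in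
  row \<open>i\<close>, column \<open>j\<close> of the generic invertible matrix and of its inverse, respectively.\<close>

datatype coord = Xc nat nat nat | Gc nat nat | Hc nat nat

type_synonym 'k cpoly = "(coord \<Rightarrow>\<^sub>0 nat) \<Rightarrow>\<^sub>0 'k"

definition const :: "'k::zero \<Rightarrow> 'k cpoly" where
  "const c = Poly_Mapping.single 0 c"

definition pvar :: "coord \<Rightarrow> 'k::zero_neq_one cpoly" where
  "pvar v = Poly_Mapping.single (Poly_Mapping.single v 1) 1"

text \<open>Evaluation of a polynomial with coefficients mapped along \<open>h\<close>, at the point \<open>y\<close>.\<close>

definition poly_eval :: "('k::zero \<Rightarrow> 'r::comm_ring_1) \<Rightarrow> (coord \<Rightarrow> 'r) \<Rightarrow> 'k cpoly \<Rightarrow> 'r" where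
  "poly_eval h y f =
     (\<Sum>m\<in>Poly_Mapping.keys f. h (Poly_Mapping.lookup f m) * (\<Prod>v\<in>Poly_Mapping.keys m. y v ^ Poly_Mapping.lookup m v))"

text \<open>Evaluation at an array; meant for polynomials in the \<open>Xc\<close> only.\<close>

definition evalX ::
    "('k::zero \<Rightarrow> 'r::comm_ring_1) \<Rightarrow> (nat \<Rightarrow> nat \<Rightarrow> nat \<Rightarrow> 'r) \<Rightarrow> 'k cpoly \<Rightarrow> 'r" where
  "evalX h y = poly_eval h (\<lambda>v. case v of Xc i j l \<Rightarrow> y i j l | Gc _ _ \<Rightarrow> 0 | Hc _ _ \<Rightarrow> 0)"

definition Xvars :: "nat \<Rightarrow> coord set" where
  "Xvars n = {Xc i j l | i j l. i < n \<and> j < n \<and> l < n}"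

definition GLvars :: "nat \<Rightarrow> coord set" where
  "GLvars n = {Gc i j | i j. i < n \<and> j < n} \<union> {Hc i j | i j. i < n \<and> j < n}"

definition poly_ring :: "coord set \<Rightarrow> 'k::field cpoly ring" where
  "poly_ring S = type_ring\<lparr>carrier := {f. \<forall>m\<in>Poly_Mapping.keys f. Poly_Mapping.keys m \<subseteq> S}\<rparr>"

text \<open>The points of the closed subscheme of \<open>Spec R\<close> defined by \<open>I\<close>, as primes of \<open>R\<close>.\<close>

definition closed_subscheme :: "('a, 'b) ring_scheme \<Rightarrow> 'a set \<Rightarrow> 'a set set" where
  "closed_subscheme R I = {P. primeideal P R \<and> I \<subseteq> P}"

definition zariski_open :: "('a, 'b) ring_scheme \<Rightarrow> 'a set \<Rightarrow> 'a set set \<Rightarrow> bool" where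
  "zariski_open R I U \<longleftrightarrow>
     (\<exists>S\<subseteq>carrier R. U = {P \<in> closed_subscheme R I. \<not> S \<subseteq> P})"

text \<open>Zariski tangent space, at the rational point \<open>x\<close>, of the closed subscheme of \<open>V\<^bsup>2,1\<^esup>\<close> defined
  by \<open>I\<close>: the \<open>v\<close> for which \<open>x + t v\<close> is a point of it over the dual numbers \<open>k[t]/(t\<^sup>2)\<close>.\<close>

definition tangent_space ::
    "nat \<Rightarrow> 'k::field cpoly set \<Rightarrow> (nat \<Rightarrow> nat \<Rightarrow> nat \<Rightarrow> 'k) \<Rightarrow> (nat \<Rightarrow> nat \<Rightarrow> nat \<Rightarrow> 'k) set" where
  "tangent_space n I x =
     {v \<in> V21 n. \<forall>f\<in>I. [:0, 0, 1:] dvd evalX (\<lambda>c. [:c:]) (\<lambda>i j l. [:x i j l, v i j l:]) f}"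

definition assoc_eqs :: "nat \<Rightarrow> 'k::field cpoly set" where
  "assoc_eqs n =
     {(\<Sum>l<n. pvar (Xc i j l) * pvar (Xc l k m)) - (\<Sum>l<n. pvar (Xc j k l) * pvar (Xc i l m))
       | i j k m. i < n \<and> j < n \<and> k < n \<and> m < n}"

definition comm_eqs :: "nat \<Rightarrow> 'k::field cpoly set" where
  "comm_eqs n = {pvar (Xc i j l) - pvar (Xc j i l) | i j l. i < n \<and> j < n \<and> l < n}"

definition Comm_ideal :: "nat \<Rightarrow> 'k::field cpoly set" where
  "Comm_ideal n = Idl\<^bsub>poly_ring (Xvars n)\<^esub> (assoc_eqs n \<union> comm_eqs n)"

definition Comm :: "nat \<Rightarrow> (nat \<Rightarrow> nat \<Rightarrow> nat \<Rightarrow> 'k::field) set" where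
  "Comm n = {x \<in> V21 n. \<forall>f\<in>Comm_ideal n. evalX (\<lambda>c. c) x f = 0}"

definition U_Comm ::
    "('k::field \<Rightarrow> 'v::ab_group_add \<Rightarrow> 'v) \<Rightarrow> nat \<Rightarrow> (nat \<Rightarrow> 'v) \<Rightarrow>
     (nat \<Rightarrow> nat \<Rightarrow> nat \<Rightarrow> 'k) set" where
  "U_Comm scale n e = {x \<in> Comm n. discr scale n e x \<noteq> 0}"

definition GL_eqs :: "nat \<Rightarrow> 'k::field cpoly set" where
  "GL_eqs n =
     {(\<Sum>l<n. pvar (Gc i l) * pvar (Hc l j)) - (if i = j then 1 else 0) | i j. i < n \<and> j < n} \<union>
     {(\<Sum>l<n. pvar (Hc i l) * pvar (Gc l j)) - (if i = j then 1 else 0) | i j. i < n \<and> j < n}"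

text \<open>The structure constants of \<open>(a, b) \<mapsto> g \<mu>(g\<^sup>-\<^sup>1 a, g\<^sup>-\<^sup>1 b)\<close>, where \<open>y\<close> are those of \<open>\<mu>\<close> and
  \<open>g\<close> is the generic matrix (columns are the images of the basis vectors).\<close>

definition generic_act ::
    "nat \<Rightarrow> (nat \<Rightarrow> nat \<Rightarrow> nat \<Rightarrow> 'k::field cpoly) \<Rightarrow> nat \<Rightarrow> nat \<Rightarrow> nat \<Rightarrow> 'k cpoly" where
  "generic_act n y i j l =
     (\<Sum>a<n. \<Sum>b<n. \<Sum>c<n. pvar (Gc l c) * y a b c * pvar (Hc a i) * pvar (Hc b j))"

text \<open>The orbit of the rational point \<open>x\<close> is the image of the morphism of schemes
  \<open>g \<mapsto> g \<cdot> x\<close> from \<open>GL(V)\<close> to \<open>V\<^bsup>2,1\<^esup>\<close>, i.e. the set of preimages, under the comorphism, of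
  the primes of \<open>k[GL(V)]\<close>. (The orbit under the group of rational points of \<open>GL(V)\<close> is smaller
  when \<open>k\<close> is not algebraically closed.)\<close>

definition orbit :: "nat \<Rightarrow> (nat \<Rightarrow> nat \<Rightarrow> nat \<Rightarrow> 'k::field) \<Rightarrow> 'k cpoly set set" where
  "orbit n x =
     (\<lambda>Q. {f \<in> carrier (poly_ring (Xvars n)).
             evalX const (generic_act n (\<lambda>i j l. const (x i j l))) f \<in> Q})
     ` closed_subscheme (poly_ring (GLvars n)) (GL_eqs n)"

text \<open>The orbit, with its reduced structure, is an open subscheme of its closure; the latter is
  defined by the intersection of the primes belonging to the orbit. Hence the two have the same
  tangent space at \<open>x\<close>.\<close>

definition orbit_tangent_space ::
    "nat \<Rightarrow> (nat \<Rightarrow> nat \<Rightarrow> nat \<Rightarrow> 'k::field) \<Rightarrow> (nat \<Rightarrow> nat \<Rightarrow> nat \<Rightarrow> 'k) set" where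
  "orbit_tangent_space n x = tangent_space n (\<Inter>(orbit n x)) x"

definition stack_tangent_space ::
    "nat \<Rightarrow> (nat \<Rightarrow> nat \<Rightarrow> nat \<Rightarrow> 'k::field) \<Rightarrow> (nat \<Rightarrow> nat \<Rightarrow> nat \<Rightarrow> 'k) set set" where
  "stack_tangent_space n x =
     quotient_space (tangent_space n (Comm_ideal n) x) (orbit_tangent_space n x)"

text \<open>The \<open>GL(V)\<close>-invariants \<open>f\<close> in the coordinate ring of \<open>Comm(V)\<close>, i.e. those for which
  \<open>f(g \<cdot> x) = f(x)\<close> as functions on \<open>GL(V) \<times> Comm(V)\<close>. The ring of invariants is represented by
  its preimage in the polynomial ring, which contains \<open>Comm_ideal n\<close>; accordingly its spectrum,
  the quotient \<open>Comm(V)//GL(V)\<close>, is \<open>closed_subscheme (invariants n) (Comm_ideal n)\<close>.\<close>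

definition invariants :: "nat \<Rightarrow> 'k::field cpoly ring" where
  "invariants n = (poly_ring (Xvars n))\<lparr>carrier :=
     {f \<in> carrier (poly_ring (Xvars n)).
        evalX const (generic_act n (\<lambda>i j l. pvar (Xc i j l))) f - f
          \<in> Idl\<^bsub>poly_ring (Xvars n \<union> GLvars n)\<^esub> (GL_eqs n \<union> assoc_eqs n \<union> comm_eqs n)}\<rparr>"

definition moduli_point :: "nat \<Rightarrow> (nat \<Rightarrow> nat \<Rightarrow> nat \<Rightarrow> 'k::field) \<Rightarrow> 'k cpoly set" where
  "moduli_point n x = {f \<in> carrier (invariants n). evalX (\<lambda>c. c) x f = 0}"

end

theory Submission
  imports Defs "HOL-Algebra.Algebraic_Closure_Type" "HOL-Computational_Algebra.Formal_Power_Series"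
begin

hide_const (open) Polynomials.degree Polynomials.lead_coeff Polynomial_Divisibility.poly_ring
  Divisibility.irreducible Divisibility.prime

text \<open>
  Since the trace form of \<open>V\<^sub>x\<close> is nondegenerate and nilpotents have trace zero, \<open>V\<^sub>x\<close> is reduced, hence
  a product of fields, which are separable in characteristic 0. If \<open>d\<close> is the basis dual to \<open>e\<close> for
  the trace form, contraction with the Casimir element \<open>\<Sum> e\<^sub>i \<otimes> d\<^sub>i\<close> is a contracting homotopy of the
  Hochschild complex. The second Adams operation (deconcatenate, then shuffle) commutes with the
  differential and acts as the scalar 2 on Harrison cochains, so a Hochschild primitive of a Harrison
  cocycle can be projected, eigenvalue by eigenvalue, to a Harrison primitive.

  Over an algebraically closed field any two algebras with nonzero discriminant are conjugate. With the
  Nullstellensatz and the existence of primes avoiding a multiplicative set, this shows that the orbit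
  of \<open>x\<close> is the locus \<open>\<Delta> \<noteq> 0\<close> in \<open>Comm(V)\<close>. A tangent vector of \<open>Comm(V)\<close> at \<open>x\<close> is a 2-cocycle, hence
  the coboundary of some \<open>D\<close>, hence the velocity of the curve \<open>(1 - t D) \<cdot> x\<close> in the orbit. Finally,
  homotheties dilate the structure constants, so the invariants on \<open>Comm(V)\<close> are constant and the
  coarse moduli space is a single point.
\<close>

section \<open>Shuffles and deconcatenation\<close>

text \<open>The Casimir contraction inserts an entry in the first slot only, so it yields Hochschild
  primitives but gives no control over the shuffle relations. The Harrison statement therefore needs
  a projection in characteristic 0, for which the signs of shuffles and deconcatenations have to be
  worked out. Cochains are treated as functionals on words: the shuffle algebra acts on them by
  transposition, and no tensor products are formed.

  The orbit is a set of primes, non-closed points included, and k need not be algebraically closed.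
  To lift a prime P of Comm(V) to GL(V) is to find a prime that contains the image of P and avoids
  the image of its complement. That these two do not interfere is tested at points over the
  algebraic closure, where a nonzero discriminant forces conjugacy. The tangent space of the orbit
  is defined through the intersection of its primes, so a tangent vector has to come from a point
  with values in a domain; the dual numbers are not one. Hence the curve is taken over k[[t]], where
  \<open>1 - t D\<close> is invertible, and truncated modulo t^2 only afterwards.\<close>

definition alt_sgn :: "nat \<Rightarrow> 'w \<Rightarrow> 'w::ab_group_add" where
  "alt_sgn n w = (if even n then w else - w)"

lemma alt_sgn_0 [simp]: "alt_sgn n 0 = 0" "alt_sgn 0 w = w"
  by (simp_all add: alt_sgn_def)

lemma alt_sgn_add: "alt_sgn n (u + v) = alt_sgn n u + alt_sgn n v"
  by (simp add: alt_sgn_def)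

text \<open>The signed sum of \<open>f\<close> over all shuffles of two lists. Unlike the sum over \<open>shuffle_perms\<close>, the
  recursion on the first entries is amenable to induction.\<close>

fun shuffle :: "('a list \<Rightarrow> 'w) \<Rightarrow> 'a list \<Rightarrow> 'a list \<Rightarrow> 'w::ab_group_add" where
  "shuffle f [] ys = f ys"
| "shuffle f (a # xs) [] = f (a # xs)"
| "shuffle f (a # xs) (b # ys) =
     shuffle (\<lambda>c. f (a # c)) xs (b # ys) + alt_sgn (Suc (length xs)) (shuffle (\<lambda>c. f (b # c)) (a # xs) ys)"

lemma shuffle_Nil2 [simp]: "shuffle f xs [] = f xs"
  by (cases xs) auto

lemma shuffle_hom:
  fixes \<phi> :: "'b::ab_group_add \<Rightarrow> 'w::ab_group_add"
  assumes "\<And>u v. \<phi> (u + v) = \<phi> u + \<phi> v"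
  shows "shuffle (\<lambda>c. \<phi> (f c)) xs ys = \<phi> (shuffle f xs ys)"
proof -
  have neg: "\<phi> (- u) = - \<phi> u" for u
    using assms[of u "-u"] assms[of 0 0] by (simp add: eq_neg_iff_add_eq_0 add.commute)
  show ?thesis
    by (induction f xs ys rule: shuffle.induct) (auto simp: alt_sgn_def assms neg)
qed

lemma shuffle_add: "shuffle (\<lambda>c. f c + g c) xs ys = shuffle f xs ys + shuffle g xs ys"
proof (induction "length xs + length ys" arbitrary: f g xs ys rule: less_induct)
  case less
  then show ?case by (cases xs; cases ys) (auto simp: alt_sgn_def)
qed

lemma shuffle_neg: "shuffle (\<lambda>c. - f c) xs ys = - shuffle f xs ys"
  by (rule shuffle_hom) simp

lemma shuffle_diff: "shuffle (\<lambda>c. f c - g c) xs ys = shuffle f xs ys - shuffle g xs ys"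
  using shuffle_add[of f "\<lambda>c. - g c"] by (simp add: shuffle_neg)

lemma shuffle_alt_sgn: "shuffle (\<lambda>c. alt_sgn n (f c)) xs ys = alt_sgn n (shuffle f xs ys)"
  by (rule shuffle_hom) (simp add: alt_sgn_def)

lemma shuffle_zero [simp]: "shuffle (\<lambda>c. 0) xs ys = 0"
  using shuffle_hom[of "\<lambda>_. 0" "\<lambda>_. 0"] by simp

text \<open>Signs in the recursion depend on the length of an intermediate word. That length is
  constant over one shuffle, and this congruence lets such a sign be pulled out.\<close>

lemma shuffle_cong_length:
  "(\<And>c. length c = length xs + length ys \<Longrightarrow> f c = g c) \<Longrightarrow> shuffle f xs ys = shuffle g xs ys"
proof (induction "length xs + length ys" arbitrary: f g xs ys rule: less_induct)
  case less
  show ?case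
  proof (cases xs)
    case Nil then show ?thesis using less.prems by simp
  next
    case xs: (Cons a xs')
    show ?thesis
    proof (cases ys)
      case Nil then show ?thesis using less.prems by simp
    next
      case ys: (Cons b ys')
      have "shuffle (\<lambda>c. f (a # c)) xs' (b # ys') = shuffle (\<lambda>c. g (a # c)) xs' (b # ys')"
        by (rule less.hyps) (auto simp: xs ys less.prems)
      moreover have "shuffle (\<lambda>c. f (b # c)) (a # xs') ys' = shuffle (\<lambda>c. g (b # c)) (a # xs') ys'"
        by (rule less.hyps) (auto simp: xs ys less.prems)
      ultimately show ?thesis by (simp add: xs ys)
    qed
  qed
qed

text \<open>Every entry of \<open>xs\<close> passes every entry of \<open>ys\<close>, at the cost of
  one sign for each pair.\<close>

lemma shuffle_commute: "shuffle f xs ys = alt_sgn (length xs * length ys) (shuffle f ys xs)"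
proof (induction "length xs + length ys" arbitrary: f xs ys rule: less_induct)
  case less
  show ?case
  proof (cases xs)
    case Nil then show ?thesis by simp
  next
    case xs: (Cons a xs')
    show ?thesis
    proof (cases ys)
      case Nil then show ?thesis by simp
    next
      case ys: (Cons b ys')
      have 1: "shuffle (\<lambda>c. f (a # c)) xs' (b # ys') =
          alt_sgn (length xs' * length (b # ys')) (shuffle (\<lambda>c. f (a # c)) (b # ys') xs')"
        by (rule less.hyps) (auto simp: xs ys)
      have 2: "shuffle (\<lambda>c. f (b # c)) (a # xs') ys' =
          alt_sgn (length (a # xs') * length ys') (shuffle (\<lambda>c. f (b # c)) ys' (a # xs'))"
        by (rule less.hyps) (auto simp: xs ys)
      show ?thesis by (simp add: xs ys 1 2) (auto simp: alt_sgn_def)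
    qed
  qed
qed

text \<open>Both sides split according to whether the first entry of the outcome comes from
  \<open>x\<close>, \<open>y\<close> or \<open>z\<close>; the three parts match by
  induction.\<close>

lemma shuffle_assoc: "shuffle (\<lambda>c. shuffle f c z) x y = shuffle (\<lambda>d. shuffle f x d) y z"
proof (induction "length x + length y + length z" arbitrary: f x y z rule: less_induct)
  case less
  show ?case
  proof (cases "x = [] \<or> y = [] \<or> z = []")
    case True
    moreover have "shuffle (shuffle f []) y z = shuffle f y z" by (rule shuffle_cong_length) simp
    ultimately show ?thesis by auto
  next
    case False
    then obtain a x' b y' c z' where xyz: "x = a # x'" "y = b # y'" "z = c # z'"
      by (metis neq_Nil_conv)
    have A: "shuffle (\<lambda>w. shuffle (\<lambda>d. f (a # d)) w z) x' y = shuffle (\<lambda>d. shuffle (\<lambda>d. f (a # d)) x' d) y z"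
      by (rule less.hyps) (auto simp: xyz)
    have B: "shuffle (\<lambda>w. shuffle (\<lambda>d. f (b # d)) w z) x y' = shuffle (\<lambda>d. shuffle (\<lambda>d. f (b # d)) x d) y' z"
      by (rule less.hyps) (auto simp: xyz)
    have C: "shuffle (\<lambda>w. shuffle (\<lambda>d. f (c # d)) w z') x y = shuffle (\<lambda>d. shuffle (\<lambda>d. f (c # d)) x d) y z'"
      by (rule less.hyps) (auto simp: xyz)
    \<comment> \<open>The inner sign involves the length of the shuffled word \<open>w\<close>,
      which is that of \<open>x'\<close> and \<open>y\<close> together.\<close>
    have 1: "shuffle (\<lambda>w. alt_sgn (Suc (length w)) (shuffle (\<lambda>d. f (c # d)) (a # w) z')) x' y
        = alt_sgn (length x + length y) (shuffle (\<lambda>w. shuffle (\<lambda>d. f (c # d)) (a # w) z') x' y)"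
      unfolding shuffle_alt_sgn[symmetric] by (rule shuffle_cong_length) (simp add: xyz)
    have 2: "shuffle (\<lambda>w. alt_sgn (Suc (length w)) (shuffle (\<lambda>d. f (c # d)) (b # w) z')) x y'
        = alt_sgn (length x + length y) (shuffle (\<lambda>w. shuffle (\<lambda>d. f (c # d)) (b # w) z') x y')"
      unfolding shuffle_alt_sgn[symmetric] by (rule shuffle_cong_length) (simp add: xyz)
    have L: "shuffle (\<lambda>c. shuffle f c z) x y = shuffle (\<lambda>w. shuffle (\<lambda>d. f (a # d)) w z) x' y
       + alt_sgn (length x) (shuffle (\<lambda>w. shuffle (\<lambda>d. f (b # d)) w z) x y')
       + alt_sgn (length x + length y) (shuffle (\<lambda>w. shuffle (\<lambda>d. f (c # d)) w z') x y)"
      using 1 2 by (simp add: xyz shuffle_add) (simp add: alt_sgn_def)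
    have R: "shuffle (\<lambda>d. shuffle f x d) y z = shuffle (\<lambda>d. shuffle (\<lambda>d. f (a # d)) x' d) y z
       + alt_sgn (length x) (shuffle (\<lambda>d. shuffle (\<lambda>d. f (b # d)) x d) y' z)
       + alt_sgn (length x + length y) (shuffle (\<lambda>d. shuffle (\<lambda>d. f (c # d)) x d) y z')"
      by (simp add: xyz shuffle_add shuffle_alt_sgn) (simp add: alt_sgn_def)
    show ?thesis unfolding L R A B C ..
  qed
qed

section \<open>Deconcatenation, the coproduct of the shuffle bialgebra\<close>

fun deconc :: "('a list \<Rightarrow> 'a list \<Rightarrow> 'w) \<Rightarrow> 'a list \<Rightarrow> 'w::ab_group_add" where
  "deconc F [] = F [] []"
| "deconc F (a # xs) = F [] (a # xs) + deconc (\<lambda>u v. F (a # u) v) xs"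

lemma deconc_hom:
  assumes "\<And>u v. \<phi> (u + v) = \<phi> u + \<phi> v"
  shows "deconc (\<lambda>u v. \<phi> (F u v)) xs = \<phi> (deconc F xs)"
  by (induction F xs rule: deconc.induct) (auto simp: assms)

lemma deconc_add: "deconc (\<lambda>u v. F u v + G u v) xs = deconc F xs + deconc G xs"
  by (induction xs arbitrary: F G) auto

lemma deconc_neg: "deconc (\<lambda>u v. - F u v) xs = - deconc F xs"
  by (rule deconc_hom) simp

lemma deconc_diff: "deconc (\<lambda>u v. F u v - G u v) xs = deconc F xs - deconc G xs"
  using deconc_add[of F "\<lambda>u v. - G u v"] by (simp add: deconc_neg)

lemma deconc_alt_sgn: "deconc (\<lambda>u v. alt_sgn n (F u v)) xs = alt_sgn n (deconc F xs)"
  by (rule deconc_hom) (simp add: alt_sgn_def)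

lemma deconc_cong:
  "(\<And>u v. xs = u @ v \<Longrightarrow> F u v = G u v) \<Longrightarrow> deconc F xs = deconc G xs"
  by (induction xs arbitrary: F G) fastforce+

lemma shuffle_deconc_commute: "shuffle (\<lambda>c. deconc (F c) u) x y = deconc (\<lambda>v w. shuffle (\<lambda>c. F c v w) x y) u"
  by (induction u arbitrary: F) (auto simp: shuffle_add)

text \<open>The bialgebra law: deconcatenation is multiplicative for shuffles, and the sign is the
  Koszul sign for moving \<open>y1\<close> past \<open>x2\<close>. Both sides are split by whether
  the first piece of the cut is empty and, if not, by the origin of its first entry.\<close>

lemma deconc_shuffle_compat:
  fixes F :: "'a list \<Rightarrow> 'a list \<Rightarrow> 'w::ab_group_add"
  shows "shuffle (deconc F) xs ys = deconc (\<lambda>x1 x2. deconc (\<lambda>y1 y2. alt_sgn (length x2 * length y1)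
     (shuffle (\<lambda>z1. shuffle (\<lambda>z2. F z1 z2) x2 y2) x1 y1)) ys) xs"
proof (induction "length xs + length ys" arbitrary: F xs ys rule: less_induct)
  case less
  show ?case
  proof (cases "xs = [] \<or> ys = []")
    case True
    have [simp]: "deconc (\<lambda>x1 x2. deconc (\<lambda>y1 y2. alt_sgn (length x2 * length y1) (shuffle (\<lambda>z1. shuffle (\<lambda>z2. F z1 z2) x2 y2) x1 y1)) []) xs = deconc F xs"
      for xs by (rule deconc_cong) simp
    have [simp]: "deconc (\<lambda>x1 x2. deconc (\<lambda>y1 y2. alt_sgn (length x2 * length y1) (shuffle (\<lambda>z1. shuffle (\<lambda>z2. F z1 z2) x2 y2) x1 y1)) ys) [] = deconc F ys"
      for ys by simp
    show ?thesis using True by (auto simp del: deconc.simps)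
  next
    case False
    then obtain a x b y where xy: "xs = a # x" "ys = b # y"
      by (metis neq_Nil_conv)
    let ?G = "\<lambda>F x1 x2 y1 y2. alt_sgn (length x2 * length y1) (shuffle (\<lambda>z1. shuffle (\<lambda>z2. F z1 z2) x2 y2) x1 y1)"
    have A: "shuffle (deconc (\<lambda>u v. F (a # u) v)) x ys = deconc (\<lambda>x1 x2. deconc (?G (\<lambda>u v. F (a # u) v) x1 x2) ys) x"
      by (rule less.hyps) (auto simp: xy)
    have B: "shuffle (deconc (\<lambda>u v. F (b # u) v)) xs y = deconc (\<lambda>x1 x2. deconc (?G (\<lambda>u v. F (b # u) v) x1 x2) y) xs"
      by (rule less.hyps) (auto simp: xy)
    \<comment> \<open>The three parts: the first piece is empty, begins with \<open>a\<close>, or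
      begins with \<open>b\<close>.\<close>
    have L: "shuffle (deconc F) xs ys = shuffle (F []) xs ys
       + deconc (\<lambda>x1 x2. deconc (?G (\<lambda>u v. F (a # u) v) x1 x2) ys) x
       + alt_sgn (length xs) (deconc (\<lambda>x1 x2. deconc (?G (\<lambda>u v. F (b # u) v) x1 x2) y) xs)"
      unfolding A[symmetric] B[symmetric] by (simp add: xy shuffle_add) (simp add: alt_sgn_def)
    have eq: "?G F (a # x1) x2 (b # y1) y2 = ?G (\<lambda>u v. F (a # u) v) x1 x2 (b # y1) y2
        + alt_sgn (length xs) (?G (\<lambda>u v. F (b # u) v) (a # x1) x2 y1 y2)"
      if "x = x1 @ x2" "y = y1 @ y2" for x1 x2 y1 y2
      using that by (simp add: xy) (auto simp: alt_sgn_def)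
    \<comment> \<open>With nothing taken from \<open>xs\<close>, the first piece begins with
      \<open>b\<close>, which has passed all of \<open>xs\<close>.\<close>
    have eq0: "?G F [] x2 (b # y1) y2 = alt_sgn (length xs) (?G (\<lambda>u v. F (b # u) v) [] x2 y1 y2)"
      if "xs = x2" "y = y1 @ y2" for x2 y1 y2
      using that by (simp add: xy) (auto simp: alt_sgn_def)
    have "deconc (\<lambda>x1 x2. deconc (?G F x1 x2) ys) xs
      = deconc (?G F [] xs) ys + deconc (\<lambda>x1 x2. deconc (?G F (a # x1) x2) ys) x"
      by (simp only: xy deconc.simps)
    also have "deconc (?G F [] xs) ys = shuffle (F []) xs ys + deconc (\<lambda>y1 y2. ?G F [] xs (b # y1) y2) y"
      by (simp only: xy deconc.simps shuffle.simps list.size mult_0_right alt_sgn_0)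
    also have "deconc (\<lambda>y1 y2. ?G F [] xs (b # y1) y2) y = alt_sgn (length xs) (deconc (?G (\<lambda>u v. F (b # u) v) [] xs) y)"
      unfolding deconc_alt_sgn[symmetric] by (rule deconc_cong) (rule eq0, auto)
    also have "deconc (\<lambda>x1 x2. deconc (?G F (a # x1) x2) ys) x =
       deconc (\<lambda>x1 x2. ?G F (a # x1) x2 [] ys + deconc (\<lambda>y1 y2. ?G F (a # x1) x2 (b # y1) y2) y) x"
      by (simp add: xy)
    also have "\<dots> = deconc (\<lambda>x1 x2. ?G (\<lambda>u v. F (a # u) v) x1 x2 [] ys + deconc (\<lambda>y1 y2. ?G (\<lambda>u v. F (a # u) v) x1 x2 (b # y1) y2
        + alt_sgn (length xs) (?G (\<lambda>u v. F (b # u) v) (a # x1) x2 y1 y2)) y) x"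
      by (intro deconc_cong arg_cong2[where f="(+)"] eq) auto
    also have "\<dots> = deconc (\<lambda>x1 x2. deconc (?G (\<lambda>u v. F (a # u) v) x1 x2) ys
        + alt_sgn (length xs) (deconc (?G (\<lambda>u v. F (b # u) v) (a # x1) x2) y)) x"
      by (simp add: xy deconc_add deconc_alt_sgn add.assoc)
    also have "\<dots> = deconc (\<lambda>x1 x2. deconc (?G (\<lambda>u v. F (a # u) v) x1 x2) ys) x
        + alt_sgn (length xs) (deconc (\<lambda>x1 x2. deconc (?G (\<lambda>u v. F (b # u) v) (a # x1) x2) y) x)"
      by (simp add: deconc_add deconc_alt_sgn)
    finally have R: "deconc (\<lambda>x1 x2. deconc (?G F x1 x2) ys) xs
      = shuffle (F []) xs ys + alt_sgn (length xs) (deconc (?G (\<lambda>u v. F (b # u) v) [] xs) y)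
        + (deconc (\<lambda>x1 x2. deconc (?G (\<lambda>u v. F (a # u) v) x1 x2) ys) x
        + alt_sgn (length xs) (deconc (\<lambda>x1 x2. deconc (?G (\<lambda>u v. F (b # u) v) (a # x1) x2) y) x))" .
    have X: "deconc (\<lambda>x1 x2. deconc (?G (\<lambda>u v. F (b # u) v) x1 x2) y) xs
       = deconc (?G (\<lambda>u v. F (b # u) v) [] xs) y
         + deconc (\<lambda>x1 x2. deconc (?G (\<lambda>u v. F (b # u) v) (a # x1) x2) y) x"
      by (simp only: xy deconc.simps)
    have "s + t + (u + v) = s + u + (t + v)" for s t u v :: 'w
      by (simp add: ac_simps)
    then show ?thesis
      unfolding L R X alt_sgn_add .
  qed
qed

text \<open>The second Adams operation.\<close>

definition adams :: "('a list \<Rightarrow> 'w) \<Rightarrow> 'a list \<Rightarrow> 'w::ab_group_add" where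
  "adams f = deconc (shuffle f)"

text \<open>The Adams operation is the convolution square of the identity, and on a commutative
  bialgebra such a power is multiplicative. The Koszul sign of the bialgebra law cancels against the
  one from commuting \<open>x2\<close> with \<open>y1\<close>.\<close>

lemma adams_shuffle: "shuffle (adams f) xs ys = adams (\<lambda>x. adams (\<lambda>y. shuffle f x y) ys) xs"
proof -
  have key: "alt_sgn (length x2 * length y1) (shuffle (\<lambda>z1. shuffle (\<lambda>z2. shuffle f z1 z2) x2 y2) x1 y1)
     = shuffle (\<lambda>x. shuffle (\<lambda>y. shuffle f x y) y1 y2) x1 x2" for x1 x2 y1 y2
  proof -
    have "shuffle (\<lambda>z1. shuffle (\<lambda>z2. shuffle f z1 z2) x2 y2) x1 y1
        = shuffle (\<lambda>z1. shuffle (\<lambda>c. shuffle f c y2) z1 x2) x1 y1"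
      by (simp add: shuffle_assoc)
    also have "\<dots> = shuffle (\<lambda>z. shuffle (\<lambda>c. shuffle f c y2) x1 z) y1 x2"
      by (simp add: shuffle_assoc[of "\<lambda>c. shuffle f c y2" x2 x1 y1])
    also have "\<dots> = alt_sgn (length x2 * length y1) (shuffle (\<lambda>z. shuffle (\<lambda>c. shuffle f c y2) x1 z) x2 y1)"
      by (subst shuffle_commute) (simp add: mult.commute)
    also have "shuffle (\<lambda>z. shuffle (\<lambda>c. shuffle f c y2) x1 z) x2 y1 = shuffle (\<lambda>z. shuffle (\<lambda>c. shuffle f c y2) z y1) x1 x2"
      by (simp add: shuffle_assoc[of "\<lambda>c. shuffle f c y2" y1 x1 x2])
    also have "\<dots> = shuffle (\<lambda>x. shuffle (\<lambda>y. shuffle f x y) y1 y2) x1 x2"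
      by (simp add: shuffle_assoc)
    finally show ?thesis by (simp add: alt_sgn_def)
  qed
  show ?thesis
    unfolding adams_def deconc_shuffle_compat key shuffle_deconc_commute ..
qed

text \<open>The mirror image of the defining recursion, for the comparison with permutations, which
  looks at the entry that lands last. For \<open>a\<close> to land last it passes \<open>ys\<close>
  and \<open>b\<close>, hence the sign with \<open>Suc (length ys)\<close>.\<close>

lemma shuffle_snoc:
  "shuffle f (xs @ [a]) (ys @ [b]) = alt_sgn (Suc (length ys)) (shuffle (\<lambda>c. f (c @ [a])) xs (ys @ [b]))
     + shuffle (\<lambda>c. f (c @ [b])) (xs @ [a]) ys"
proof (induction "length xs + length ys" arbitrary: f xs ys rule: less_induct)
  case less
  show ?case
  proof (cases xs)
    case xs: Nil
    show ?thesis
    proof (cases ys)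
      case Nil then show ?thesis by (simp add: xs)
    next
      case (Cons c ys')
      have "shuffle (\<lambda>d. f (c # d)) ([] @ [a]) (ys' @ [b])
         = alt_sgn (Suc (length ys')) (shuffle (\<lambda>d. f (c # d @ [a])) [] (ys' @ [b]))
            + shuffle (\<lambda>d. f (c # d @ [b])) ([] @ [a]) ys'"
        by (rule less.hyps) (simp add: xs Cons)
      then show ?thesis by (simp add: xs Cons) (simp add: alt_sgn_def)
    qed
  next
    case xs: (Cons d xs')
    show ?thesis
    proof (cases ys)
      case Nil
      have "shuffle (\<lambda>c. f (d # c)) (xs' @ [a]) ([] @ [b])
         = alt_sgn (Suc (length [])) (shuffle (\<lambda>c. f (d # c @ [a])) xs' ([] @ [b]))
            + shuffle (\<lambda>c. f (d # c @ [b])) (xs' @ [a]) []"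
        using less.hyps[of xs' "[]" "\<lambda>c. f (d # c)"] by (simp add: xs Nil)
      then show ?thesis by (simp add: xs Nil) (simp add: alt_sgn_def)
    next
      case (Cons c ys')
      have 1: "shuffle (\<lambda>d. f (c # d)) (xs @ [a]) (ys' @ [b])
         = alt_sgn (Suc (length ys')) (shuffle (\<lambda>d. f (c # d @ [a])) xs (ys' @ [b]))
            + shuffle (\<lambda>d. f (c # d @ [b])) (xs @ [a]) ys'"
        by (rule less.hyps) (simp add: Cons)
      have 2: "shuffle (\<lambda>c. f (d # c)) (xs' @ [a]) (ys @ [b])
         = alt_sgn (Suc (length ys)) (shuffle (\<lambda>c. f (d # c @ [a])) xs' (ys @ [b]))
            + shuffle (\<lambda>c. f (d # c @ [b])) (xs' @ [a]) ys"
        by (rule less.hyps) (simp add: xs)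
      show ?thesis using 1 2 by (simp add: xs Cons) (auto simp: alt_sgn_def)
    qed
  qed
qed

section \<open>The bar differential\<close>

locale comm_product =
  fixes \<mu> :: "'v \<Rightarrow> 'v \<Rightarrow> 'v::ab_group_add"
  assumes add_right: "\<And>a x y. \<mu> a (x + y) = \<mu> a x + \<mu> a y"
    and commute: "\<And>a b. \<mu> a b = \<mu> b a"
begin

text \<open>The Hochschild differential splits into the term that multiplies by the first argument and the rest;
  by commutativity, the term that multiplies by the last argument is the case \<open>[]\<close> of \<open>merge_hd\<close>.
  Both parts are derivations for shuffles.\<close>

fun hd_out :: "('v list \<Rightarrow> 'v) \<Rightarrow> 'v list \<Rightarrow> 'v" where
  "hd_out f [] = 0"
| "hd_out f (a # xs) = \<mu> a (f xs)"

fun merge_hd :: "('v list \<Rightarrow> 'v) \<Rightarrow> 'v \<Rightarrow> 'v list \<Rightarrow> 'v" where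
  "merge_hd f a [] = \<mu> a (f [])"
| "merge_hd f a (b # xs) = f (\<mu> a b # xs)"

fun tl_out :: "('v list \<Rightarrow> 'v) \<Rightarrow> 'v list \<Rightarrow> 'v" where
  "tl_out f [] = 0"
| "tl_out f (a # xs) = - merge_hd f a xs - tl_out (\<lambda>c. f (a # c)) xs"

definition bar_d :: "('v list \<Rightarrow> 'v) \<Rightarrow> 'v list \<Rightarrow> 'v" where
  "bar_d f xs = hd_out f xs + tl_out f xs"

lemma mult_simps:
  "\<mu> a 0 = 0" "\<mu> a (- x) = - \<mu> a x" "\<mu> a (x - y) = \<mu> a x - \<mu> a y"
proof -
  show z: "\<mu> a 0 = 0" for a using add_right[of a 0 0] by simp
  show n: "\<mu> a (- x) = - \<mu> a x" for a x using add_right[of a x "-x"] z[of a]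
    by (simp add: eq_neg_iff_add_eq_0 add.commute)
  show "\<mu> a (x - y) = \<mu> a x - \<mu> a y" using add_right[of a x "-y"] n by simp
qed

lemma shuffle_mult: "shuffle (\<lambda>c. \<mu> a (f c)) xs ys = \<mu> a (shuffle f xs ys)"
  by (rule shuffle_hom) (rule add_right)

lemma deconc_mult: "deconc (\<lambda>u v. \<mu> a (F u v)) xs = \<mu> a (deconc F xs)"
  by (rule deconc_hom) (rule add_right)

lemma mult_alt_sgn: "\<mu> a (alt_sgn n x) = alt_sgn n (\<mu> a x)"
  by (simp add: alt_sgn_def mult_simps)

lemma hd_out_add: "hd_out (\<lambda>c. f c + g c) xs = hd_out f xs + hd_out g xs"
  by (cases xs) (auto simp: add_right)

lemma merge_hd_add: "merge_hd (\<lambda>c. f c + g c) a xs = merge_hd f a xs + merge_hd g a xs"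
  by (cases xs) (auto simp: add_right)

lemma merge_hd_alt_sgn: "merge_hd (\<lambda>c. alt_sgn n (f c)) a xs = alt_sgn n (merge_hd f a xs)"
  by (cases xs) (auto simp: mult_alt_sgn)

lemma tl_out_add: "tl_out (\<lambda>c. f c + g c) xs = tl_out f xs + tl_out g xs"
  by (induction xs arbitrary: f g) (auto simp: merge_hd_add)

lemma tl_out_alt_sgn: "tl_out (\<lambda>c. alt_sgn n (f c)) xs = alt_sgn n (tl_out f xs)"
  by (induction xs arbitrary: f) (auto simp: merge_hd_alt_sgn, auto simp: alt_sgn_def)

lemma tl_out_cong:
  "(\<And>c. Suc (length c) = length xs \<Longrightarrow> f c = g c) \<Longrightarrow> tl_out f xs = tl_out g xs"
proof (induction xs arbitrary: f g)
  case (Cons a xs)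
  have "merge_hd f a xs = merge_hd g a xs" by (cases xs) (auto simp: Cons.prems)
  moreover have "tl_out (\<lambda>c. f (a # c)) xs = tl_out (\<lambda>c. g (a # c)) xs"
    by (rule Cons.IH) (simp add: Cons.prems)
  ultimately show ?case by simp
qed auto

lemma hd_out_shuffle:
  "shuffle (hd_out f) xs ys = hd_out (\<lambda>u. shuffle f u ys) xs + alt_sgn (length xs) (hd_out (\<lambda>v. shuffle f xs v) ys)"
  by (cases xs; cases ys) (auto simp: shuffle_mult)

text \<open>The terms that merge an entry of \<open>xs\<close> with an entry of \<open>ys\<close>
  occur in both orders and with opposite signs. Since the product is commutative they cancel, and
  what remains is the derivation rule.\<close>

lemma tl_out_shuffle:
  "shuffle (tl_out f) xs ys = tl_out (\<lambda>u. shuffle f u ys) xs + alt_sgn (length xs) (tl_out (\<lambda>v. shuffle f xs v) ys)"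
proof (induction "length xs + length ys" arbitrary: f xs ys rule: less_induct)
  case less
  show ?case
  proof (cases "xs = [] \<or> ys = []")
    case True
    moreover have "tl_out (shuffle f []) ys = tl_out f ys" by (rule tl_out_cong) simp
    ultimately show ?thesis by auto
  next
    case False
    then obtain a x b y where xy: "xs = a # x" "ys = b # y"
      by (metis neq_Nil_conv)
    let ?fa = "\<lambda>c. f (a # c)" and ?fb = "\<lambda>c. f (b # c)" and ?fab = "\<lambda>c. f (\<mu> a b # c)"
    have A: "shuffle (tl_out ?fa) x ys = tl_out (\<lambda>u. shuffle ?fa u ys) x + alt_sgn (length x) (tl_out (\<lambda>v. shuffle ?fa x v) ys)"
      by (rule less.hyps) (auto simp: xy)
    have B: "shuffle (tl_out ?fb) xs y = tl_out (\<lambda>u. shuffle ?fb u y) xs + alt_sgn (length xs) (tl_out (\<lambda>v. shuffle ?fb xs v) y)"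
      by (rule less.hyps) (auto simp: xy)
    \<comment> \<open>The term with \<open>?fab\<close>, in which \<open>a\<close> and
      \<open>b\<close> are merged, is isolated here and again in \<open>m2\<close>; the two
      contributions cancel in \<open>grp\<close>.\<close>
    have m1: "shuffle (merge_hd f a) x (b # y) + alt_sgn (length x) (merge_hd (\<lambda>u. shuffle ?fb u y) a x)
        = merge_hd (\<lambda>u. shuffle f u (b # y)) a x + alt_sgn (length x) (shuffle ?fab x y)"
      by (cases x) (auto simp: shuffle_mult alt_sgn_def)
    have m2: "shuffle (merge_hd f b) (a # x) y + merge_hd (\<lambda>v. shuffle ?fa x v) b y
        = shuffle ?fab x y + merge_hd (\<lambda>v. shuffle f (a # x) v) b y"
      by (cases y) (auto simp: commute[of b a])
    have T1: "tl_out (\<lambda>u. shuffle f (a # u) ys) x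
        = tl_out (\<lambda>u. shuffle ?fa u ys) x + alt_sgn (length x) (tl_out (\<lambda>u. shuffle ?fb (a # u) y) x)"
      unfolding tl_out_add[symmetric] tl_out_alt_sgn[symmetric] by (rule tl_out_cong) (simp add: xy)
    have T2: "tl_out (\<lambda>v. shuffle f xs (b # v)) y
        = tl_out (\<lambda>v. shuffle ?fa x (b # v)) y + alt_sgn (Suc (length x)) (tl_out (\<lambda>v. shuffle ?fb xs v) y)"
      unfolding tl_out_add[symmetric] tl_out_alt_sgn[symmetric] by (rule tl_out_cong) (simp add: xy)
    have L: "shuffle (tl_out f) xs ys = - shuffle (merge_hd f a) x ys - shuffle (tl_out ?fa) x ys
       + alt_sgn (length x) (shuffle (merge_hd f b) xs y + shuffle (tl_out ?fb) xs y)"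
      by (simp add: xy shuffle_diff shuffle_neg) (simp add: alt_sgn_def)
    have A': "tl_out (\<lambda>v. shuffle ?fa x v) ys = - merge_hd (\<lambda>v. shuffle ?fa x v) b y - tl_out (\<lambda>v. shuffle ?fa x (b # v)) y"
      by (simp only: xy tl_out.simps)
    have B': "tl_out (\<lambda>u. shuffle ?fb u y) xs = - merge_hd (\<lambda>u. shuffle ?fb u y) a x - tl_out (\<lambda>u. shuffle ?fb (a # u) y) x"
      by (simp only: xy tl_out.simps)
    have R: "tl_out (\<lambda>u. shuffle f u ys) xs = - merge_hd (\<lambda>u. shuffle f u ys) a x - tl_out (\<lambda>u. shuffle f (a # u) ys) x"
      "tl_out (\<lambda>v. shuffle f xs v) ys = - merge_hd (\<lambda>v. shuffle f xs v) b y - tl_out (\<lambda>v. shuffle f xs (b # v)) y"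
      by (simp_all only: xy tl_out.simps)
    have len: "length xs = Suc (length x)" by (simp add: xy)
    have grp: "- (N1 + alt_sgn k S - alt_sgn k M1) - (P + alt_sgn k (- M2 - R)) + alt_sgn k (S + N2 - M2 + (- M1 - Q + alt_sgn (Suc k) W))
        = - N1 - (P + alt_sgn k Q) + alt_sgn (Suc k) (- N2 - (R + alt_sgn (Suc k) W))"
      for N1 S M1 P M2 R N2 Q W :: 'v and k by (simp add: alt_sgn_def algebra_simps)
    show ?thesis
      unfolding L A B A' B' R T1[folded xy(2)] T2 m1[folded eq_diff_eq xy(2)] m2[folded eq_diff_eq xy(1)] len
      by (rule grp)
  qed
qed

lemma bar_d_shuffle:
  "shuffle (bar_d f) xs ys = bar_d (\<lambda>u. shuffle f u ys) xs + alt_sgn (length xs) (bar_d (\<lambda>v. shuffle f xs v) ys)"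
  unfolding bar_d_def shuffle_add hd_out_shuffle tl_out_shuffle by (simp add: alt_sgn_add)

text \<open>An entry next to the cut multiplies from outside twice, as last entry of the prefix and
  as first entry of the suffix, with opposite signs; this cancellation makes the differential a
  coderivation. The term \<open>hd_out\<close> of the prefix is added in
  \<open>bar_d_deconc\<close>.\<close>

lemma tl_out_deconc:
  "deconc (\<lambda>u v. tl_out (\<lambda>u. F u v) u + alt_sgn (length u) (bar_d (F u) v)) xs = tl_out (deconc F) xs"
proof (induction xs arbitrary: F)
  case (Cons a xs)
  let ?Fa = "\<lambda>u v. F (a # u) v"
  have IH: "deconc (\<lambda>u v. tl_out (\<lambda>u. ?Fa u v) u + alt_sgn (length u) (bar_d (?Fa u) v)) xs = tl_out (deconc ?Fa) xs"
    by (rule Cons.IH)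
  \<comment> \<open>The cut right after \<open>a\<close> contributes
    \<open>\<mu> a (F [] xs)\<close>, which the cut right before \<open>a\<close> cancels.\<close>
  have m: "merge_hd (deconc F) a xs + \<mu> a (F [] xs) = merge_hd (F []) a xs + deconc (\<lambda>u v. merge_hd (\<lambda>u. F u v) a u) xs"
    by (cases xs) auto
  have "deconc (\<lambda>u v. tl_out (\<lambda>u. F u v) u + alt_sgn (length u) (bar_d (F u) v)) (a # xs)
     = bar_d (F []) (a # xs) + deconc (\<lambda>u v. - merge_hd (\<lambda>u. F u v) a u
         - (tl_out (\<lambda>u. ?Fa u v) u + alt_sgn (length u) (bar_d (?Fa u) v))) xs"
    by (simp, rule deconc_cong) (simp add: alt_sgn_def)
  also have "\<dots> = bar_d (F []) (a # xs) - deconc (\<lambda>u v. merge_hd (\<lambda>u. F u v) a u) xs - tl_out (deconc ?Fa) xs"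
    unfolding deconc_diff IH deconc_neg by simp
  also have "\<dots> = tl_out (deconc F) (a # xs)"
    unfolding tl_out.simps deconc.simps m[folded eq_diff_eq] bar_d_def hd_out.simps tl_out_add by simp
  finally show ?case .
qed (simp add: bar_d_def)

lemma bar_d_deconc:
  "bar_d (deconc F) xs = deconc (\<lambda>u v. bar_d (\<lambda>u. F u v) u + alt_sgn (length u) (bar_d (F u) v)) xs"
proof -
  have "hd_out (deconc F) xs = deconc (\<lambda>u v. hd_out (\<lambda>u. F u v) u) xs"
    by (cases xs) (auto simp: deconc_mult)
  then show ?thesis
    unfolding bar_d_def[of "deconc F"] tl_out_deconc[symmetric]
    by (simp only: bar_d_def deconc_add add.assoc)
qed

text \<open>The differential is a derivation for shuffles and a coderivation for deconcatenation,
  with the same sign on the second factor, so it commutes with their composite.\<close>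

theorem bar_d_adams: "bar_d (adams f) = adams (bar_d f)"
proof -
  have "(\<lambda>u v. bar_d (\<lambda>u. shuffle f u v) u + alt_sgn (length u) (bar_d (shuffle f u) v)) = shuffle (bar_d f)"
    by (intro ext) (rule bar_d_shuffle[symmetric])
  then show ?thesis
    unfolding adams_def by (auto simp: bar_d_deconc)
qed

end

section \<open>Shuffle permutations\<close>

text \<open>Position \<open>q\<close> jumps to the end \<open>m\<close>, and the positions behind it
  close the gap. Splitting off this cycle reduces a shuffle that puts the last entry of its first
  block at the end to a shuffle of one entry less.\<close>

definition cyc :: "nat \<Rightarrow> nat \<Rightarrow> nat \<Rightarrow> nat" where
  "cyc q m i = (if i = q then m else if q < i \<and> i \<le> m then i - 1 else i)"

lemma cyc_permutes: "q \<le> m \<Longrightarrow> cyc q m permutes {..<Suc m}"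
  by (rule bij_imp_permutes[OF bij_betw_byWitness[where f' = "\<lambda>i. if i = m then q else if q \<le> i \<and> i < m then Suc i else i"]])
     (auto simp: cyc_def)

lemma inv_cyc: "q \<le> m \<Longrightarrow> inv_into UNIV (cyc q m) = (\<lambda>i. if i = m then q else if q \<le> i \<and> i < m then Suc i else i)"
  by (rule inv_equality) (auto simp: cyc_def)

lemma evenperm_cyc: "q \<le> m \<Longrightarrow> evenperm (cyc q m) = even (m - q)"
proof (induction m rule: dec_induct)
  case base
  have "cyc q q = id" by (auto simp: cyc_def)
  then show ?case by (simp add: evenperm_id)
next
  case (step m)
  have "cyc q (Suc m) = transpose m (Suc m) \<circ> cyc q m"
    using step.hyps by (auto simp: cyc_def transpose_def fun_eq_iff)
  moreover have "permutation (cyc q m)"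
    using cyc_permutes step.hyps by (blast intro: permutation_permutes[THEN iffD2])
  ultimately have "evenperm (cyc q (Suc m)) = (\<not> evenperm (cyc q m))"
    using evenperm_comp[of "transpose m (Suc m)" "cyc q m"] by (simp add: permutation_swap_id evenperm_swap)
  then show ?case using step by (simp add: Suc_diff_le)
qed

lemma strict_mono_perm_max:
  assumes "\<sigma> permutes {..<Suc m}" "strict_mono_on {p..<Suc m} \<sigma>" "i \<in> {p..<Suc m}" "\<sigma> i = m"
  shows "i = m"
proof (rule ccontr)
  assume "i \<noteq> m"
  then have "\<sigma> i < \<sigma> m" using assms by (intro strict_mono_onD[OF assms(2)]) auto
  moreover have "\<sigma> m < Suc m" using permutes_in_image[OF assms(1), of m] by simp
  ultimately show False using assms(4) by simp
qed

lemma permutes_lessThan_Suc_fix: "\<sigma> permutes {..<Suc m} \<Longrightarrow> \<sigma> m = m \<Longrightarrow> \<sigma> permutes {..<m}"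
  using permutes_superset[of \<sigma> "{..<Suc m}" "{..<m}"] by (auto simp: less_Suc_eq)

lemma permutes_lessThan_Suc: "\<sigma> permutes {..<m} \<Longrightarrow> \<sigma> permutes {..<Suc m}"
  by (erule permutes_subset) auto

text \<open>The minimum covers \<open>p = Suc m\<close>, where the second block is empty and the
  fixed last entry belongs to the first block.\<close>

lemma shuffle_perms_fix:
  assumes "p \<le> Suc m"
  shows "{\<sigma> \<in> shuffle_perms p (Suc m). \<sigma> m = m} = shuffle_perms (min p m) m"
proof (intro Set.set_eqI iffI)
  fix \<sigma> assume "\<sigma> \<in> {\<sigma> \<in> shuffle_perms p (Suc m). \<sigma> m = m}"
  then show "\<sigma> \<in> shuffle_perms (min p m) m"
    by (auto simp: shuffle_perms_def strict_mono_on_def intro: permutes_lessThan_Suc_fix)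
next
  fix \<sigma> assume "\<sigma> \<in> shuffle_perms (min p m) m"
  then have \<sigma>: "\<sigma> permutes {..<m}" "strict_mono_on {..<min p m} \<sigma>" "strict_mono_on {min p m..<m} \<sigma>"
    by (auto simp: shuffle_perms_def)
  have m: "\<sigma> m = m" and lt: "\<And>i. i < m \<Longrightarrow> \<sigma> i < m"
    using \<sigma>(1) permutes_in_image[OF \<sigma>(1)] by (auto simp: permutes_def)
  have "\<sigma> i < \<sigma> j" if "i < j" "j < p \<or> p \<le> i \<and> j < Suc m" for i j
  proof (cases "j = m")
    case True then show ?thesis using that lt m by simp
  next
    case False
    then show ?thesis using that \<sigma>(2,3) assms by (auto simp: strict_mono_on_def)
  qed
  then show "\<sigma> \<in> {\<sigma> \<in> shuffle_perms p (Suc m). \<sigma> m = m}"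
    using m \<sigma>(1) by (auto simp: shuffle_perms_def strict_mono_on_def intro: permutes_lessThan_Suc)
qed

lemma shuffle_perms_cyc:
  assumes "q < m"
  shows "{\<sigma> \<in> shuffle_perms (Suc q) (Suc m). \<sigma> q = m} = (\<lambda>\<tau>. \<tau> \<circ> cyc q m) ` shuffle_perms q m"
proof (intro Set.set_eqI iffI)
  fix \<sigma> assume "\<sigma> \<in> {\<sigma> \<in> shuffle_perms (Suc q) (Suc m). \<sigma> q = m}"
  then have \<sigma>: "\<sigma> permutes {..<Suc m}" "strict_mono_on {..<Suc q} \<sigma>" "strict_mono_on {Suc q..<Suc m} \<sigma>" "\<sigma> q = m"
    by (auto simp: shuffle_perms_def)
  let ?\<tau> = "\<sigma> \<circ> inv_into UNIV (cyc q m)"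
  have c: "cyc q m permutes {..<Suc m}" using assms by (simp add: cyc_permutes)
  have "?\<tau> permutes {..<Suc m}" using \<sigma>(1) c by (intro permutes_compose permutes_inv)
  moreover have "?\<tau> m = m" using assms \<sigma>(4) by (simp add: inv_cyc)
  ultimately have "?\<tau> permutes {..<m}" by (rule permutes_lessThan_Suc_fix)
  moreover have "strict_mono_on {..<q} ?\<tau>" "strict_mono_on {q..<m} ?\<tau>"
    using \<sigma>(2,3) assms by (auto simp: inv_cyc strict_mono_on_def)
  ultimately have "?\<tau> \<in> shuffle_perms q m" by (simp add: shuffle_perms_def)
  moreover have "\<sigma> = ?\<tau> \<circ> cyc q m" using permutes_inv_o(2)[OF c] by (simp add: o_assoc[symmetric])
  ultimately show "\<sigma> \<in> (\<lambda>\<tau>. \<tau> \<circ> cyc q m) ` shuffle_perms q m" by blast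
next
  fix \<sigma> assume "\<sigma> \<in> (\<lambda>\<tau>. \<tau> \<circ> cyc q m) ` shuffle_perms q m"
  then obtain \<tau> where \<tau>: "\<sigma> = \<tau> \<circ> cyc q m" "\<tau> permutes {..<m}" "strict_mono_on {..<q} \<tau>" "strict_mono_on {q..<m} \<tau>"
    by (auto simp: shuffle_perms_def)
  have m: "\<tau> m = m" and lt: "\<And>i. i < m \<Longrightarrow> \<tau> i < m"
    using \<tau>(2) permutes_in_image[OF \<tau>(2)] by (auto simp: permutes_def)
  have "\<sigma> q = m" using m by (simp add: \<tau>(1) cyc_def)
  have "\<sigma> permutes {..<Suc m}"
    unfolding \<tau>(1) using \<tau>(2) assms by (intro permutes_compose cyc_permutes permutes_lessThan_Suc) auto
  moreover have "\<sigma> i < \<sigma> j" if "i < j" "j < Suc q \<or> Suc q \<le> i \<and> j < Suc m" for i j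
  proof -
    have "\<tau> (i - 1) < \<tau> (j - 1)" if "q < i"
      using strict_mono_onD[OF \<tau>(4), of "i - 1" "j - 1"] that \<open>i < j\<close> \<open>j < Suc q \<or> Suc q \<le> i \<and> j < Suc m\<close> by simp
    then show ?thesis
      using that \<tau>(3) assms lt m by (auto simp: \<tau>(1) cyc_def strict_mono_on_def)
  qed
  ultimately show "\<sigma> \<in> {\<sigma> \<in> shuffle_perms (Suc q) (Suc m). \<sigma> q = m}"
    using \<open>\<sigma> q = m\<close> by (auto simp: shuffle_perms_def strict_mono_on_def)
qed

text \<open>By monotonicity only the last entry of one of the two blocks can land in the last
  position.\<close>

lemma shuffle_perms_Suc_cases:
  assumes "\<sigma> \<in> shuffle_perms p (Suc m)" "p \<le> Suc m"
  shows "\<sigma> m = m \<or> (0 < p \<and> \<sigma> (p - 1) = m)"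
proof -
  have \<sigma>: "\<sigma> permutes {..<Suc m}" "strict_mono_on {..<p} \<sigma>" "strict_mono_on {p..<Suc m} \<sigma>"
    using assms by (auto simp: shuffle_perms_def)
  obtain i where i: "\<sigma> i = m" "i < Suc m"
    using \<sigma>(1) permutes_in_image[OF \<sigma>(1)] by (metis lessThan_iff lessI permutes_inverses(1))
  show ?thesis
  proof (cases "i < p")
    case True
    have "i = p - 1"
    proof (rule ccontr)
      assume "i \<noteq> p - 1"
      then have "\<sigma> i < \<sigma> (p - 1)" using True by (intro strict_mono_onD[OF \<sigma>(2)]) auto
      moreover have "\<sigma> (p - 1) < Suc m" using permutes_in_image[OF \<sigma>(1), of "p - 1"] True assms by simp
      ultimately show False using i by simp
    qed
    then show ?thesis using i True by auto
  next
    case False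
    then show ?thesis using strict_mono_perm_max[OF \<sigma>(1,3), of i] i by auto
  qed
qed

lemma finite_shuffle_perms [simp]: "finite (shuffle_perms p m)"
  by (rule finite_subset[OF _ finite_permutations[of "{..<m}"]]) (auto simp: shuffle_perms_def)

definition perm_sgn :: "(nat \<Rightarrow> nat) \<Rightarrow> 'w \<Rightarrow> 'w::ab_group_add" where
  "perm_sgn \<sigma> w = (if evenperm \<sigma> then w else - w)"

lemma permute_list_snoc:
  assumes "\<sigma> permutes {..<length xs}"
  shows "permute_list (inv_into UNIV \<sigma>) (xs @ [a]) = permute_list (inv_into UNIV \<sigma>) xs @ [a]"
proof -
  have \<sigma>: "inv_into UNIV \<sigma> permutes {..<length xs}" using assms by (rule permutes_inv)
  have "inv_into UNIV \<sigma> (length xs) = length xs" "\<And>i. i < length xs \<Longrightarrow> inv_into UNIV \<sigma> i < length xs"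
    using \<sigma> permutes_in_image[OF \<sigma>] by (auto simp: permutes_def)
  then show ?thesis by (auto simp: permute_list_def nth_append)
qed

lemma permute_list_cyc:
  assumes "\<tau> permutes {..<length xs + length ys}"
  shows "permute_list (inv_into UNIV (\<tau> \<circ> cyc (length xs) (length xs + length ys))) (xs @ a # ys)
    = permute_list (inv_into UNIV \<tau>) (xs @ ys) @ [a]"
proof -
  let ?m = "length xs + length ys"
  have \<tau>: "inv_into UNIV \<tau> permutes {..<?m}" using assms by (rule permutes_inv)
  have m: "inv_into UNIV \<tau> ?m = ?m" and lt: "\<And>i. i < ?m \<Longrightarrow> inv_into UNIV \<tau> i < ?m"
    using \<tau> permutes_in_image[OF \<tau>] by (auto simp: permutes_def)
  have "inv_into UNIV (\<tau> \<circ> cyc (length xs) ?m) = inv_into UNIV (cyc (length xs) ?m) \<circ> inv_into UNIV \<tau>"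
    using assms cyc_permutes[of "length xs" ?m] by (intro o_inv_distrib permutes_bij) auto
  then show ?thesis
    using m lt lt[THEN less_imp_neq] by (auto simp: permute_list_def inv_cyc nth_append nth_Cons' less_diff_conv2 intro!: nth_equalityI)
qed

text \<open>The shuffle permutations are sorted by the block that supplies the final entry. Each
  class is in bijection with the shuffles of one entry less, and together they reproduce the
  recursion \<open>shuffle_snoc\<close>.\<close>

theorem shuffle_perms_sum:
  assumes "p \<le> length as"
  shows "(\<Sum>\<sigma>\<in>shuffle_perms p (length as). perm_sgn \<sigma> (f (permute_list (inv_into UNIV \<sigma>) as))) = shuffle f (take p as) (drop p as)"
  using assms
proof (induction "length as" arbitrary: p as f)
  case 0
  then have "shuffle_perms p (length as) = {id}" by (auto simp: shuffle_perms_def permutes_empty strict_mono_on_def)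
  then show ?case using 0 by (simp add: perm_sgn_def evenperm_id)
next
  case (Suc m)
  obtain bs b where as: "as = bs @ [b]" "length bs = m"
    using Suc.hyps(2) by (metis length_Suc_conv_rev)
  \<comment> \<open>Shuffles that leave the last entry \<open>b\<close> in place.\<close>
  have fixm: "(\<Sum>\<sigma>\<in>{\<sigma> \<in> shuffle_perms p (Suc m). \<sigma> m = m}. perm_sgn \<sigma> (f (permute_list (inv_into UNIV \<sigma>) as)))
     = shuffle (\<lambda>c. f (c @ [b])) (take p bs) (drop p bs)"
  proof -
    have "(\<Sum>\<sigma>\<in>shuffle_perms (min p m) m. perm_sgn \<sigma> (f (permute_list (inv_into UNIV \<sigma>) as)))
       = (\<Sum>\<sigma>\<in>shuffle_perms (min p m) m. perm_sgn \<sigma> (f (permute_list (inv_into UNIV \<sigma>) bs @ [b])))"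
      by (rule sum.cong) (auto simp: as shuffle_perms_def permute_list_snoc)
    also have "\<dots> = shuffle (\<lambda>c. f (c @ [b])) (take (min p m) bs) (drop (min p m) bs)"
      using Suc.hyps(1)[of bs "min p m" "\<lambda>c. f (c @ [b])"] as by simp
    also have "take (min p m) bs = take p bs"
      using as(2) by (auto simp: min_def)
    also have "drop (min p m) bs = drop p bs"
      using as(2) by (auto simp: min_def)
    finally show ?thesis
      using shuffle_perms_fix[of p m] Suc.prems Suc.hyps(2) by simp
  qed
  show ?case
  proof (cases "p = 0 \<or> p = Suc m")
    case True
    then have "{\<sigma> \<in> shuffle_perms p (Suc m). \<sigma> m = m} = shuffle_perms p (Suc m)"
      using shuffle_perms_Suc_cases[of _ p m] by auto
    then show ?thesis using True fixm as(1) as(2)[symmetric] Suc.hyps(2) by auto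
  next
    case False
    then obtain q where q: "p = Suc q" "q < m" using Suc.prems Suc.hyps(2) by (cases p) auto
    define xs a ys where "xs = take q as" "a = as ! q" "ys = drop p as"
    have as': "as = xs @ a # ys"
      unfolding xs_a_ys_def q using Suc.hyps(2) q by (simp add: Cons_nth_drop_Suc)
    have len: "length xs = q" "length xs + length ys = m" "length ys = m - q"
      using Suc.hyps(2) q by (auto simp: xs_a_ys_def)
    have "ys \<noteq> []" using len q by auto
    then obtain ys' where ys: "ys = ys' @ [b]"
      using as(1) as' by (metis append_butlast_last_id last_ConsR last_append last_snoc list.distinct(1))
    have bs: "take p bs = xs @ [a]" "drop p bs = ys'"
    proof -
      have "bs = xs @ a # ys'" using as(1) as' ys by simp
      then show "take p bs = xs @ [a]" "drop p bs = ys'" using len(1) q(1) by simp_all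
    qed
    \<comment> \<open>Shuffles whose final entry is \<open>a\<close>, the last of the first block;
      the cycle that brings it to the end has the parity of \<open>m - q\<close>.\<close>
    have "(\<Sum>\<sigma>\<in>(\<lambda>\<tau>. \<tau> \<circ> cyc q m) ` shuffle_perms q m. perm_sgn \<sigma> (f (permute_list (inv_into UNIV \<sigma>) as)))
      = (\<Sum>\<tau>\<in>shuffle_perms q m. perm_sgn (\<tau> \<circ> cyc q m) (f (permute_list (inv_into UNIV (\<tau> \<circ> cyc q m)) as)))"
    proof (rule sum.reindex_cong[OF _ refl refl])
      have "\<tau> \<circ> cyc q m \<circ> inv_into UNIV (cyc q m) = \<tau>" for \<tau> :: "nat \<Rightarrow> nat"
        using permutes_inv_o(1)[OF cyc_permutes[of q m]] q by (simp add: o_assoc[symmetric])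
      then show "inj_on (\<lambda>\<tau>. \<tau> \<circ> cyc q m) (shuffle_perms q m)"
        by (intro inj_on_inverseI[where g = "\<lambda>\<tau>. \<tau> \<circ> inv_into UNIV (cyc q m)"])
    qed
    also have "\<dots> = (\<Sum>\<tau>\<in>shuffle_perms q m. alt_sgn (m - q) (perm_sgn \<tau> (f (permute_list (inv_into UNIV \<tau>) (xs @ ys) @ [a]))))"
    proof (rule sum.cong[OF refl])
      fix \<tau> assume "\<tau> \<in> shuffle_perms q m"
      then have \<tau>: "\<tau> permutes {..<m}" by (simp add: shuffle_perms_def)
      have "evenperm (\<tau> \<circ> cyc q m) = (evenperm \<tau> = even (m - q))"
        using \<tau> q cyc_permutes[of q m] evenperm_cyc[of q m]
        by (subst evenperm_comp) (auto intro: permutation_permutes[THEN iffD2])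
      moreover have "permute_list (inv_into UNIV (\<tau> \<circ> cyc q m)) as = permute_list (inv_into UNIV \<tau>) (xs @ ys) @ [a]"
        using permute_list_cyc[of \<tau> xs ys a, unfolded len(2), unfolded len(1)] \<tau> by (simp only: as')
      ultimately show "perm_sgn (\<tau> \<circ> cyc q m) (f (permute_list (inv_into UNIV (\<tau> \<circ> cyc q m)) as))
        = alt_sgn (m - q) (perm_sgn \<tau> (f (permute_list (inv_into UNIV \<tau>) (xs @ ys) @ [a])))"
        by (simp only: perm_sgn_def alt_sgn_def) simp
    qed
    also have "\<dots> = alt_sgn (m - q) (\<Sum>\<tau>\<in>shuffle_perms q m. perm_sgn \<tau> (f (permute_list (inv_into UNIV \<tau>) (xs @ ys) @ [a])))"
      by (simp add: alt_sgn_def sum_negf)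
    also have "\<dots> = alt_sgn (m - q) (shuffle (\<lambda>c. f (c @ [a])) xs ys)"
      using Suc.hyps(1)[of "xs @ ys" q "\<lambda>c. f (c @ [a])"] len q by simp
    finally have cyc: "(\<Sum>\<sigma>\<in>{\<sigma> \<in> shuffle_perms p (Suc m). \<sigma> q = m}. perm_sgn \<sigma> (f (permute_list (inv_into UNIV \<sigma>) as)))
       = alt_sgn (m - q) (shuffle (\<lambda>c. f (c @ [a])) xs ys)"
      using q by (simp add: shuffle_perms_cyc)
    have decomp: "shuffle_perms p (Suc m) = {\<sigma> \<in> shuffle_perms p (Suc m). \<sigma> q = m} \<union> {\<sigma> \<in> shuffle_perms p (Suc m). \<sigma> m = m}"
      using shuffle_perms_Suc_cases[of _ p m] q by auto
    have "{\<sigma> \<in> shuffle_perms p (Suc m). \<sigma> q = m} \<inter> {\<sigma> \<in> shuffle_perms p (Suc m). \<sigma> m = m} = {}"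
      using q by (auto simp: shuffle_perms_def) (metis permutes_inj injD less_irrefl)
    then have "(\<Sum>\<sigma>\<in>shuffle_perms p (Suc m). perm_sgn \<sigma> (f (permute_list (inv_into UNIV \<sigma>) as)))
       = alt_sgn (m - q) (shuffle (\<lambda>c. f (c @ [a])) xs ys) + shuffle (\<lambda>c. f (c @ [b])) (xs @ [a]) ys'"
      using fixm cyc bs by (subst decomp, subst sum.union_disjoint) auto
    also have "\<dots> = shuffle f (xs @ [a]) ys"
      using shuffle_snoc[of f xs a ys' b] len ys by simp
    also have "xs @ [a] = take p as" using as' len(1) q(1) by simp
    finally show ?thesis
      unfolding Suc.hyps(2)[symmetric] \<open>ys = drop p as\<close> .
  qed
qed

section \<open>Iterated shuffle products and the eigenvalues of the Adams operation\<close>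

fun multi_shuffle :: "('a list \<Rightarrow> 'w) \<Rightarrow> 'a list list \<Rightarrow> 'w::ab_group_add" where
  "multi_shuffle f [] = f []"
| "multi_shuffle f (x # L) = multi_shuffle (shuffle f x) L"

text \<open>Vanishing on the \<open>j\<close>-th power of the augmentation ideal of the shuffle
  algebra. For \<open>j = 2\<close> this is the Harrison condition.\<close>

definition kills_products :: "nat \<Rightarrow> ('a list \<Rightarrow> 'w::ab_group_add) \<Rightarrow> bool" where
  "kills_products j f \<longleftrightarrow> (\<forall>L. length L = j \<and> [] \<notin> set L \<longrightarrow> multi_shuffle f L = 0)"

lemma multi_shuffle_hom:
  fixes \<phi> :: "'b::ab_group_add \<Rightarrow> 'w::ab_group_add"
  assumes "\<And>u v. \<phi> (u + v) = \<phi> u + \<phi> v"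
  shows "multi_shuffle (\<lambda>c. \<phi> (f c)) L = \<phi> (multi_shuffle f L)"
proof (induction L arbitrary: f)
  case (Cons x L)
  have "shuffle (\<lambda>c. \<phi> (f c)) x = (\<lambda>d. \<phi> (shuffle f x d))"
    by (rule ext) (rule shuffle_hom, rule assms)
  then show ?case by (simp add: Cons.IH)
qed simp

lemma multi_shuffle_add: "multi_shuffle (\<lambda>c. f c + g c) L = multi_shuffle f L + multi_shuffle g L"
proof (induction L arbitrary: f g)
  case (Cons x L)
  have "shuffle (\<lambda>c. f c + g c) x = (\<lambda>d. shuffle f x d + shuffle g x d)"
    by (rule ext) (rule shuffle_add)
  then show ?case by (simp add: Cons.IH)
qed simp

lemma multi_shuffle_alt_sgn: "multi_shuffle (\<lambda>c. alt_sgn n (f c)) L = alt_sgn n (multi_shuffle f L)"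
  by (rule multi_shuffle_hom) (rule alt_sgn_add)

lemma multi_shuffle_zero: "multi_shuffle (\<lambda>c. 0) L = 0"
  using multi_shuffle_hom[of "\<lambda>_. 0" "\<lambda>_. 0"] by simp

lemma multi_shuffle_diff: "multi_shuffle (\<lambda>c. f c - g c) L = multi_shuffle f L - multi_shuffle g L"
  using multi_shuffle_add[of f "\<lambda>c. - g c"] multi_shuffle_hom[of uminus g] by simp

lemma multi_shuffle_cong_length:
  "(\<And>c. length c = sum_list (map length L) \<Longrightarrow> f c = g c) \<Longrightarrow> multi_shuffle f L = multi_shuffle g L"
proof (induction L arbitrary: f g)
  case (Cons x L)
  show ?case unfolding multi_shuffle.simps
    by (rule Cons.IH, rule shuffle_cong_length, rule Cons.prems) simp
qed simp

lemma multi_shuffle_shuffle_commute: "multi_shuffle (\<lambda>c. shuffle (\<lambda>u. G u c) x y) L = shuffle (\<lambda>u. multi_shuffle (G u) L) x y"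
proof (induction "length x + length y" arbitrary: G x y rule: less_induct)
  case less
  show ?case
  proof (cases "x = [] \<or> y = []")
    case True then show ?thesis by auto
  next
    case False
    then obtain a x' b y' where xy: "x = a # x'" "y = b # y'" by (metis neq_Nil_conv)
    have "multi_shuffle (\<lambda>c. shuffle (\<lambda>u. G (a # u) c) x' y) L = shuffle (\<lambda>u. multi_shuffle (G (a # u)) L) x' y"
      by (rule less.hyps) (simp add: xy)
    moreover have "multi_shuffle (\<lambda>c. shuffle (\<lambda>u. G (b # u) c) x y') L = shuffle (\<lambda>u. multi_shuffle (G (b # u)) L) x y'"
      by (rule less.hyps) (simp add: xy)
    ultimately show ?thesis by (simp add: xy multi_shuffle_add multi_shuffle_alt_sgn)
  qed
qed

lemma multi_shuffle_deconc_commute: "multi_shuffle (\<lambda>c. deconc (\<lambda>u v. G u v c) x) L = deconc (\<lambda>u v. multi_shuffle (G u v) L) x"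
  by (induction x arbitrary: G) (auto simp: multi_shuffle_add)

lemma multi_shuffle_adams_commute: "multi_shuffle (\<lambda>c. adams (\<lambda>u. G u c) x) L = adams (\<lambda>u. multi_shuffle (G u) L) x"
proof -
  have "shuffle (\<lambda>u. multi_shuffle (G u) L) = (\<lambda>u v. multi_shuffle (\<lambda>c. shuffle (\<lambda>u. G u c) u v) L)"
    by (intro ext) (simp add: multi_shuffle_shuffle_commute)
  then show ?thesis
    unfolding adams_def by (simp add: multi_shuffle_deconc_commute[symmetric])
qed

lemma adams_cong_length:
  assumes "\<And>c. length c = length x \<Longrightarrow> f c = g c"
  shows "adams f x = adams g x"
  unfolding adams_def by (rule deconc_cong, rule shuffle_cong_length, rule assms) simp

lemma deconc_last:
  "(\<And>u v. v \<noteq> [] \<Longrightarrow> xs = u @ v \<Longrightarrow> G u v = 0) \<Longrightarrow> deconc G xs = G xs []"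
proof (induction xs arbitrary: G)
  case (Cons a xs)
  have "deconc (\<lambda>u v. G (a # u) v) xs = G (a # xs) []"
    by (rule Cons.IH) (simp add: Cons.prems)
  then show ?case using Cons.prems[of "a # xs" "[]"] by simp
qed simp

lemma deconc_ends:
  assumes "xs \<noteq> []" "\<And>u v. u \<noteq> [] \<Longrightarrow> v \<noteq> [] \<Longrightarrow> xs = u @ v \<Longrightarrow> F u v = 0"
  shows "deconc F xs = F [] xs + F xs []"
proof -
  obtain a ys where xs: "xs = a # ys" using assms(1) by (cases xs) auto
  have "deconc (\<lambda>u v. F (a # u) v) ys = F (a # ys) []"
    by (rule deconc_last) (simp add: assms(2) xs)
  then show ?thesis by (simp add: xs)
qed

text \<open>A product of \<open>j\<close> nonempty words has length at least \<open>j\<close>, so a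
  cochain kills all products of sufficiently many factors. This starts the descending induction in
  \<open>harrison_primitive\<close>.\<close>

lemma kills_products_length:
  assumes "\<And>c. length c \<noteq> m \<Longrightarrow> f c = 0" "m < j"
  shows "kills_products j f"
  unfolding kills_products_def
proof (intro allI impI, elim conjE)
  fix L :: "'a list list" assume L: "length L = j" "[] \<notin> set L"
  have "length L \<le> sum_list (map length L)" using L(2)
    by (induction L) (auto simp: Suc_le_eq add_strict_increasing)
  then have "multi_shuffle f L = multi_shuffle (\<lambda>_. 0) L"
    using assms L(1) by (intro multi_shuffle_cong_length) auto
  then show "multi_shuffle f L = 0" by (simp add: multi_shuffle_zero)
qed

locale char_0_space = vector_space scale for scale :: "'k::field_char_0 \<Rightarrow> 'v::ab_group_add \<Rightarrow> 'v"
begin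

lemma shuffle_scale: "shuffle (\<lambda>c. scale r (f c)) xs ys = scale r (shuffle f xs ys)"
  by (rule shuffle_hom) (rule scale_right_distrib)

lemma multi_shuffle_scale: "multi_shuffle (\<lambda>c. scale r (f c)) L = scale r (multi_shuffle f L)"
  by (rule multi_shuffle_hom) (rule scale_right_distrib)

lemma adams_scale: "adams (\<lambda>c. scale r (f c)) x = scale r (adams f x)"
proof -
  have "shuffle (\<lambda>c. scale r (f c)) = (\<lambda>u v. scale r (shuffle f u v))" by (intro ext) (rule shuffle_scale)
  then show ?thesis unfolding adams_def by (simp add: deconc_hom scale_right_distrib)
qed

text \<open>On one nonempty word the Adams operation is twice the identity plus products of two
  shorter words. Being multiplicative, it is \<open>2 ^ j\<close> on products of \<open>j\<close>
  factors, up to products of more factors, which \<open>f\<close> kills.\<close>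

lemma multi_shuffle_adams:
  assumes "kills_products (Suc (length L)) f" "[] \<notin> set L"
  shows "multi_shuffle (adams f) L = scale (2 ^ length L) (multi_shuffle f L)"
  using assms
proof (induction L arbitrary: f)
  case Nil
  then show ?case by (simp add: adams_def)
next
  case (Cons x L)
  let ?F = "\<lambda>u. multi_shuffle f (u # L)"
  have "multi_shuffle (adams f) (x # L) = adams (\<lambda>u. multi_shuffle (adams (shuffle f u)) L) x"
  proof -
    have "shuffle (adams f) x = (\<lambda>c. adams (\<lambda>u. adams (shuffle f u) c) x)" by (rule ext) (rule adams_shuffle)
    then show ?thesis by (simp add: multi_shuffle_adams_commute)
  qed
  also have "\<dots> = adams (\<lambda>u. scale (2 ^ length L) (?F u)) x"
  proof (rule adams_cong_length)
    fix u :: "'a list" assume u: "length u = length x"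
    have "u \<noteq> []" using u Cons.prems(2) by auto
    then have "kills_products (Suc (length L)) (shuffle f u)"
      using Cons.prems(1) unfolding kills_products_def
      by (metis length_Cons multi_shuffle.simps(2) set_ConsD)
    then show "multi_shuffle (adams (shuffle f u)) L = scale (2 ^ length L) (?F u)"
      using Cons.IH Cons.prems(2) by simp
  qed
  also have "\<dots> = scale (2 ^ length L) (adams ?F x)" by (rule adams_scale)
  also have "adams ?F x = ?F x + ?F x"
    unfolding adams_def
  proof (subst deconc_ends)
    \<comment> \<open>The inner terms of the deconcatenation split the factor \<open>x\<close> in
      two, and \<open>f\<close> kills the resulting product with one factor more.\<close>
    fix u v assume uv: "u \<noteq> []" "v \<noteq> []" "x = u @ v"
    have "shuffle ?F u v = multi_shuffle (\<lambda>c. shuffle (\<lambda>w. shuffle f w c) u v) L" by (simp add: multi_shuffle_shuffle_commute)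
    also have "(\<lambda>c. shuffle (\<lambda>w. shuffle f w c) u v) = shuffle (shuffle f u) v"
      by (rule ext) (rule shuffle_assoc)
    also have "multi_shuffle \<dots> L = multi_shuffle f (u # v # L)" by simp
    also have "\<dots> = 0" using Cons.prems uv unfolding kills_products_def
      by (metis length_Cons list.set_intros(2) set_ConsD)
    finally show "shuffle ?F u v = 0" .
  qed (use Cons.prems in auto)
  also have "?F x + ?F x = scale 2 (?F x)"
    using scale_left_distrib[of 1 1 "?F x"] by simp
  finally show ?case by (simp add: mult.commute)
qed

section \<open>Multilinearity of cochains and the Harrison condition\<close>

definition lin :: "('v \<Rightarrow> 'v) \<Rightarrow> bool" where
  "lin \<phi> \<longleftrightarrow> (\<forall>u v. \<phi> (u + v) = \<phi> u + \<phi> v) \<and> (\<forall>c v. \<phi> (scale c v) = scale c (\<phi> v))"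

lemma linear_iff_lin: "Vector_Spaces.linear scale scale \<phi> \<longleftrightarrow> lin \<phi>"
proof -
  have "vector_space_pair scale scale" ..
  then show ?thesis unfolding lin_def
    by (simp add: Vector_Spaces.linear_def vector_space_pair_def module_hom_def module_hom_axioms_def
        module_iff_vector_space)
qed

definition multilin :: "nat \<Rightarrow> ('v list \<Rightarrow> 'v) \<Rightarrow> bool" where
  "multilin m f \<longleftrightarrow> (\<forall>as i. length as = m \<and> i < m \<longrightarrow> lin (\<lambda>v. f (as[i := v])))"

lemma cochains_iff: "f \<in> cochains scale m \<longleftrightarrow> (\<forall>as. length as \<noteq> m \<longrightarrow> f as = 0) \<and> multilin m f"
  by (simp add: cochains_def linear_iff_lin multilin_def)

lemma lin_zero: "lin (\<lambda>v. 0)" by (simp add: lin_def)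
lemma lin_add: "lin \<phi> \<Longrightarrow> lin \<psi> \<Longrightarrow> lin (\<lambda>v. \<phi> v + \<psi> v)"
  by (simp add: lin_def algebra_simps)
lemma lin_neg: "lin \<phi> \<Longrightarrow> lin (\<lambda>v. - \<phi> v)"
  by (simp add: lin_def)
lemma lin_diff: "lin \<phi> \<Longrightarrow> lin \<psi> \<Longrightarrow> lin (\<lambda>v. \<phi> v - \<psi> v)"
  by (simp add: lin_def algebra_simps)
lemma lin_scale: "lin \<phi> \<Longrightarrow> lin (\<lambda>v. scale r (\<phi> v))"
  by (simp add: lin_def algebra_simps)
lemma lin_sum: "(\<And>i. i \<in> I \<Longrightarrow> lin (\<phi> i)) \<Longrightarrow> lin (\<lambda>v. \<Sum>i\<in>I. \<phi> i v)"
  by (induction I rule: infinite_finite_induct) (auto simp: lin_zero lin_add)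
lemma perm_sgn_0 [simp]: "perm_sgn \<sigma> 0 = 0"
  by (simp add: perm_sgn_def)

lemma perm_sgn_eq: "scale (of_int (sign \<sigma>)) w = perm_sgn \<sigma> w"
  by (simp add: perm_sgn_def sign_def)

lemma lin_perm_sgn: "lin \<phi> \<Longrightarrow> lin (\<lambda>v. perm_sgn \<sigma> (\<phi> v))"
  by (cases "evenperm \<sigma>") (simp_all add: perm_sgn_def lin_neg)

text \<open>Each summand merely permutes the arguments of \<open>f\<close>, and so multilinearity
  passes to the Adams operation.\<close>

lemma adams_eq_sum:
  fixes as :: "'a list" and f :: "'a list \<Rightarrow> 'v"
  shows "adams f as = (\<Sum>p\<le>length as. \<Sum>\<sigma>\<in>shuffle_perms p (length as). perm_sgn \<sigma> (f (permute_list (inv_into UNIV \<sigma>) as)))"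
proof -
  have "deconc F as = (\<Sum>p\<le>length as. F (take p as) (drop p as))" for F :: "'a list \<Rightarrow> 'a list \<Rightarrow> 'v"
    by (induction as arbitrary: F) (auto simp: sum.atMost_Suc_shift simp del: sum.atMost_Suc)
  then show ?thesis unfolding adams_def by (simp add: shuffle_perms_sum)
qed

lemma permute_list_update:
  assumes "\<sigma> permutes {..<length as}" "i < length as"
  shows "permute_list (inv_into UNIV \<sigma>) (as[i := v]) = (permute_list (inv_into UNIV \<sigma>) as)[\<sigma> i := v]"
proof (rule nth_equalityI)
  fix j assume "j < length (permute_list (inv_into UNIV \<sigma>) (as[i := v]))"
  then have j: "j < length as" by simp
  have "inv_into UNIV \<sigma> j < length as"
    using permutes_in_image[OF permutes_inv[OF assms(1)], of j] j by simp
  moreover have "inv_into UNIV \<sigma> j = i \<longleftrightarrow> j = \<sigma> i"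
    using permutes_inverses[OF assms(1)] by metis
  ultimately show "permute_list (inv_into UNIV \<sigma>) (as[i := v]) ! j = (permute_list (inv_into UNIV \<sigma>) as)[\<sigma> i := v] ! j"
    using j by (auto simp: permute_list_def nth_list_update)
qed simp

lemma multilin_adams:
  assumes "multilin m f"
  shows "multilin m (adams f)"
  unfolding multilin_def
proof (intro allI impI, elim conjE)
  fix as :: "'v list" and i assume as: "length as = m" "i < m"
  have "lin (\<lambda>v. f (permute_list (inv_into UNIV \<sigma>) (as[i := v])))" if "\<sigma> \<in> shuffle_perms p m" for \<sigma> p
  proof -
    have \<sigma>: "\<sigma> permutes {..<length as}" using that as by (simp add: shuffle_perms_def)
    then have "\<sigma> i < m" using permutes_in_image[OF \<sigma>] as by simp
    then show ?thesis
      using assms as \<sigma> by (simp add: permute_list_update multilin_def)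
  qed
  then show "lin (\<lambda>v. adams f (as[i := v]))"
    unfolding adams_eq_sum using as by (auto intro!: lin_sum lin_perm_sgn)
qed

lemma adams_cochains: "f \<in> cochains scale m \<Longrightarrow> adams f \<in> cochains scale m"
  by (auto simp: cochains_iff multilin_adams) (simp add: adams_eq_sum)

lemma cochains_diff: "f \<in> cochains scale m \<Longrightarrow> g \<in> cochains scale m \<Longrightarrow> (\<lambda>c. f c - g c) \<in> cochains scale m"
  by (auto simp: cochains_iff multilin_def lin_diff)

lemma cochains_scale: "f \<in> cochains scale m \<Longrightarrow> (\<lambda>c. scale r (f c)) \<in> cochains scale m"
  by (auto simp: cochains_iff multilin_def lin_scale)

lemma kills_products_2: "kills_products 2 f \<longleftrightarrow> (\<forall>xs ys. xs \<noteq> [] \<and> ys \<noteq> [] \<longrightarrow> shuffle f xs ys = 0)"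
proof
  assume *: "kills_products 2 f"
  show "\<forall>xs ys. xs \<noteq> [] \<and> ys \<noteq> [] \<longrightarrow> shuffle f xs ys = 0"
  proof (intro allI impI)
    fix xs ys :: "'a list" assume "xs \<noteq> [] \<and> ys \<noteq> []"
    then show "shuffle f xs ys = 0" using *[unfolded kills_products_def, rule_format, of "[xs, ys]"] by auto
  qed
next
  assume *: "\<forall>xs ys. xs \<noteq> [] \<and> ys \<noteq> [] \<longrightarrow> shuffle f xs ys = 0"
  show "kills_products 2 f" unfolding kills_products_def
    by (auto simp: length_Suc_conv numeral_2_eq_2 *)
qed

text \<open>Translates the condition on permutations in degree \<open>m\<close> into one on pairs of
  nonempty words of any length. Nothing is added by the other lengths, as a cochain vanishes outside
  its degree.\<close>

lemma harrison_cochains_eq: "harrison_cochains scale m = {f \<in> cochains scale m. kills_products 2 f}"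
proof -
  have "(\<forall>p as. 0 < p \<and> p < m \<and> length as = m \<longrightarrow>
      (\<Sum>\<sigma>\<in>shuffle_perms p m. scale (of_int (sign \<sigma>)) (f (permute_list (inv_into UNIV \<sigma>) as))) = 0)
      \<longleftrightarrow> (\<forall>xs ys. xs \<noteq> [] \<and> ys \<noteq> [] \<longrightarrow> shuffle f xs ys = 0)" (is "?L \<longleftrightarrow> ?R")
    if f: "f \<in> cochains scale m" for f
  proof -
    have eq: "(\<Sum>\<sigma>\<in>shuffle_perms p m. scale (of_int (sign \<sigma>)) (f (permute_list (inv_into UNIV \<sigma>) as)))
        = shuffle f (take p as) (drop p as)" if "p < m" "length as = m" for p as
      using shuffle_perms_sum[of p as f] that by (simp add: perm_sgn_eq)
    show ?thesis
    proof
      assume L: ?L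
      show ?R
      proof (intro allI impI)
        fix xs ys :: "'v list" assume ne: "xs \<noteq> [] \<and> ys \<noteq> []"
        show "shuffle f xs ys = 0"
        proof (cases "length (xs @ ys) = m")
          case True
          then have "length xs < m" using ne by auto
          then show ?thesis
            using True L[rule_format, of "length xs" "xs @ ys"] eq[of "length xs" "xs @ ys"] ne by simp
        next
          case False
          then have "shuffle f xs ys = shuffle (\<lambda>_. 0) xs ys"
            using f by (intro shuffle_cong_length) (auto simp: cochains_iff)
          then show ?thesis by simp
        qed
      qed
    next
      assume R: ?R
      show ?L
        by (intro allI impI, elim conjE, subst eq) (auto intro!: R[rule_format])
    qed
  qed
  then show ?thesis
    unfolding harrison_cochains_def kills_products_2 by blast
qed

end

section \<open>Hochschild and Harrison cohomology of separable algebras\<close>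

lemma (in comm_product) tl_out_hom:
  assumes "\<And>u v. \<phi> (u + v) = \<phi> u + \<phi> v" "\<And>a u. \<phi> (\<mu> a u) = \<mu> a (\<phi> u)"
  shows "tl_out (\<lambda>c. \<phi> (f c)) xs = \<phi> (tl_out f xs)"
proof -
  have z: "\<phi> 0 = 0" using assms(1)[of 0 0] by simp
  have d: "\<phi> (u - v) = \<phi> u - \<phi> v" for u v using assms(1)[of "u - v" v] by (simp add: algebra_simps)
  have neg: "\<phi> (- u) = - \<phi> u" for u using d[of 0 u] z by simp
  have m: "merge_hd (\<lambda>c. \<phi> (f c)) a xs = \<phi> (merge_hd f a xs)" for f a xs
    by (cases xs) (auto simp: assms)
  show ?thesis by (induction xs arbitrary: f) (auto simp: m d neg z)
qed

lemma (in comm_product) hd_out_hom: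
  assumes "\<And>u v. \<phi> (u + v) = \<phi> u + \<phi> v" "\<And>a u. \<phi> (\<mu> a u) = \<mu> a (\<phi> u)"
  shows "hd_out (\<lambda>c. \<phi> (f c)) xs = \<phi> (hd_out f xs)"
proof -
  have z: "\<phi> 0 = 0" using assms(1)[of 0 0] by simp
  show ?thesis by (cases xs) (auto simp: assms z)
qed

lemma (in comm_product) bar_d_hom:
  assumes "\<And>u v. \<phi> (u + v) = \<phi> u + \<phi> v" "\<And>a u. \<phi> (\<mu> a u) = \<mu> a (\<phi> u)"
  shows "bar_d (\<lambda>c. \<phi> (f c)) xs = \<phi> (bar_d f xs)"
  unfolding bar_d_def using assms by (simp add: hd_out_hom tl_out_hom)

lemma (in comm_product) bar_d_add: "bar_d (\<lambda>c. f c + g c) xs = bar_d f xs + bar_d g xs"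
  by (simp add: bar_d_def hd_out_add tl_out_add)

lemma (in comm_product) bar_d_neg: "bar_d (\<lambda>c. - f c) xs = - bar_d f xs"
  by (rule bar_d_hom) (simp_all add: mult_simps)

lemma (in comm_product) bar_d_diff: "bar_d (\<lambda>c. f c - g c) xs = bar_d f xs - bar_d g xs"
  using bar_d_add[of f "\<lambda>c. - g c"] by (simp add: bar_d_neg)

lemma quotient_space_trivial:
  fixes U :: "'w::minus set"
  assumes "U \<noteq> {}" "\<And>u v. u \<in> U \<Longrightarrow> v \<in> U \<Longrightarrow> u - v \<in> U"
  shows "quotient_space U U = {U}"
proof -
  have "{(w, w'). w \<in> U \<and> w' \<in> U \<and> w - w' \<in> U} = U \<times> U" using assms by auto
  then show ?thesis unfolding quotient_space_def quotient_def using assms(1) by auto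
qed

section \<open>The Hochschild differential of a commutative algebra\<close>

locale comm_algebra = char_0_space scale + comm_product \<mu>
  for scale :: "'k::field_char_0 \<Rightarrow> 'v::ab_group_add \<Rightarrow> 'v" and \<mu> :: "'v \<Rightarrow> 'v \<Rightarrow> 'v" +
  assumes scale_right: "\<And>a r b. \<mu> a (scale r b) = scale r (\<mu> a b)"
    and assoc: "\<And>a b c. \<mu> (\<mu> a b) c = \<mu> a (\<mu> b c)"
begin

lemma mult_left_commute: "\<mu> a (\<mu> b c) = \<mu> b (\<mu> a c)"
  using assoc[of a b c] assoc[of b a c] by (simp add: commute)

lemma add_left: "\<mu> (a + b) c = \<mu> a c + \<mu> b c"
  by (simp add: commute[of _ c] add_right)

lemma scale_left: "\<mu> (scale r b) c = scale r (\<mu> b c)"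
  by (simp add: commute[of _ c] scale_right)

lemma bar_d_scale: "bar_d (\<lambda>c. scale r (f c)) xs = scale r (bar_d f xs)"
  by (rule bar_d_hom) (simp_all add: scale_right_distrib scale_right)

lemma bar_d_mult: "bar_d (\<lambda>c. \<mu> a (f c)) xs = \<mu> a (bar_d f xs)"
  by (rule bar_d_hom) (simp_all add: add_right mult_left_commute)

lemma bar_d_Cons: "bar_d f (a # w) = \<mu> a (f w) - merge_hd f a w + hd_out (\<lambda>c. f (a # c)) w - bar_d (\<lambda>c. f (a # c)) w"
  by (simp add: bar_d_def)

lemma bar_d_bar_d: "bar_d (bar_d f) xs = 0"
proof (induction xs arbitrary: f)
  case Nil
  then show ?case by (simp add: bar_d_def)
next
  case (Cons a w)
  let ?fa = "\<lambda>c. f (a # c)"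
  have ga: "(\<lambda>c. bar_d f (a # c)) = (\<lambda>c. \<mu> a (f c) - merge_hd f a c + hd_out ?fa c - bar_d ?fa c)"
    by (simp add: bar_d_Cons)
  show ?case
  proof (cases w)
    case Nil
    then show ?thesis by (simp add: bar_d_def mult_simps)
  next
    case w: (Cons b v)
    let ?fab = "\<lambda>c. f (\<mu> a b # c)"
    have 1: "bar_d (\<lambda>c. bar_d f (a # c)) w = \<mu> a (bar_d f w) - bar_d (merge_hd f a) w + bar_d (hd_out ?fa) w"
      unfolding ga bar_d_add bar_d_diff Cons.IH bar_d_mult by simp
    have 2: "bar_d (merge_hd f a) w = \<mu> b (merge_hd f a v) - merge_hd (merge_hd f a) b v + hd_out ?fab v - bar_d ?fab v"
      by (simp add: w bar_d_Cons)
    have 3: "bar_d (hd_out ?fa) w = \<mu> b (hd_out ?fa v) - merge_hd (hd_out ?fa) b v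
       + hd_out (\<lambda>c. \<mu> b (?fa c)) v - \<mu> b (bar_d ?fa v)"
      by (simp add: w bar_d_Cons bar_d_mult)
    have 4: "merge_hd (bar_d f) a w = \<mu> (\<mu> a b) (f v) - merge_hd f (\<mu> a b) v + hd_out ?fab v - bar_d ?fab v"
      by (simp add: w bar_d_Cons)
    have 5: "hd_out (\<lambda>c. bar_d f (a # c)) w = \<mu> b (\<mu> a (f v) - merge_hd f a v + hd_out ?fa v - bar_d ?fa v)"
      by (simp add: w bar_d_Cons)
    \<comment> \<open>Associativity: the two ways of merging \<open>a\<close>, \<open>b\<close> and
      the next argument agree. If \<open>v\<close> is empty, the value of \<open>f\<close> takes the
      place of the next argument.\<close>
    have 6: "merge_hd f (\<mu> a b) v - merge_hd (merge_hd f a) b v + merge_hd (hd_out ?fa) b v = hd_out (\<lambda>c. \<mu> b (?fa c)) v"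
    proof (cases v)
      case Nil then show ?thesis
        by (simp add: mult_simps assoc mult_left_commute[of a b])
    next
      case (Cons c t) then show ?thesis
        by (simp add: assoc commute[of b c] mult_left_commute[of b c])
    qed
    have "bar_d (bar_d f) (a # w) = \<mu> a (bar_d f w) - merge_hd (bar_d f) a w
       + hd_out (\<lambda>c. bar_d f (a # c)) w - bar_d (\<lambda>c. bar_d f (a # c)) w"
      by (rule bar_d_Cons)
    also have "\<dots> = 0"
      unfolding 1 2 3 4 5 6[symmetric] by (simp add: add_right mult_simps assoc mult_left_commute[of a b])
    finally show ?thesis .
  qed
qed

lemma tl_out_eq_sum:
  "length as = Suc m \<Longrightarrow> tl_out f as =
     (\<Sum>i<m. scale ((- 1) ^ (i + 1)) (f (take i as @ [\<mu> (as ! i) (as ! (i + 1))] @ drop (i + 2) as)))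
     + scale ((- 1) ^ (m + 1)) (\<mu> (f (butlast as)) (last as))"
proof (induction m arbitrary: f as)
  case 0
  then obtain a where "as = [a]" by (auto simp: length_Suc_conv)
  then show ?case by (simp add: commute)
next
  case (Suc m)
  then obtain a b w where as: "as = a # b # w" "length w = m" by (auto simp: length_Suc_conv)
  have "tl_out f as = - f (\<mu> a b # w) - tl_out (\<lambda>c. f (a # c)) (b # w)" by (simp add: as)
  also have "tl_out (\<lambda>c. f (a # c)) (b # w) =
     (\<Sum>i<m. scale ((- 1) ^ (i + 1)) (f (a # take i (b # w) @ [\<mu> ((b # w) ! i) ((b # w) ! (i + 1))] @ drop (i + 2) (b # w))))
     + scale ((- 1) ^ (m + 1)) (\<mu> (f (a # butlast (b # w))) (last (b # w)))"
    using as by (intro Suc.IH) simp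
  finally show ?case
    by (simp add: as sum.lessThan_Suc_shift sum_negf del: sum.lessThan_Suc)
qed

text \<open>\<open>bar_d\<close> carries no degree. The two differentials agree on lists of every
  length because a cochain vanishes outside its degree, and commutativity moves the factor
  \<open>last as\<close> to the left as in \<open>tl_out\<close>.\<close>

lemma hochschild_d_eq:
  assumes "\<And>as. length as \<noteq> m \<Longrightarrow> f as = 0"
  shows "hochschild_d scale \<mu> m f = bar_d f"
proof
  fix as
  show "hochschild_d scale \<mu> m f as = bar_d f as"
  proof (cases "length as = Suc m")
    case True
    then have "hd_out f as = \<mu> (hd as) (f (tl as))" by (cases as) auto
    then show ?thesis using True
      by (simp add: hochschild_d_def bar_d_def tl_out_eq_sum[OF True])
  next
    case False
    have "hd_out f as = 0" using assms False by (cases as) (auto simp: mult_simps)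
    moreover have "tl_out f as = tl_out (\<lambda>_. 0) as"
      using assms False by (intro tl_out_cong) auto
    moreover have "tl_out (\<lambda>_. 0) as = 0"
      using tl_out_hom[of "\<lambda>_. 0"] by (simp add: mult_simps)
    ultimately show ?thesis using False by (simp add: hochschild_d_def bar_d_def)
  qed
qed

lemma lin_mult: "lin \<phi> \<Longrightarrow> lin (\<lambda>v. \<mu> a (\<phi> v))"
  by (simp add: lin_def add_right scale_right)

lemma lin_id: "lin (\<lambda>v. v)" by (simp add: lin_def)

lemma multilin_Cons: "multilin (Suc m) f \<Longrightarrow> multilin m (\<lambda>c. f (a # c))"
  unfolding multilin_def
proof (intro allI impI, elim conjE)
  fix as :: "'v list" and i assume *: "\<forall>as i. length as = Suc m \<and> i < Suc m \<longrightarrow> lin (\<lambda>v. f (as[i := v]))" "length as = m" "i < m"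
  show "lin (\<lambda>v. f (a # as[i := v]))" using *(1)[rule_format, of "a # as" "Suc i"] *(2,3) by simp
qed

lemma multilin_hd: "multilin m f \<Longrightarrow> m = Suc (length c) \<Longrightarrow> lin (\<lambda>v. f (v # c))"
  unfolding multilin_def by (drule spec[of _ "0 # c"], drule spec[of _ 0]) simp

lemma multilin_update: "multilin m f \<Longrightarrow> length as = m \<Longrightarrow> i < m \<Longrightarrow> lin (\<lambda>v. f (as[i := v]))"
  unfolding multilin_def by blast

lemma lin_comp: "lin \<phi> \<Longrightarrow> lin \<psi> \<Longrightarrow> lin (\<lambda>v. \<phi> (\<psi> v))"
  by (simp add: lin_def)

lemma merge_hd_lin:
  assumes "multilin m f" "length as = m" "i < m"
  shows "lin (\<lambda>v. merge_hd f a (as[i := v]))"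
proof -
  obtain b w where as: "as = b # w" using assms by (cases as) auto
  show ?thesis
  proof (cases i)
    case 0
    have "lin (\<lambda>v. f (\<mu> a v # w))"
      using multilin_hd[OF assms(1), of w] assms(2) as lin_mult[OF lin_id, of a]
      by (intro lin_comp[of "\<lambda>v. f (v # w)" "\<mu> a"]) auto
    then show ?thesis by (simp add: as 0)
  next
    case (Suc j)
    then show ?thesis using multilin_update[OF assms(1), of "\<mu> a b # w" i] assms(2,3) by (simp add: as)
  qed
qed

lemma merge_hd_lin_left:
  assumes "multilin m f" "length as = m"
  shows "lin (\<lambda>v. merge_hd f v as)"
proof (cases as)
  case Nil
  then show ?thesis by (simp add: lin_def add_left scale_left)
next
  case (Cons b w)
  have "lin (\<lambda>v. \<mu> v b)" by (simp add: lin_def add_left scale_left)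
  then have "lin (\<lambda>v. f (\<mu> v b # w))"
    using multilin_hd[OF assms(1), of w] assms(2) Cons by (intro lin_comp[of "\<lambda>v. f (v # w)" "\<lambda>v. \<mu> v b"]) auto
  then show ?thesis by (simp add: Cons)
qed

text \<open>Linearity in a parameter of the function: varying the first argument of a word varies
  the function to which the recursion on the tail is applied.\<close>

lemma tl_out_lin_fun:
  assumes "\<And>c. Suc (length c) = length as \<Longrightarrow> lin (\<lambda>v. F v c)"
  shows "lin (\<lambda>v. tl_out (F v) as)"
  using assms
proof (induction as arbitrary: F)
  case Nil
  then show ?case by (simp add: lin_zero)
next
  case (Cons a as)
  have "lin (\<lambda>v. merge_hd (F v) a as)"
    using Cons.prems by (cases as) (auto intro: lin_mult)
  moreover have "lin (\<lambda>v. tl_out (\<lambda>c. F v (a # c)) as)"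
    by (rule Cons.IH) (simp add: Cons.prems)
  ultimately show ?case by (simp add: lin_diff lin_neg)
qed

lemma multilin_tl_out: "multilin m f \<Longrightarrow> multilin (Suc m) (tl_out f)"
proof (induction m arbitrary: f)
  case 0
  show ?case unfolding multilin_def
    by (auto simp: length_Suc_conv lin_def add_left scale_left)
next
  case (Suc m)
  show ?case unfolding multilin_def
  proof (intro allI impI, elim conjE)
    fix as :: "'v list" and i assume as: "length as = Suc (Suc m)" "i < Suc (Suc m)"
    then obtain a w where aw: "as = a # w" "length w = Suc m" by (auto simp: length_Suc_conv)
    show "lin (\<lambda>v. tl_out f (as[i := v]))"
    proof (cases i)
      case 0
      have "lin (\<lambda>v. tl_out (\<lambda>c. f (v # c)) w)"
        using Suc.prems aw by (intro tl_out_lin_fun) (auto intro: multilin_hd)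
      then show ?thesis
        using merge_hd_lin_left[OF Suc.prems aw(2)] by (simp add: aw 0 lin_diff lin_neg)
    next
      case (Suc j)
      have "lin (\<lambda>v. tl_out (\<lambda>c. f (a # c)) (w[j := v]))"
        using Suc.IH[OF multilin_Cons[OF Suc.prems]] as aw \<open>i = Suc j\<close> by (intro multilin_update) auto
      moreover have "lin (\<lambda>v. merge_hd f a (w[j := v]))"
        using merge_hd_lin[OF Suc.prems aw(2)] as \<open>i = Suc j\<close> by simp
      ultimately show ?thesis by (simp add: aw \<open>i = Suc j\<close> lin_diff lin_neg)
    qed
  qed
qed

lemma multilin_hd_out: "multilin m f \<Longrightarrow> multilin (Suc m) (hd_out f)"
  unfolding multilin_def[of "Suc m"]
proof (intro allI impI, elim conjE)
  fix as :: "'v list" and i assume f: "multilin m f" and as: "length as = Suc m" "i < Suc m"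
  then obtain a w where aw: "as = a # w" "length w = m" by (auto simp: length_Suc_conv)
  show "lin (\<lambda>v. hd_out f (as[i := v]))"
  proof (cases i)
    case 0 then show ?thesis by (simp add: aw lin_def add_left scale_left)
  next
    case (Suc j) then show ?thesis using multilin_update[OF f aw(2), of j] as by (simp add: aw lin_mult)
  qed
qed

lemma bar_d_cochains:
  assumes "f \<in> cochains scale m"
  shows "bar_d f \<in> cochains scale (Suc m)"
proof -
  have f: "\<And>as. length as \<noteq> m \<Longrightarrow> f as = 0" "multilin m f" using assms by (auto simp: cochains_iff)
  have "multilin (Suc m) (bar_d f)"
    using multilin_hd_out[OF f(2)] multilin_tl_out[OF f(2)]
    by (auto simp: multilin_def bar_d_def intro: lin_add)
  moreover have "bar_d f as = 0" if "length as \<noteq> Suc m" for as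
    using hochschild_d_eq[of m f] f(1) that by (simp add: hochschild_d_def fun_eq_iff split: if_splits) metis
  ultimately show ?thesis by (simp add: cochains_iff)
qed

lemma bar_d_kills_products:
  assumes "kills_products 2 f"
  shows "kills_products 2 (bar_d f)"
proof -
  \<comment> \<open>As a function of \<open>u\<close>, \<open>shuffle f u ys\<close> vanishes for
    nonempty \<open>u\<close>. The empty word is reached from a single letter only; there the letter
    is both first and last argument, and the two outer terms cancel.\<close>
  have z: "bar_d F xs = 0" if "\<And>c. c \<noteq> [] \<Longrightarrow> F c = 0" "xs \<noteq> []" for F xs
  proof (cases xs)
    case (Cons a w)
    show ?thesis
    proof (cases w)
      case Nil then show ?thesis by (simp add: Cons bar_d_def)
    next
      case (Cons b v)
      have "hd_out F xs = 0" using that Cons \<open>xs = a # w\<close> by (simp add: mult_simps)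
      moreover have "tl_out F xs = tl_out (\<lambda>_. 0) xs"
        using Cons \<open>xs = a # w\<close> by (intro tl_out_cong that(1)) auto
      moreover have "tl_out (\<lambda>_. 0) xs = 0"
        using tl_out_hom[of "\<lambda>_. 0"] by (simp add: mult_simps)
      ultimately show ?thesis by (simp add: bar_d_def)
    qed
  qed (use that in auto)
  show ?thesis
    using assms unfolding kills_products_2 bar_d_shuffle by (auto simp: z)
qed

text \<open>A primitive killing products of \<open>j + 1\<close> factors is improved to one killing products of \<open>j\<close> factors by
  subtracting \<open>2\<^sup>j\<close> times it from its image under the Adams operation, which is 2 on \<open>f\<close> and \<open>2\<^sup>j\<close>
  on products of \<open>j\<close> factors.\<close>

lemma harrison_primitive:
  assumes f: "kills_products 2 f" "f [] = 0" and h: "h \<in> cochains scale M" "bar_d h = f"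
  shows "\<exists>h' \<in> harrison_cochains scale M. bar_d h' = f"
proof -
  have adams_f: "adams f c = scale 2 (f c)" for c
  proof (cases "c = []")
    case True then show ?thesis using f(2) by (simp add: adams_def)
  next
    case False
    then show ?thesis using multi_shuffle_adams[of "[c]" f] f(1) by (simp add: numeral_2_eq_2)
  qed
  have "\<exists>h' \<in> cochains scale M. kills_products 2 h' \<and> bar_d h' = f"
    if "kills_products (d + 2) h" "h \<in> cochains scale M" "bar_d h = f" for d h
    using that
  proof (induction d arbitrary: h)
    case 0 then show ?case unfolding add_0 by blast
  next
    case (Suc d)
    let ?j = "d + 2"
    let ?r = "2 - 2 ^ ?j :: 'k"
    \<comment> \<open>The eigenvalues 2 and \<open>2 ^ ?j\<close> differ because \<open>?j\<close>
      is at least 2 and the characteristic is 0.\<close>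
    have r: "?r \<noteq> 0"
    proof -
      have "(2::nat) ^ ?j \<noteq> 2 ^ 1" by (subst power_inject_exp) auto
      then have "(of_nat (2 ^ ?j) :: 'k) \<noteq> of_nat (2 ^ 1)" unfolding of_nat_eq_iff .
      then show ?thesis by simp
    qed
    define h' where "h' = (\<lambda>c. scale (inverse ?r) (adams h c - scale (2 ^ ?j) (h c)))"
    have "kills_products ?j h'"
      unfolding kills_products_def
    proof (intro allI impI, elim conjE)
      fix L :: "'v list list" assume L: "length L = ?j" "[] \<notin> set L"
      have "multi_shuffle h' L = scale (inverse ?r) (multi_shuffle (adams h) L - scale (2 ^ ?j) (multi_shuffle h L))"
        unfolding h'_def multi_shuffle_scale multi_shuffle_diff by simp
      also have "multi_shuffle (adams h) L = scale (2 ^ ?j) (multi_shuffle h L)"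
        using multi_shuffle_adams[of L h] L Suc.prems(1) by simp
      finally show "multi_shuffle h' L = 0" by simp
    qed
    moreover have "h' \<in> cochains scale M"
      unfolding h'_def using Suc.prems(2) by (intro cochains_scale cochains_diff adams_cochains)
    moreover have "bar_d h' = f"
    proof
      fix c
      have "bar_d h' c = scale (inverse ?r) (adams f c - scale (2 ^ ?j) (f c))"
        unfolding h'_def bar_d_scale bar_d_diff bar_d_adams Suc.prems(3) by simp
      also have "adams f c - scale (2 ^ ?j) (f c) = scale ?r (f c)"
        by (simp add: adams_f scale_left_diff_distrib)
      finally show "bar_d h' c = f c" using r by simp
    qed
    ultimately show ?case by (rule Suc.IH)
  qed
  moreover have "kills_products (M + 2) h"
    using h(1) by (intro kills_products_length[of M]) (auto simp: cochains_iff)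
  ultimately show ?thesis
    using h unfolding harrison_cochains_eq by blast
qed

end

text \<open>A separability idempotent, the sum of \<open>p i\<close> tensor \<open>q i\<close>,
  written without tensor products: its invariance under moving \<open>a\<close> from one factor to
  the other is tested by applying an arbitrary linear map to the second factor and
  multiplying.\<close>

locale separable_algebra = comm_algebra scale \<mu>
  for scale :: "'k::field_char_0 \<Rightarrow> 'v::ab_group_add \<Rightarrow> 'v" and \<mu> :: "'v \<Rightarrow> 'v \<Rightarrow> 'v" +
  fixes I :: "'i set" and p q :: "'i \<Rightarrow> 'v"
  assumes casimir_unit: "\<And>b. (\<Sum>i\<in>I. \<mu> (p i) (\<mu> (q i) b)) = b"
    and casimir_move: "\<And>\<phi> a. lin \<phi> \<Longrightarrow> (\<Sum>i\<in>I. \<mu> (p i) (\<phi> (\<mu> (q i) a))) = \<mu> a (\<Sum>i\<in>I. \<mu> (p i) (\<phi> (q i)))"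
begin

definition contraction :: "('v list \<Rightarrow> 'v) \<Rightarrow> 'v list \<Rightarrow> 'v" where
  "contraction f as = (\<Sum>i\<in>I. \<mu> (p i) (f (q i # as)))"

text \<open>With \<open>q i\<close> inserted in front, the first term of the differential gives
  \<open>f\<close> by \<open>casimir_unit\<close>. The merge of \<open>q i\<close> with the first
  argument becomes multiplication by that argument, by \<open>casimir_move\<close>, and the other
  terms match those of the differential of the contraction.\<close>

lemma contraction_homotopy:
  assumes "f \<in> cochains scale (Suc m)" "as \<noteq> []"
  shows "contraction (bar_d f) as + bar_d (contraction f) as = f as"
proof -
  obtain a w where as: "as = a # w" using assms(2) by (cases as) auto
  have sumsub: "(\<Sum>i\<in>I. u i - v i) = sum u I - sum v I" for u v :: "'i \<Rightarrow> 'v" by (rule sum_subtractf)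
  have tl: "tl_out (contraction f) as = (\<Sum>i\<in>I. \<mu> (p i) (tl_out (\<lambda>c. f (q i # c)) as))"
  proof -
    have "tl_out (\<lambda>c. \<Sum>i\<in>J. F i c) as = (\<Sum>i\<in>J. tl_out (F i) as)" for F :: "'i \<Rightarrow> 'v list \<Rightarrow> 'v" and J
    proof (induction J rule: infinite_finite_induct)
      case (insert i J) then show ?case by (simp add: tl_out_add)
    qed (use tl_out_hom[of "\<lambda>_. 0"] in \<open>simp_all add: mult_simps\<close>)
    then show ?thesis unfolding contraction_def
      by (simp add: tl_out_hom[where \<phi> = "\<mu> _"] add_right mult_left_commute)
  qed
  have hd: "hd_out (contraction f) as = (\<Sum>i\<in>I. \<mu> (p i) (merge_hd f (q i) as))"
  proof (cases "length w = m")
    case True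
    then have "lin (\<lambda>v. f (v # w))" using assms(1) by (intro multilin_hd[of "Suc m"]) (auto simp: cochains_iff)
    then show ?thesis using casimir_move[of "\<lambda>v. f (v # w)" a]
      by (simp add: as contraction_def commute[of _ a])
  next
    case False
    then show ?thesis using assms(1) by (simp add: as contraction_def cochains_iff mult_simps)
  qed
  have "contraction (bar_d f) as = (\<Sum>i\<in>I. \<mu> (p i) (\<mu> (q i) (f as))
      - \<mu> (p i) (merge_hd f (q i) as) - \<mu> (p i) (tl_out (\<lambda>c. f (q i # c)) as))"
    unfolding contraction_def by (simp add: bar_d_def mult_simps add_right algebra_simps)
  also have "\<dots> = f as - bar_d (contraction f) as"
    unfolding sumsub casimir_unit tl[symmetric] hd[symmetric] bar_d_def by simp
  finally show ?thesis by simp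
qed

lemma contraction_cochains:
  assumes "f \<in> cochains scale (Suc m)"
  shows "contraction f \<in> cochains scale m"
proof -
  have f: "\<And>as. length as \<noteq> Suc m \<Longrightarrow> f as = 0" "multilin (Suc m) f" using assms by (auto simp: cochains_iff)
  have "contraction f as = 0" if "length as \<noteq> m" for as
    using f(1) that by (simp add: contraction_def mult_simps)
  moreover have "multilin m (contraction f)"
    using multilin_Cons[OF f(2)] by (auto simp: multilin_def contraction_def intro!: lin_sum lin_mult)
  ultimately show ?thesis by (simp add: cochains_iff)
qed

text \<open>The contraction says nothing about shuffle relations. A Harrison cocycle is therefore
  first bounded in the Hochschild complex, and the primitive is then corrected by
  \<open>harrison_primitive\<close>.\<close>

lemma cocycles_eq_coboundaries:
  assumes "m > 0"
  shows "cocycles scale \<mu> (cochains scale) m = coboundaries scale \<mu> (cochains scale) m"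
    "cocycles scale \<mu> (harrison_cochains scale) m = coboundaries scale \<mu> (harrison_cochains scale) m"
proof -
  obtain M where M: "m = Suc M" using assms by (cases m) auto
  have d: "hochschild_d scale \<mu> k f = bar_d f" if "f \<in> cochains scale k" for k f
    using that by (intro hochschild_d_eq) (simp add: cochains_iff)
  have prim: "\<exists>h\<in>cochains scale M. bar_d h = f" if f: "f \<in> cochains scale m" "bar_d f = (\<lambda>_. 0)" for f
  proof (intro bexI)
    show "contraction f \<in> cochains scale M" using contraction_cochains f(1) M by simp
    show "bar_d (contraction f) = f"
    proof
      fix as
      show "bar_d (contraction f) as = f as"
      proof (cases "as = []")
        case True
        then show ?thesis using f(1) M by (simp add: cochains_iff bar_d_def)
      next
        case False
        then show ?thesis using contraction_homotopy[of f M as] f M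
          by (simp add: contraction_def[of "\<lambda>_. 0"] mult_simps)
      qed
    qed
  qed
  have H: "harrison_cochains scale k \<subseteq> cochains scale k" for k by (auto simp: harrison_cochains_eq)
  show "cocycles scale \<mu> (cochains scale) m = coboundaries scale \<mu> (cochains scale) m"
  proof (intro equalityI subsetI)
    fix f assume "f \<in> cocycles scale \<mu> (cochains scale) m"
    then have "f \<in> cochains scale m" "bar_d f = (\<lambda>_. 0)"
      using d by (auto simp: cocycles_def)
    then obtain h where "h \<in> cochains scale M" "bar_d h = f"
      using prim by blast
    then show "f \<in> coboundaries scale \<mu> (cochains scale) m"
      using M d by (auto simp: coboundaries_def image_iff)
  next
    fix f assume "f \<in> coboundaries scale \<mu> (cochains scale) m"
    then obtain h where h: "h \<in> cochains scale M" "f = bar_d h"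
      using M d by (auto simp: coboundaries_def)
    have "f \<in> cochains scale m" using bar_d_cochains[OF h(1)] h(2) M by simp
    then show "f \<in> cocycles scale \<mu> (cochains scale) m"
      using d h(2) bar_d_bar_d by (auto simp: cocycles_def)
  qed
  show "cocycles scale \<mu> (harrison_cochains scale) m = coboundaries scale \<mu> (harrison_cochains scale) m"
  proof (intro equalityI subsetI)
    fix f assume "f \<in> cocycles scale \<mu> (harrison_cochains scale) m"
    then have f: "f \<in> harrison_cochains scale m" "f \<in> cochains scale m" "hochschild_d scale \<mu> m f = (\<lambda>_. 0)"
      using H by (auto simp: cocycles_def)
    then have "bar_d f = (\<lambda>_. 0)" using d by simp
    note f = f(1,2) this
    then obtain h where "h \<in> cochains scale M" "bar_d h = f" using prim by blast
    then obtain h where "h \<in> harrison_cochains scale M" "bar_d h = f"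
      using harrison_primitive[of f h M] f M by (auto simp: harrison_cochains_eq cochains_iff)
    moreover from this have "hochschild_d scale \<mu> M h = f" using d H by blast
    ultimately show "f \<in> coboundaries scale \<mu> (harrison_cochains scale) m"
      using M by (auto simp: coboundaries_def intro: rev_image_eqI)
  next
    fix f assume "f \<in> coboundaries scale \<mu> (harrison_cochains scale) m"
    then obtain h where h: "h \<in> harrison_cochains scale M" "f = hochschild_d scale \<mu> M h"
      using M by (auto simp: coboundaries_def)
    then have "f = bar_d h" using d H by blast
    note h = h(1) this
    have "f \<in> harrison_cochains scale m"
      using bar_d_cochains[of h M] bar_d_kills_products[of h] h M by (auto simp: harrison_cochains_eq)
    moreover from this have "hochschild_d scale \<mu> m f = bar_d f" using d H by blast
    ultimately show "f \<in> cocycles scale \<mu> (harrison_cochains scale) m"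
      using h(2) bar_d_bar_d by (auto simp: cocycles_def)
  qed
qed

lemma cohomology_trivial:
  assumes "m > 0"
  shows "HH scale \<mu> m = {coboundaries scale \<mu> (cochains scale) m}"
    "Harr scale \<mu> m = {coboundaries scale \<mu> (harrison_cochains scale) m}"
proof -
  have d: "hochschild_d scale \<mu> k f = bar_d f" if "f \<in> cochains scale k" for k f
    using that by (intro hochschild_d_eq) (simp add: cochains_iff)
  have 0: "(\<lambda>_. 0) \<in> cochains scale k" for k by (simp add: cochains_iff multilin_def lin_zero)
  have d0: "bar_d (\<lambda>_. 0) = (\<lambda>_. 0)" using bar_d_diff[of "\<lambda>_. 0" "\<lambda>_. 0"] by (simp add: fun_eq_iff)
  have k: "kills_products 2 (\<lambda>c. f c - g c)" if "kills_products 2 f" "kills_products 2 g" for f g :: "'v list \<Rightarrow> 'v"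
    using that by (simp add: kills_products_def multi_shuffle_diff)
  have k0: "kills_products 2 (\<lambda>_. 0 :: 'v)" by (simp add: kills_products_def multi_shuffle_zero)
  have ne: "(\<lambda>_. 0) \<in> cocycles scale \<mu> (cochains scale) m"
    "(\<lambda>_. 0) \<in> cocycles scale \<mu> (harrison_cochains scale) m"
    using 0 d d0 k0 by (auto simp: cocycles_def harrison_cochains_eq)
  have "quotient_space (cocycles scale \<mu> (cochains scale) m) (cocycles scale \<mu> (cochains scale) m)
      = {cocycles scale \<mu> (cochains scale) m}"
    using ne(1) d bar_d_diff cochains_diff[of _ m]
    by (intro quotient_space_trivial) (auto simp: cocycles_def fun_diff_def)
  then show "HH scale \<mu> m = {coboundaries scale \<mu> (cochains scale) m}"
    unfolding HH_def cocycles_eq_coboundaries(1)[OF assms] .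
  have "quotient_space (cocycles scale \<mu> (harrison_cochains scale) m) (cocycles scale \<mu> (harrison_cochains scale) m)
      = {cocycles scale \<mu> (harrison_cochains scale) m}"
    using ne(2) d bar_d_diff cochains_diff[of _ m] k
    by (intro quotient_space_trivial) (auto simp: cocycles_def fun_diff_def harrison_cochains_eq)
  then show "Harr scale \<mu> m = {coboundaries scale \<mu> (harrison_cochains scale) m}"
    unfolding Harr_def cocycles_eq_coboundaries(2)[OF assms] .
qed

end

section \<open>Algebras given by structure constants\<close>

lemma sum_delta2:
  fixes i j n :: nat
  assumes "i < n" "j < n"
  shows "(\<Sum>a<n. \<Sum>b<n. (if a = i then 1 else 0) * (if b = j then 1 else 0) * f a b) = (f i j :: 'a::comm_semiring_1)"
proof -
  have "(\<Sum>b<n. (if a = i then 1 else 0) * (if b = j then 1 else 0) * f a b) = (if a = i then f a j else 0)" for a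
    using assms by (auto simp: if_distrib[of "\<lambda>c. c * _"] cong: if_cong)
  then show ?thesis using assms by simp
qed

text \<open>The algebra is the span \<open>A\<close> of the \<open>e i\<close> and need not be the whole type, so that algebras over the
  algebraic closure can be realised inside its polynomials.\<close>

locale based_space = vector_space scale
  for scale :: "'k::field \<Rightarrow> 'v::ab_group_add \<Rightarrow> 'v" +
  fixes n :: nat and e :: "nat \<Rightarrow> 'v"
  assumes inj_e: "inj_on e {..<n}" and indep_e: "independent (e ` {..<n})"
begin

abbreviation A :: "'v set" where "A \<equiv> span (e ` {..<n})"
abbreviation co :: "'v \<Rightarrow> nat \<Rightarrow> 'k" where "co \<equiv> coordinate scale n e"

lemma e_in_A [simp]: "i < n \<Longrightarrow> e i \<in> A"
  by (auto intro: span_base)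

lemma co_add: "a \<in> A \<Longrightarrow> b \<in> A \<Longrightarrow> co (a + b) i = co a i + co b i"
  by (simp add: coordinate_def representation_add[OF indep_e])

lemma co_scale: "a \<in> A \<Longrightarrow> co (scale c a) i = c * co a i"
  by (simp add: coordinate_def representation_scale[OF indep_e])

lemma co_zero [simp]: "co 0 i = 0"
  by (simp add: coordinate_def representation_zero)

lemma co_sum: "(\<And>j. j \<in> J \<Longrightarrow> f j \<in> A) \<Longrightarrow> co (\<Sum>j\<in>J. f j) i = (\<Sum>j\<in>J. co (f j) i)"
  by (induction J rule: infinite_finite_induct) (auto simp: co_add span_sum)

lemma co_diff: "a \<in> A \<Longrightarrow> b \<in> A \<Longrightarrow> co (a - b) i = co a i - co b i"
  by (simp add: coordinate_def representation_diff[OF indep_e])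

lemma co_e: "i < n \<Longrightarrow> j < n \<Longrightarrow> co (e j) i = (if i = j then 1 else 0)"
  using inj_e by (auto simp: coordinate_def representation_basis[OF indep_e] inj_on_def)

lemma lincomb_in_A: "(\<Sum>i<n. scale (c i) (e i)) \<in> A"
  by (intro span_sum span_scale) simp

lemma co_lincomb: "i < n \<Longrightarrow> co (\<Sum>j<n. scale (c j) (e j)) i = c i"
proof -
  assume "i < n"
  then have "co (\<Sum>j<n. scale (c j) (e j)) i = (\<Sum>j<n. if i = j then c j else 0)"
    by (subst co_sum) (auto simp: span_scale co_scale co_e if_distrib[of "\<lambda>c. _ * c"] cong: if_cong)
  then show ?thesis using \<open>i < n\<close> by simp
qed

lemma expand: "a \<in> A \<Longrightarrow> a = (\<Sum>i<n. scale (co a i) (e i))"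
  using sum_representation_eq[OF indep_e, of a "e ` {..<n}"] inj_e
  by (simp add: coordinate_def sum.reindex)

lemma A_eqI: "a \<in> A \<Longrightarrow> b \<in> A \<Longrightarrow> (\<And>i. i < n \<Longrightarrow> co a i = co b i) \<Longrightarrow> a = b"
  using expand[of a] expand[of b] by simp

lemma finite_e: "finite (e ` {..<n})" by simp

lemma card_e: "card (e ` {..<n}) = n" using inj_e by (simp add: card_image)

text \<open>\<open>dependent\<close> speaks of sets, so a repetition in the family has to supply a
  relation by itself.\<close>

lemma family_dependent:
  assumes "\<And>j. v j \<in> A"
  shows "\<exists>c. (\<exists>j\<le>n. c j \<noteq> 0) \<and> (\<Sum>j\<le>n. scale (c j) (v j)) = 0"
proof (cases "inj_on v {..n}")
  case False
  then obtain i j where ij: "i \<le> n" "j \<le> n" "i \<noteq> j" "v i = v j" by (auto simp: inj_on_def)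
  define c :: "nat \<Rightarrow> 'k" where "c l = (if l = i then 1 else 0) - (if l = j then 1 else 0)" for l
  have "(\<Sum>l\<le>n. scale (c l) (v l)) = 0"
    using ij by (simp add: c_def scale_left_diff_distrib sum_subtractf if_distrib[of "\<lambda>c. scale c _"] cong: if_cong)
  moreover have "c i \<noteq> 0" using ij by (simp add: c_def)
  ultimately show ?thesis using ij(1) by metis
next
  case True
  have "dependent (v ` {..n})"
  proof (rule ccontr)
    assume "independent (v ` {..n})"
    then have "card (v ` {..n}) \<le> card (e ` {..<n})"
      using independent_span_bound[OF finite_e, of "v ` {..n}"] assms by auto
    then show False using True by (simp add: card_image card_e)
  qed
  then obtain u where u: "(\<Sum>w\<in>v ` {..n}. scale (u w) w) = 0" "\<exists>w\<in>v ` {..n}. u w \<noteq> 0"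
    using dependent_finite[of "v ` {..n}"] by auto
  then have "(\<Sum>j\<le>n. scale (u (v j)) (v j)) = 0" "\<exists>j\<le>n. u (v j) \<noteq> 0"
    using True by (auto simp: sum.reindex)
  then show ?thesis by (intro exI[of _ "\<lambda>j. u (v j)"] conjI)
qed

lemma alg_mult_alt: "alg_mult scale n e y a b = (\<Sum>l<n. scale (\<Sum>i<n. \<Sum>j<n. co a i * co b j * y i j l) (e l))"
proof -
  have "alg_mult scale n e y a b = (\<Sum>i<n. \<Sum>l<n. \<Sum>j<n. scale (co a i * co b j * y i j l) (e l))"
    unfolding alg_mult_def by (intro sum.cong refl sum.swap)
  also have "\<dots> = (\<Sum>l<n. \<Sum>i<n. \<Sum>j<n. scale (co a i * co b j * y i j l) (e l))"
    by (rule sum.swap)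
  finally show ?thesis by (simp add: scale_sum_left)
qed

lemma alg_mult_closed [simp]: "alg_mult scale n e y a b \<in> A"
  unfolding alg_mult_alt by (rule lincomb_in_A)

lemma co_alg_mult: "l < n \<Longrightarrow> co (alg_mult scale n e y a b) l = (\<Sum>i<n. \<Sum>j<n. co a i * co b j * y i j l)"
  unfolding alg_mult_alt by (rule co_lincomb)

lemma alg_mult_add:
  assumes "b \<in> A" "c \<in> A"
  shows "alg_mult scale n e y a (b + c) = alg_mult scale n e y a b + alg_mult scale n e y a c"
    "alg_mult scale n e y (b + c) a = alg_mult scale n e y b a + alg_mult scale n e y c a"
  using assms by (auto intro!: A_eqI simp: span_add co_alg_mult co_add algebra_simps sum.distrib)

lemma alg_mult_scale:
  assumes "b \<in> A"
  shows "alg_mult scale n e y a (scale r b) = scale r (alg_mult scale n e y a b)"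
    "alg_mult scale n e y (scale r b) a = scale r (alg_mult scale n e y b a)"
  using assms by (auto intro!: A_eqI simp: span_scale co_alg_mult co_scale algebra_simps sum_distrib_left)

lemma alg_mult_e: "i < n \<Longrightarrow> j < n \<Longrightarrow> alg_mult scale n e y (e i) (e j) = (\<Sum>l<n. scale (y i j l) (e l))"
  by (rule A_eqI) (simp_all add: lincomb_in_A co_alg_mult co_lincomb co_e sum_delta2)

text \<open>The scaling \<open>sc\<close> of the target is a parameter, so that the lemma serves
  both for maps into \<open>A\<close> and for linear forms.\<close>

lemma linear_ext:
  assumes "a \<in> A" "\<And>i. i < n \<Longrightarrow> S (e i) = T (e i)"
    "\<And>b c. b \<in> A \<Longrightarrow> c \<in> A \<Longrightarrow> S (b + c) = (S b + S c :: 'w::ab_group_add)"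
    "\<And>b c. b \<in> A \<Longrightarrow> c \<in> A \<Longrightarrow> T (b + c) = T b + T c"
    "\<And>r b. b \<in> A \<Longrightarrow> S (scale r b) = sc r (S b)"
    "\<And>r b. b \<in> A \<Longrightarrow> T (scale r b) = sc r (T b)"
  shows "S a = T a"
proof -
  have z: "S 0 = 0" "T 0 = 0" using assms(3,4)[of 0 0] by (simp_all add: span_zero)
  have "S (\<Sum>i\<in>J. scale (co a i) (e i)) = (\<Sum>i\<in>J. sc (co a i) (S (e i)))
     \<and> T (\<Sum>i\<in>J. scale (co a i) (e i)) = (\<Sum>i\<in>J. sc (co a i) (T (e i)))" if "J \<subseteq> {..<n}" for J
    using finite_subset[OF that finite_lessThan] that
    by (induction J rule: finite_induct) (auto simp: z assms(3-6) span_sum span_scale subset_iff)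
  then have "S (\<Sum>i<n. scale (co a i) (e i)) = (\<Sum>i<n. sc (co a i) (S (e i)))"
    "T (\<Sum>i<n. scale (co a i) (e i)) = (\<Sum>i<n. sc (co a i) (T (e i)))" by auto
  then show ?thesis using expand[OF assms(1)] assms(2) by simp
qed

text \<open>Allows a trace to be computed in a basis adapted to an ideal.\<close>

lemma trace_basis_indep:
  assumes B: "independent B" "finite B" "span B = A"
    and T: "\<And>a. a \<in> A \<Longrightarrow> T a \<in> A" "\<And>a b. a \<in> A \<Longrightarrow> b \<in> A \<Longrightarrow> T (a + b) = T a + T b"
      "\<And>c a. a \<in> A \<Longrightarrow> T (scale c a) = scale c (T a)"
  shows "endo_trace scale n e T = (\<Sum>b\<in>B. representation B (T b) b)"
proof -
  have BA: "b \<in> A" if "b \<in> B" for b using that B(3) by (metis span_base)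
  have T0: "T 0 = 0" using T(3)[of 0 0] by (simp add: span_zero)
  have Tsum: "T (\<Sum>j\<in>J. f j) = (\<Sum>j\<in>J. T (f j))" if "\<And>j. j \<in> J \<Longrightarrow> f j \<in> A" for J and f :: "'x \<Rightarrow> 'v"
    using that by (induction J rule: infinite_finite_induct) (auto simp: T0 T(2) span_sum)
  have Be: "e i = (\<Sum>b\<in>B. scale (representation B (e i) b) b)" if "i < n" for i
    using sum_representation_eq[OF B(1), of "e i" B] B(2,3) that by simp
  have "co (T (e i)) i = (\<Sum>b\<in>B. representation B (e i) b * co (T b) i)" if "i < n" for i
  proof -
    have "T (e i) = (\<Sum>b\<in>B. scale (representation B (e i) b) (T b))"
      by (subst Be[OF that], subst Tsum) (auto simp: BA span_scale T(3))
    then show ?thesis using BA T(1) by (simp add: co_sum span_scale co_scale)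
  qed
  then have "endo_trace scale n e T = (\<Sum>i<n. \<Sum>b\<in>B. representation B (e i) b * co (T b) i)"
    by (simp add: endo_trace_def)
  also have "\<dots> = (\<Sum>b\<in>B. \<Sum>i<n. co (T b) i * representation B (e i) b)"
    by (subst sum.swap) (simp add: mult.commute)
  also have "\<dots> = (\<Sum>b\<in>B. representation B (T b) b)"
  proof (rule sum.cong[OF refl])
    fix b assume b: "b \<in> B"
    have "representation B (T b) = representation B (\<Sum>i<n. scale (co (T b) i) (e i))"
      using expand[OF T(1)[OF BA[OF b]]] by simp
    also have "\<dots> = (\<lambda>b'. \<Sum>i<n. co (T b) i * representation B (e i) b')"
      using B(1,3) by (subst representation_sum) (auto simp: span_scale representation_scale)
    finally show "(\<Sum>i<n. co (T b) i * representation B (e i) b) = representation B (T b) b" by simp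
  qed
  finally show ?thesis .
qed

end

locale comm_structure = based_space scale n e
  for scale :: "'k::field \<Rightarrow> 'v::ab_group_add \<Rightarrow> 'v" and n and e :: "nat \<Rightarrow> 'v" +
  fixes x :: "nat \<Rightarrow> nat \<Rightarrow> nat \<Rightarrow> 'k"
  assumes x_sym: "\<lbrakk>i < n; j < n; l < n\<rbrakk> \<Longrightarrow> x i j l = x j i l"
    and x_assoc: "\<lbrakk>i < n; j < n; k < n; m < n\<rbrakk> \<Longrightarrow>
      (\<Sum>l<n. x i j l * x l k m) = (\<Sum>l<n. x j k l * x i l m)"
begin

abbreviation \<mu> where "\<mu> \<equiv> alg_mult scale n e x"

lemmas co_mult = co_alg_mult[of _ x]
lemmas mult_add_right = alg_mult_add(1)[of _ _ x]
lemmas mult_add_left = alg_mult_add(2)[of _ _ x]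
lemmas mult_scale_right = alg_mult_scale(1)[of _ x]
lemmas mult_scale_left = alg_mult_scale(2)[of _ x]
lemmas mult_e = alg_mult_e[of _ _ x]

lemma mult_commute: "\<mu> a b = \<mu> b a"
proof (rule A_eqI)
  fix l assume "l < n"
  then show "co (\<mu> a b) l = co (\<mu> b a) l"
    unfolding co_mult[OF \<open>l < n\<close>]
    by (subst sum.swap) (intro sum.cong refl, simp add: x_sym mult.commute)
qed simp_all

lemma mult_zero [simp]: "\<mu> a 0 = 0" "\<mu> 0 a = 0"
  using mult_scale_right[of 0 a 0] mult_commute[of 0 a] by (simp_all add: span_zero)

lemma mult_diff_right: "b \<in> A \<Longrightarrow> c \<in> A \<Longrightarrow> \<mu> a (b - c) = \<mu> a b - \<mu> a c"
  using mult_add_right[of "b - c" c a] by (simp add: span_diff)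

lemma mult_sum_right: "(\<And>j. j \<in> J \<Longrightarrow> f j \<in> A) \<Longrightarrow> \<mu> a (\<Sum>j\<in>J. f j) = (\<Sum>j\<in>J. \<mu> a (f j))"
  by (induction J rule: infinite_finite_induct) (auto simp: mult_add_right span_sum)

lemma mult_sum_left: "(\<And>j. j \<in> J \<Longrightarrow> f j \<in> A) \<Longrightarrow> \<mu> (\<Sum>j\<in>J. f j) a = (\<Sum>j\<in>J. \<mu> (f j) a)"
  using mult_sum_right[of J f a] by (simp add: mult_commute)

lemma mult_assoc_e:
  assumes "i < n" "j < n" "k < n"
  shows "\<mu> (\<mu> (e i) (e j)) (e k) = \<mu> (e i) (\<mu> (e j) (e k))"
proof -
  have "\<mu> (\<mu> (e i) (e j)) (e k) = (\<Sum>l<n. scale (x i j l) (\<Sum>m<n. scale (x l k m) (e m)))"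
    using assms by (simp only: mult_e[of i j], subst mult_sum_left) (auto simp: span_scale mult_scale_left mult_e intro!: sum.cong)
  also have "\<dots> = (\<Sum>m<n. scale (\<Sum>l<n. x i j l * x l k m) (e m))"
    by (simp add: scale_sum_right scale_sum_left) (rule sum.swap)
  also have "\<dots> = (\<Sum>m<n. scale (\<Sum>l<n. x j k l * x i l m) (e m))"
    using assms by (simp add: x_assoc)
  also have "\<dots> = (\<Sum>l<n. scale (x j k l) (\<Sum>m<n. scale (x i l m) (e m)))"
    by (simp add: scale_sum_right scale_sum_left) (rule sum.swap)
  also have "\<dots> = \<mu> (e i) (\<mu> (e j) (e k))"
    using assms by (simp only: mult_e[of j k], subst mult_sum_right) (auto simp: span_scale mult_scale_right mult_e intro!: sum.cong)
  finally show ?thesis .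
qed

lemma mult_assoc:
  assumes "a \<in> A" "b \<in> A" "c \<in> A"
  shows "\<mu> (\<mu> a b) c = \<mu> a (\<mu> b c)"
proof -
  note lin = mult_add_left mult_add_right mult_scale_left mult_scale_right span_add span_scale
  have 1: "\<mu> (\<mu> (e i) (e j)) c = \<mu> (e i) (\<mu> (e j) c)" if "i < n" "j < n" for i j
    using assms(3) by (rule linear_ext[where sc = scale]) (simp_all add: lin mult_assoc_e that)
  have 2: "\<mu> (\<mu> (e i) b) c = \<mu> (e i) (\<mu> b c)" if "i < n" for i
    using assms(2) by (rule linear_ext[where sc = scale and S = "\<lambda>b. \<mu> (\<mu> (e i) b) c" and T = "\<lambda>b. \<mu> (e i) (\<mu> b c)"])
      (simp_all add: lin 1 that)
  show ?thesis
    using assms(1) by (rule linear_ext[where sc = scale and S = "\<lambda>a. \<mu> (\<mu> a b) c" and T = "\<lambda>a. \<mu> a (\<mu> b c)"])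
      (simp_all add: lin 2)
qed

lemma mult_left_commute: "a \<in> A \<Longrightarrow> b \<in> A \<Longrightarrow> c \<in> A \<Longrightarrow> \<mu> a (\<mu> b c) = \<mu> b (\<mu> a c)"
  using mult_assoc[of a b c] mult_assoc[of b a c] by (simp add: mult_commute[of a b])

definition tr :: "'v \<Rightarrow> 'k" where "tr a = endo_trace scale n e (\<mu> a)"

lemma tr_add: "a \<in> A \<Longrightarrow> b \<in> A \<Longrightarrow> tr (a + b) = tr a + tr b"
  by (simp add: tr_def endo_trace_def mult_add_left co_add sum.distrib)

lemma tr_scale: "a \<in> A \<Longrightarrow> tr (scale c a) = c * tr a"
  by (simp add: tr_def endo_trace_def mult_scale_left co_scale sum_distrib_left)

lemma tr_zero [simp]: "tr 0 = 0" by (simp add: tr_def endo_trace_def)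

lemma tr_sum: "(\<And>j. j \<in> J \<Longrightarrow> f j \<in> A) \<Longrightarrow> tr (\<Sum>j\<in>J. f j) = (\<Sum>j\<in>J. tr (f j))"
  by (induction J rule: infinite_finite_induct) (auto simp: tr_add span_sum)

lemma tr_diff: "a \<in> A \<Longrightarrow> b \<in> A \<Longrightarrow> tr (a - b) = tr a - tr b"
  using tr_add[of "a - b" b] by (simp add: span_diff)

text \<open>In a basis of \<open>A\<close> that extends one of the ideal \<open>J\<close>,
  multiplication by \<open>c\<close> kills \<open>J\<close> and maps everything into
  \<open>J\<close>. Hence all its diagonal entries vanish.\<close>

lemma tr_square_zero:
  assumes c: "c \<in> A" "\<mu> c c = 0"
  shows "tr c = 0"
proof -
  define J where "J = \<mu> c ` A"
  have J: "subspace J" unfolding J_def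
  proof (rule subspaceI)
    show "0 \<in> \<mu> c ` A" by (rule rev_image_eqI[of 0]) (simp_all add: span_zero)
  next
    fix u v assume "u \<in> \<mu> c ` A" "v \<in> \<mu> c ` A"
    then show "u + v \<in> \<mu> c ` A" by (auto simp: mult_add_right[symmetric] intro!: imageI span_add)
  next
    fix r u assume "u \<in> \<mu> c ` A"
    then show "scale r u \<in> \<mu> c ` A" by (auto simp: mult_scale_right[symmetric] intro!: imageI span_scale)
  qed
  have JA: "J \<subseteq> A" by (auto simp: J_def)
  obtain B1 where B1: "B1 \<subseteq> J" "independent B1" "J \<subseteq> span B1"
    using maximal_independent_subset by blast
  obtain B where B: "B1 \<subseteq> B" "B \<subseteq> A" "independent B" "A \<subseteq> span B"
    using maximal_independent_subset_extend[of B1 A] B1 JA by blast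
  have fin: "finite B" using independent_span_bound[OF finite_e B(3)] B(2) by simp
  have sp: "span B = A" using B span_mono[OF B(2)] by (auto simp: span_span)
  have "tr c = (\<Sum>b\<in>B. representation B (\<mu> c b) b)"
    unfolding tr_def using B(3) fin sp
    by (intro trace_basis_indep) (auto simp: mult_add_right mult_scale_right)
  also have "\<dots> = 0"
  proof (rule sum.neutral, rule ballI)
    fix b assume b: "b \<in> B"
    show "representation B (\<mu> c b) b = 0"
    proof (cases "b \<in> B1")
      case True
      then obtain d where d: "d \<in> A" "b = \<mu> c d" using B1(1) by (auto simp: J_def)
      then have "\<mu> c b = 0" using c by (simp add: mult_assoc[symmetric])
      then show ?thesis by (simp add: representation_zero)
    next
      case False
      have "\<mu> c b \<in> span B1" using B1(3) b B(2) by (auto simp: J_def)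
      then have "representation B (\<mu> c b) = representation B1 (\<mu> c b)"
        using representation_extend[OF B(3) _ B(1)] by blast
      then show ?thesis using False representation_ne_zero by metis
    qed
  qed
  finally show ?thesis .
qed

end

section \<open>The trace form and the Casimir element\<close>

locale etale_structure = comm_structure scale n e x
  for scale :: "'k::field \<Rightarrow> 'v::ab_group_add \<Rightarrow> 'v" and n and e :: "nat \<Rightarrow> 'v" and x +
  assumes discr_nonzero: "discr scale n e x \<noteq> 0"
begin

definition gram :: "'k mat" where "gram = mat n n (\<lambda>(i, j). tr (\<mu> (e i) (e j)))"

lemma gram_carrier: "gram \<in> carrier_mat n n" by (simp add: gram_def)

lemma det_gram: "det gram \<noteq> 0"
  using discr_nonzero by (simp add: discr_def gram_def tr_def Let_def)

lemma nondegenerate: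
  assumes "a \<in> A" "\<And>i. i < n \<Longrightarrow> tr (\<mu> a (e i)) = 0"
  shows "a = 0"
proof (rule A_eqI)
  fix i assume i: "i < n"
  let ?v = "vec n (co a)"
  have "gram *\<^sub>v ?v = 0\<^sub>v n"
  proof (rule eq_vecI)
    fix j assume "j < dim_vec (0\<^sub>v n :: 'k vec)"
    then have j: "j < n" by simp
    have "(gram *\<^sub>v ?v) $ j = (\<Sum>i<n. tr (\<mu> (e j) (e i)) * co a i)"
      using j by (simp add: gram_def scalar_prod_def atLeast0LessThan)
    also have "\<dots> = tr (\<Sum>i<n. scale (co a i) (\<mu> (e j) (e i)))"
      by (simp add: tr_sum span_scale tr_scale mult.commute)
    also have "(\<Sum>i<n. scale (co a i) (\<mu> (e j) (e i))) = \<mu> (e j) (\<Sum>i<n. scale (co a i) (e i))"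
      by (subst mult_sum_right) (auto simp: span_scale mult_scale_right)
    also have "tr \<dots> = 0" using assms(2)[OF j] expand[OF assms(1)] by (simp add: mult_commute)
    finally show "(gram *\<^sub>v ?v) $ j = 0\<^sub>v n $ j" using j by simp
  qed (simp add: gram_def)
  then have "?v = 0\<^sub>v n"
    using det_gram det_0_iff_vec_prod_zero_field[OF gram_carrier] vec_carrier[of n "co a"] by blast
  then have "?v $ i = 0\<^sub>v n $ i" by simp
  then show "co a i = co 0 i" using i by simp
qed (use assms in \<open>simp_all add: span_zero\<close>)

lemma tr_eqI:
  assumes "a \<in> A" "b \<in> A" "\<And>i. i < n \<Longrightarrow> tr (\<mu> (e i) a) = tr (\<mu> (e i) b)"
  shows "a = b"
  using nondegenerate[of "a - b"] assms by (simp add: span_diff mult_commute[of "a - b"] mult_diff_right tr_diff)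

text \<open>The coordinates of the dual basis are the columns of the inverse Gram matrix.\<close>

lemma dual_basis_exists:
  "\<exists>d. (\<forall>j. d j \<in> A) \<and> (\<forall>i<n. \<forall>j<n. tr (\<mu> (e i) (d j)) = (if i = j then 1 else 0))"
proof -
  obtain B where B: "B \<in> carrier_mat n n" "gram * B = 1\<^sub>m n"
    using det_non_zero_imp_unit[OF gram_carrier det_gram, of "()"]
    unfolding Units_def ring_mat_def by auto
  define d where "d j = (\<Sum>l<n. scale (B $$ (l, j)) (e l))" for j
  have "tr (\<mu> (e i) (d j)) = (if i = j then 1 else 0)" if "i < n" "j < n" for i j
  proof -
    have "tr (\<mu> (e i) (d j)) = (\<Sum>l<n. B $$ (l, j) * tr (\<mu> (e i) (e l)))"
      unfolding d_def by (subst mult_sum_right) (auto simp: span_scale mult_scale_right tr_sum tr_scale)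
    also have "\<dots> = (gram * B) $$ (i, j)"
      using that B(1) by (simp add: gram_def scalar_prod_def atLeast0LessThan mult.commute)
    finally show ?thesis using B(2) that by simp
  qed
  then show ?thesis by (intro exI[of _ d]) (simp add: d_def lincomb_in_A)
qed

definition d :: "nat \<Rightarrow> 'v" where
  "d = (SOME d. (\<forall>j. d j \<in> A) \<and> (\<forall>i<n. \<forall>j<n. tr (\<mu> (e i) (d j)) = (if i = j then 1 else 0)))"

lemma d_in_A [simp]: "d j \<in> A" and tr_e_d: "i < n \<Longrightarrow> j < n \<Longrightarrow> tr (\<mu> (e i) (d j)) = (if i = j then 1 else 0)"
  using someI_ex[OF dual_basis_exists] unfolding d_def[symmetric] by auto

lemma tr_mult_d: "a \<in> A \<Longrightarrow> j < n \<Longrightarrow> tr (\<mu> a (d j)) = co a j"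
  by (rule linear_ext[where sc = "(*)"])
    (simp_all add: mult_add_left tr_add co_add mult_scale_left tr_scale co_scale tr_e_d co_e eq_commute)

text \<open>The element that represents the linear form \<open>tr\<close> with respect to the trace
  form. By associativity and nondegeneracy it is the unit of the algebra.\<close>

definition u :: 'v where "u = (\<Sum>i<n. scale (tr (e i)) (d i))"

lemma u_in_A [simp]: "u \<in> A"
  unfolding u_def by (intro span_sum span_scale) simp

lemma tr_mult_u: "i < n \<Longrightarrow> tr (\<mu> (e i) u) = tr (e i)"
  unfolding u_def by (subst mult_sum_right)
    (auto simp: span_scale mult_scale_right tr_sum tr_scale tr_e_d if_distrib[of "\<lambda>c. _ * c"] cong: if_cong)

lemma tr_u: "a \<in> A \<Longrightarrow> tr (\<mu> a u) = tr a"
  by (rule linear_ext[where sc = "(*)"]) (simp_all add: mult_add_left tr_add mult_scale_left tr_scale tr_mult_u)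

lemma unit [simp]: "a \<in> A \<Longrightarrow> \<mu> u a = a" "a \<in> A \<Longrightarrow> \<mu> a u = a"
proof -
  assume a: "a \<in> A"
  show "\<mu> a u = a"
    by (rule tr_eqI) (use a in \<open>simp_all add: mult_assoc[symmetric] tr_u\<close>)
  then show "\<mu> u a = a" by (simp add: mult_commute)
qed

text \<open>As \<open>d\<close> reads off coordinates, the trace of multiplication by
  \<open>c\<close> is the sum of the numbers \<open>tr (\<mu> (\<mu> c (e j)) (d j))\<close>. So the
  sum of the products of \<open>e j\<close> and \<open>d j\<close> pairs with every \<open>c\<close>
  as the unit does.\<close>

lemma casimir_unit: "b \<in> A \<Longrightarrow> (\<Sum>i<n. \<mu> (e i) (\<mu> (d i) b)) = b"
proof (rule tr_eqI)
  fix i assume b: "b \<in> A" and i: "i < n"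
  let ?c = "\<mu> b (e i)"
  have "tr (\<mu> (e i) (\<Sum>j<n. \<mu> (e j) (\<mu> (d j) b))) = (\<Sum>j<n. tr (\<mu> (e i) (\<mu> (e j) (\<mu> (d j) b))))"
    by (subst mult_sum_right) (auto simp: tr_sum)
  also have "\<dots> = (\<Sum>j<n. tr (\<mu> (\<mu> ?c (e j)) (d j)))"
  proof (intro sum.cong refl arg_cong[of _ _ tr])
    fix j assume "j \<in> {..<n}"
    then have j: "j < n" by simp
    have "\<mu> (e j) (\<mu> (d j) b) = \<mu> b (\<mu> (e j) (d j))"
      using b j by (simp add: mult_commute[of "d j" b] mult_left_commute[of "e j" b])
    then show "\<mu> (e i) (\<mu> (e j) (\<mu> (d j) b)) = \<mu> (\<mu> ?c (e j)) (d j)"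
      using b i j by (simp add: mult_assoc mult_left_commute[of "e i" b])
  qed
  also have "\<dots> = tr ?c"
    by (simp add: tr_mult_d tr_def[of ?c] endo_trace_def)
  finally show "tr (\<mu> (e i) (\<Sum>j<n. \<mu> (e j) (\<mu> (d j) b))) = tr (\<mu> (e i) b)" by (simp add: mult_commute)
qed (auto intro: span_sum)

text \<open>Multiplication by \<open>a\<close> is self-adjoint for the trace form, so its matrix in
  the basis \<open>d\<close> is the transpose of its matrix in the basis \<open>e\<close>. This
  moves \<open>a\<close> from one factor of the Casimir element to the other.\<close>

lemma casimir_move:
  assumes a: "a \<in> A" and \<phi>: "\<And>b. b \<in> A \<Longrightarrow> \<phi> b \<in> A" "\<And>b c. b \<in> A \<Longrightarrow> c \<in> A \<Longrightarrow> \<phi> (b + c) = \<phi> b + \<phi> c"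
    "\<And>r b. b \<in> A \<Longrightarrow> \<phi> (scale r b) = scale r (\<phi> b)"
  shows "(\<Sum>i<n. \<mu> (e i) (\<phi> (\<mu> (d i) a))) = \<mu> a (\<Sum>i<n. \<mu> (e i) (\<phi> (d i)))"
proof -
  have \<phi>0: "\<phi> 0 = 0" using \<phi>(3)[of 0 0] by (simp add: span_zero)
  have \<phi>sum: "\<phi> (\<Sum>j\<in>J. f j) = (\<Sum>j\<in>J. \<phi> (f j))" if "\<And>j. j \<in> J \<Longrightarrow> f j \<in> A" for J and f :: "nat \<Rightarrow> 'v"
    using that by (induction J rule: infinite_finite_induct) (auto simp: \<phi>0 \<phi>(2) span_sum)
  have da: "\<mu> (d j) a = (\<Sum>i<n. scale (co (\<mu> a (e i)) j) (d i))" if j: "j < n" for j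
  proof (rule tr_eqI)
    fix i assume i: "i < n"
    have "tr (\<mu> (e i) (\<mu> (d j) a)) = tr (\<mu> (\<mu> a (e i)) (d j))"
      using a i by (simp add: mult_commute[of "d j" a] mult_assoc mult_left_commute[of "e i" a])
    also have "\<dots> = co (\<mu> a (e i)) j" using j by (simp add: tr_mult_d)
    also have "\<dots> = tr (\<mu> (e i) (\<Sum>i<n. scale (co (\<mu> a (e i)) j) (d i)))"
      using i by (subst mult_sum_right)
        (auto simp: span_scale mult_scale_right tr_sum tr_scale tr_e_d if_distrib[of "\<lambda>c. _ * c"] cong: if_cong)
    finally show "tr (\<mu> (e i) (\<mu> (d j) a)) = tr (\<mu> (e i) (\<Sum>i<n. scale (co (\<mu> a (e i)) j) (d i)))" .
  qed (auto intro!: span_sum span_scale)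
  have "(\<Sum>j<n. \<mu> (e j) (\<phi> (\<mu> (d j) a))) = (\<Sum>j<n. \<Sum>i<n. scale (co (\<mu> a (e i)) j) (\<mu> (e j) (\<phi> (d i))))"
  proof (intro sum.cong refl)
    fix j assume "j \<in> {..<n}"
    then have "\<phi> (\<mu> (d j) a) = (\<Sum>i<n. scale (co (\<mu> a (e i)) j) (\<phi> (d i)))"
      by (simp add: da) (subst \<phi>sum, auto simp: span_scale \<phi>)
    then show "\<mu> (e j) (\<phi> (\<mu> (d j) a)) = (\<Sum>i<n. scale (co (\<mu> a (e i)) j) (\<mu> (e j) (\<phi> (d i))))"
      by (simp, subst mult_sum_right) (auto simp: \<phi> span_scale mult_scale_right)
  qed
  also have "\<dots> = (\<Sum>i<n. \<Sum>j<n. scale (co (\<mu> a (e i)) j) (\<mu> (e j) (\<phi> (d i))))" by (rule sum.swap)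
  also have "\<dots> = (\<Sum>i<n. \<mu> (\<mu> a (e i)) (\<phi> (d i)))"
  proof (intro sum.cong refl)
    fix i assume "i \<in> {..<n}"
    have "\<mu> (\<mu> a (e i)) (\<phi> (d i)) = \<mu> (\<Sum>j<n. scale (co (\<mu> a (e i)) j) (e j)) (\<phi> (d i))"
      using expand[of "\<mu> a (e i)"] by simp
    also have "\<dots> = (\<Sum>j<n. scale (co (\<mu> a (e i)) j) (\<mu> (e j) (\<phi> (d i))))"
      by (subst mult_sum_left) (auto simp: span_scale mult_scale_left)
    finally show "(\<Sum>j<n. scale (co (\<mu> a (e i)) j) (\<mu> (e j) (\<phi> (d i)))) = \<mu> (\<mu> a (e i)) (\<phi> (d i))" ..
  qed
  also have "\<dots> = \<mu> a (\<Sum>i<n. \<mu> (e i) (\<phi> (d i)))"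
    using a by (subst mult_sum_right) (auto simp: mult_assoc \<phi> intro!: sum.cong)
  finally show ?thesis .
qed

text \<open>All products of \<open>a\<close> with basis vectors square to zero as well, so
  \<open>a\<close> is orthogonal to everything.\<close>

lemma square_zero_imp_zero:
  assumes "a \<in> A" "\<mu> a a = 0"
  shows "a = 0"
proof (rule nondegenerate[OF assms(1)])
  fix i assume i: "i < n"
  have "\<mu> (\<mu> a (e i)) (\<mu> a (e i)) = \<mu> (\<mu> a a) (\<mu> (e i) (e i))"
    using assms(1) i by (simp add: mult_assoc mult_left_commute)
  then show "tr (\<mu> a (e i)) = 0" using assms(2) by (intro tr_square_zero) simp_all
qed

section \<open>Powers, nilpotents and von Neumann regularity\<close>

definition alg_power :: "'v \<Rightarrow> nat \<Rightarrow> 'v" where "alg_power a j = (\<mu> a ^^ j) u"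

lemma alg_power_simps [simp]: "alg_power a 0 = u" "alg_power a (Suc j) = \<mu> a (alg_power a j)"
  by (simp_all add: alg_power_def)

lemma alg_power_in_A [simp]: "alg_power a j \<in> A" by (cases j) simp_all

lemma alg_power_add: "a \<in> A \<Longrightarrow> alg_power a (i + j) = \<mu> (alg_power a i) (alg_power a j)"
  by (induction i) (simp_all add: mult_assoc)

lemma alg_power_mult: "a \<in> A \<Longrightarrow> b \<in> A \<Longrightarrow> alg_power (\<mu> a b) j = \<mu> (alg_power a j) (alg_power b j)"
  by (induction j) (simp_all add: mult_assoc mult_left_commute[of b])

lemma nilpotent_imp_zero:
  assumes "a \<in> A" "alg_power a (Suc k) = 0"
  shows "a = 0"
  using assms(2)
proof (induction k)
  case 0 then show ?case using assms(1) by simp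
next
  case (Suc k)
  have "\<mu> (alg_power a (Suc k)) (alg_power a (Suc k)) = \<mu> (alg_power a k) (alg_power a (Suc (Suc k)))"
    using assms(1) by (simp add: mult_assoc mult_left_commute[of a "alg_power a k"])
  then have "\<mu> (alg_power a (Suc k)) (alg_power a (Suc k)) = 0" unfolding Suc.prems by simp
  then have "alg_power a (Suc k) = 0" by (rule square_zero_imp_zero[rotated]) simp
  then show ?case by (rule Suc.IH)
qed

text \<open>In a linear relation between powers of \<open>a\<close>, solving for the lowest term
  gives a^k = a^(k+1) b. Then a (1 - a b) is nilpotent, hence zero.\<close>

lemma regular:
  assumes a: "a \<in> A"
  shows "\<exists>b\<in>A. \<mu> (\<mu> a b) a = a"
proof -
  obtain c where c: "\<exists>j\<le>n. c j \<noteq> 0" "(\<Sum>j\<le>n. scale (c j) (alg_power a j)) = 0"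
    using family_dependent[of "alg_power a"] by auto
  define k where "k = (LEAST j. j \<le> n \<and> c j \<noteq> 0)"
  have k: "k \<le> n" "c k \<noteq> 0" and less: "\<And>j. j < k \<Longrightarrow> c j = 0"
    using LeastI_ex[OF c(1)] not_less_Least[of _ "\<lambda>j. j \<le> n \<and> c j \<noteq> 0"] unfolding k_def[symmetric] by fastforce+
  define c' where "c' j = - c j / c k" for j
  define b where "b = (\<Sum>j\<in>{k<..n}. scale (c' j) (alg_power a (j - k - 1)))"
  have b: "b \<in> A" unfolding b_def by (intro span_sum span_scale) simp
  have "0 = (\<Sum>j\<in>{k..n}. scale (c j) (alg_power a j))"
    unfolding c(2)[symmetric] using less by (intro sum.mono_neutral_right) auto
  also have "\<dots> = scale (c k) (alg_power a k) + (\<Sum>j\<in>{k<..n}. scale (c j) (alg_power a j))"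
    using k(1) by (subst sum.atLeast_Suc_atMost) (auto simp: atLeastSucAtMost_greaterThanAtMost)
  finally have e0: "scale (c k) (alg_power a k) = - (\<Sum>j\<in>{k<..n}. scale (c j) (alg_power a j))"
    by (simp add: eq_neg_iff_add_eq_0)
  have "\<mu> (alg_power a (Suc k)) b = (\<Sum>j\<in>{k<..n}. scale (c' j) (alg_power a j))"
  proof -
    have "\<mu> (alg_power a (Suc k)) (alg_power a (j - k - 1)) = alg_power a j" if "j \<in> {k<..n}" for j
      using that alg_power_add[OF a, of "Suc k" "j - k - 1"] by simp
    then show ?thesis unfolding b_def
      by (subst mult_sum_right) (auto simp: span_scale mult_scale_right intro!: sum.cong)
  qed
  also have "\<dots> = scale (inverse (c k)) (scale (c k) (alg_power a k))"
    unfolding e0 by (simp add: c'_def scale_sum_right sum_negf divide_inverse mult.commute)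
  also have "\<dots> = alg_power a k" using k(2) by simp
  finally have *: "\<mu> (alg_power a (Suc k)) b = alg_power a k" .
  define f where "f = u - \<mu> a b"
  define z where "z = \<mu> a f"
  have f: "f \<in> A" unfolding f_def by (intro span_diff) simp_all
  have "\<mu> (alg_power a k) f = alg_power a k - \<mu> (alg_power a (Suc k)) b"
    unfolding f_def using a b by (simp add: mult_diff_right mult_assoc mult_left_commute[of a])
  then have 0: "\<mu> (alg_power a k) f = 0" using * by simp
  \<comment> \<open>The power contains a^k f as a factor, which is zero.\<close>
  have "alg_power z (Suc k) = \<mu> (\<mu> (alg_power a k) f) (\<mu> a (alg_power f k))"
    unfolding z_def using a f by (simp add: alg_power_mult mult_assoc mult_left_commute)
  then have "alg_power z (Suc k) = 0" using 0 by simp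
  then have "z = 0" using nilpotent_imp_zero[of z k] by (simp add: z_def)
  then have "a = \<mu> a (\<mu> a b)" unfolding z_def f_def using a by (simp add: mult_diff_right)
  then show ?thesis using b by (intro bexI[of _ b]) (simp_all add: mult_commute)
qed

section \<open>Orthogonal idempotents\<close>

definition orth_idems :: "'v set \<Rightarrow> bool" where
  "orth_idems E \<longleftrightarrow> finite E \<and> E \<subseteq> A \<and> (\<forall>v\<in>E. v \<noteq> 0 \<and> \<mu> v v = v) \<and> (\<forall>v\<in>E. \<forall>w\<in>E. v \<noteq> w \<longrightarrow> \<mu> v w = 0)"

lemma orth_idems_insert:
  assumes "orth_idems E" "r \<in> A" "r \<noteq> 0" "\<mu> r r = r" "\<And>v. v \<in> E \<Longrightarrow> \<mu> v r = 0"
  shows "orth_idems (insert r E)"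
proof -
  have "\<mu> r v = 0" if "v \<in> E" for v using assms(5)[OF that] by (subst mult_commute)
  then show ?thesis using assms unfolding orth_idems_def by blast
qed

lemma orth_idems_subset: "orth_idems E \<Longrightarrow> F \<subseteq> E \<Longrightarrow> orth_idems F"
  unfolding orth_idems_def by (blast intro: finite_subset)

lemma orth_idems_lincomb:
  assumes "orth_idems E" "v \<in> E"
  shows "\<mu> v (\<Sum>w\<in>E. scale (c w) w) = scale (c v) v"
proof -
  have "\<mu> v (\<Sum>w\<in>E. scale (c w) w) = (\<Sum>w\<in>E. scale (c w) (\<mu> v w))"
    using assms by (subst mult_sum_right) (auto simp: orth_idems_def span_scale mult_scale_right subset_iff intro!: sum.cong)
  also have "\<dots> = (\<Sum>w\<in>E. if w = v then scale (c v) v else 0)"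
    using assms by (intro sum.cong) (auto simp: orth_idems_def)
  finally show ?thesis using assms by (simp add: orth_idems_def)
qed

lemma orth_idems_independent:
  assumes "orth_idems E"
  shows "independent E"
proof
  assume "dependent E"
  moreover have "finite E" using assms by (simp add: orth_idems_def)
  ultimately obtain c v where c: "(\<Sum>w\<in>E. scale (c w) w) = 0" "v \<in> E" "c v \<noteq> 0"
    using dependent_finite by auto
  then have "scale (c v) v = 0" using orth_idems_lincomb[OF assms c(2), of c] by simp
  then show False using c assms by (auto simp: orth_idems_def)
qed

lemma orth_idems_card: "orth_idems E \<Longrightarrow> card E \<le> n"
  using independent_span_bound[OF finite_e orth_idems_independent] card_e by (auto simp: orth_idems_def)

text \<open>An orthogonal family of largest cardinality, bounded by \<open>n\<close> through
  independence, must sum to the unit and cannot be refined. Regularity produces idempotents below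
  each member, so nonzero elements below \<open>v\<close> are invertible relative to
  \<open>v\<close>.\<close>

lemma primitive_idempotents:
  "\<exists>E. orth_idems E \<and> (\<Sum>v\<in>E. v) = u \<and> (\<forall>v\<in>E. \<forall>a\<in>A. \<mu> v a \<noteq> 0 \<longrightarrow> (\<exists>b\<in>A. \<mu> (\<mu> v a) b = v))"
proof -
  obtain E where E: "orth_idems E" and max: "\<And>F. orth_idems F \<Longrightarrow> card F \<le> card E"
  proof -
    have "orth_idems {}" by (simp add: orth_idems_def)
    then have "\<exists>E. orth_idems E \<and> (\<forall>F. orth_idems F \<longrightarrow> card F \<le> card E)"
      by (rule ex_has_greatest_nat[of _ _ _ "Suc n"]) (simp add: less_Suc_eq_le orth_idems_card)
    then show ?thesis using that by blast
  qed
  note Ed = E[unfolded orth_idems_def]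
  have EA: "v \<in> A" if "v \<in> E" for v using Ed that by auto
  have sum: "(\<Sum>v\<in>E. v) = u"
  proof (rule ccontr)
    assume ne: "(\<Sum>v\<in>E. v) \<noteq> u"
    let ?s = "\<Sum>v\<in>E. v"
    have s: "?s \<in> A" using EA by (intro span_sum) auto
    have vs: "\<mu> v ?s = v" if "v \<in> E" for v using orth_idems_lincomb[OF E that, of "\<lambda>_. 1"] by simp
    have ss: "\<mu> ?s ?s = ?s" using EA vs by (subst mult_sum_left) auto
    \<comment> \<open>The complement of the sum is an idempotent orthogonal to \<open>E\<close> and
      would enlarge the family.\<close>
    let ?r = "u - ?s"
    have r: "?r \<in> A" using s by (simp add: span_diff)
    have vr: "\<mu> v ?r = 0" if "v \<in> E" for v using vs[OF that] EA[OF that] s by (simp add: mult_diff_right)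
    have sr: "\<mu> ?s ?r = 0" using ss s by (simp add: mult_diff_right)
    have rr: "\<mu> ?r ?r = ?r" using sr r s mult_diff_right[of u ?s ?r] by (simp add: mult_commute[of ?r ?s])
    have rE: "?r \<notin> E" using vr rr ne by auto
    have "orth_idems (insert ?r E)"
      using E r rr ne vr by (intro orth_idems_insert) auto
    then have "card (insert ?r E) \<le> card E" by (rule max)
    then show False using rE Ed by simp
  qed
  \<comment> \<open>Otherwise \<open>f\<close> and \<open>v - f\<close> could replace
    \<open>v\<close> and enlarge the family.\<close>
  have prim: "f = v" if v: "v \<in> E" and f: "f \<in> A" "\<mu> f f = f" "\<mu> v f = f" "f \<noteq> 0" for v f
  proof (rule ccontr)
    assume ne: "f \<noteq> v"
    let ?g = "v - f"
    have vv: "\<mu> v v = v" using Ed v by auto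
    have g: "?g \<in> A" "?g \<noteq> 0" using ne f EA[OF v] by (auto simp: span_diff)
    have fg: "\<mu> f ?g = 0" using f EA[OF v] by (simp add: mult_diff_right mult_commute[of f v])
    have vg: "\<mu> v ?g = ?g" using f EA[OF v] vv by (simp add: mult_diff_right)
    have gg: "\<mu> ?g ?g = ?g" using fg vg mult_diff_right[of v f ?g] f EA[OF v]
      by (simp add: mult_commute[of ?g v] mult_commute[of ?g f])
    have orth: "\<mu> w f = 0" "\<mu> w ?g = 0" if "w \<in> E" "w \<noteq> v" for w
    proof -
      have "\<mu> w v = 0" using Ed v that by auto
      then have "\<mu> w (\<mu> v h) = 0" if "h \<in> A" for h
        using that EA[OF v] EA[OF \<open>w \<in> E\<close>] by (simp add: mult_assoc[symmetric])
      from this[OF f(1)] this[OF g(1)] show "\<mu> w f = 0" "\<mu> w ?g = 0" using f vg by simp_all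
    qed
    have fE: "f \<notin> E - {v}" "?g \<notin> E - {v}" using orth f gg g by auto
    have "f \<noteq> ?g" using fg f(2,4) by auto
    have "orth_idems (insert f (insert ?g (E - {v})))"
    proof (rule orth_idems_insert)
      show "orth_idems (insert ?g (E - {v}))"
        using orth g gg orth_idems_subset[OF E] by (intro orth_idems_insert) auto
      show "\<mu> w f = 0" if "w \<in> insert ?g (E - {v})" for w
        using that orth fg mult_commute[of ?g f] by auto
    qed (use f in auto)
    then have "card (insert f (insert ?g (E - {v}))) \<le> card E" by (rule max)
    moreover have "card (insert f (insert ?g (E - {v}))) = Suc (Suc (card (E - {v})))"
      using fE \<open>f \<noteq> ?g\<close> Ed by simp
    moreover have "Suc (card (E - {v})) = card E" using card_Suc_Diff1[of E v] v Ed by blast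
    ultimately show False by simp
  qed
  have "\<exists>b\<in>A. \<mu> (\<mu> v a) b = v" if v: "v \<in> E" and a: "a \<in> A" "\<mu> v a \<noteq> 0" for v a
  proof -
    let ?c = "\<mu> v a"
    obtain b where b: "b \<in> A" "\<mu> (\<mu> ?c b) ?c = ?c" using regular[of ?c] by auto
    \<comment> \<open>A generalised inverse \<open>b\<close> of \<open>?c\<close> makes this product
      a nonzero idempotent below \<open>v\<close>, hence equal to \<open>v\<close>.\<close>
    let ?f = "\<mu> ?c b"
    have vv: "\<mu> v v = v" using Ed v by auto
    have "\<mu> (\<mu> ?f ?c) b = \<mu> ?f ?f" using b(1) by (intro mult_assoc) simp_all
    then have "\<mu> ?f ?f = ?f" unfolding b(2) by simp
    moreover have "\<mu> v ?f = ?f" using vv EA[OF v] a b by (simp add: mult_assoc[symmetric])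
    moreover have "?f \<noteq> 0" using b a by auto
    ultimately have "?f = v" by (rule prim[OF v, rotated]) simp_all
    then show ?thesis using b by auto
  qed
  then show ?thesis using E sum by blast
qed

end

section \<open>Decomposition into fields\<close>

context etale_structure
begin

definition alg_eval :: "'v \<Rightarrow> 'k poly \<Rightarrow> 'v" where
  "alg_eval a p = (\<Sum>i\<le>degree p. scale (poly.coeff p i) (alg_power a i))"

lemma alg_eval_bound:
  assumes "degree p \<le> N"
  shows "alg_eval a p = (\<Sum>i\<le>N. scale (poly.coeff p i) (alg_power a i))"
  unfolding alg_eval_def using assms by (intro sum.mono_neutral_left) (auto simp: coeff_eq_0)

lemma alg_eval_in_A [simp]: "alg_eval a p \<in> A"
  unfolding alg_eval_def by (intro span_sum span_scale) simp

lemma alg_eval_0 [simp]: "alg_eval a 0 = 0" by (simp add: alg_eval_def)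

lemma alg_eval_pCons: "alg_eval a (pCons c p) = scale c u + \<mu> a (alg_eval a p)"
proof -
  have "alg_eval a (pCons c p) = (\<Sum>i\<le>Suc (degree p). scale (poly.coeff (pCons c p) i) (alg_power a i))"
    by (rule alg_eval_bound) (rule degree_pCons_le)
  also have "\<dots> = scale c u + (\<Sum>i\<le>degree p. scale (poly.coeff p i) (\<mu> a (alg_power a i)))"
    by (subst sum.atMost_Suc_shift) simp
  also have "(\<Sum>i\<le>degree p. scale (poly.coeff p i) (\<mu> a (alg_power a i))) = \<mu> a (alg_eval a p)"
    unfolding alg_eval_def by (subst mult_sum_right) (auto simp: span_scale mult_scale_right)
  finally show ?thesis .
qed

lemma alg_eval_add: "alg_eval a (p + q) = alg_eval a p + alg_eval a q"
proof -
  let ?N = "max (degree p) (degree q)"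
  have "alg_eval a (p + q) = (\<Sum>i\<le>?N. scale (poly.coeff (p + q) i) (alg_power a i))"
    by (rule alg_eval_bound) (simp add: degree_add_le)
  then show ?thesis
    by (simp add: alg_eval_bound[of p ?N] alg_eval_bound[of q ?N] scale_left_distrib sum.distrib)
qed

lemma alg_eval_smult: "alg_eval a (smult c p) = scale c (alg_eval a p)"
  by (subst alg_eval_bound[of _ "degree p"]) (simp_all add: alg_eval_def scale_sum_right)

lemma alg_eval_mult: "a \<in> A \<Longrightarrow> alg_eval a (p * q) = \<mu> (alg_eval a p) (alg_eval a q)"
  by (induction p) (simp_all add: alg_eval_pCons alg_eval_add alg_eval_smult mult_add_left mult_scale_left mult_assoc span_scale)

lemma idem_mult:
  assumes "w \<in> A" "\<mu> w w = w" "a \<in> A" "b \<in> A"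
  shows "\<mu> (\<mu> w a) (\<mu> w b) = \<mu> w (\<mu> a b)"
proof -
  have "\<mu> (\<mu> w a) (\<mu> w b) = \<mu> w (\<mu> w (\<mu> a b))"
    using assms by (simp add: mult_assoc[of w a] mult_left_commute[of a w])
  also have "\<dots> = \<mu> w (\<mu> a b)"
    using assms by (simp add: mult_assoc[of w w, symmetric])
  finally show ?thesis .
qed

text \<open>Expresses that the ideal generated by \<open>w\<close> is a field with unit
  \<open>w\<close>.\<close>

definition prim_idem :: "'v \<Rightarrow> bool" where
  "prim_idem w \<longleftrightarrow> w \<in> A \<and> w \<noteq> 0 \<and> \<mu> w w = w \<and> (\<forall>a\<in>A. \<mu> w a \<noteq> 0 \<longrightarrow> (\<exists>b\<in>A. \<mu> (\<mu> w a) b = w))"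

text \<open>The minimal polynomial of the image of \<open>a\<close> in the field cut out by
  \<open>w\<close>. It exists because \<open>n + 1\<close> powers of \<open>a\<close> are dependent,
  and it is irreducible because a field has no zero divisors.\<close>

lemma irreducible_annihilator:
  assumes a: "a \<in> A" and w: "prim_idem w"
  shows "\<exists>p. irreducible p \<and> \<mu> w (alg_eval a p) = 0"
proof -
  have w': "w \<in> A" "w \<noteq> 0" "\<mu> w w = w" using w by (auto simp: prim_idem_def)
  obtain c where c: "\<exists>j\<le>n. c j \<noteq> 0" "(\<Sum>j\<le>n. scale (c j) (alg_power a j)) = 0"
    using family_dependent[of "alg_power a"] by auto
  define p0 where "p0 = Poly (map c [0..<Suc n])"
  have co0: "poly.coeff p0 j = (if j \<le> n then c j else 0)" for j
    by (simp add: p0_def coeff_Poly_eq nth_default_def less_Suc_eq_le del: upt_Suc)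
  have "degree p0 \<le> n" by (intro degree_le) (simp add: co0)
  then have "alg_eval a p0 = 0" using c(2) by (simp add: alg_eval_bound co0)
  moreover have "p0 \<noteq> 0" using c(1) co0 by (metis coeff_0)
  ultimately have ex: "p0 \<noteq> 0 \<and> \<mu> w (alg_eval a p0) = 0" by simp
  obtain p where p: "p \<noteq> 0" "\<mu> w (alg_eval a p) = 0" and
    min: "\<And>q. q \<noteq> 0 \<Longrightarrow> \<mu> w (alg_eval a q) = 0 \<Longrightarrow> degree p \<le> degree q"
    using ex_has_least_nat[of "\<lambda>p. p \<noteq> 0 \<and> \<mu> w (alg_eval a p) = 0" p0 degree, OF ex] by auto
  have "irreducible p"
  proof (rule Factorial_Ring.irreducibleI)
    show "p \<noteq> 0" by fact
    show "\<not> p dvd 1"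
    proof
      assume "p dvd 1"
      then obtain r where r: "p = [:r:]" "r \<noteq> 0" using p(1)
        by (metis is_unit_poly_iff dvd_0_left_iff zero_neq_one is_unit_iff_degree degree_eq_zeroE pCons_0_0)
      then have "scale r w = 0" using p(2) w'(1) by (simp add: alg_eval_pCons mult_scale_right)
      then show False using r w' by simp
    qed
    fix q1 q2 assume q: "p = q1 * q2"
    have "\<mu> (\<mu> w (alg_eval a q1)) (\<mu> w (alg_eval a q2)) = \<mu> w (alg_eval a p)"
      using w' a by (simp add: q alg_eval_mult idem_mult)
    then have prod: "\<mu> (\<mu> w (alg_eval a q1)) (\<mu> w (alg_eval a q2)) = 0" using p by simp
    have ne: "q1 \<noteq> 0" "q2 \<noteq> 0" using q p(1) by auto
    have deg: "degree p = degree q1 + degree q2" using q ne by (simp add: degree_mult_eq)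
    \<comment> \<open>The value of \<open>q1\<close> is zero or invertible in that field, so one of
      the factors annihilates. By minimality it has the full degree, and the other factor is a
      constant.\<close>
    show "q1 dvd 1 \<or> q2 dvd 1"
    proof (cases "\<mu> w (alg_eval a q1) = 0")
      case True
      then have "degree p \<le> degree q1" using min ne by blast
      then show ?thesis using deg ne by (simp add: is_unit_iff_degree)
    next
      case False
      then obtain b where b: "b \<in> A" "\<mu> (\<mu> w (alg_eval a q1)) b = w"
        using w by (auto simp: prim_idem_def)
      have "\<mu> w (alg_eval a q2) = \<mu> (\<mu> (\<mu> w (alg_eval a q1)) b) (\<mu> w (alg_eval a q2))"
        using b w' by (simp add: mult_assoc[symmetric])
      also have "\<dots> = \<mu> b (\<mu> (\<mu> w (alg_eval a q1)) (\<mu> w (alg_eval a q2)))"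
        using b by (subst mult_commute[of _ b]) (simp add: mult_assoc[of b])
      finally have "\<mu> w (alg_eval a q2) = 0" using prod by simp
      then have "degree p \<le> degree q2" using min ne by blast
      then show ?thesis using deg ne by (simp add: is_unit_iff_degree)
    qed
  qed
  then show ?thesis using p(2) by blast
qed

definition factor :: "'v \<Rightarrow> 'v ring" where
  "factor w = \<lparr>carrier = {a \<in> A. \<mu> w a = a}, monoid.mult = \<mu>, one = w, zero = 0, add = (+)\<rparr>"

lemma factor_simps [simp]:
  "carrier (factor w) = {a \<in> A. \<mu> w a = a}" "monoid.mult (factor w) = \<mu>" "one (factor w) = w"
  "zero (factor w) = 0" "add (factor w) = (+)"
  by (simp_all add: factor_def)

lemma factor_field:
  assumes "prim_idem w"
  shows "field (factor w)"
proof -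
  have w: "w \<in> A" "w \<noteq> 0" "\<mu> w w = w" using assms by (auto simp: prim_idem_def)
  have "abelian_group (factor w)"
  proof (rule abelian_groupI)
    fix a assume "a \<in> carrier (factor w)"
    then have "- a \<in> carrier (factor w)" using mult_diff_right[of 0 a w] by (simp add: span_neg span_zero)
    then show "\<exists>b\<in>carrier (factor w). b \<oplus>\<^bsub>factor w\<^esub> a = \<zero>\<^bsub>factor w\<^esub>"
      by (intro bexI[of _ "- a"]) simp_all
  qed (auto simp: span_add span_zero mult_add_right ac_simps)
  moreover have "comm_monoid (factor w)"
  proof (rule comm_monoidI)
    fix a b assume "a \<in> carrier (factor w)" "b \<in> carrier (factor w)"
    then show "a \<otimes>\<^bsub>factor w\<^esub> b \<in> carrier (factor w)"
      using w by (simp add: mult_assoc[of w, symmetric])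
    show "a \<otimes>\<^bsub>factor w\<^esub> b = b \<otimes>\<^bsub>factor w\<^esub> a" by (simp add: mult_commute)
  qed (use w in \<open>simp_all add: mult_assoc\<close>)
  ultimately have "cring (factor w)"
    by (rule cringI) (auto simp: mult_add_left)
  then show ?thesis
  proof (rule cring.cring_fieldI2)
    show "\<zero>\<^bsub>factor w\<^esub> \<noteq> \<one>\<^bsub>factor w\<^esub>" using w by simp
    fix a assume a: "a \<in> carrier (factor w)" "a \<noteq> \<zero>\<^bsub>factor w\<^esub>"
    then have "\<mu> w a \<noteq> 0" by simp
    then obtain b where b: "b \<in> A" "\<mu> (\<mu> w a) b = w" using assms a by (auto simp: prim_idem_def)
    have "\<mu> a (\<mu> w b) = w" using a b w by (simp add: mult_left_commute[of a w] mult_assoc[of w a, symmetric])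
    then show "\<exists>b\<in>carrier (factor w). a \<otimes>\<^bsub>factor w\<^esub> b = \<one>\<^bsub>factor w\<^esub>"
      using w b by (intro bexI[of _ "\<mu> w b"]) (simp_all add: mult_assoc[of w w, symmetric])
  qed
qed

lemma factor_finsum:
  assumes "prim_idem w" "finite S" "\<And>i. i \<in> S \<Longrightarrow> f i \<in> carrier (factor w)"
  shows "finsum (factor w) f S = sum f S"
proof -
  interpret F: field "factor w" by (rule factor_field) fact
  show ?thesis using assms(2,3)
  proof (induction S rule: finite_induct)
    case (insert i S)
    then show ?case by (subst F.finsum_insert) (auto simp: Pi_def)
  qed (metis F.finsum_empty factor_simps(4) sum.empty)
qed

lemma factor_nat_pow:
  assumes "a \<in> carrier (factor w)" "w \<in> A"
  shows "a [^]\<^bsub>factor w\<^esub> (i::nat) = \<mu> w (alg_power a i)"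
proof (induction i)
  case 0 then show ?case using assms by (simp add: nat_pow_def)
next
  case (Suc i)
  have "a [^]\<^bsub>factor w\<^esub> Suc i = \<mu> (a [^]\<^bsub>factor w\<^esub> i) a" by (simp add: nat_pow_def)
  then show ?case unfolding Suc using assms by (simp add: mult_assoc mult_commute[of "alg_power a i" a])
qed

lemma orth_idems_prim:
  assumes "orth_idems E" "\<forall>v\<in>E. \<forall>a\<in>A. \<mu> v a \<noteq> 0 \<longrightarrow> (\<exists>b\<in>A. \<mu> (\<mu> v a) b = v)" "v \<in> E"
  shows "prim_idem v"
  using assms by (auto simp: prim_idem_def orth_idems_def)

end

text \<open>In characteristic 0 the derivative of a nonconstant polynomial is nonzero and of smaller
  degree, so an irreducible polynomial cannot divide its derivative.\<close>

lemma irreducible_coprime_pderiv: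
  fixes p :: "'k::field_char_0 poly"
  assumes "irreducible p"
  shows "coprime p (pderiv p)"
proof (rule coprimeI)
  have "p \<noteq> 0" "\<not> is_unit p" using assms by auto
  then have deg: "degree p \<noteq> 0" by (simp add: is_unit_iff_degree)
  then have "pderiv p \<noteq> 0" by (simp add: pderiv_eq_0_iff)
  moreover have "degree (pderiv p) < degree p" using deg by (simp add: degree_pderiv)
  ultimately have not_dvd: "\<not> p dvd pderiv p" using dvd_imp_degree_le by fastforce
  fix c assume c: "c dvd p" "c dvd pderiv p"
  then obtain d where d: "p = c * d" by (elim dvdE)
  then have "is_unit c \<or> is_unit d" using assms by (rule Factorial_Ring.irreducibleD[rotated])
  moreover have "\<not> is_unit d"
  proof
    assume "is_unit d"
    then have "p dvd c" by (simp add: d mult_unit_dvd_iff)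
    then show False using c(2) not_dvd dvd_trans by blast
  qed
  ultimately show "is_unit c" by blast
qed

locale etale_structure_char_0 = etale_structure scale n e x
  for scale :: "'k::field_char_0 \<Rightarrow> 'v::ab_group_add \<Rightarrow> 'v" and n and e :: "nat \<Rightarrow> 'v" and x
begin

lemma factor_separable:
  assumes w: "prim_idem w"
  shows "finite_separable_extension (factor w) (\<lambda>c. scale c w)"
proof -
  interpret F: field "factor w" by (rule factor_field) fact
  have wA: "w \<in> A" "w \<noteq> 0" "\<mu> w w = w" using w by (auto simp: prim_idem_def)
  let ?K = "range (\<lambda>c. scale c w)"
  have wK: "scale c w \<in> carrier (factor w)" for c
    using wA by (simp add: span_scale mult_scale_right)
  have hom: "(\<lambda>c. scale c w) \<in> Ring.ring_hom type_ring (factor w)"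
    using wA wK by (auto simp: Ring.ring_hom_def type_ring_def scale_left_distrib mult_scale_left mult_scale_right span_scale)
  have neg: "\<ominus>\<^bsub>factor w\<^esub> a = - a" if "a \<in> carrier (factor w)" for a
  proof (rule F.minus_equality)
    show "- a \<in> carrier (factor w)" using that mult_diff_right[of 0 a w] by (simp add: span_neg span_zero)
  qed (use that in auto)
  have "subring ?K (factor w)"
  proof (rule F.subringI)
    show "\<one>\<^bsub>factor w\<^esub> \<in> ?K" by (rule range_eqI[of _ _ 1]) simp
    show "\<ominus>\<^bsub>factor w\<^esub> h \<in> ?K" if h: "h \<in> ?K" for h
    proof -
      obtain c where "h = scale c w" using h by auto
      then have "\<ominus>\<^bsub>factor w\<^esub> h = scale (- c) w" using neg wK by simp
      then show ?thesis by (rule range_eqI)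
    qed
    show "h1 \<otimes>\<^bsub>factor w\<^esub> h2 \<in> ?K" if h: "h1 \<in> ?K" "h2 \<in> ?K" for h1 h2
    proof -
      obtain c1 c2 where "h1 = scale c1 w" "h2 = scale c2 w" using h by auto
      then have "h1 \<otimes>\<^bsub>factor w\<^esub> h2 = scale (c1 * c2) w"
        using wA by (simp add: mult_scale_left mult_scale_right span_scale)
      then show ?thesis by blast
    qed
    show "h1 \<oplus>\<^bsub>factor w\<^esub> h2 \<in> ?K" if "h1 \<in> ?K" "h2 \<in> ?K" for h1 h2
      using that by (auto simp: scale_left_distrib[symmetric])
  qed (use wK in blast)
  then have K: "subfield ?K (factor w)"
  proof (rule F.subfieldI')
    fix k assume k: "k \<in> ?K - {\<zero>\<^bsub>factor w\<^esub>}"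
    then obtain c where c: "k = scale c w" "c \<noteq> 0" by auto
    have "inv\<^bsub>factor w\<^esub> k = scale (inverse c) w"
    proof (rule F.comm_inv_char)
      show "k \<otimes>\<^bsub>factor w\<^esub> scale (inverse c) w = \<one>\<^bsub>factor w\<^esub>"
        using c wA by (simp add: mult_scale_left mult_scale_right span_scale)
    qed (use wK c in blast)+
    then show "inv\<^bsub>factor w\<^esub> k \<in> ?K" by auto
  qed
  have "F.finite_dimension ?K (carrier (factor w))"
  proof -
    \<comment> \<open>The components of the basis vectors along \<open>w\<close> span the factor
      over the scalar multiples of \<open>w\<close>.\<close>
    define Us where "Us = map (\<lambda>i. \<mu> w (e i)) [0..<n]"
    have Us: "set Us \<subseteq> carrier (factor w)" using wA by (auto simp: Us_def mult_assoc[symmetric])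
    have comb: "F.combine (map (\<lambda>i. scale (c i) w) L) (map (\<lambda>i. \<mu> w (e i)) L) = (\<Sum>i\<leftarrow>L. scale (c i) (\<mu> w (e i)))"
      if "set L \<subseteq> {..<n}" for c L
      using that
    proof (induction L)
      case (Cons i L)
      then have "F.combine (map (\<lambda>i. scale (c i) w) (i # L)) (map (\<lambda>i. \<mu> w (e i)) (i # L))
        = \<mu> (scale (c i) w) (\<mu> w (e i)) + (\<Sum>i\<leftarrow>L. scale (c i) (\<mu> w (e i)))" by simp
      also have "\<mu> (scale (c i) w) (\<mu> w (e i)) = scale (c i) (\<mu> w (e i))"
        using wA Cons.prems by (simp add: mult_scale_left mult_assoc[symmetric])
      finally show ?case by simp
    qed simp
    have "a \<in> F.Span ?K Us" if a: "a \<in> carrier (factor w)" for a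
    proof -
      have "a = \<mu> w (\<Sum>i<n. scale (co a i) (e i))" using a expand[of a] by simp
      also have "\<dots> = (\<Sum>i<n. scale (co a i) (\<mu> w (e i)))"
        by (subst mult_sum_right) (auto simp: span_scale mult_scale_right)
      also have "\<dots> = (\<Sum>i\<leftarrow>[0..<n]. scale (co a i) (\<mu> w (e i)))"
        by (simp add: interv_sum_list_conv_sum_set_nat atLeast0LessThan)
      also have "\<dots> = F.combine (map (\<lambda>i. scale (co a i) w) [0..<n]) Us"
        unfolding Us_def by (rule comb[symmetric]) auto
      finally show ?thesis
        unfolding F.Span_eq_combine_set[OF K Us]
        by (intro CollectI exI[of _ "map (\<lambda>i. scale (co a i) w) [0..<n]"] conjI) auto
    qed
    then have "carrier (factor w) = F.Span ?K Us"
      using F.Span_in_carrier[OF _ Us, of ?K] K[THEN subfieldE(3)] by blast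
    then show ?thesis using F.Span_finite_dimension[OF K Us] by simp
  qed
  moreover have "\<exists>p :: 'k poly. irreducible p \<and> coprime p (pderiv p) \<and>
      (\<Oplus>\<^bsub>factor w\<^esub>i\<in>{..degree p}. scale (poly.coeff p i) w \<otimes>\<^bsub>factor w\<^esub> a [^]\<^bsub>factor w\<^esub> i) = \<zero>\<^bsub>factor w\<^esub>"
    if a: "a \<in> carrier (factor w)" for a
  proof -
    have aA: "a \<in> A" using a by simp
    obtain p where p: "irreducible p" "\<mu> w (alg_eval a p) = 0" using irreducible_annihilator[OF aA w] by blast
    have summand: "scale c w \<otimes>\<^bsub>factor w\<^esub> a [^]\<^bsub>factor w\<^esub> i = \<mu> w (scale c (alg_power a i))" for c and i :: nat
      using wA by (simp add: factor_nat_pow[OF a wA(1)] mult_scale_left mult_scale_right mult_assoc[symmetric])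
    have "(\<Oplus>\<^bsub>factor w\<^esub>i\<in>{..degree p}. scale (poly.coeff p i) w \<otimes>\<^bsub>factor w\<^esub> a [^]\<^bsub>factor w\<^esub> i)
       = (\<Sum>i\<le>degree p. \<mu> w (scale (poly.coeff p i) (alg_power a i)))"
      unfolding summand by (rule factor_finsum[OF w]) (use wA in \<open>auto simp: mult_assoc[symmetric] span_scale\<close>)
    also have "\<dots> = \<mu> w (alg_eval a p)" unfolding alg_eval_def
      by (subst mult_sum_right) (auto simp: span_scale)
    finally show ?thesis using p irreducible_coprime_pderiv by auto
  qed
  ultimately show ?thesis
    unfolding finite_separable_extension_def using F.field_axioms hom by blast
qed

text \<open>The isomorphism sends \<open>a\<close> to its components along the primitive
  idempotents; its inverse adds the components up.\<close>

theorem finite_etale: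
  assumes UN: "A = UNIV"
  shows "finite_etale scale \<mu>"
proof -
  obtain E where E: "orth_idems E" "(\<Sum>v\<in>E. v) = u" "\<forall>v\<in>E. \<forall>a\<in>A. \<mu> v a \<noteq> 0 \<longrightarrow> (\<exists>b\<in>A. \<mu> (\<mu> v a) b = v)"
    using primitive_idempotents by blast
  have fin: "finite E" using E(1) by (simp add: orth_idems_def)
  obtain w where w: "bij_betw w {0..<card E} E" using ex_bij_betw_nat_finite[OF fin] by blast
  let ?r = "card E"
  have wE: "w s \<in> E" if "s < ?r" for s using w that by (auto simp: bij_betw_def)
  have prim: "prim_idem (w s)" if "s < ?r" for s using orth_idems_prim[OF E(1,3) wE[OF that]] .
  have idem: "\<mu> (w s) (w s) = w s" if "s < ?r" for s using prim[OF that] by (simp add: prim_idem_def)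
  have orth: "\<mu> (w s) (w t) = 0" if "s < ?r" "t < ?r" "s \<noteq> t" for s t
  proof -
    have "w s \<noteq> w t" using w that unfolding bij_betw_def inj_on_def by auto
    then show ?thesis using E(1) wE that(1,2) unfolding orth_idems_def by blast
  qed
  have sumw: "(\<Sum>s<?r. w s) = u"
    using sum.reindex_bij_betw[OF w, of "\<lambda>v. v"] E(2) by (simp add: atLeast0LessThan)
  have all [simp]: "a \<in> A" for a using UN by simp
  define \<psi> where "\<psi> a = (\<lambda>s\<in>{..<?r}. \<mu> (w s) a)" for a
  have recover: "(\<Sum>s<?r. \<psi> a s) = a" for a
  proof -
    have "(\<Sum>s<?r. \<psi> a s) = (\<Sum>s<?r. \<mu> (w s) a)" by (simp add: \<psi>_def)
    also have "\<dots> = \<mu> (\<Sum>s<?r. w s) a" by (rule mult_sum_left[symmetric]) simp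
    finally show ?thesis by (simp add: sumw)
  qed
  have "bij_betw \<psi> UNIV (\<Pi>\<^sub>E s\<in>{..<?r}. carrier (factor (w s)))"
  proof (rule bij_betw_byWitness[where f' = "\<lambda>g. \<Sum>s<?r. g s"])
    show "\<forall>a\<in>UNIV. (\<Sum>s<?r. \<psi> a s) = a" using recover by blast
    show "\<forall>g\<in>\<Pi>\<^sub>E s\<in>{..<?r}. carrier (factor (w s)). \<psi> (\<Sum>s<?r. g s) = g"
    proof
      fix g assume g: "g \<in> (\<Pi>\<^sub>E s\<in>{..<?r}. carrier (factor (w s)))"
      then have gs: "\<mu> (w s) (g s) = g s" if "s < ?r" for s using that by (auto simp: PiE_def Pi_def)
      have "\<mu> (w s) (\<Sum>t<?r. g t) = g s" if s: "s < ?r" for s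
      proof -
        have "\<mu> (w s) (\<Sum>t<?r. g t) = (\<Sum>t<?r. \<mu> (w s) (g t))" by (rule mult_sum_right) simp
        also have "\<dots> = (\<Sum>t<?r. if t = s then g s else 0)"
        proof (intro sum.cong refl)
          fix t assume "t \<in> {..<?r}"
          then have t: "t < ?r" by simp
          have "\<mu> (w s) (g t) = \<mu> (\<mu> (w s) (w t)) (g t)" using gs[OF t] by (simp add: mult_assoc)
          then show "\<mu> (w s) (g t) = (if t = s then g s else 0)" using gs[OF s] orth[OF s t] by auto
        qed
        finally show ?thesis using s by simp
      qed
      then show "\<psi> (\<Sum>s<?r. g s) = g" using g by (auto simp: \<psi>_def fun_eq_iff PiE_def extensional_def)
    qed
    show "\<psi> ` UNIV \<subseteq> (\<Pi>\<^sub>E s\<in>{..<?r}. carrier (factor (w s)))"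
      using idem by (auto simp: \<psi>_def PiE_def mult_assoc[symmetric])
    show "(\<lambda>g. \<Sum>s<?r. g s) ` (\<Pi>\<^sub>E s\<in>{..<?r}. carrier (factor (w s))) \<subseteq> UNIV" by simp
  qed
  moreover have "\<psi> (a + b) s = \<psi> a s \<oplus>\<^bsub>factor (w s)\<^esub> \<psi> b s" if "s < ?r" for s a b
    using that by (simp add: \<psi>_def mult_add_right)
  moreover have "\<psi> (\<mu> a b) s = \<psi> a s \<otimes>\<^bsub>factor (w s)\<^esub> \<psi> b s" if "s < ?r" for s a b
    using that idem[OF that] by (simp add: \<psi>_def idem_mult)
  moreover have "\<psi> (scale c a) s = scale c (w s) \<otimes>\<^bsub>factor (w s)\<^esub> \<psi> a s" if "s < ?r" for s c a
    using that idem[OF that] by (simp add: \<psi>_def mult_scale_right mult_scale_left mult_assoc[of "w s" "w s", symmetric])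
  ultimately show ?thesis
    unfolding finite_etale_def
    by (intro exI[of _ ?r] exI[of _ "\<lambda>s. factor (w s)"] exI[of _ "\<lambda>s c. scale c (w s)"] exI[of _ \<psi>] conjI)
      (blast intro: factor_separable[OF prim])+
qed

end

section \<open>Split algebras over an algebraically closed field\<close>

locale split_structure = etale_structure scale n e x
  for scale :: "'k::alg_closed_field \<Rightarrow> 'v::ab_group_add \<Rightarrow> 'v" and n and e :: "nat \<Rightarrow> 'v" and x
begin

text \<open>The irreducible polynomial that annihilates \<open>a\<close> on this factor has a root,
  hence is linear up to a unit.\<close>

lemma prim_idem_line:
  assumes w: "prim_idem w" and a: "a \<in> A"
  shows "\<exists>r. \<mu> w a = scale r w"
proof -
  obtain p where p: "irreducible p" "\<mu> w (alg_eval a p) = 0" using irreducible_annihilator[OF a w] by blast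
  have "degree p > 0" using p(1) by (auto simp: irreducible_def is_unit_iff_degree)
  then obtain r where "poly p r = 0" using alg_closed_imp_poly_has_root by blast
  then obtain q where q: "p = [:- r, 1:] * q" by (auto simp: poly_eq_0_iff_dvd elim: dvdE)
  have "\<not> [:- r, 1:] dvd 1" by (simp add: is_unit_iff_degree)
  then have "q dvd 1" using Factorial_Ring.irreducibleD[OF p(1) q] by blast
  then obtain c where c: "q = [:c:]" by (auto simp: is_unit_poly_iff)
  have "p \<noteq> 0" using p(1) by auto
  then have "c \<noteq> 0" using q c by auto
  note c = c this
  have wA: "w \<in> A" using w by (simp add: prim_idem_def)
  have "p = smult c [:- r, 1:]" using q c by simp
  then have "alg_eval a p = scale c (a - scale r u)"
    using a by (simp add: alg_eval_smult alg_eval_pCons mult_scale_right scale_right_diff_distrib)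
  then have "\<mu> w (alg_eval a p) = scale c (\<mu> w a - scale r w)"
    using a wA by (simp add: mult_scale_right span_diff span_scale mult_diff_right)
  then show ?thesis using p(2) c(2) by auto
qed

text \<open>An isomorphism with the product of \<open>n\<close> copies of the field:
  \<open>b\<close> lists the primitive idempotents, and \<open>r v i\<close> is the value of the
  \<open>i\<close>-th character at \<open>v\<close>.\<close>

definition character_basis :: "(nat \<Rightarrow> 'v) \<Rightarrow> ('v \<Rightarrow> nat \<Rightarrow> 'k) \<Rightarrow> bool" where
  "character_basis b r \<longleftrightarrow> (\<forall>i<n. b i \<in> A) \<and> (\<forall>v\<in>A. v = (\<Sum>i<n. scale (r v i) (b i))) \<and>
     (\<forall>v\<in>A. \<forall>w\<in>A. \<forall>i<n. r (v + w) i = r v i + r w i \<and> r (\<mu> v w) i = r v i * r w i) \<and>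
     (\<forall>c. \<forall>v\<in>A. \<forall>i<n. r (scale c v) i = c * r v i) \<and>
     (\<forall>i<n. \<forall>j<n. r (b j) i = (if i = j then 1 else 0))"

lemma character_basis_exists: "\<exists>b r. character_basis b r"
proof -
  obtain E where E: "orth_idems E" "(\<Sum>v\<in>E. v) = u" "\<forall>v\<in>E. \<forall>a\<in>A. \<mu> v a \<noteq> 0 \<longrightarrow> (\<exists>b\<in>A. \<mu> (\<mu> v a) b = v)"
    using primitive_idempotents by blast
  note Ed = E(1)[unfolded orth_idems_def]
  have prim: "prim_idem v" if "v \<in> E" for v using orth_idems_prim[OF E(1,3) that] .
  have EA: "v \<in> A" if "v \<in> E" for v using Ed that by auto
  define \<rho> where "\<rho> v w = (SOME r. \<mu> w v = scale r w)" for v w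
  have \<rho>: "\<mu> w v = scale (\<rho> v w) w" if "w \<in> E" "v \<in> A" for w v
    unfolding \<rho>_def using prim_idem_line[OF prim[OF that(1)] that(2)] by (rule someI_ex)
  have eq: "\<rho> v w = c" if "w \<in> E" "v \<in> A" "\<mu> w v = scale c w" for v w c
    using \<rho>[of w v] that Ed by auto
  have expE: "v = (\<Sum>w\<in>E. scale (\<rho> v w) w)" if "v \<in> A" for v
  proof -
    have "v = \<mu> (\<Sum>w\<in>E. w) v" using that E(2) by simp
    also have "\<dots> = (\<Sum>w\<in>E. \<mu> w v)" using EA by (intro mult_sum_left) auto
    finally show ?thesis using \<rho>[OF _ that] by simp
  qed
  \<comment> \<open>At most \<open>n\<close> by independence; at least \<open>n\<close> because
    every factor is a line, so that the idempotents span \<open>A\<close>.\<close>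
  have "card E = n"
  proof (rule antisym)
    show "card E \<le> n" using orth_idems_card E(1) .
    have "A \<subseteq> span E" using expE by (metis (no_types, lifting) span_base span_scale span_sum subsetI)
    then have "e ` {..<n} \<subseteq> span E" using e_in_A by (auto dest!: subsetD)
    then show "n \<le> card E" using independent_span_bound[of E "e ` {..<n}"] Ed indep_e card_e by auto
  qed
  then obtain b where b: "bij_betw b {..<n} E"
    using ex_bij_betw_nat_finite[of E] Ed by (auto simp: atLeast0LessThan)
  have bE: "b i \<in> E" if "i < n" for i using b that by (auto simp: bij_betw_def)
  have c1: "v = (\<Sum>i<n. scale (\<rho> v (b i)) (b i))" if "v \<in> A" for v
    using expE[OF that] sum.reindex_bij_betw[OF b, of "\<lambda>w. scale (\<rho> v w) w"] by simp
  have c2: "\<rho> (v + w) (b i) = \<rho> v (b i) + \<rho> w (b i)" if "v \<in> A" "w \<in> A" "i < n" for v w i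
  proof (rule eq)
    show "\<mu> (b i) (v + w) = scale (\<rho> v (b i) + \<rho> w (b i)) (b i)"
      unfolding mult_add_right[OF that(1,2)] scale_left_distrib
        \<rho>[OF bE[OF that(3)] that(1)] \<rho>[OF bE[OF that(3)] that(2)] ..
  qed (use that bE in \<open>auto simp: span_add\<close>)
  have c3: "\<rho> (\<mu> v w) (b i) = \<rho> v (b i) * \<rho> w (b i)" if "v \<in> A" "w \<in> A" "i < n" for v w i
  proof (rule eq)
    note bA = EA[OF bE[OF that(3)]]
    have "\<mu> (b i) (\<mu> v w) = \<mu> (\<mu> (b i) v) w" by (rule mult_assoc[OF bA that(1,2), symmetric])
    also have "\<dots> = scale (\<rho> v (b i)) (\<mu> (b i) w)"
      unfolding \<rho>[OF bE[OF that(3)] that(1)] by (rule mult_scale_left[OF bA])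
    also have "\<dots> = scale (\<rho> v (b i) * \<rho> w (b i)) (b i)"
      unfolding \<rho>[OF bE[OF that(3)] that(2)] by simp
    finally show "\<mu> (b i) (\<mu> v w) = scale (\<rho> v (b i) * \<rho> w (b i)) (b i)" .
  qed (use that bE in auto)
  have c4: "\<rho> (scale c v) (b i) = c * \<rho> v (b i)" if "v \<in> A" "i < n" for c v i
  proof (rule eq)
    show "\<mu> (b i) (scale c v) = scale (c * \<rho> v (b i)) (b i)"
      unfolding mult_scale_right[OF that(1)] \<rho>[OF bE[OF that(2)] that(1)] by simp
  qed (use that bE in \<open>auto simp: span_scale\<close>)
  have c5: "\<rho> (b j) (b i) = (if i = j then 1 else 0)" if "i < n" "j < n" for i j
  proof (rule eq)
    show "\<mu> (b i) (b j) = scale (if i = j then 1 else 0) (b i)"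
    proof (cases "i = j")
      case True then show ?thesis using Ed bE[OF that(2)] by auto
    next
      case False
      then have "b i \<noteq> b j" using b that unfolding bij_betw_def inj_on_def by auto
      then show ?thesis using Ed bE[OF that(1)] bE[OF that(2)] False by auto
    qed
  qed (use that bE EA in auto)
  have c0: "b i \<in> A" if "i < n" for i using EA[OF bE[OF that]] .
  have "character_basis b (\<lambda>v i. \<rho> v (b i))"
    unfolding character_basis_def
    by (intro conjI ballI allI impI) (rule c0 c1 c2 c3 c4 c5; assumption)+
  then show ?thesis by blast
qed

end

text \<open>Both algebras are products of \<open>n\<close> copies of the field, so matching their
  primitive idempotents is an isomorphism; \<open>G\<close> and \<open>H\<close> are the matrices of
  it and of its inverse.\<close>

lemma split_structures_conjugate:
  fixes scale :: "'k::alg_closed_field \<Rightarrow> 'v::ab_group_add \<Rightarrow> 'v"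
  assumes "split_structure scale n e x" "split_structure scale n e y"
  shows "\<exists>G H. (\<forall>i<n. \<forall>j<n. (\<Sum>l<n. G i l * H l j) = (if i = j then 1 else 0)) \<and>
    (\<forall>i<n. \<forall>j<n. (\<Sum>l<n. H i l * G l j) = (if i = j then 1 else 0)) \<and>
    (\<forall>i<n. \<forall>j<n. \<forall>l<n. y i j l = (\<Sum>a<n. \<Sum>b<n. \<Sum>c<n. G l c * x a b c * H a i * H b j))"
proof -
  interpret X: split_structure scale n e x by fact
  interpret Y: split_structure scale n e y by fact
  obtain bx rx where "X.character_basis bx rx" using X.character_basis_exists by blast
  note rx' = this[unfolded X.character_basis_def]
  have bx: "\<And>i. i < n \<Longrightarrow> bx i \<in> X.A" and
    rx: "\<And>v. v \<in> X.A \<Longrightarrow> v = (\<Sum>i<n. scale (rx v i) (bx i))"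
      "\<And>v w i. v \<in> X.A \<Longrightarrow> w \<in> X.A \<Longrightarrow> i < n \<Longrightarrow> rx (v + w) i = rx v i + rx w i"
      "\<And>v w i. v \<in> X.A \<Longrightarrow> w \<in> X.A \<Longrightarrow> i < n \<Longrightarrow> rx (X.\<mu> v w) i = rx v i * rx w i"
      "\<And>c v i. v \<in> X.A \<Longrightarrow> i < n \<Longrightarrow> rx (scale c v) i = c * rx v i"
      "\<And>i j. i < n \<Longrightarrow> j < n \<Longrightarrow> rx (bx j) i = (if i = j then 1 else 0)"
    using rx' by blast+
  obtain b_y ry where "Y.character_basis b_y ry" using Y.character_basis_exists by blast
  note ry' = this[unfolded Y.character_basis_def]
  have by': "\<And>i. i < n \<Longrightarrow> b_y i \<in> X.A" and
    ry: "\<And>v. v \<in> X.A \<Longrightarrow> v = (\<Sum>i<n. scale (ry v i) (b_y i))"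
      "\<And>v w i. v \<in> X.A \<Longrightarrow> w \<in> X.A \<Longrightarrow> i < n \<Longrightarrow> ry (v + w) i = ry v i + ry w i"
      "\<And>v w i. v \<in> X.A \<Longrightarrow> w \<in> X.A \<Longrightarrow> i < n \<Longrightarrow> ry (Y.\<mu> v w) i = ry v i * ry w i"
      "\<And>c v i. v \<in> X.A \<Longrightarrow> i < n \<Longrightarrow> ry (scale c v) i = c * ry v i"
      "\<And>i j. i < n \<Longrightarrow> j < n \<Longrightarrow> ry (b_y j) i = (if i = j then 1 else 0)"
    using ry' by blast+
  define g where "g v = (\<Sum>i<n. scale (rx v i) (b_y i))" for v
  define h where "h v = (\<Sum>i<n. scale (ry v i) (bx i))" for v
  have lincomb: "r (\<Sum>j<n. scale (c j) (b j)) i = c i"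
    if r: "\<And>v w i. v \<in> X.A \<Longrightarrow> w \<in> X.A \<Longrightarrow> i < n \<Longrightarrow> r (v + w) i = r v i + r w i"
      "\<And>c v i. v \<in> X.A \<Longrightarrow> i < n \<Longrightarrow> r (scale c v) i = c * r v i"
      "\<And>i j. i < n \<Longrightarrow> j < n \<Longrightarrow> r (b j) i = (if i = j then 1 else (0::'k))"
      "\<And>i. i < n \<Longrightarrow> b i \<in> X.A" and i: "i < n" for r b c i
  proof -
    have r0: "r 0 i = 0" using r(2)[of 0 i 0] i by (simp add: X.span_zero)
    have "r (\<Sum>j\<in>J. scale (c j) (b j)) i = (\<Sum>j\<in>J. c j * r (b j) i)" if "J \<subseteq> {..<n}" for J
      using finite_subset[OF that finite_lessThan] that
      by (induction J rule: finite_induct) (auto simp: r0 r(1,2,4) i X.span_sum X.span_scale subset_iff)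
    then have "r (\<Sum>j<n. scale (c j) (b j)) i = (\<Sum>j<n. c j * (if i = j then 1 else 0))"
      using r(3)[OF i] by simp
    then show ?thesis using i by (simp add: if_distrib[of "\<lambda>c. _ * c"] cong: if_cong)
  qed
  have gA: "g v \<in> X.A" for v unfolding g_def using by' by (intro X.span_sum X.span_scale) auto
  have hA: "h v \<in> X.A" for v unfolding h_def using bx by (intro X.span_sum X.span_scale) auto
  have rg: "ry (g v) i = rx v i" if "i < n" for v i
    unfolding g_def using lincomb[of ry b_y i "rx v"] ry by' that by blast
  have rh: "rx (h v) i = ry v i" if "i < n" for v i
    unfolding h_def using lincomb[of rx bx i "ry v"] rx bx that by blast
  have gh: "g (h v) = v" if "v \<in> X.A" for v
    using ry(1)[OF that] rh by (simp add: g_def)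
  have hg: "h (g v) = v" if "v \<in> X.A" for v
    using rx(1)[OF that] rg by (simp add: h_def)
  have g_add: "g (v + w) = g v + g w" if "v \<in> X.A" "w \<in> X.A" for v w
    using that rx(2) by (simp add: g_def X.scale_left_distrib sum.distrib)
  have h_add: "h (v + w) = h v + h w" if "v \<in> X.A" "w \<in> X.A" for v w
    using that ry(2) by (simp add: h_def X.scale_left_distrib sum.distrib)
  have g_scale: "g (scale c v) = scale c (g v)" if "v \<in> X.A" for c v
    using that rx(4) by (simp add: g_def X.scale_sum_right)
  have h_scale: "h (scale c v) = scale c (h v)" if "v \<in> X.A" for c v
    using that ry(4) by (simp add: h_def X.scale_sum_right)
  define G where "G l c = X.co (g (e c)) l" for l c
  define H where "H a i = X.co (h (e i)) a" for a i
  have expand_lin: "X.co (k v) l = (\<Sum>c<n. X.co v c * X.co (k (e c)) l)"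
    if k: "\<And>v. k v \<in> X.A" "\<And>v w. v \<in> X.A \<Longrightarrow> w \<in> X.A \<Longrightarrow> k (v + w) = k v + k w"
      "\<And>c v. v \<in> X.A \<Longrightarrow> k (scale c v) = scale c (k v)" and v: "v \<in> X.A" for k v l
    using v
  proof (rule X.linear_ext[where sc = "(*)"])
    fix i assume i: "i < n"
    show "X.co (k (e i)) l = (\<Sum>c<n. X.co (e i) c * X.co (k (e c)) l)"
      using i by (simp add: X.co_e if_distrib[of "\<lambda>c. c * _"] cong: if_cong)
  qed (auto simp: k X.co_add X.co_scale sum.distrib algebra_simps sum_distrib_left)
  have "(\<Sum>l<n. G i l * H l j) = (if i = j then 1 else 0)" if "i < n" "j < n" for i j
    using expand_lin[of g "h (e j)" i] gA g_add g_scale hA gh[of "e j"] X.co_e[of i j] that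
    by (simp add: G_def H_def mult.commute)
  moreover have "(\<Sum>l<n. H i l * G l j) = (if i = j then 1 else 0)" if "i < n" "j < n" for i j
    using expand_lin[of h "g (e j)" i] hA h_add h_scale gA hg[of "e j"] X.co_e[of i j] that
    by (simp add: G_def H_def mult.commute)
  moreover have "y i j l = (\<Sum>a<n. \<Sum>b<n. \<Sum>c<n. G l c * x a b c * H a i * H b j)"
    if ijl: "i < n" "j < n" "l < n" for i j l
  proof -
    have "g (X.\<mu> (h (e i)) (h (e j))) = Y.\<mu> (e i) (e j)"
      unfolding g_def using ry(1)[of "Y.\<mu> (e i) (e j)"] ijl
      by (simp add: rx(3) ry(3) hA rh)
    then have "y i j l = X.co (g (X.\<mu> (h (e i)) (h (e j)))) l"
      using ijl by (simp add: Y.mult_e X.co_lincomb)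
    also have "\<dots> = (\<Sum>c<n. X.co (X.\<mu> (h (e i)) (h (e j))) c * G l c)"
      unfolding G_def by (rule expand_lin) (simp_all add: gA g_add g_scale)
    also have "\<dots> = (\<Sum>c<n. \<Sum>a<n. \<Sum>b<n. G l c * x a b c * H a i * H b j)"
      by (simp add: X.co_mult H_def sum_distrib_left sum_distrib_right algebra_simps)
    also have "\<dots> = (\<Sum>a<n. \<Sum>c<n. \<Sum>b<n. G l c * x a b c * H a i * H b j)"
      by (rule sum.swap)
    also have "\<dots> = (\<Sum>a<n. \<Sum>b<n. \<Sum>c<n. G l c * x a b c * H a i * H b j)"
      by (intro sum.cong refl sum.swap)
    finally show ?thesis .
  qed
  ultimately show ?thesis by blast
qed

section \<open>Polynomials, ideals and prime ideals\<close>

definition monom_val :: "(coord \<Rightarrow> 'r::comm_ring_1) \<Rightarrow> (coord \<Rightarrow>\<^sub>0 nat) \<Rightarrow> 'r" where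
  "monom_val y m = (\<Prod>v\<in>Poly_Mapping.keys m. y v ^ Poly_Mapping.lookup m v)"

lemma monom_val_superset:
  "finite S \<Longrightarrow> Poly_Mapping.keys m \<subseteq> S \<Longrightarrow> monom_val y m = (\<Prod>v\<in>S. y v ^ Poly_Mapping.lookup m v)"
  unfolding monom_val_def by (rule prod.mono_neutral_left) (auto simp: in_keys_iff)

lemma monom_val_add: "monom_val y (m + m') = monom_val y m * monom_val y m'"
proof -
  let ?S = "Poly_Mapping.keys m \<union> Poly_Mapping.keys m'"
  have "monom_val y (m + m') = (\<Prod>v\<in>?S. y v ^ Poly_Mapping.lookup (m + m') v)"
    by (rule monom_val_superset) (simp_all add: keys_add)
  then show ?thesis
    by (simp add: monom_val_superset[of ?S m] monom_val_superset[of ?S m'] lookup_add power_add prod.distrib)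
qed

lemma monom_val_0 [simp]: "monom_val y 0 = 1" by (simp add: monom_val_def)

lemma monom_val_single [simp]: "monom_val y (Poly_Mapping.single v k) = y v ^ k"
  by (cases "k = 0") (simp_all add: monom_val_def)

lemma poly_eval_superset:
  assumes "h 0 = 0" "finite S" "Poly_Mapping.keys f \<subseteq> S"
  shows "poly_eval h y f = (\<Sum>m\<in>S. h (Poly_Mapping.lookup f m) * monom_val y m)"
  unfolding poly_eval_def monom_val_def[symmetric] using assms
  by (intro sum.mono_neutral_left) (auto simp: in_keys_iff)

lemma cpoly_expand: "f = (\<Sum>m\<in>Poly_Mapping.keys f. Poly_Mapping.single m (Poly_Mapping.lookup f m))"
  by (rule poly_mapping_eqI) (auto simp: lookup_sum lookup_single when_def in_keys_iff)

lemma cpoly_mult_expand: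
  "f * g = (\<Sum>m\<in>Poly_Mapping.keys f. \<Sum>m'\<in>Poly_Mapping.keys g.
     Poly_Mapping.single (m + m') (Poly_Mapping.lookup f m * Poly_Mapping.lookup g m'))"
  for f g :: "'k::comm_ring_1 cpoly"
  by (subst (1) cpoly_expand[of f], subst (1) cpoly_expand[of g])
    (simp add: sum_product mult_single)

context comm_ring_hom
begin

lemma poly_eval_add: "poly_eval hom y (f + g) = poly_eval hom y f + poly_eval hom y g"
proof -
  let ?S = "Poly_Mapping.keys f \<union> Poly_Mapping.keys g"
  have "poly_eval hom y (f + g) = (\<Sum>m\<in>?S. hom (Poly_Mapping.lookup (f + g) m) * monom_val y m)"
    by (rule poly_eval_superset) (simp_all add: keys_add)
  then show ?thesis
    by (simp add: poly_eval_superset[of hom ?S f] poly_eval_superset[of hom ?S g] lookup_add hom_add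
        sum.distrib algebra_simps)
qed

lemma poly_eval_0 [simp]: "poly_eval hom y 0 = 0"
  by (simp add: poly_eval_def)

lemma poly_eval_sum: "poly_eval hom y (\<Sum>i\<in>I. F i) = (\<Sum>i\<in>I. poly_eval hom y (F i))"
  by (induction I rule: infinite_finite_induct) (auto simp: poly_eval_add)

lemma poly_eval_single: "poly_eval hom y (Poly_Mapping.single m c) = hom c * monom_val y m"
  by (subst poly_eval_superset[where S = "{m}"]) auto

lemma poly_eval_mult: "poly_eval hom y (f * g) = poly_eval hom y f * poly_eval hom y g"
  unfolding cpoly_mult_expand poly_eval_sum poly_eval_single
  by (simp add: poly_eval_def monom_val_def[symmetric] sum_product hom_mult monom_val_add algebra_simps)

lemma poly_eval_const [simp]: "poly_eval hom y (const c) = hom c"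
  by (simp add: const_def poly_eval_single)

lemma poly_eval_pvar [simp]: "poly_eval hom y (pvar v) = y v"
  by (simp add: pvar_def poly_eval_single)

lemma poly_eval_1 [simp]: "poly_eval hom y 1 = 1"
  using poly_eval_single[of y 0 1] by simp

lemma poly_eval_hom: "comm_ring_hom (poly_eval hom y)"
  by unfold_locales (simp_all add: poly_eval_add poly_eval_mult)

lemma poly_eval_comp:
  "poly_eval hom z (poly_eval const Y f) = poly_eval hom (\<lambda>v. poly_eval hom z (Y v)) f"
proof -
  interpret ev: comm_ring_hom "poly_eval hom z" by (rule poly_eval_hom)
  show ?thesis
    unfolding poly_eval_def[of const] poly_eval_def[of hom "\<lambda>v. poly_eval hom z (Y v)"]
    by (simp add: ev.hom_sum ev.hom_mult ev.hom_prod ev.hom_power)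
qed

end

lemma const_hom: "comm_ring_hom (const :: 'k::comm_ring_1 \<Rightarrow> 'k cpoly)"
  by unfold_locales (simp_all add: const_def single_add mult_single)

lemma poly_eval_cong:
  "(\<And>m v. m \<in> Poly_Mapping.keys f \<Longrightarrow> v \<in> Poly_Mapping.keys m \<Longrightarrow> y v = y' v) \<Longrightarrow> poly_eval h y f = poly_eval h y' f"
  unfolding poly_eval_def by (intro sum.cong prod.cong refl arg_cong2[where f = "(*)"]) auto

section \<open>Polynomials in given variables; subrings with their ideals and primes\<close>

definition polys_in :: "coord set \<Rightarrow> 'k::field cpoly set" where
  "polys_in S = {f. \<forall>m\<in>Poly_Mapping.keys f. Poly_Mapping.keys m \<subseteq> S}"

lemma carrier_poly_ring [simp]: "carrier (poly_ring S) = polys_in S"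
  by (simp add: poly_ring_def polys_in_def)

text \<open>All coordinate rings are subrings of one polynomial type. Ideals and primes are handled
  relative to a subset \<open>C\<close> of a type with its own ring operations;
  \<open>ideal_iff\<close> and \<open>prime_iff\<close> translate from rings given as
  records.\<close>

locale csubring =
  fixes C :: "'r::comm_ring_1 set"
  assumes C_1: "1 \<in> C" and C_add: "a \<in> C \<Longrightarrow> b \<in> C \<Longrightarrow> a + b \<in> C"
    and C_neg: "a \<in> C \<Longrightarrow> - a \<in> C" and C_mult: "a \<in> C \<Longrightarrow> b \<in> C \<Longrightarrow> a * b \<in> C"
begin

lemma C_0: "0 \<in> C" using C_add[OF C_1 C_neg[OF C_1]] by simp
lemma C_diff: "a \<in> C \<Longrightarrow> b \<in> C \<Longrightarrow> a - b \<in> C" using C_add[of a "- b"] C_neg by simp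
lemma C_sum: "(\<And>i. i \<in> I \<Longrightarrow> f i \<in> C) \<Longrightarrow> sum f I \<in> C"
  by (induction I rule: infinite_finite_induct) (auto simp: C_0 C_add)
lemma C_prod: "(\<And>i. i \<in> I \<Longrightarrow> f i \<in> C) \<Longrightarrow> prod f I \<in> C"
  by (induction I rule: infinite_finite_induct) (auto simp: C_1 C_mult)
lemma C_power: "a \<in> C \<Longrightarrow> a ^ k \<in> C"
  by (induction k) (auto simp: C_1 C_mult)

abbreviation "R \<equiv> type_ring\<lparr>carrier := C\<rparr>"

lemma R_simps [simp]: "carrier R = C" "monoid.mult R = (*)" "one R = 1" "zero R = 0" "add R = (+)"
  by (simp_all add: type_ring_def)

lemma cring_R: "cring R"
proof (rule cringI)
  show "abelian_group R"
  proof (rule abelian_groupI)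
    fix a assume "a \<in> carrier R"
    then show "\<exists>b\<in>carrier R. b \<oplus>\<^bsub>R\<^esub> a = \<zero>\<^bsub>R\<^esub>"
      by (intro bexI[of _ "- a"]) (auto simp: C_neg)
  qed (auto simp: C_add C_0 ac_simps)
  show "comm_monoid R" by (rule comm_monoidI) (auto simp: C_mult C_1 ac_simps)
qed (auto simp: algebra_simps)

definition is_ideal :: "'r set \<Rightarrow> bool" where
  "is_ideal I \<longleftrightarrow> I \<subseteq> C \<and> 0 \<in> I \<and> (\<forall>a\<in>I. \<forall>b\<in>I. a + b \<in> I) \<and> (\<forall>a\<in>I. \<forall>c\<in>C. c * a \<in> I)"

lemma ideal_neg: "is_ideal I \<Longrightarrow> a \<in> I \<Longrightarrow> - a \<in> I"
  using C_neg[OF C_1] unfolding is_ideal_def by (metis mult_minus1)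

lemma ideal_diff: "is_ideal I \<Longrightarrow> a \<in> I \<Longrightarrow> b \<in> I \<Longrightarrow> a - b \<in> I"
  using ideal_neg[of I b] unfolding is_ideal_def by (metis diff_conv_add_uminus)

lemma ideal_sum: "is_ideal I \<Longrightarrow> (\<And>i. i \<in> J \<Longrightarrow> f i \<in> I) \<Longrightarrow> sum f J \<in> I"
  by (induction J rule: infinite_finite_induct) (auto simp: is_ideal_def)

lemma ideal_mult: "is_ideal I \<Longrightarrow> a \<in> I \<Longrightarrow> c \<in> C \<Longrightarrow> c * a \<in> I" "is_ideal I \<Longrightarrow> a \<in> I \<Longrightarrow> c \<in> C \<Longrightarrow> a * c \<in> I"
  unfolding is_ideal_def by (auto simp: mult.commute)

lemma ideal_add: "is_ideal I \<Longrightarrow> a \<in> I \<Longrightarrow> b \<in> I \<Longrightarrow> a + b \<in> I"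
  unfolding is_ideal_def by auto

lemma ideal_iff: "ideal I R \<longleftrightarrow> is_ideal I"
proof
  assume "ideal I R"
  then interpret I: ideal I R .
  show "is_ideal I" unfolding is_ideal_def
    using I.a_subset I.I_l_closed additive_subgroup.zero_closed[OF I.additive_subgroup_axioms]
      additive_subgroup.a_closed[OF I.additive_subgroup_axioms] by auto
next
  assume I: "is_ideal I"
  interpret cring R by (rule cring_R)
  have neg: "\<ominus>\<^bsub>R\<^esub> a = - a" if "a \<in> C" for a
    using that by (intro minus_equality) (auto simp: C_neg)
  show "ideal I R"
  proof (rule idealI)
    show "ring R" by unfold_locales
    show "subgroup I (add_monoid R)"
    proof (rule add.subgroupI)
      show "I \<subseteq> carrier R" "I \<noteq> {}" using I by (auto simp: is_ideal_def)
      fix a assume "a \<in> I"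
      then show "\<ominus>\<^bsub>R\<^esub> a \<in> I" using ideal_neg[OF I] neg I by (auto simp: is_ideal_def)
    qed (use I in \<open>auto simp: is_ideal_def\<close>)
  qed (use I in \<open>auto simp: is_ideal_def mult.commute\<close>)
qed

definition is_prime :: "'r set \<Rightarrow> bool" where
  "is_prime P \<longleftrightarrow> is_ideal P \<and> 1 \<notin> P \<and> (\<forall>a\<in>C. \<forall>b\<in>C. a * b \<in> P \<longrightarrow> a \<in> P \<or> b \<in> P)"

lemma prime_iff: "primeideal P R \<longleftrightarrow> is_prime P"
proof
  assume "primeideal P R"
  then interpret P: primeideal P R .
  have "is_ideal P" using P.is_ideal ideal_iff by simp
  moreover have "1 \<notin> P" using P.one_imp_carrier P.I_notcarr by auto
  ultimately show "is_prime P" unfolding is_prime_def using P.I_prime by auto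
next
  assume P: "is_prime P"
  show "primeideal P R"
  proof (rule primeidealI)
    show "ideal P R" using P ideal_iff by (simp add: is_prime_def)
    show "cring R" by (rule cring_R)
    show "carrier R \<noteq> P" using P C_1 by (auto simp: is_prime_def)
  qed (use P in \<open>auto simp: is_prime_def\<close>)
qed

lemma Idl_minimal:
  assumes "is_ideal I" "S \<subseteq> I"
  shows "Idl\<^bsub>R\<^esub> S \<subseteq> I"
proof -
  interpret cring R by (rule cring_R)
  show ?thesis using assms by (intro genideal_minimal) (simp_all add: ideal_iff)
qed

lemma Idl_ideal: "S \<subseteq> C \<Longrightarrow> is_ideal (Idl\<^bsub>R\<^esub> S)" and Idl_self: "S \<subseteq> C \<Longrightarrow> S \<subseteq> Idl\<^bsub>R\<^esub> S"
proof -
  interpret cring R by (rule cring_R)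
  assume S: "S \<subseteq> C"
  show "is_ideal (Idl\<^bsub>R\<^esub> S)" using genideal_ideal[of S] S ideal_iff by simp
  show "S \<subseteq> Idl\<^bsub>R\<^esub> S" using genideal_self[of S] S by simp
qed

lemma prime_power: "is_prime P \<Longrightarrow> a \<in> C \<Longrightarrow> a ^ k \<in> P \<Longrightarrow> a \<in> P"
proof (induction k)
  case (Suc k)
  then have "a \<in> P \<or> a ^ k \<in> P" using C_power[of a k] unfolding is_prime_def by auto
  then show ?case using Suc by blast
qed (simp add: is_prime_def)

text \<open>An ideal maximal among those disjoint from a multiplicative set is prime.\<close>

lemma prime_avoiding:
  assumes I: "is_ideal I" and M: "M \<subseteq> C" "1 \<in> M" "\<And>a b. a \<in> M \<Longrightarrow> b \<in> M \<Longrightarrow> a * b \<in> M" and dis: "I \<inter> M = {}"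
  shows "\<exists>P. is_prime P \<and> I \<subseteq> P \<and> P \<inter> M = {}"
proof -
  let ?\<A> = "{J. is_ideal J \<and> I \<subseteq> J \<and> J \<inter> M = {}}"
  have "\<exists>P\<in>?\<A>. \<forall>Z\<in>?\<A>. P \<subseteq> Z \<longrightarrow> Z = P"
  proof (rule subset_Zorn_nonempty)
    show "?\<A> \<noteq> {}" using I dis by auto
    fix \<C> assume ne: "\<C> \<noteq> {}" and ch: "subset.chain ?\<A> \<C>"
    have sub: "\<C> \<subseteq> ?\<A>" and tot: "\<And>Z Y. Z \<in> \<C> \<Longrightarrow> Y \<in> \<C> \<Longrightarrow> Z \<subseteq> Y \<or> Y \<subseteq> Z"
      using ch unfolding subset_chain_def by blast+
    have "is_ideal (\<Union>\<C>)"
      unfolding is_ideal_def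
    proof (intro conjI ballI)
      show "\<Union>\<C> \<subseteq> C" using sub by (auto simp: is_ideal_def)
      show "0 \<in> \<Union>\<C>" using sub ne by (auto simp: is_ideal_def)
      fix a assume "a \<in> \<Union>\<C>"
      then obtain Z where Z: "Z \<in> \<C>" "a \<in> Z" by auto
      { fix b assume "b \<in> \<Union>\<C>"
        then obtain Y where Y: "Y \<in> \<C>" "b \<in> Y" by auto
        from tot[OF Z(1) Y(1)] show "a + b \<in> \<Union>\<C>"
        proof
          assume "Z \<subseteq> Y"
          then have "a + b \<in> Y" using Z Y sub ideal_add[of Y a b] by auto
          then show ?thesis using Y by auto
        next
          assume "Y \<subseteq> Z"
          then have "a + b \<in> Z" using Z Y sub ideal_add[of Z a b] by auto
          then show ?thesis using Z by auto
        qed }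
      { fix c assume "c \<in> C"
        then have "c * a \<in> Z" using Z sub ideal_mult(1)[of Z a c] by auto
        then show "c * a \<in> \<Union>\<C>" using Z by auto }
    qed
    then show "\<Union>\<C> \<in> ?\<A>" using sub ne by blast
  qed
  then obtain P where P0: "P \<in> ?\<A>" "\<forall>Z\<in>?\<A>. P \<subseteq> Z \<longrightarrow> Z = P" by (elim bexE)
  have P: "is_ideal P" "I \<subseteq> P" "P \<inter> M = {}" using P0(1) by simp_all
  have max: "Z = P" if "is_ideal Z" "I \<subseteq> Z" "Z \<inter> M = {}" "P \<subseteq> Z" for Z
    using bspec[OF P0(2), of Z] that by simp
  \<comment> \<open>By maximality, the ideal generated by \<open>P\<close> and \<open>a\<close>
    meets \<open>M\<close>.\<close>
  have key: "\<exists>c\<in>C. \<exists>p\<in>P. p + c * a \<in> M" if a: "a \<in> C" "a \<notin> P" for a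
  proof (rule ccontr)
    assume neg: "\<not> (\<exists>c\<in>C. \<exists>p\<in>P. p + c * a \<in> M)"
    let ?Z = "{p + c * a | p c. p \<in> P \<and> c \<in> C}"
    have PC: "P \<subseteq> C" using P(1) by (simp add: is_ideal_def)
    have P0: "0 \<in> P" using P(1) by (simp add: is_ideal_def)
    have "is_ideal ?Z"
      unfolding is_ideal_def
    proof (intro conjI ballI)
      show "?Z \<subseteq> C" using PC a by (auto intro!: C_add C_mult)
      show "0 \<in> ?Z" using P0 C_0 by (intro CollectI exI[of _ 0]) auto
      fix z1 assume "z1 \<in> ?Z"
      then obtain p1 c1 where z1: "z1 = p1 + c1 * a" "p1 \<in> P" "c1 \<in> C" by auto
      { fix z2 assume "z2 \<in> ?Z"
        then obtain p2 c2 where z2: "z2 = p2 + c2 * a" "p2 \<in> P" "c2 \<in> C" by auto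
        have "z1 + z2 = (p1 + p2) + (c1 + c2) * a" by (simp add: z1 z2 algebra_simps)
        then show "z1 + z2 \<in> ?Z" using z1 z2 ideal_add[OF P(1)] C_add by blast }
      { fix c assume c: "c \<in> C"
        have "c * z1 = c * p1 + (c * c1) * a" by (simp add: z1 algebra_simps)
        then show "c * z1 \<in> ?Z" using z1 c ideal_mult(1)[OF P(1)] C_mult by blast }
    qed
    moreover have sub: "P \<subseteq> ?Z"
    proof
      fix p assume "p \<in> P"
      then show "p \<in> ?Z" using C_0 by (intro CollectI exI[of _ p] exI[of _ 0]) auto
    qed
    moreover have "?Z \<inter> M = {}" using neg by blast
    ultimately have "?Z = P" using P(2) by (intro max) auto
    moreover have "a \<in> ?Z" using P0 C_1 by (intro CollectI exI[of _ 0] exI[of _ 1]) auto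
    ultimately show False using a by simp
  qed
  have "is_prime P"
    unfolding is_prime_def
  proof (intro conjI ballI impI)
    show "is_ideal P" by fact
    show "1 \<notin> P" using P(3) M(2) by auto
    fix a b assume ab: "a \<in> C" "b \<in> C" "a * b \<in> P"
    show "a \<in> P \<or> b \<in> P"
    proof (rule ccontr)
      assume "\<not> (a \<in> P \<or> b \<in> P)"
      then obtain c p c' p' where c: "c \<in> C" "p \<in> P" "p + c * a \<in> M" "c' \<in> C" "p' \<in> P" "p' + c' * b \<in> M"
        using key ab by metis
      have "(p + c * a) * (p' + c' * b) = (p' + c' * b) * p + (c * a) * p' + (c * c') * (a * b)"
        by (simp add: algebra_simps)
      moreover have "p' + c' * b \<in> C" "c * a \<in> C" "c * c' \<in> C"
        using c ab M(1) by (auto intro: C_mult)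
      ultimately have "(p + c * a) * (p' + c' * b) \<in> P"
        using c(2,5) ab(3) by (auto intro!: ideal_add[OF P(1)] ideal_mult(1)[OF P(1)])
      then show False using P(3) M(3)[OF c(3,6)] by auto
    qed
  qed
  then show ?thesis using P by blast
qed

end

lemma csubring_UNIV: "csubring UNIV" by unfold_locales auto

lemma csubring_polys_in: "csubring (polys_in S)"
proof
  show "1 \<in> polys_in S" by (simp add: polys_in_def)
  fix a b :: "'k::field cpoly" assume a: "a \<in> polys_in S"
  show "- a \<in> polys_in S" using a by (simp add: polys_in_def in_keys_iff)
  assume b: "b \<in> polys_in S"
  show "a + b \<in> polys_in S" using a b keys_add[of a b] by (auto simp: polys_in_def)
  show "a * b \<in> polys_in S"
    unfolding polys_in_def
  proof (intro CollectI ballI)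
    fix m assume "m \<in> Poly_Mapping.keys (a * b)"
    then obtain m1 m2 where m: "m = m1 + m2" "m1 \<in> Poly_Mapping.keys a" "m2 \<in> Poly_Mapping.keys b"
      using keys_mult[of a b] by auto
    then show "Poly_Mapping.keys m \<subseteq> S" using a b keys_add[of m1 m2] unfolding polys_in_def by blast
  qed
qed

lemma poly_ring_eq: "poly_ring S = type_ring\<lparr>carrier := polys_in S\<rparr>"
  by (simp add: poly_ring_def polys_in_def)

lemma const_in_polys_in [simp]: "const c \<in> polys_in S"
  by (simp add: const_def polys_in_def)

lemma pvar_in_polys_in [simp]: "v \<in> S \<Longrightarrow> pvar v \<in> polys_in S"
  by (simp add: pvar_def polys_in_def)

lemma polys_in_mono: "S \<subseteq> T \<Longrightarrow> polys_in S \<subseteq> polys_in T"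
  by (auto simp: polys_in_def)

lemma poly_eval_closed:
  assumes "csubring C" "\<And>c. h c \<in> C" "\<And>v. v \<in> S \<Longrightarrow> y v \<in> C" "f \<in> polys_in S"
  shows "poly_eval h y f \<in> C"
proof -
  interpret csubring C by fact
  show ?thesis unfolding poly_eval_def
    using assms(2-4) by (intro C_sum C_mult C_prod C_power) (auto simp: polys_in_def)
qed

lemma poly_eval_cong_polys_in:
  "f \<in> polys_in S \<Longrightarrow> (\<And>v. v \<in> S \<Longrightarrow> y v = y' v) \<Longrightarrow> poly_eval h y f = poly_eval h y' f"
  by (rule poly_eval_cong) (auto simp: polys_in_def)

lemma hom_preimage_ideal:
  assumes "comm_ring_hom \<phi>" "csubring C" "csubring D" "\<phi> ` C \<subseteq> D" "csubring.is_ideal D J"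
  shows "csubring.is_ideal C {f \<in> C. \<phi> f \<in> J}"
proof -
  interpret \<phi>: comm_ring_hom \<phi> by fact
  interpret C: csubring C by fact
  interpret D: csubring D by fact
  show ?thesis
    unfolding C.is_ideal_def using assms(4,5) D.ideal_mult(1)[OF assms(5)]
    by (auto simp: C.C_0 C.C_add C.C_mult \<phi>.hom_add \<phi>.hom_mult D.ideal_add image_subset_iff D.is_ideal_def)
qed

lemma hom_preimage_prime:
  assumes "comm_ring_hom \<phi>" "csubring C" "csubring D" "\<phi> ` C \<subseteq> D" "csubring.is_prime D J"
  shows "csubring.is_prime C {f \<in> C. \<phi> f \<in> J}"
proof -
  interpret \<phi>: comm_ring_hom \<phi> by fact
  interpret C: csubring C by fact
  interpret D: csubring D by fact
  have "C.is_ideal {f \<in> C. \<phi> f \<in> J}"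
    using assms by (intro hom_preimage_ideal[of _ C D]) (auto simp: D.is_prime_def)
  then show ?thesis
    using assms(4,5) unfolding C.is_prime_def D.is_prime_def
    by (auto simp: \<phi>.hom_mult image_subset_iff)
qed

lemma zero_ideal_UNIV: "csubring.is_ideal UNIV {0}"
proof -
  interpret csubring "UNIV :: 'a::comm_ring_1 set" by (rule csubring_UNIV)
  show "is_ideal {0}" by (simp add: is_ideal_def)
qed

lemma zero_prime_UNIV: "csubring.is_prime UNIV {0 :: 'a::idom}"
proof -
  interpret csubring "UNIV :: 'a::idom set" by (rule csubring_UNIV)
  show "is_prime {0}" by (simp add: is_prime_def is_ideal_def)
qed

text \<open>Used modulo the power series divisible by t^2, to replace a formal curve by its
  first-order part.\<close>

lemma poly_eval_cong_mod:
  assumes "comm_ring_hom h" "csubring.is_ideal UNIV J" "\<And>v. v \<in> S \<Longrightarrow> y v - y' v \<in> J" "f \<in> polys_in S"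
  shows "poly_eval h y f - poly_eval h y' f \<in> J"
proof -
  interpret h: comm_ring_hom h by fact
  interpret U: csubring "UNIV :: 'b set" by (rule csubring_UNIV)
  note J = assms(2)
  have mult: "a * b - a' * b' \<in> J" if "a - a' \<in> J" "b - b' \<in> J" for a b a' b'
  proof -
    have "a * b - a' * b' = b * (a - a') + a' * (b - b')" by (simp add: algebra_simps)
    then show ?thesis using that by (auto intro!: U.ideal_add[OF J] U.ideal_mult(1)[OF J])
  qed
  have z: "0 \<in> J" using J by (simp add: U.is_ideal_def)
  have pow: "a ^ k - a' ^ k \<in> J" if "a - a' \<in> J" for a a' and k :: nat
    by (induction k) (auto simp: z that intro!: mult)
  have prd: "prod F A - prod F' A \<in> J" if "\<And>i. i \<in> A \<Longrightarrow> F i - F' i \<in> J" for F F' and A :: "coord set"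
    using that by (induction A rule: infinite_finite_induct) (auto simp: z intro!: mult)
  have "poly_eval h y f - poly_eval h y' f
    = (\<Sum>m\<in>Poly_Mapping.keys f. h (Poly_Mapping.lookup f m) * monom_val y m - h (Poly_Mapping.lookup f m) * monom_val y' m)"
    by (simp add: poly_eval_def monom_val_def sum_subtractf)
  also have "\<dots> \<in> J"
    using assms(3,4) unfolding monom_val_def polys_in_def
    by (intro U.ideal_sum[OF J] mult prd pow) (auto simp: z)
  finally show ?thesis .
qed

section \<open>The Nullstellensatz\<close>

definition coeffs_in :: "'r::comm_ring_1 set \<Rightarrow> 'r poly set" where
  "coeffs_in B = {q. \<forall>i. Polynomial.coeff q i \<in> B}"

context csubring
begin

lemma coeffs_in_0: "0 \<in> coeffs_in C" by (simp add: coeffs_in_def C_0)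
lemma coeffs_in_add: "p \<in> coeffs_in C \<Longrightarrow> q \<in> coeffs_in C \<Longrightarrow> p + q \<in> coeffs_in C" by (simp add: coeffs_in_def C_add)
lemma coeffs_in_diff: "p \<in> coeffs_in C \<Longrightarrow> q \<in> coeffs_in C \<Longrightarrow> p - q \<in> coeffs_in C" by (simp add: coeffs_in_def C_diff)
lemma coeffs_in_smult: "c \<in> C \<Longrightarrow> q \<in> coeffs_in C \<Longrightarrow> Polynomial.smult c q \<in> coeffs_in C" by (simp add: coeffs_in_def C_mult)
lemma coeffs_in_mult: "p \<in> coeffs_in C \<Longrightarrow> q \<in> coeffs_in C \<Longrightarrow> p * q \<in> coeffs_in C"
  by (auto simp: coeffs_in_def coeff_mult intro!: C_sum C_mult)
lemma coeffs_in_monom: "c \<in> C \<Longrightarrow> Polynomial.monom c k \<in> coeffs_in C" by (simp add: coeffs_in_def C_0)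
lemma coeffs_in_pCons: "pCons c p \<in> coeffs_in C \<longleftrightarrow> c \<in> C \<and> p \<in> coeffs_in C"
  by (auto simp: coeffs_in_def coeff_pCons split: nat.splits)

text \<open>Leading coefficients need not be invertible in \<open>C\<close>, so the dividend is
  scaled by their powers. The degree bound on \<open>s\<close> matters in
  \<open>adjoin_generator\<close>.\<close>

lemma pseudo_division:
  assumes q: "q \<in> coeffs_in C" "degree q \<noteq> 0" and g: "g \<in> coeffs_in C"
  shows "\<exists>N. \<exists>s\<in>coeffs_in C. \<exists>r\<in>coeffs_in C. Polynomial.smult (lead_coeff q ^ N) g = q * s + r \<and>
    degree r < degree q \<and> degree s \<le> degree g - degree q"
  using g
proof (induction "degree g" arbitrary: g rule: less_induct)
  case less
  show ?case
  proof (cases "degree g < degree q")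
    case True
    then show ?thesis using less.prems coeffs_in_0
      by (intro exI[of _ 0] bexI[of _ 0] bexI[of _ g]) auto
  next
    case False
    let ?a = "lead_coeff q" and ?b = "lead_coeff g" and ?k = "degree g - degree q"
    define g' where "g' = Polynomial.smult ?a g - Polynomial.monom ?b ?k * q"
    have aC: "?a \<in> C" "?b \<in> C" using q less.prems by (auto simp: coeffs_in_def)
    have g'C: "g' \<in> coeffs_in C" unfolding g'_def using less.prems q aC
      by (intro coeffs_in_diff coeffs_in_smult coeffs_in_mult coeffs_in_monom)
    have le: "degree g' \<le> degree g"
    proof -
      have "degree (Polynomial.monom ?b ?k * q) \<le> ?k + degree q"
        by (rule order_trans[OF degree_mult_le]) (simp add: degree_monom_le)
      then show ?thesis unfolding g'_def using False degree_smult_le[of ?a g]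
        by (intro degree_diff_le) auto
    qed
    have "Polynomial.coeff g' (degree g) = 0"
      using False by (simp add: g'_def coeff_monom_mult)
    then have lt: "degree g' < degree g"
      using le False q(2) by (metis leading_coeff_0_iff degree_0 le_less not_gr0 not_le le_zero_eq)
    obtain N s r where IH: "s \<in> coeffs_in C" "r \<in> coeffs_in C" "Polynomial.smult (?a ^ N) g' = q * s + r"
      "degree r < degree q" "degree s \<le> degree g' - degree q"
      using less.hyps[OF lt g'C] by blast
    let ?s = "s + Polynomial.monom (?a ^ N * ?b) ?k"
    have "Polynomial.smult (?a ^ Suc N) g = Polynomial.smult (?a ^ N) g' + Polynomial.smult (?a ^ N) (Polynomial.monom ?b ?k * q)"
      unfolding g'_def by (simp add: smult_diff_right mult.commute)
    also have "Polynomial.smult (?a ^ N) (Polynomial.monom ?b ?k * q) = Polynomial.monom (?a ^ N * ?b) ?k * q"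
      by (simp add: smult_monom mult_smult_left[symmetric])
    finally have "Polynomial.smult (?a ^ Suc N) g = q * ?s + r"
      unfolding IH(3) by (simp add: algebra_simps)
    moreover have "?s \<in> coeffs_in C" using IH(1) aC by (intro coeffs_in_add coeffs_in_monom C_mult C_power)
    moreover have "degree ?s \<le> ?k"
      using IH(5) lt by (intro degree_add_le degree_monom_le) auto
    ultimately show ?thesis using IH(2,4) by blast
  qed
qed

text \<open>Cutting \<open>g\<close> off above its highest coefficient outside \<open>P\<close>
  changes it only modulo \<open>P\<close> and makes the leading coefficient nonzero there.\<close>

lemma strip_leading:
  assumes D: "is_ideal P" "g \<in> coeffs_in C" and i: "Polynomial.coeff g i \<notin> P"
  shows "\<exists>g'\<in>coeffs_in C. lead_coeff g' \<notin> P \<and> degree g' \<le> degree g \<and> (\<forall>j. Polynomial.coeff (g - g') j \<in> P)"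
proof -
  have P0: "0 \<in> P" using D(1) by (simp add: is_ideal_def)
  define i0 where "i0 = (GREATEST i. Polynomial.coeff g i \<notin> P)"
  have bound: "\<And>i. Polynomial.coeff g i \<notin> P \<Longrightarrow> i \<le> degree g" using P0 by (metis le_degree)
  have i0: "Polynomial.coeff g i0 \<notin> P" unfolding i0_def
    by (rule GreatestI_nat[of _ i "degree g"]) (use i bound in auto)
  have above: "Polynomial.coeff g j \<in> P" if "j > i0" for j
  proof (rule ccontr)
    assume "Polynomial.coeff g j \<notin> P"
    then have "j \<le> i0" unfolding i0_def by (intro Greatest_le_nat[of _ _ "degree g"]) (use bound in auto)
    then show False using that by simp
  qed
  define g' where "g' = poly_cutoff (Suc i0) g"
  have cg': "Polynomial.coeff g' j = (if j \<le> i0 then Polynomial.coeff g j else 0)" for j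
    by (simp add: g'_def coeff_poly_cutoff)
  have "Polynomial.coeff g i0 \<noteq> 0" using i0 P0 by auto
  then have dg': "degree g' = i0"
    by (intro antisym degree_le le_degree) (auto simp: cg')
  have "g' \<in> coeffs_in C" using D(2) C_0 by (auto simp: coeffs_in_def cg')
  moreover have "lead_coeff g' \<notin> P" using i0 by (simp add: dg' cg')
  moreover have "degree g' \<le> degree g" using bound[OF i0] dg' by simp
  moreover have "Polynomial.coeff (g - g') j \<in> P" for j using above[of j] P0 by (simp add: cg')
  ultimately show ?thesis by blast
qed

end

text \<open>The step of the Nullstellensatz that adjoins one generator \<open>t\<close> to a subring \<open>B\<close>:
  either the prime \<open>P\<close> is extended from \<open>B\<close>, or a polynomial \<open>q\<close> of least degree whose leading
  coefficient is nonzero modulo \<open>P\<close> plays the role of a minimal polynomial.\<close>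

lemma adjoin_generator:
  fixes B D P :: "'r::comm_ring_1 set"
  assumes B: "csubring B" and D: "csubring D" and BD: "B \<subseteq> D"
    and evD: "\<And>q. q \<in> coeffs_in B \<Longrightarrow> Polynomial.poly q t \<in> D"
    and DB: "\<And>f. f \<in> D \<Longrightarrow> \<exists>q\<in>coeffs_in B. f = Polynomial.poly q t"
    and P: "csubring.is_prime D P" and f: "f \<in> D" "f \<notin> P"
  shows "(\<forall>q\<in>coeffs_in B. Polynomial.poly q t \<in> P \<longrightarrow> (\<forall>i. Polynomial.coeff q i \<in> P)) \<or>
    (\<exists>q\<in>coeffs_in B. \<exists>c\<in>B - P. \<exists>c1\<in>D. \<exists>p1\<in>P. Polynomial.poly q t \<in> P \<and> lead_coeff q \<notin> P \<and> degree q > 0 \<and> c = f * c1 + p1 \<and>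
      (\<forall>g\<in>coeffs_in B. Polynomial.poly g t \<in> P \<longrightarrow> (\<exists>N. \<exists>s\<in>coeffs_in B. \<exists>r\<in>coeffs_in B.
         Polynomial.smult (lead_coeff q ^ N) g = q * s + r \<and> (\<forall>i. Polynomial.coeff r i \<in> P))))"
proof -
  interpret B: csubring B by fact
  interpret D: csubring D by fact
  have Pid: "D.is_ideal P" and P1: "1 \<notin> P" and Pprime: "\<And>a b. a \<in> D \<Longrightarrow> b \<in> D \<Longrightarrow> a * b \<in> P \<Longrightarrow> a \<in> P \<or> b \<in> P"
    using P by (auto simp: D.is_prime_def)
  have P0: "0 \<in> P" and PD: "P \<subseteq> D" using Pid by (auto simp: D.is_ideal_def)
  have PBid: "B.is_ideal (P \<inter> B)"
    unfolding B.is_ideal_def using P0 B.C_0 BD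
    by (auto intro: D.ideal_add[OF Pid] B.C_add B.C_mult D.ideal_mult(1)[OF Pid])
  have tD: "t \<in> D" using evD[of "[:0, 1:]"] by (simp add: B.coeffs_in_pCons B.C_0 B.C_1 B.coeffs_in_0)
  have coefP: "Polynomial.poly g t \<in> P" if "\<And>i. Polynomial.coeff g i \<in> P" for g
    unfolding poly_altdef using that tD by (intro D.ideal_sum[OF Pid] D.ideal_mult(2)[OF Pid] D.C_power)
  have strip: "\<exists>g'\<in>coeffs_in B. lead_coeff g' \<notin> P \<and> degree g' \<le> degree g \<and> Polynomial.poly g t - Polynomial.poly g' t \<in> P"
    if g: "g \<in> coeffs_in B" "Polynomial.coeff g i \<notin> P" for g i
  proof -
    have "Polynomial.coeff g i \<notin> P \<inter> B" using g by simp
    then obtain g' where g': "g' \<in> coeffs_in B" "lead_coeff g' \<notin> P \<inter> B" "degree g' \<le> degree g"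
      "\<forall>j. Polynomial.coeff (g - g') j \<in> P \<inter> B"
      using B.strip_leading[OF PBid g(1)] by blast
    have "lead_coeff g' \<in> B" using g'(1) by (simp add: coeffs_in_def)
    moreover have "Polynomial.poly (g - g') t \<in> P" using g'(4) by (intro coefP) auto
    ultimately show ?thesis using g' by (intro bexI[of _ g']) auto
  qed
  show ?thesis (is "?ext \<or> ?goal")
  proof (cases ?ext)
    case False
    then obtain q0 i where q0: "q0 \<in> coeffs_in B" "Polynomial.poly q0 t \<in> P" "Polynomial.coeff q0 i \<notin> P" by blast
    let ?Q = "\<lambda>q. q \<in> coeffs_in B \<and> Polynomial.poly q t \<in> P \<and> lead_coeff q \<notin> P"
    obtain q1 where q1: "q1 \<in> coeffs_in B" "lead_coeff q1 \<notin> P" "Polynomial.poly q0 t - Polynomial.poly q1 t \<in> P"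
      using strip[OF q0(1,3)] by blast
    have "Polynomial.poly q0 t - (Polynomial.poly q0 t - Polynomial.poly q1 t) \<in> P"
      by (rule D.ideal_diff[OF Pid q0(2) q1(3)])
    then have "?Q q1" using q1 by simp
    then obtain q where q: "q \<in> coeffs_in B" "Polynomial.poly q t \<in> P" "lead_coeff q \<notin> P"
      and qmin: "\<And>q'. ?Q q' \<Longrightarrow> degree q \<le> degree q'"
      using ex_has_least_nat[of ?Q q1 degree] by blast
    have dq: "degree q > 0"
    proof (rule ccontr)
      assume "\<not> degree q > 0"
      then obtain a where "q = [:a:]" by (metis degree_eq_zeroE gr0I)
      then show False using q by simp
    qed
    \<comment> \<open>Otherwise stripping \<open>r\<close> would give a candidate of smaller degree
      than \<open>q\<close>.\<close>
    have K: "Polynomial.coeff r i \<in> P" if r: "r \<in> coeffs_in B" "Polynomial.poly r t \<in> P" "degree r < degree q" for r i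
    proof (rule ccontr)
      assume "Polynomial.coeff r i \<notin> P"
      then obtain r' where r': "r' \<in> coeffs_in B" "lead_coeff r' \<notin> P" "degree r' \<le> degree r" "Polynomial.poly r t - Polynomial.poly r' t \<in> P"
        using strip[OF r(1)] by blast
      have "Polynomial.poly r t - (Polynomial.poly r t - Polynomial.poly r' t) \<in> P"
        by (rule D.ideal_diff[OF Pid r(2) r'(4)])
      then have "degree q \<le> degree r'" using r' by (intro qmin) simp
      then show False using r'(3) r(3) by simp
    qed
    have div: "\<exists>N. \<exists>s\<in>coeffs_in B. \<exists>r\<in>coeffs_in B. Polynomial.smult (lead_coeff q ^ N) g = q * s + r \<and> (\<forall>i. Polynomial.coeff r i \<in> P)"
      if g: "g \<in> coeffs_in B" "Polynomial.poly g t \<in> P" for g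
    proof -
      obtain N s r where sr: "s \<in> coeffs_in B" "r \<in> coeffs_in B" "Polynomial.smult (lead_coeff q ^ N) g = q * s + r" "degree r < degree q"
        using B.pseudo_division[OF q(1) _ g(1)] dq by blast
      have "Polynomial.poly r t = lead_coeff q ^ N * Polynomial.poly g t - Polynomial.poly s t * Polynomial.poly q t"
        using arg_cong[OF sr(3), of "\<lambda>p. Polynomial.poly p t"] by (simp add: algebra_simps)
      moreover have "lead_coeff q ^ N \<in> D" using q(1) BD by (intro D.C_power) (auto simp: coeffs_in_def)
      ultimately have "Polynomial.poly r t \<in> P"
        using g(2) q(2) evD[OF sr(1)] by (auto intro!: D.ideal_diff[OF Pid] D.ideal_mult(1)[OF Pid])
      then have "\<forall>i. Polynomial.coeff r i \<in> P" using K sr by blast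
      then show ?thesis using sr by blast
    qed
    \<comment> \<open>Membership in the ideal generated by \<open>f\<close> and \<open>P\<close>. An
      element of \<open>B\<close> is sought in it that lies outside \<open>P\<close>: at a zero of
      \<open>P\<close> where this element does not vanish, neither does \<open>f\<close>.\<close>
    let ?F = "\<lambda>z. \<exists>c\<in>D. \<exists>p\<in>P. z = f * c + p"
    have F_mult: "?F (d * z)" if z: "?F z" and d: "d \<in> D" for d z
    proof -
      obtain c p where "c \<in> D" "p \<in> P" "z = f * c + p" using z by blast
      then have "d * z = f * (d * c) + d * p" by (simp add: algebra_simps)
      moreover have "d * c \<in> D" "d * p \<in> P"
        using d \<open>c \<in> D\<close> \<open>p \<in> P\<close> by (auto intro: D.C_mult D.ideal_mult(1)[OF Pid])
      ultimately show ?thesis by blast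
    qed
    have F_diff: "?F (z - z')" if z: "?F z" "?F z'" for z z'
    proof -
      obtain c p c' p' where *: "c \<in> D" "p \<in> P" "z = f * c + p" "c' \<in> D" "p' \<in> P" "z' = f * c' + p'" using z by blast
      then have "z - z' = f * (c - c') + (p - p')" "c - c' \<in> D" "p - p' \<in> P"
        using D.C_diff D.ideal_diff[OF Pid] by (auto simp: algebra_simps)
      then show ?thesis by blast
    qed
    have F_P: "?F p" if "p \<in> P" for p using that D.C_0 by (intro bexI[of _ 0] bexI[of _ p]) auto
    let ?M = "\<lambda>g. g \<in> coeffs_in B \<and> ?F (Polynomial.poly g t) \<and> Polynomial.poly g t \<notin> P \<and> lead_coeff g \<notin> P"
    have toM: "\<exists>g'. ?M g' \<and> degree g' \<le> degree g" if g: "g \<in> coeffs_in B" "?F (Polynomial.poly g t)" "Polynomial.poly g t \<notin> P" for g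
    proof -
      obtain i where "Polynomial.coeff g i \<notin> P" using coefP g(3) by blast
      then obtain g' where g': "g' \<in> coeffs_in B" "lead_coeff g' \<notin> P" "degree g' \<le> degree g" "Polynomial.poly g t - Polynomial.poly g' t \<in> P"
        using strip[OF g(1)] by blast
      have "?F (Polynomial.poly g t - (Polynomial.poly g t - Polynomial.poly g' t))"
        by (rule F_diff[OF g(2) F_P[OF g'(4)]])
      moreover have "Polynomial.poly g' t \<notin> P"
        using D.ideal_add[OF Pid _ g'(4), of "Polynomial.poly g' t"] g(3) by auto
      ultimately show ?thesis using g' by (intro exI[of _ g']) simp
    qed
    obtain gf where gf: "gf \<in> coeffs_in B" "f = Polynomial.poly gf t" using DB[OF f(1)] by blast
    have "?F f" using D.C_1 P0 by (intro bexI[of _ 1] bexI[of _ 0]) auto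
    then obtain g0 where "?M g0" using toM[OF gf(1)] gf(2) f(2) by blast
    then obtain g where g: "?M g" and gmin: "\<And>g'. ?M g' \<Longrightarrow> degree g \<le> degree g'"
      using ex_has_least_nat[of ?M g0 degree] by blast
    have small: "Polynomial.poly r t \<in> P" if "r \<in> coeffs_in B" "?F (Polynomial.poly r t)" "degree r < degree g" for r
      using toM[OF that(1,2)] gmin that(3) by fastforce
    \<comment> \<open>If not, divide \<open>q\<close> by \<open>g\<close>. By minimality of
      \<open>g\<close> the remainder vanishes at \<open>t\<close> modulo \<open>P\<close>, hence so
      does the quotient \<open>s\<close>. Both have smaller degree than \<open>q\<close>, so their
      coefficients lie in \<open>P\<close>, against the leading coefficient of
      \<open>q\<close>.\<close>
    have "degree g = 0"
    proof (rule ccontr)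
      assume dg: "degree g \<noteq> 0"
      \<comment> \<open>Otherwise the remainder of \<open>g\<close> by \<open>q\<close> has smaller
        degree than \<open>g\<close> and vanishes at \<open>t\<close> modulo \<open>P\<close>, which
        would put the value of \<open>g\<close> at \<open>t\<close> into \<open>P\<close>.\<close>
      have lt: "degree g < degree q"
      proof (rule ccontr)
        assume ge: "\<not> degree g < degree q"
        obtain N s r where sr: "s \<in> coeffs_in B" "r \<in> coeffs_in B" "Polynomial.smult (lead_coeff q ^ N) g = q * s + r" "degree r < degree q"
          using B.pseudo_division[OF q(1) _ conjunct1[OF g]] dq by blast
        have r: "Polynomial.poly r t = lead_coeff q ^ N * Polynomial.poly g t - Polynomial.poly s t * Polynomial.poly q t"
          using arg_cong[OF sr(3), of "\<lambda>p. Polynomial.poly p t"] by (simp add: algebra_simps)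
        have aD: "lead_coeff q ^ N \<in> D" "lead_coeff q \<in> D" using q(1) BD by (auto simp: coeffs_in_def intro!: D.C_power)
        have "?F (Polynomial.poly r t)"
          unfolding r using g aD evD[OF sr(1)] F_P[OF q(2)] by (intro F_diff F_mult) auto
        then have rP: "Polynomial.poly r t \<in> P" using sr ge by (intro small) auto
        have "lead_coeff q ^ N * Polynomial.poly g t = Polynomial.poly r t + Polynomial.poly s t * Polynomial.poly q t"
          using r by simp
        also have "\<dots> \<in> P" using rP evD[OF sr(1)] q(2) by (intro D.ideal_add[OF Pid] D.ideal_mult(1)[OF Pid])
        finally have "lead_coeff q ^ N \<in> P \<or> Polynomial.poly g t \<in> P" using g by (intro Pprime aD evD) auto
        then show False using D.prime_power[OF P aD(2)] q(3) g by blast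
      qed
      obtain N s r where sr: "s \<in> coeffs_in B" "r \<in> coeffs_in B" "Polynomial.smult (lead_coeff g ^ N) q = g * s + r" "degree r < degree g"
        "degree s \<le> degree q - degree g"
        using B.pseudo_division[OF conjunct1[OF g] dg q(1)] by blast
      have r: "Polynomial.poly r t = lead_coeff g ^ N * Polynomial.poly q t - Polynomial.poly s t * Polynomial.poly g t"
        using arg_cong[OF sr(3), of "\<lambda>p. Polynomial.poly p t"] by (simp add: algebra_simps)
      have bD: "lead_coeff g ^ N \<in> D" "lead_coeff g \<in> D" using g BD by (auto simp: coeffs_in_def intro!: D.C_power)
      have "?F (Polynomial.poly r t)"
        unfolding r using g bD evD[OF sr(1)] F_P[OF q(2)] by (intro F_diff F_mult) auto
      then have rP: "Polynomial.poly r t \<in> P" using sr by (intro small) auto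
      have "Polynomial.poly s t * Polynomial.poly g t = lead_coeff g ^ N * Polynomial.poly q t - Polynomial.poly r t"
        using r by simp
      also have "\<dots> \<in> P" using rP bD q(2) by (intro D.ideal_diff[OF Pid] D.ideal_mult(1)[OF Pid])
      finally have "Polynomial.poly s t \<in> P" using g evD sr(1) Pprime by blast
      then have sP: "\<And>i. Polynomial.coeff s i \<in> P" using sr(5) dg lt by (intro K sr(1)) auto
      have rP': "\<And>i. Polynomial.coeff r i \<in> P" using rP sr lt by (intro K) auto
      have "lead_coeff g ^ N * lead_coeff q = Polynomial.coeff (g * s + r) (degree q)"
        unfolding sr(3)[symmetric] by simp
      also have "\<dots> \<in> P"
        unfolding coeff_add coeff_mult using g sP rP' BD
        by (intro D.ideal_add[OF Pid] D.ideal_sum[OF Pid] D.ideal_mult(1)[OF Pid]) (auto simp: coeffs_in_def)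
      finally have "lead_coeff g ^ N \<in> P \<or> lead_coeff q \<in> P"
        using bD q(1) BD by (intro Pprime) (auto simp: coeffs_in_def)
      then show False using D.prime_power[OF P bD(2)] q(3) g by blast
    qed
    then obtain c where c: "g = [:c:]" by (metis degree_eq_zeroE)
    then have "c \<in> B - P" "?F c" using g by (auto simp: B.coeffs_in_pCons)
    then have ?goal using q dq div by blast
    then show ?thesis ..
  qed blast
qed

section \<open>Extending a geometric point one variable at a time\<close>

lemma to_ac_hom: "comm_ring_hom (to_ac :: 'k::field \<Rightarrow> 'k alg_closure)"
  by unfold_locales simp_all

lemma pvar_power: "pvar v ^ k = (Poly_Mapping.single (Poly_Mapping.single v k) 1 :: 'k::comm_ring_1 cpoly)"
proof (induction k)
  case (Suc k)
  have "Poly_Mapping.single v (Suc k) = Poly_Mapping.single v 1 + Poly_Mapping.single v k"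
    by (simp add: single_add[symmetric])
  then show ?case unfolding power_Suc Suc by (simp add: pvar_def mult_single)
qed simp

lemma polys_in_insert_poly:
  assumes "f \<in> polys_in (insert v T)"
  shows "\<exists>q\<in>coeffs_in (polys_in T). f = Polynomial.poly q (pvar v)"
proof -
  interpret csubring "polys_in T :: 'a cpoly set" by (rule csubring_polys_in)
  define m' where "m' m = Poly_Mapping.update v 0 m" for m :: "coord \<Rightarrow>\<^sub>0 nat"
  define q where "q = (\<Sum>m\<in>Poly_Mapping.keys f.
    Polynomial.monom (Poly_Mapping.single (m' m) (Poly_Mapping.lookup f m)) (Poly_Mapping.lookup m v))"
  have m: "m = m' m + Poly_Mapping.single v (Poly_Mapping.lookup m v)" for m
    by (rule poly_mapping_eqI) (simp add: m'_def lookup_add lookup_update lookup_single when_def)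
  have "Poly_Mapping.single (m' m) c \<in> polys_in T" if "m \<in> Poly_Mapping.keys f" for m and c :: 'a
    using that assms by (auto simp: polys_in_def m'_def keys_update split: if_splits)
  then have "q \<in> coeffs_in (polys_in T)" unfolding q_def coeffs_in_def
    by (auto simp: coeff_sum C_0 intro!: C_sum)
  moreover have "Polynomial.poly q (pvar v) = f"
  proof -
    have "Polynomial.poly q (pvar v) = (\<Sum>m\<in>Poly_Mapping.keys f. Poly_Mapping.single m (Poly_Mapping.lookup f m))"
      unfolding q_def poly_sum poly_monom pvar_power mult_single m[symmetric] by simp
    then show ?thesis by (simp add: cpoly_expand[symmetric])
  qed
  ultimately show ?thesis by blast
qed

lemma exists_nonroot:
  fixes a :: "nat \<Rightarrow> 'r::field_char_0"
  assumes "j \<le> d" "a j \<noteq> 0"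
  shows "\<exists>\<tau>. (\<Sum>i\<le>d. a i * \<tau> ^ i) \<noteq> 0"
proof -
  let ?p = "\<Sum>i\<le>d. Polynomial.monom (a i) i"
  have "Polynomial.coeff ?p j = a j" using assms(1) by (simp add: coeff_sum if_distrib cong: if_cong)
  then have "?p \<noteq> 0" using assms(2) by auto
  then have "finite {\<tau>. Polynomial.poly ?p \<tau> = 0}" by (rule poly_roots_finite)
  then obtain \<tau> where "Polynomial.poly ?p \<tau> \<noteq> 0" using ex_new_if_finite[OF infinite_UNIV_char_0] by blast
  then show ?thesis by (auto simp: poly_sum poly_monom)
qed

text \<open>Induction on the set of variables. The claim is made for every \<open>f\<close> outside
  \<open>P\<close>, since each extension by a coordinate prescribes its own polynomial in the
  previous variables that must not vanish.\<close>

theorem nullstellensatz: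
  fixes P :: "'k::field_char_0 cpoly set"
  assumes S: "finite S" and P: "csubring.is_prime (polys_in S) P" and f: "f \<in> polys_in S" "f \<notin> P"
  shows "\<exists>y :: coord \<Rightarrow> 'k alg_closure. (\<forall>p\<in>P. poly_eval to_ac y p = 0) \<and> poly_eval to_ac y f \<noteq> 0"
proof -
  interpret h: comm_ring_hom "to_ac :: 'k \<Rightarrow> 'k alg_closure" by (rule to_ac_hom)
  let ?ev = "poly_eval (to_ac :: 'k \<Rightarrow> 'k alg_closure)"
  interpret R: csubring "polys_in S :: 'k cpoly set" by (rule csubring_polys_in)
  have Pid: "R.is_ideal P" and P1: "1 \<notin> P" and PS': "P \<subseteq> polys_in S"
    and Pprime: "\<And>a b. a \<in> polys_in S \<Longrightarrow> b \<in> polys_in S \<Longrightarrow> a * b \<in> P \<Longrightarrow> a \<in> P \<or> b \<in> P"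
    using P by (auto simp: R.is_prime_def R.is_ideal_def)
  have main: "\<forall>f\<in>polys_in T - P. \<exists>y. (\<forall>p\<in>P \<inter> polys_in T. ?ev y p = 0) \<and> ?ev y f \<noteq> 0" if "finite T" "T \<subseteq> S" for T
    using that
  proof (induction T rule: finite_induct)
    case empty
    have const: "\<exists>c. g = const c" if "g \<in> polys_in {}" for g :: "'k cpoly"
    proof -
      have "Poly_Mapping.keys g \<subseteq> {0}" using that by (auto simp: polys_in_def)
      then have "g = Poly_Mapping.single 0 (Poly_Mapping.lookup g 0)"
        by (intro poly_mapping_eqI) (auto simp: lookup_single when_def in_keys_iff)
      then show ?thesis unfolding const_def by blast
    qed
    have c0: "c = 0" if "const c \<in> P" for c :: 'k
    proof (rule ccontr)
      assume "c \<noteq> 0"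
      then have "const (inverse c) * const c = (1 :: 'k cpoly)" by (simp add: const_def mult_single)
      then show False using R.ideal_mult(1)[OF Pid that, of "const (inverse c)"] P1 by simp
    qed
    have "0 \<in> P" using Pid by (simp add: R.is_ideal_def)
    then have c1: "const 0 \<in> P" by (simp add: const_def)
    show ?case
    proof
      fix g assume g: "g \<in> polys_in {} - P"
      then obtain c where c: "g = const c" using const by blast
      then have "c \<noteq> 0" using g c1 by auto
      moreover have "?ev y p = 0" if p: "p \<in> P \<inter> polys_in {}" for y p
      proof -
        obtain d where d: "p = const d" using const p by blast
        then have "d = 0" using c0 p by simp
        then show ?thesis by (simp add: d)
      qed
      ultimately show "\<exists>y. (\<forall>p\<in>P \<inter> polys_in {}. ?ev y p = 0) \<and> ?ev y g \<noteq> 0"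
        by (auto simp: c)
    qed
  next
    case (insert v T)
    let ?B = "polys_in T :: 'k cpoly set" and ?D = "polys_in (insert v T) :: 'k cpoly set"
    interpret B: csubring ?B by (rule csubring_polys_in)
    interpret D: csubring ?D by (rule csubring_polys_in)
    have BD: "?B \<subseteq> ?D" "?D \<subseteq> polys_in S" using insert.prems by (auto intro!: polys_in_mono)
    have evD: "Polynomial.poly q (pvar v) \<in> ?D" if "q \<in> coeffs_in ?B" for q
      unfolding poly_altdef using that BD(1) by (intro D.C_sum D.C_mult D.C_power) (auto simp: coeffs_in_def)
    have P': "D.is_prime (P \<inter> ?D)"
      unfolding D.is_prime_def D.is_ideal_def
    proof (intro conjI ballI impI)
      show "0 \<in> P \<inter> ?D" using Pid D.C_0 by (simp add: R.is_ideal_def)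
      show "1 \<notin> P \<inter> ?D" using P1 by simp
      fix a b assume "a \<in> P \<inter> ?D" "b \<in> P \<inter> ?D"
      then show "a + b \<in> P \<inter> ?D" by (simp add: R.ideal_add[OF Pid] D.C_add)
    next
      fix a c assume "a \<in> P \<inter> ?D" "c \<in> ?D"
      then show "c * a \<in> P \<inter> ?D" using BD(2) R.ideal_mult(1)[OF Pid, of a c] by (auto simp: D.C_mult)
    next
      fix a b assume "a \<in> ?D" "b \<in> ?D" "a * b \<in> P \<inter> ?D"
      then show "a \<in> P \<inter> ?D \<or> b \<in> P \<inter> ?D" using Pprime[of a b] BD(2) by auto
    qed simp
    show ?case
    proof
      fix f assume f: "f \<in> ?D - P"
      define ext where "ext y \<tau> = (\<lambda>w. if w = v then \<tau> else y w)" for y :: "coord \<Rightarrow> 'k alg_closure" and \<tau>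
      have ev_ext: "?ev (ext y \<tau>) (Polynomial.poly q (pvar v)) = (\<Sum>i\<le>degree q. ?ev y (Polynomial.coeff q i) * \<tau> ^ i)"
        if "q \<in> coeffs_in ?B" for q y \<tau>
      proof -
        interpret E: comm_ring_hom "?ev (ext y \<tau>)" by (rule h.poly_eval_hom)
        have "?ev (ext y \<tau>) (Polynomial.coeff q i) = ?ev y (Polynomial.coeff q i)" for i
          using that insert.hyps(2) by (intro poly_eval_cong_polys_in[of _ T]) (auto simp: coeffs_in_def ext_def)
        then show ?thesis
          unfolding poly_altdef E.hom_sum E.hom_mult E.hom_power by (simp add: ext_def)
      qed
      consider (gen) "\<forall>q\<in>coeffs_in ?B. Polynomial.poly q (pvar v) \<in> P \<inter> ?D \<longrightarrow> (\<forall>i. Polynomial.coeff q i \<in> P \<inter> ?D)"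
        | (alg) q c c1 p1 where "q \<in> coeffs_in ?B" "c \<in> ?B" "c \<notin> P \<inter> ?D" "c1 \<in> ?D" "p1 \<in> P \<inter> ?D"
          "Polynomial.poly q (pvar v) \<in> P \<inter> ?D" "lead_coeff q \<notin> P \<inter> ?D" "degree q > 0" "c = f * c1 + p1"
          "\<And>g. g \<in> coeffs_in ?B \<Longrightarrow> Polynomial.poly g (pvar v) \<in> P \<inter> ?D \<Longrightarrow> \<exists>N. \<exists>s\<in>coeffs_in ?B. \<exists>r\<in>coeffs_in ?B.
             Polynomial.smult (lead_coeff q ^ N) g = q * s + r \<and> (\<forall>i. Polynomial.coeff r i \<in> P \<inter> ?D)"
      proof -
        assume *: "\<And>q c c1 p1. q \<in> coeffs_in ?B \<Longrightarrow> c \<in> ?B \<Longrightarrow> c \<notin> P \<inter> ?D \<Longrightarrow> c1 \<in> ?D \<Longrightarrow> p1 \<in> P \<inter> ?D \<Longrightarrow>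
          Polynomial.poly q (pvar v) \<in> P \<inter> ?D \<Longrightarrow> lead_coeff q \<notin> P \<inter> ?D \<Longrightarrow> degree q > 0 \<Longrightarrow> c = f * c1 + p1 \<Longrightarrow>
          (\<And>g. g \<in> coeffs_in ?B \<Longrightarrow> Polynomial.poly g (pvar v) \<in> P \<inter> ?D \<Longrightarrow> \<exists>N. \<exists>s\<in>coeffs_in ?B. \<exists>r\<in>coeffs_in ?B.
             Polynomial.smult (lead_coeff q ^ N) g = q * s + r \<and> (\<forall>i. Polynomial.coeff r i \<in> P \<inter> ?D)) \<Longrightarrow> thesis"
          and **: "\<forall>q\<in>coeffs_in ?B. Polynomial.poly q (pvar v) \<in> P \<inter> ?D \<longrightarrow> (\<forall>i. Polynomial.coeff q i \<in> P \<inter> ?D) \<Longrightarrow> thesis"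
        have "f \<in> ?D" "f \<notin> P \<inter> ?D" using f by auto
        note adj = adjoin_generator[OF B.csubring_axioms D.csubring_axioms BD(1) evD polys_in_insert_poly P' this]
        show thesis
          by (rule disjE[OF adj], assumption, assumption, erule **, elim bexE conjE DiffE)
            (rule *, assumption+, drule (1) bspec, erule (1) mp)
      qed
      then show "\<exists>y. (\<forall>p\<in>P \<inter> ?D. ?ev y p = 0) \<and> ?ev y f \<noteq> 0"
      proof cases
        \<comment> \<open>All relations come from the coefficients, so the new coordinate is free:
          any value that is not a root of the specialised \<open>f\<close> will do.\<close>
        case gen
        obtain qf where qf: "qf \<in> coeffs_in ?B" "f = Polynomial.poly qf (pvar v)" using polys_in_insert_poly f by blast
        have "\<exists>j. Polynomial.coeff qf j \<notin> P"
        proof (rule ccontr)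
          assume "\<not> ?thesis"
          then have "f \<in> P" unfolding qf(2) poly_altdef
            using insert.prems by (intro R.ideal_sum[OF Pid] R.ideal_mult(2)[OF Pid] R.C_power) auto
          then show False using f by simp
        qed
        then obtain j where j: "Polynomial.coeff qf j \<notin> P" ..
        then have "j \<le> degree qf" using Pid by (intro le_degree) (auto simp: R.is_ideal_def)
        have "Polynomial.coeff qf j \<in> ?B - P" using qf(1) j by (auto simp: coeffs_in_def)
        then obtain y where y: "\<forall>p\<in>P \<inter> ?B. ?ev y p = 0" "?ev y (Polynomial.coeff qf j) \<noteq> 0"
          using insert.IH insert.prems by blast
        then obtain \<tau> where \<tau>: "(\<Sum>i\<le>degree qf. ?ev y (Polynomial.coeff qf i) * \<tau> ^ i) \<noteq> 0"
          using exists_nonroot[of j "degree qf" "\<lambda>i. ?ev y (Polynomial.coeff qf i)"] \<open>j \<le> degree qf\<close> by blast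
        have "?ev (ext y \<tau>) p = 0" if p: "p \<in> P \<inter> ?D" for p
        proof -
          obtain q where q: "q \<in> coeffs_in ?B" "p = Polynomial.poly q (pvar v)" using polys_in_insert_poly p by blast
          then have "Polynomial.coeff q i \<in> P \<inter> ?B" for i using gen p by (auto simp: coeffs_in_def)
          then show ?thesis unfolding q(2) ev_ext[OF q(1)] using y(1) by simp
        qed
        moreover have "?ev (ext y \<tau>) f \<noteq> 0" unfolding qf(2) ev_ext[OF qf(1)] using \<tau> .
        ultimately show ?thesis by blast
      next
        case (alg q c c1 p1)
        let ?a = "lead_coeff q"
        have aB: "?a \<in> ?B" using alg(1) by (simp add: coeffs_in_def)
        have "?a \<notin> P" "c \<notin> P" using alg aB BD(1) by auto
        \<comment> \<open>Where \<open>?a\<close> is nonzero, the specialised \<open>q\<close> keeps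
          its positive degree and has a root, and powers of \<open>?a\<close> can be cancelled;
          where \<open>c\<close> is nonzero, so is \<open>f\<close>.\<close>
        then have "?a * c \<in> ?B - P"
          using Pprime[of ?a c] aB alg(2) BD B.C_mult by blast
        then obtain y where y: "\<forall>p\<in>P \<inter> ?B. ?ev y p = 0" "?ev y (?a * c) \<noteq> 0"
          using insert.IH insert.prems by blast
        interpret E: comm_ring_hom "?ev y" by (rule h.poly_eval_hom)
        have ya: "?ev y ?a \<noteq> 0" "?ev y c \<noteq> 0" using y(2) by (auto simp: E.hom_mult)
        obtain \<tau> where \<tau>: "(\<Sum>i\<le>degree q. ?ev y (Polynomial.coeff q i) * \<tau> ^ i) = 0"
          using alg_closed[of "degree q" "\<lambda>i. ?ev y (Polynomial.coeff q i)"] alg(8) ya(1) by blast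
        interpret E': comm_ring_hom "?ev (ext y \<tau>)" by (rule h.poly_eval_hom)
        have eB: "?ev (ext y \<tau>) b = ?ev y b" if "b \<in> ?B" for b
          using that insert.hyps(2) by (intro poly_eval_cong_polys_in[of _ T]) (auto simp: ext_def)
        have kill: "?ev (ext y \<tau>) p = 0" if p: "p \<in> P \<inter> ?D" for p
        proof -
          obtain g where g: "g \<in> coeffs_in ?B" "p = Polynomial.poly g (pvar v)" using polys_in_insert_poly p by blast
          then obtain N s r where sr: "s \<in> coeffs_in ?B" "r \<in> coeffs_in ?B" "Polynomial.smult (?a ^ N) g = q * s + r"
            "\<forall>i. Polynomial.coeff r i \<in> P \<inter> ?D" using alg(10)[of g] p by blast
          have r0: "?ev (ext y \<tau>) (Polynomial.poly r (pvar v)) = 0"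
            unfolding ev_ext[OF sr(2)] using y(1) sr(2,4) by (intro sum.neutral) (auto simp: coeffs_in_def)
          have q0: "?ev (ext y \<tau>) (Polynomial.poly q (pvar v)) = 0"
            unfolding ev_ext[OF alg(1)] by (rule \<tau>)
          have "?a ^ N * p = Polynomial.poly q (pvar v) * Polynomial.poly s (pvar v) + Polynomial.poly r (pvar v)"
            using arg_cong[OF sr(3), of "\<lambda>z. Polynomial.poly z (pvar v)"] g(2) by simp
          then have "?ev (ext y \<tau>) (?a ^ N * p) = 0"
            using r0 q0 by (simp add: E'.hom_add E'.hom_mult)
          then have "?ev y ?a ^ N * ?ev (ext y \<tau>) p = 0"
            using eB[OF aB] by (simp add: E'.hom_mult E'.hom_power)
          then show ?thesis using ya(1) by simp
        qed
        have "?ev (ext y \<tau>) c = ?ev (ext y \<tau>) f * ?ev (ext y \<tau>) c1"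
          unfolding alg(9) E'.hom_add E'.hom_mult kill[OF alg(5)] by simp
        then have "?ev (ext y \<tau>) f \<noteq> 0" using ya(2) eB[OF alg(2)] by auto
        then show ?thesis using kill by blast
      qed
    qed
  qed
  obtain y where y: "\<forall>p\<in>P \<inter> polys_in S. ?ev y p = 0" "?ev y f \<noteq> 0"
    using main[OF S order_refl] f by blast
  have "?ev y p = 0" if "p \<in> P" for p using y(1) PS' that by blast
  then show ?thesis using y(2) by blast
qed

section \<open>The action of the general linear group\<close>

definition act :: "nat \<Rightarrow> (nat \<Rightarrow> nat \<Rightarrow> 'r) \<Rightarrow> (nat \<Rightarrow> nat \<Rightarrow> 'r) \<Rightarrow> (nat \<Rightarrow> nat \<Rightarrow> nat \<Rightarrow> 'r) \<Rightarrow> nat \<Rightarrow> nat \<Rightarrow> nat \<Rightarrow> 'r::comm_ring_1" where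
  "act n G H y i j l = (\<Sum>a<n. \<Sum>b<n. \<Sum>c<n. G l c * y a b c * H a i * H b j)"

text \<open>Taking the equations modulo \<open>J\<close> lets one statement serve for points over a
  field, for coordinate rings modulo an ideal and for the dual numbers.\<close>

definition eqs_mod :: "nat \<Rightarrow> 'r set \<Rightarrow> (nat \<Rightarrow> nat \<Rightarrow> nat \<Rightarrow> 'r::comm_ring_1) \<Rightarrow> bool" where
  "eqs_mod n J y \<longleftrightarrow> (\<forall>i<n. \<forall>j<n. \<forall>l<n. y i j l - y j i l \<in> J) \<and>
     (\<forall>i<n. \<forall>j<n. \<forall>k<n. \<forall>m<n. (\<Sum>l<n. y i j l * y l k m) - (\<Sum>l<n. y j k l * y i l m) \<in> J)"

definition Xval :: "(nat \<Rightarrow> nat \<Rightarrow> nat \<Rightarrow> 'r::zero) \<Rightarrow> coord \<Rightarrow> 'r" where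
  "Xval y v = (case v of Xc i j l \<Rightarrow> y i j l | Gc _ _ \<Rightarrow> 0 | Hc _ _ \<Rightarrow> 0)"

lemma Xval_simps [simp]: "Xval y (Xc i j l) = y i j l" "Xval y (Gc i j) = 0" "Xval y (Hc i j) = 0"
  by (simp_all add: Xval_def)

lemma evalX_eq: "evalX h y = poly_eval h (Xval y)"
  by (simp add: evalX_def Xval_def[abs_def])

lemma Xc_in_Xvars [simp]: "i < n \<Longrightarrow> j < n \<Longrightarrow> l < n \<Longrightarrow> Xc i j l \<in> Xvars n"
  by (simp add: Xvars_def)

lemma Gc_Hc_in_GLvars [simp]: "i < n \<Longrightarrow> j < n \<Longrightarrow> Gc i j \<in> GLvars n" "i < n \<Longrightarrow> j < n \<Longrightarrow> Hc i j \<in> GLvars n"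
  by (simp_all add: GLvars_def)

lemma finite_Xvars: "finite (Xvars n)"
proof -
  have "Xvars n = (\<lambda>(i, j, l). Xc i j l) ` ({..<n} \<times> {..<n} \<times> {..<n})" by (force simp: Xvars_def)
  then show ?thesis by simp
qed

lemma finite_GLvars: "finite (GLvars n)"
proof -
  have "GLvars n = (\<lambda>(i, j). Gc i j) ` ({..<n} \<times> {..<n}) \<union> (\<lambda>(i, j). Hc i j) ` ({..<n} \<times> {..<n})"
    by (auto simp: GLvars_def)
  then show ?thesis by simp
qed

lemma evalX_hom: "comm_ring_hom h \<Longrightarrow> comm_ring_hom (evalX h y)"
  unfolding evalX_eq by (rule comm_ring_hom.poly_eval_hom)

lemma evalX_cong:
  "f \<in> polys_in (Xvars n) \<Longrightarrow> (\<And>i j l. i < n \<Longrightarrow> j < n \<Longrightarrow> l < n \<Longrightarrow> y i j l = y' i j l) \<Longrightarrow> evalX h y f = evalX h y' f"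
  unfolding evalX_eq by (rule poly_eval_cong_polys_in) (auto simp: Xvars_def)

lemma evalX_closed:
  assumes "csubring D" "\<And>c. h c \<in> D" "\<And>i j l. i < n \<Longrightarrow> j < n \<Longrightarrow> l < n \<Longrightarrow> y i j l \<in> D" "f \<in> polys_in (Xvars n)"
  shows "evalX h y f \<in> D"
  unfolding evalX_eq using assms by (intro poly_eval_closed[of _ _ "Xvars n"]) (auto simp: Xvars_def)

lemma poly_eval_evalX:
  assumes "comm_ring_hom h"
  shows "poly_eval h z (evalX const Y f) = evalX h (\<lambda>i j l. poly_eval h z (Y i j l)) f"
proof -
  interpret comm_ring_hom h by fact
  have "(\<lambda>v. poly_eval h z (Xval Y v)) = Xval (\<lambda>i j l. poly_eval h z (Y i j l))"
    by (rule HOL.ext) (simp add: Xval_def split: coord.splits)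
  then show ?thesis unfolding evalX_eq by (simp add: poly_eval_comp)
qed

lemma generic_act_eq: "generic_act n y = act n (\<lambda>i j. pvar (Gc i j)) (\<lambda>i j. pvar (Hc i j)) y"
  by (intro HOL.ext) (simp add: generic_act_def act_def)

lemma poly_eval_generic_act:
  assumes "comm_ring_hom h"
  shows "poly_eval h z (generic_act n y i j l)
    = act n (\<lambda>i j. z (Gc i j)) (\<lambda>i j. z (Hc i j)) (\<lambda>a b c. poly_eval h z (y a b c)) i j l"
proof -
  interpret h: comm_ring_hom h by fact
  interpret E: comm_ring_hom "poly_eval h z" by (rule h.poly_eval_hom)
  show ?thesis by (simp add: generic_act_def act_def E.hom_sum E.hom_mult)
qed

lemma eqs_in_polys_in: "assoc_eqs n \<union> comm_eqs n \<subseteq> polys_in (Xvars n)"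
proof -
  interpret csubring "polys_in (Xvars n) :: 'a cpoly set" by (rule csubring_polys_in)
  show ?thesis unfolding assoc_eqs_def comm_eqs_def
    by (auto intro!: C_diff C_sum C_mult pvar_in_polys_in)
qed

lemma Comm_ideal_is_ideal: "csubring.is_ideal (polys_in (Xvars n)) (Comm_ideal n :: 'a::field cpoly set)"
  and Comm_ideal_gens: "assoc_eqs n \<union> comm_eqs n \<subseteq> (Comm_ideal n :: 'a cpoly set)"
proof -
  interpret csubring "polys_in (Xvars n) :: 'a cpoly set" by (rule csubring_polys_in)
  show "is_ideal (Comm_ideal n)" "assoc_eqs n \<union> comm_eqs n \<subseteq> (Comm_ideal n :: 'a cpoly set)"
    unfolding Comm_ideal_def poly_ring_eq using Idl_ideal[OF eqs_in_polys_in] Idl_self[OF eqs_in_polys_in] by auto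
qed

lemma eval_eqs:
  assumes "comm_ring_hom h"
  shows "evalX h y ` (assoc_eqs n \<union> comm_eqs n) \<subseteq> J \<longleftrightarrow> eqs_mod n J y"
proof -
  interpret h: comm_ring_hom h by fact
  interpret E: comm_ring_hom "evalX h y" by (rule evalX_hom) fact
  have v: "evalX h y (pvar (Xc i j l)) = y i j l" for i j l by (simp add: evalX_eq)
  have m: "evalX h y (a - b) = evalX h y a - evalX h y b" for a b by (rule E.hom_minus)
  have 1: "evalX h y ` assoc_eqs n \<subseteq> J \<longleftrightarrow> (\<forall>i j k m. i < n \<and> j < n \<and> k < n \<and> m < n \<longrightarrow>
      evalX h y ((\<Sum>l<n. pvar (Xc i j l) * pvar (Xc l k m)) - (\<Sum>l<n. pvar (Xc j k l) * pvar (Xc i l m))) \<in> J)"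
    unfolding assoc_eqs_def image_subset_iff by blast
  have 2: "evalX h y ` comm_eqs n \<subseteq> J \<longleftrightarrow> (\<forall>i j l. i < n \<and> j < n \<and> l < n \<longrightarrow>
      evalX h y (pvar (Xc i j l) - pvar (Xc j i l)) \<in> J)"
    unfolding comm_eqs_def image_subset_iff by blast
  show ?thesis unfolding image_Un Un_subset_iff 1 2 eqs_mod_def m E.hom_sum E.hom_mult v by blast
qed

lemma eval_Comm_ideal:
  assumes h: "comm_ring_hom h" and D: "csubring D" "\<And>c. h c \<in> D" "\<And>i j l. i < n \<Longrightarrow> j < n \<Longrightarrow> l < n \<Longrightarrow> y i j l \<in> D"
    and J: "csubring.is_ideal D J" and eqs: "eqs_mod n J y" and f: "f \<in> Comm_ideal n"
  shows "evalX h y f \<in> J"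
proof -
  interpret C: csubring "polys_in (Xvars n) :: 'a cpoly set" by (rule csubring_polys_in)
  have "C.is_ideal {f \<in> polys_in (Xvars n). evalX h y f \<in> J}"
    using D by (intro hom_preimage_ideal[OF evalX_hom[OF h] C.csubring_axioms D(1) _ J])
      (auto intro!: evalX_closed[where n = n and D = D])
  moreover have "assoc_eqs n \<union> comm_eqs n \<subseteq> {f \<in> polys_in (Xvars n). evalX h y f \<in> J}"
    using eqs_in_polys_in eval_eqs[OF h, of y n J] eqs by auto
  ultimately have "Comm_ideal n \<subseteq> {f \<in> polys_in (Xvars n). evalX h y f \<in> J}"
    unfolding Comm_ideal_def poly_ring_eq by (rule C.Idl_minimal)
  then show ?thesis using f by blast
qed

lemma id_hom: "comm_ring_hom (\<lambda>c::'a::comm_ring_1. c)" by unfold_locales simp_all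

lemma Comm_eqs: "x \<in> Comm n \<Longrightarrow> eqs_mod n {0} x"
  using eval_eqs[OF id_hom, of x n "{0}"] Comm_ideal_gens[of n] by (auto simp: Comm_def)

lemma sum_out4: "(\<Sum>c<n. \<Sum>a<n. \<Sum>b<n. \<Sum>b'<n. \<Sum>c'<n. f c a b b' c')
   = (\<Sum>a<n. \<Sum>b<n. \<Sum>b'<n. \<Sum>c'<n. \<Sum>c<n. f c a b b' c')" for n :: nat and f :: "_ \<Rightarrow> _ \<Rightarrow> _ \<Rightarrow> _ \<Rightarrow> _ \<Rightarrow> 'r::comm_monoid_add"
proof -
  have "(\<Sum>c<n. \<Sum>a<n. \<Sum>b<n. \<Sum>b'<n. \<Sum>c'<n. f c a b b' c') = (\<Sum>a<n. \<Sum>c<n. \<Sum>b<n. \<Sum>b'<n. \<Sum>c'<n. f c a b b' c')"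
    by (rule sum.swap)
  also have "\<dots> = (\<Sum>a<n. \<Sum>b<n. \<Sum>c<n. \<Sum>b'<n. \<Sum>c'<n. f c a b b' c')" by (intro sum.cong refl sum.swap)
  also have "\<dots> = (\<Sum>a<n. \<Sum>b<n. \<Sum>b'<n. \<Sum>c<n. \<Sum>c'<n. f c a b b' c')" by (intro sum.cong refl sum.swap)
  also have "\<dots> = (\<Sum>a<n. \<Sum>b<n. \<Sum>b'<n. \<Sum>c'<n. \<Sum>c<n. f c a b b' c')" by (intro sum.cong refl sum.swap)
  finally show ?thesis .
qed

lemma sum_rot3: "(\<Sum>b<n. \<Sum>b'<n. \<Sum>a<n. f a b b') = (\<Sum>a<n. \<Sum>b<n. \<Sum>b'<n. f a b b')"
  for n :: nat and f :: "_ \<Rightarrow> _ \<Rightarrow> _ \<Rightarrow> 'r::comm_monoid_add"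
proof -
  have "(\<Sum>b<n. \<Sum>b'<n. \<Sum>a<n. f a b b') = (\<Sum>b<n. \<Sum>a<n. \<Sum>b'<n. f a b b')" by (intro sum.cong refl sum.swap)
  also have "\<dots> = (\<Sum>a<n. \<Sum>b<n. \<Sum>b'<n. f a b b')" by (rule sum.swap)
  finally show ?thesis .
qed

text \<open>The products of \<open>act n G H y\<close> only use \<open>H G = 1\<close>, which may hold modulo an ideal.\<close>

lemma act_eqs:
  fixes G H :: "nat \<Rightarrow> nat \<Rightarrow> 'r::comm_ring_1"
  assumes C: "csubring C" and J: "csubring.is_ideal C J"
    and mem: "\<And>i j. i < n \<Longrightarrow> j < n \<Longrightarrow> G i j \<in> C" "\<And>i j. i < n \<Longrightarrow> j < n \<Longrightarrow> H i j \<in> C"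
      "\<And>i j l. i < n \<Longrightarrow> j < n \<Longrightarrow> l < n \<Longrightarrow> y i j l \<in> C"
    and HG: "\<And>a c. a < n \<Longrightarrow> c < n \<Longrightarrow> (\<Sum>l<n. H a l * G l c) - (if a = c then 1 else 0) \<in> J"
    and eqs: "eqs_mod n J y"
  shows "eqs_mod n J (act n G H y)"
proof -
  interpret C: csubring C by fact
  \<comment> \<open>The transformed structure constants with one of the three matrices left off.
    When two of them are multiplied, the open indices meet in the product of \<open>H\<close> and
    \<open>G\<close>, which is the identity modulo \<open>J\<close>.\<close>
  define T where "T i j c = (\<Sum>a<n. \<Sum>b<n. y a b c * H a i * H b j)" for i j c
  define U where "U a k m = (\<Sum>b<n. \<Sum>c<n. G m c * y a b c * H b k)" for a k m
  define U' where "U' i b m = (\<Sum>a<n. \<Sum>c<n. G m c * y a b c * H a i)" for i b m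
  have TC: "T i j c \<in> C" if "i < n" "j < n" "c < n" for i j c
    unfolding T_def using that by (intro C.C_sum C.C_mult mem) auto
  have UC: "U i j c \<in> C" if "i < n" "j < n" "c < n" for i j c
    unfolding U_def using that by (intro C.C_sum C.C_mult mem) auto
  have UC': "U' i j c \<in> C" if "i < n" "j < n" "c < n" for i j c
    unfolding U'_def using that by (intro C.C_sum C.C_mult mem) auto
  have aT: "act n G H y i j l = (\<Sum>c<n. G l c * T i j c)" for i j l
  proof -
    have "act n G H y i j l = (\<Sum>a<n. \<Sum>c<n. \<Sum>b<n. G l c * y a b c * H a i * H b j)"
      unfolding act_def by (intro sum.cong refl sum.swap)
    also have "\<dots> = (\<Sum>c<n. \<Sum>a<n. \<Sum>b<n. G l c * y a b c * H a i * H b j)" by (rule sum.swap)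
    finally show ?thesis by (simp add: T_def sum_distrib_left mult.assoc)
  qed
  have aU: "act n G H y l k m = (\<Sum>a<n. H a l * U a k m)" for l k m
    by (simp add: act_def U_def sum_distrib_left algebra_simps)
  have aU': "act n G H y i l m = (\<Sum>b<n. H b l * U' i b m)" for i l m
  proof -
    have "act n G H y i l m = (\<Sum>b<n. \<Sum>a<n. \<Sum>c<n. G m c * y a b c * H a i * H b l)"
      unfolding act_def by (rule sum.swap)
    then show ?thesis by (simp add: U'_def sum_distrib_left algebra_simps)
  qed
  have contract: "(\<Sum>l<n. (\<Sum>c<n. G l c * t c) * (\<Sum>a<n. H a l * w a)) - (\<Sum>c<n. t c * w c) \<in> J"
    if tw: "\<And>c. c < n \<Longrightarrow> t c \<in> C" "\<And>c. c < n \<Longrightarrow> w c \<in> C" for t w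
  proof -
    have "(\<Sum>l<n. (\<Sum>c<n. G l c * t c) * (\<Sum>a<n. H a l * w a))
       = (\<Sum>l<n. \<Sum>c<n. \<Sum>a<n. t c * w a * (H a l * G l c))"
      by (simp add: sum_product algebra_simps)
    also have "\<dots> = (\<Sum>c<n. \<Sum>l<n. \<Sum>a<n. t c * w a * (H a l * G l c))" by (rule sum.swap)
    also have "\<dots> = (\<Sum>c<n. \<Sum>a<n. \<Sum>l<n. t c * w a * (H a l * G l c))" by (intro sum.cong refl sum.swap)
    also have "\<dots> = (\<Sum>c<n. \<Sum>a<n. t c * w a * (\<Sum>l<n. H a l * G l c))" by (simp add: sum_distrib_left)
    finally have 1: "(\<Sum>l<n. (\<Sum>c<n. G l c * t c) * (\<Sum>a<n. H a l * w a)) = \<dots>" .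
    have "(\<Sum>a<n. t c * w a * (if a = c then 1 else 0)) = t c * w c" if "c < n" for c
      using that by (simp add: if_distrib[of "\<lambda>u. _ * u"] cong: if_cong)
    then have 2: "(\<Sum>c<n. t c * w c) = (\<Sum>c<n. \<Sum>a<n. t c * w a * (if a = c then 1 else 0))" by simp
    have "(\<Sum>l<n. (\<Sum>c<n. G l c * t c) * (\<Sum>a<n. H a l * w a)) - (\<Sum>c<n. t c * w c)
       = (\<Sum>c<n. \<Sum>a<n. t c * w a * ((\<Sum>l<n. H a l * G l c) - (if a = c then 1 else 0)))"
      unfolding 1 2 by (simp add: sum_subtractf[symmetric] right_diff_distrib)
    also have "\<dots> \<in> J" by (intro C.ideal_sum[OF J] C.ideal_mult(1)[OF J] HG C.C_mult tw) auto
    finally show ?thesis .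
  qed
  have y_comm: "y i j l - y j i l \<in> J" if "i < n" "j < n" "l < n" for i j l
    using eqs that by (simp add: eqs_mod_def)
  have y_assoc: "(\<Sum>l<n. y i j l * y l k m) - (\<Sum>l<n. y j k l * y i l m) \<in> J" if "i < n" "j < n" "k < n" "m < n" for i j k m
    using eqs that by (simp add: eqs_mod_def)
  show ?thesis
    unfolding eqs_mod_def
  proof (intro conjI allI impI)
    fix i j l assume ijl: "i < n" "j < n" "l < n"
    have "act n G H y j i l = (\<Sum>a<n. \<Sum>b<n. \<Sum>c<n. G l c * y b a c * H b j * H a i)"
      unfolding act_def by (rule sum.swap)
    then have "act n G H y i j l - act n G H y j i l
       = (\<Sum>a<n. \<Sum>b<n. \<Sum>c<n. (G l c * H a i * H b j) * (y a b c - y b a c))"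
      by (simp add: act_def sum_subtractf[symmetric] algebra_simps)
    also have "\<dots> \<in> J" using ijl by (intro C.ideal_sum[OF J] C.ideal_mult(1)[OF J] y_comm C.C_mult mem) auto
    finally show "act n G H y i j l - act n G H y j i l \<in> J" .
  next
    fix i j k m assume ijkm: "i < n" "j < n" "k < n" "m < n"
    have 1: "(\<Sum>l<n. act n G H y i j l * act n G H y l k m) - (\<Sum>c<n. T i j c * U c k m) \<in> J"
      unfolding aT[of i j] aU[of _ k m] using ijkm TC UC by (intro contract) auto
    have 2: "(\<Sum>l<n. act n G H y j k l * act n G H y i l m) - (\<Sum>c<n. T j k c * U' i c m) \<in> J"
      unfolding aT[of j k] aU'[of i _ m] using ijkm TC UC' by (intro contract) auto
    \<comment> \<open>The common coefficient with which the associativity relations of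
      \<open>y\<close> enter.\<close>
    let ?K = "\<lambda>a b b' c'. H a i * H b j * H b' k * G m c'"
    have "(\<Sum>c<n. T i j c * U c k m) = (\<Sum>c<n. \<Sum>a<n. \<Sum>b<n. \<Sum>b'<n. \<Sum>c'<n. ?K a b b' c' * (y a b c * y c b' c'))"
      unfolding T_def U_def sum_distrib_right unfolding sum_distrib_left by (simp add: ac_simps)
    note step1 = this
    have E1: "(\<Sum>c<n. T i j c * U c k m) = (\<Sum>a<n. \<Sum>b<n. \<Sum>b'<n. \<Sum>c'<n. ?K a b b' c' * (\<Sum>c<n. y a b c * y c b' c'))"
      unfolding sum_distrib_left by (rule trans[OF step1 sum_out4])
    have "(\<Sum>c<n. T j k c * U' i c m) = (\<Sum>c<n. \<Sum>b<n. \<Sum>b'<n. \<Sum>a<n. \<Sum>c'<n. ?K a b b' c' * (y b b' c * y a c c'))"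
      unfolding T_def U'_def sum_distrib_right unfolding sum_distrib_left by (simp add: ac_simps)
    also have "\<dots> = (\<Sum>c<n. \<Sum>a<n. \<Sum>b<n. \<Sum>b'<n. \<Sum>c'<n. ?K a b b' c' * (y b b' c * y a c c'))"
      by (intro sum.cong refl sum_rot3)
    finally have step2: "(\<Sum>c<n. T j k c * U' i c m) = \<dots>" .
    have E2: "(\<Sum>c<n. T j k c * U' i c m) = (\<Sum>a<n. \<Sum>b<n. \<Sum>b'<n. \<Sum>c'<n. ?K a b b' c' * (\<Sum>c<n. y b b' c * y a c c'))"
      unfolding sum_distrib_left by (rule trans[OF step2 sum_out4])
    have "(\<Sum>c<n. T i j c * U c k m) - (\<Sum>c<n. T j k c * U' i c m) = (\<Sum>a<n. \<Sum>b<n. \<Sum>b'<n. \<Sum>c'<n.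
        ?K a b b' c' * ((\<Sum>c<n. y a b c * y c b' c') - (\<Sum>c<n. y b b' c * y a c c')))"
      unfolding E1 E2 by (simp only: sum_subtractf right_diff_distrib)
    also have "\<dots> \<in> J"
      using ijkm by (intro C.ideal_sum[OF J] C.ideal_mult(1)[OF J] y_assoc C.C_mult mem) auto
    finally have 3: "(\<Sum>c<n. T i j c * U c k m) - (\<Sum>c<n. T j k c * U' i c m) \<in> J" .
    have "(\<Sum>l<n. act n G H y i j l * act n G H y l k m) - (\<Sum>l<n. act n G H y j k l * act n G H y i l m)
      = ((\<Sum>l<n. act n G H y i j l * act n G H y l k m) - (\<Sum>c<n. T i j c * U c k m))
        + ((\<Sum>c<n. T i j c * U c k m) - (\<Sum>c<n. T j k c * U' i c m))
        - ((\<Sum>l<n. act n G H y j k l * act n G H y i l m) - (\<Sum>c<n. T j k c * U' i c m))" by simp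
    also have "\<dots> \<in> J" by (rule C.ideal_diff[OF J C.ideal_add[OF J 1 3] 2])
    finally show "(\<Sum>l<n. act n G H y i j l * act n G H y l k m) - (\<Sum>l<n. act n G H y j k l * act n G H y i l m) \<in> J" .
  qed
qed

section \<open>The discriminant as a polynomial and its behaviour under the action\<close>

definition disc :: "nat \<Rightarrow> (nat \<Rightarrow> nat \<Rightarrow> nat \<Rightarrow> 'r::comm_ring_1) \<Rightarrow> 'r" where
  "disc n y = Determinant.det (mat n n (\<lambda>(i, j). \<Sum>l<n. y i j l * (\<Sum>m<n. y l m m)))"

lemma (in comm_ring_hom) hom_disc: "hom (disc n y) = disc n (\<lambda>i j l. hom (y i j l))"
proof -
  have "map_mat hom (mat n n (\<lambda>(i, j). \<Sum>l<n. y i j l * (\<Sum>m<n. y l m m)))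
    = mat n n (\<lambda>(i, j). \<Sum>l<n. hom (y i j l) * (\<Sum>m<n. hom (y l m m)))"
    by (rule eq_matI) (auto simp: hom_sum hom_mult)
  then show ?thesis unfolding disc_def hom_det[symmetric] by simp
qed

definition Delta :: "nat \<Rightarrow> 'k::field cpoly" where
  "Delta n = disc n (\<lambda>i j l. pvar (Xc i j l))"

lemma evalX_Delta:
  assumes "comm_ring_hom h"
  shows "evalX h y (Delta n) = disc n y"
proof -
  interpret h: comm_ring_hom h by fact
  interpret E: comm_ring_hom "evalX h y" by (rule evalX_hom) fact
  show ?thesis unfolding Delta_def E.hom_disc by (simp add: evalX_eq)
qed

lemma Delta_in_polys_in: "(Delta n :: 'a::field cpoly) \<in> polys_in (Xvars n)"
proof -
  interpret csubring "polys_in (Xvars n) :: 'a cpoly set" by (rule csubring_polys_in)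
  have sgn: "(signof p :: 'a cpoly) \<in> polys_in (Xvars n)" for p :: "nat \<Rightarrow> nat"
    by (cases "evenperm p") (simp_all add: sign_def C_1 C_neg[OF C_1])
  show ?thesis unfolding Delta_def disc_def Determinant.det_def
    by (auto intro!: C_sum C_mult C_prod sgn pvar_in_polys_in simp: permutes_in_image)
qed

text \<open>Expanding the trace form in structure constants makes the discriminant meaningful over
  every commutative ring, in particular for the generic product.\<close>

lemma (in comm_structure) discr_eq_disc: "discr scale n e x = disc n x"
proof -
  have "tr (\<mu> (e i) (e j)) = (\<Sum>l<n. x i j l * (\<Sum>m<n. x l m m))" if "i < n" "j < n" for i j
  proof -
    have te: "tr (e l) = (\<Sum>m<n. x l m m)" if "l < n" for l
      using that by (simp add: tr_def endo_trace_def mult_e co_lincomb)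
    show ?thesis unfolding mult_e[OF that] by (subst tr_sum) (auto simp: span_scale tr_scale te)
  qed
  then show ?thesis unfolding discr_def disc_def Let_def tr_def
    by (intro arg_cong[of _ _ Determinant.det] cong_mat) auto
qed

text \<open>The Gram matrix of the trace form changes by congruence with the invertible matrix
  \<open>H\<close>, so its determinant is multiplied by a nonzero square.\<close>

lemma disc_act_nonzero:
  fixes G H :: "nat \<Rightarrow> nat \<Rightarrow> 'r::field"
  assumes HG: "\<And>a c. a < n \<Longrightarrow> c < n \<Longrightarrow> (\<Sum>l<n. H a l * G l c) = (if a = c then 1 else 0)"
    and y: "disc n y \<noteq> 0"
  shows "disc n (act n G H y) \<noteq> 0"
proof -
  let ?D = "\<lambda>y. mat n n (\<lambda>(i, j). \<Sum>l<n. y i j l * (\<Sum>m<n. y l m m))"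
  let ?H = "mat n n (\<lambda>(i, j). H i j)" and ?G = "mat n n (\<lambda>(i, j). G i j)"
  define Y where "Y = act n G H y"
  have contract: "(\<Sum>l<n. (\<Sum>c<n. G l c * t c) * (\<Sum>a<n. H a l * w a)) = (\<Sum>c<n. t c * w c)" for t w
  proof -
    have "(\<Sum>l<n. (\<Sum>c<n. G l c * t c) * (\<Sum>a<n. H a l * w a))
       = (\<Sum>l<n. \<Sum>c<n. \<Sum>a<n. t c * w a * (H a l * G l c))"
      by (simp add: sum_product algebra_simps)
    also have "\<dots> = (\<Sum>c<n. \<Sum>l<n. \<Sum>a<n. t c * w a * (H a l * G l c))" by (rule sum.swap)
    also have "\<dots> = (\<Sum>c<n. \<Sum>a<n. \<Sum>l<n. t c * w a * (H a l * G l c))" by (intro sum.cong refl sum.swap)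
    also have "\<dots> = (\<Sum>c<n. \<Sum>a<n. t c * w a * (\<Sum>l<n. H a l * G l c))" by (simp add: sum_distrib_left)
    also have "\<dots> = (\<Sum>c<n. \<Sum>a<n. t c * w a * (if a = c then 1 else 0))" using HG by simp
    finally show ?thesis by (simp add: if_distrib[of "\<lambda>u. _ * u"] cong: if_cong)
  qed
  have Ylm: "Y l m m' = (\<Sum>a<n. H a l * (\<Sum>b<n. \<Sum>c<n. G m' c * y a b c * H b m))" for l m m'
    by (simp add: Y_def act_def sum_distrib_left algebra_simps)
  have tY: "(\<Sum>m<n. Y l m m) = (\<Sum>a<n. H a l * (\<Sum>b<n. y a b b))" for l
  proof -
    have "(\<Sum>m<n. Y l m m) = (\<Sum>a<n. H a l * (\<Sum>m<n. \<Sum>b<n. \<Sum>c<n. G m c * y a b c * H b m))"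
      unfolding Ylm by (subst sum.swap) (simp add: sum_distrib_left)
    also have "(\<lambda>a. \<Sum>m<n. \<Sum>b<n. \<Sum>c<n. G m c * y a b c * H b m) = (\<lambda>a. \<Sum>b<n. y a b b)"
    proof
      fix a
      have "(\<Sum>m<n. \<Sum>b<n. \<Sum>c<n. G m c * y a b c * H b m) = (\<Sum>b<n. \<Sum>c<n. \<Sum>m<n. G m c * y a b c * H b m)"
        by (rule sum_rot3[symmetric])
      also have "\<dots> = (\<Sum>b<n. \<Sum>c<n. y a b c * (\<Sum>m<n. H b m * G m c))"
        by (simp add: sum_distrib_left ac_simps)
      also have "\<dots> = (\<Sum>b<n. \<Sum>c<n. y a b c * (if b = c then 1 else 0))" using HG by simp
      finally show "(\<Sum>m<n. \<Sum>b<n. \<Sum>c<n. G m c * y a b c * H b m) = (\<Sum>b<n. y a b b)"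
        by (simp add: if_distrib[of "\<lambda>u. _ * u"] cong: if_cong)
    qed
    finally show ?thesis .
  qed
  have YT: "Y i j l = (\<Sum>c<n. G l c * (\<Sum>a<n. \<Sum>b<n. y a b c * H a i * H b j))" for i j l
  proof -
    have "Y i j l = (\<Sum>a<n. \<Sum>c<n. \<Sum>b<n. G l c * y a b c * H a i * H b j)"
      unfolding Y_def act_def by (intro sum.cong refl sum.swap)
    also have "\<dots> = (\<Sum>c<n. \<Sum>a<n. \<Sum>b<n. G l c * y a b c * H a i * H b j)" by (rule sum.swap)
    finally show ?thesis by (simp add: sum_distrib_left mult.assoc)
  qed
  have DYt: "(\<Sum>c<n. (\<Sum>a<n. \<Sum>b<n. y a b c * H a i * H b j) * t c) = (\<Sum>b<n. (\<Sum>a<n. H a i * (\<Sum>c<n. y a b c * t c)) * H b j)" for i j t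
  proof -
    have "(\<Sum>c<n. (\<Sum>a<n. \<Sum>b<n. y a b c * H a i * H b j) * t c) = (\<Sum>c<n. \<Sum>a<n. \<Sum>b<n. H a i * (y a b c * t c) * H b j)"
      by (simp add: sum_distrib_left sum_distrib_right ac_simps)
    also have "\<dots> = (\<Sum>a<n. \<Sum>c<n. \<Sum>b<n. H a i * (y a b c * t c) * H b j)" by (rule sum.swap)
    also have "\<dots> = (\<Sum>a<n. \<Sum>b<n. \<Sum>c<n. H a i * (y a b c * t c) * H b j)" by (intro sum.cong refl sum.swap)
    also have "\<dots> = (\<Sum>b<n. \<Sum>a<n. \<Sum>c<n. H a i * (y a b c * t c) * H b j)" by (rule sum.swap)
    finally show ?thesis by (simp add: sum_distrib_left sum_distrib_right)
  qed
  have DY: "(\<Sum>l<n. Y i j l * (\<Sum>m<n. Y l m m)) = (\<Sum>b<n. (\<Sum>a<n. H a i * (\<Sum>c<n. y a b c * (\<Sum>m<n. y c m m))) * H b j)" for i j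
    unfolding tY YT[of i j] by (rule trans[OF contract DYt])
  have "?D Y = transpose_mat ?H * ?D y * ?H"
    by (rule eq_matI) (auto simp: scalar_prod_def atLeast0LessThan DY)
  then have "disc n Y = Determinant.det (transpose_mat ?H) * disc n y * Determinant.det ?H"
    using det_mult[of "transpose_mat ?H * ?D y" n ?H] det_mult[of "transpose_mat ?H" n "?D y"]
    by (simp add: disc_def)
  moreover have "?H * ?G = 1\<^sub>m n"
    by (rule eq_matI) (auto simp: scalar_prod_def atLeast0LessThan HG)
  then have "Determinant.det ?H * Determinant.det ?G = 1"
    using det_mult[of ?H n ?G] by simp
  then have "Determinant.det ?H \<noteq> 0" by auto
  ultimately show ?thesis using y by (simp add: Y_def Determinant.det_transpose[of _ n])
qed

section \<open>The orbit as an open subscheme\<close>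

text \<open>Supplies an \<open>n\<close>-dimensional space over any field, in particular over the
  algebraic closure.\<close>

lemma based_space_poly:
  "based_space (Polynomial.smult :: 'k::field \<Rightarrow> 'k poly \<Rightarrow> 'k poly) n (Polynomial.monom 1)"
proof -
  interpret vector_space "Polynomial.smult :: 'k \<Rightarrow> 'k poly \<Rightarrow> 'k poly"
    by unfold_locales (simp_all add: smult_add_right smult_add_left)
  have inj: "inj_on (Polynomial.monom (1::'k)) {..<n}"
    by (intro inj_onI) (simp add: monom_eq_iff')
  have "independent (Polynomial.monom (1::'k) ` {..<n})"
  proof
    assume "dependent (Polynomial.monom (1::'k) ` {..<n})"
    then obtain c v where c: "(\<Sum>w\<in>Polynomial.monom 1 ` {..<n}. Polynomial.smult (c w) w) = 0"
      "v \<in> Polynomial.monom (1::'k) ` {..<n}" "c v \<noteq> 0"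
      using dependent_finite[of "Polynomial.monom (1::'k) ` {..<n}"] by auto
    obtain i where i: "i < n" "v = Polynomial.monom 1 i" using c(2) by auto
    have "(\<Sum>j<n. Polynomial.smult (c (Polynomial.monom 1 j)) (Polynomial.monom 1 j)) = 0"
      using c(1) inj by (simp add: sum.reindex)
    then have "Polynomial.coeff (\<Sum>j<n. Polynomial.smult (c (Polynomial.monom 1 j)) (Polynomial.monom 1 j)) i = 0" by simp
    then have "c (Polynomial.monom 1 i) = 0"
      using i(1) by (simp add: coeff_sum if_distrib[of "\<lambda>u. _ * u"] cong: if_cong)
    then show False using c(3) i by simp
  qed
  with inj show ?thesis by unfold_locales
qed

lemma split_structure_poly:
  fixes y :: "nat \<Rightarrow> nat \<Rightarrow> nat \<Rightarrow> 'k::alg_closed_field"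
  assumes "eqs_mod n {0} y" "disc n y \<noteq> 0"
  shows "split_structure Polynomial.smult n (Polynomial.monom 1) y"
proof -
  interpret based_space "Polynomial.smult :: 'k \<Rightarrow> 'k poly \<Rightarrow> 'k poly" n "Polynomial.monom 1"
    by (rule based_space_poly)
  interpret comm_structure "Polynomial.smult :: 'k \<Rightarrow> 'k poly \<Rightarrow> 'k poly" n "Polynomial.monom 1" y
    by unfold_locales (use assms(1) in \<open>unfold eqs_mod_def singleton_iff right_minus_eq, blast+\<close>)
  show ?thesis by unfold_locales (use assms(2) discr_eq_disc in simp)
qed

text \<open>The comorphism of the orbit map from GL(V) to the space of products.\<close>

definition orb_map :: "nat \<Rightarrow> (nat \<Rightarrow> nat \<Rightarrow> nat \<Rightarrow> 'k::field) \<Rightarrow> 'k cpoly \<Rightarrow> 'k cpoly" where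
  "orb_map n x = evalX const (generic_act n (\<lambda>i j l. const (x i j l)))"

lemma orb_map_hom: "comm_ring_hom (orb_map n x)"
  unfolding orb_map_def by (rule evalX_hom, rule const_hom)

lemma generic_act_closed:
  assumes "i < n" "j < n" "l < n" "GLvars n \<subseteq> S" "\<And>a b c. a < n \<Longrightarrow> b < n \<Longrightarrow> c < n \<Longrightarrow> y a b c \<in> polys_in S"
  shows "generic_act n y i j l \<in> polys_in S"
proof -
  interpret csubring "polys_in S :: 'a cpoly set" by (rule csubring_polys_in)
  have "Gc a b \<in> S" "Hc a b \<in> S" if "a < n" "b < n" for a b
    using that assms(4) Gc_Hc_in_GLvars by (meson subsetD)+
  then show ?thesis unfolding generic_act_def using assms(1-3,5)
    by (intro C_sum C_mult pvar_in_polys_in) auto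
qed

lemma orb_map_closed: "f \<in> polys_in (Xvars n) \<Longrightarrow> orb_map n x f \<in> polys_in (GLvars n)"
  unfolding orb_map_def by (rule evalX_closed[OF csubring_polys_in]) (auto intro!: generic_act_closed)

lemma GL_eqs_in_polys_in: "GL_eqs n \<subseteq> polys_in (GLvars n)"
proof -
  interpret csubring "polys_in (GLvars n) :: 'a cpoly set" by (rule csubring_polys_in)
  show ?thesis unfolding GL_eqs_def
    by (auto intro!: C_diff C_sum C_mult pvar_in_polys_in C_1 C_0)
qed

lemma poly_eval_GL_eqs:
  assumes "comm_ring_hom h"
  shows "poly_eval h z ` GL_eqs n \<subseteq> {0} \<longleftrightarrow>
    (\<forall>i<n. \<forall>j<n. (\<Sum>l<n. z (Gc i l) * z (Hc l j)) = (if i = j then 1 else 0)) \<and>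
    (\<forall>i<n. \<forall>j<n. (\<Sum>l<n. z (Hc i l) * z (Gc l j)) = (if i = j then 1 else 0))"
proof -
  interpret h: comm_ring_hom h by fact
  interpret E: comm_ring_hom "poly_eval h z" by (rule h.poly_eval_hom)
  have i: "poly_eval h z (if a = b then 1 else 0) = (if a = b then 1 else 0)" for a b :: nat by simp
  have 1: "poly_eval h z ` {(\<Sum>l<n. pvar (Gc i l) * pvar (Hc l j)) - (if i = j then 1 else 0) | i j. i < n \<and> j < n} \<subseteq> {0}
    \<longleftrightarrow> (\<forall>i j. i < n \<and> j < n \<longrightarrow> poly_eval h z ((\<Sum>l<n. pvar (Gc i l) * pvar (Hc l j)) - (if i = j then 1 else 0)) \<in> {0})"
    unfolding image_subset_iff by blast
  have 2: "poly_eval h z ` {(\<Sum>l<n. pvar (Hc i l) * pvar (Gc l j)) - (if i = j then 1 else 0) | i j. i < n \<and> j < n} \<subseteq> {0}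
    \<longleftrightarrow> (\<forall>i j. i < n \<and> j < n \<longrightarrow> poly_eval h z ((\<Sum>l<n. pvar (Hc i l) * pvar (Gc l j)) - (if i = j then 1 else 0)) \<in> {0})"
    unfolding image_subset_iff by blast
  show ?thesis
    unfolding GL_eqs_def image_Un Un_subset_iff 1 2 E.hom_minus E.hom_sum E.hom_mult h.poly_eval_pvar i
      singleton_iff right_minus_eq by blast
qed

lemma poly_eval_orb_map:
  assumes "comm_ring_hom h"
  shows "poly_eval h z (orb_map n x f)
    = evalX h (act n (\<lambda>i j. z (Gc i j)) (\<lambda>i j. z (Hc i j)) (\<lambda>a b c. h (x a b c))) f"
proof -
  interpret h: comm_ring_hom h by fact
  show ?thesis unfolding orb_map_def poly_eval_evalX[OF assms] poly_eval_generic_act[OF assms] by simp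
qed

lemma eqs_mod_hom:
  assumes "comm_ring_hom h" "eqs_mod n {0} x" "0 \<in> J"
  shows "eqs_mod n J (\<lambda>a b c. h (x a b c))"
proof -
  interpret h: comm_ring_hom h by fact
  show ?thesis
    unfolding eqs_mod_def
  proof (intro conjI allI impI)
    fix i j l assume "i < n" "j < n" "l < n"
    then have "x i j l = x j i l"
      using assms(2) unfolding eqs_mod_def singleton_iff right_minus_eq by blast
    then show "h (x i j l) - h (x j i l) \<in> J" using assms(3) by simp
  next
    fix i j k m assume "i < n" "j < n" "k < n" "m < n"
    then have "(\<Sum>l<n. x i j l * x l k m) = (\<Sum>l<n. x j k l * x i l m)"
      using assms(2) unfolding eqs_mod_def singleton_iff right_minus_eq by blast
    then have "h (\<Sum>l<n. x i j l * x l k m) = h (\<Sum>l<n. x j k l * x i l m)" by (rule arg_cong)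
    then show "(\<Sum>l<n. h (x i j l) * h (x l k m)) - (\<Sum>l<n. h (x j k l) * h (x i l m)) \<in> J"
      unfolding h.hom_sum h.hom_mult using assms(3) by simp
  qed
qed

text \<open>If the discriminant were in the preimage of a prime \<open>Q\<close> of GL(V), it would
  vanish on an algebra conjugate to \<open>x\<close> at a geometric zero of \<open>Q\<close>.
  Conversely, a \<open>Q\<close> above a given \<open>P\<close> is found by avoiding the image of
  the complement of \<open>P\<close>.\<close>

lemma orbit_eq:
  fixes x :: "nat \<Rightarrow> nat \<Rightarrow> nat \<Rightarrow> 'k::field_char_0"
  assumes x: "x \<in> Comm n" and dx: "disc n x \<noteq> 0"
  shows "orbit n x = {P \<in> closed_subscheme (poly_ring (Xvars n)) (Comm_ideal n). \<not> {Delta n} \<subseteq> P}"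
proof -
  let ?X = "polys_in (Xvars n) :: 'k cpoly set" and ?GL = "polys_in (GLvars n) :: 'k cpoly set"
  let ?\<phi> = "orb_map n x"
  interpret X: csubring ?X by (rule csubring_polys_in)
  interpret GL: csubring ?GL by (rule csubring_polys_in)
  interpret \<phi>: comm_ring_hom ?\<phi> by (rule orb_map_hom)
  interpret h: comm_ring_hom "to_ac :: 'k \<Rightarrow> 'k alg_closure" by (rule to_ac_hom)
  note xe = Comm_eqs[OF x]
  have sub_closed: "?\<phi> ` ?X \<subseteq> ?GL" using orb_map_closed by blast
  have orb: "orbit n x = (\<lambda>Q. {f \<in> ?X. ?\<phi> f \<in> Q}) ` {Q. GL.is_prime Q \<and> GL_eqs n \<subseteq> Q}"
    unfolding orbit_def closed_subscheme_def orb_map_def poly_ring_eq GL.prime_iff by simp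
  have cs: "closed_subscheme (poly_ring (Xvars n)) (Comm_ideal n) = {P. X.is_prime P \<and> Comm_ideal n \<subseteq> P}"
    unfolding closed_subscheme_def poly_ring_eq X.prime_iff ..
  let ?tx = "\<lambda>a b c. to_ac (x a b c)"
  have dtx: "disc n ?tx \<noteq> 0" using dx h.hom_disc[of n x] by (metis to_ac_eq_0_iff)
  have fwd: "X.is_prime {f \<in> ?X. ?\<phi> f \<in> Q} \<and> Comm_ideal n \<subseteq> {f \<in> ?X. ?\<phi> f \<in> Q} \<and> Delta n \<notin> {f \<in> ?X. ?\<phi> f \<in> Q}"
    if Q: "GL.is_prime Q" "GL_eqs n \<subseteq> Q" for Q
  proof (intro conjI)
    have Qid: "GL.is_ideal Q" using Q(1) by (simp add: GL.is_prime_def)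
    show "X.is_prime {f \<in> ?X. ?\<phi> f \<in> Q}"
      by (rule hom_preimage_prime[OF orb_map_hom X.csubring_axioms GL.csubring_axioms sub_closed Q(1)])
    have "eqs_mod n Q (act n (\<lambda>i j. pvar (Gc i j)) (\<lambda>i j. pvar (Hc i j)) (\<lambda>i j l. const (x i j l)))"
    proof (rule act_eqs[OF GL.csubring_axioms Qid])
      show "(\<Sum>l<n. pvar (Hc a l) * pvar (Gc l c)) - (if a = c then 1 else 0) \<in> Q" if "a < n" "c < n" for a c
        using Q(2) that unfolding GL_eqs_def by blast
      show "eqs_mod n Q (\<lambda>i j l. const (x i j l))"
        using Qid by (intro eqs_mod_hom[OF const_hom xe]) (simp add: GL.is_ideal_def)
    qed auto
    then have "evalX const (generic_act n (\<lambda>i j l. const (x i j l))) f \<in> Q" if "f \<in> Comm_ideal n" for f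
      using that by (intro eval_Comm_ideal[OF const_hom GL.csubring_axioms _ _ Qid])
        (auto simp: generic_act_eq[symmetric] intro!: generic_act_closed)
    then show "Comm_ideal n \<subseteq> {f \<in> ?X. ?\<phi> f \<in> Q}"
      using Comm_ideal_is_ideal[where 'a = 'k and n = n] by (auto simp: orb_map_def X.is_ideal_def)
    show "Delta n \<notin> {f \<in> ?X. ?\<phi> f \<in> Q}"
    proof
      assume "Delta n \<in> {f \<in> ?X. ?\<phi> f \<in> Q}"
      then have D: "?\<phi> (Delta n) \<in> Q" by simp
      have "1 \<notin> Q" using Q(1) by (simp add: GL.is_prime_def)
      then obtain z :: "coord \<Rightarrow> 'k alg_closure" where z: "\<forall>p\<in>Q. poly_eval to_ac z p = 0"
        using nullstellensatz[OF finite_GLvars Q(1) GL.C_1] by blast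
      have "poly_eval to_ac z ` GL_eqs n \<subseteq> {0}" using z Q(2) by auto
      then have HG: "(\<Sum>l<n. z (Hc a l) * z (Gc l c)) = (if a = c then 1 else 0)" if "a < n" "c < n" for a c
        using that unfolding poly_eval_GL_eqs[OF to_ac_hom] by blast
      have "disc n (act n (\<lambda>i j. z (Gc i j)) (\<lambda>i j. z (Hc i j)) ?tx) = 0"
        using z D poly_eval_orb_map[OF to_ac_hom, of z n x "Delta n"] by (simp add: evalX_Delta[OF to_ac_hom])
      then show False using disc_act_nonzero[OF HG dtx] by simp
    qed
  qed
  have bwd: "\<exists>Q. GL.is_prime Q \<and> GL_eqs n \<subseteq> Q \<and> P = {f \<in> ?X. ?\<phi> f \<in> Q}"
    if P: "X.is_prime P" "Comm_ideal n \<subseteq> P" "Delta n \<notin> P" for P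
  proof -
    have Pid: "X.is_ideal P" and PX: "P \<subseteq> ?X" and P1: "1 \<notin> P" and P0: "0 \<in> P"
      and Pprime: "\<And>a b. a \<in> ?X \<Longrightarrow> b \<in> ?X \<Longrightarrow> a * b \<in> P \<Longrightarrow> a \<in> P \<or> b \<in> P"
      using P(1) by (auto simp: X.is_prime_def X.is_ideal_def)
    define M where "M = ?\<phi> ` (?X - P)"
    have gens: "GL_eqs n \<union> ?\<phi> ` P \<subseteq> ?GL" using GL_eqs_in_polys_in orb_map_closed PX by blast
    define I where "I = Idl\<^bsub>GL.R\<^esub> (GL_eqs n \<union> ?\<phi> ` P)"
    have Iid: "GL.is_ideal I" and Isub: "GL_eqs n \<union> ?\<phi> ` P \<subseteq> I"
      unfolding I_def using GL.Idl_ideal[OF gens] GL.Idl_self[OF gens] by auto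
    \<comment> \<open>Were the image of such an \<open>f\<close> in \<open>I\<close>, take a
      geometric zero of \<open>P\<close> at which \<open>f\<close> and the discriminant are nonzero.
      It is an algebra conjugate to \<open>x\<close>, and the conjugating matrices form a zero of
      \<open>I\<close> at which the image of \<open>f\<close> takes the value of
      \<open>f\<close>.\<close>
    have dis: "?\<phi> f \<notin> I" if f: "f \<in> ?X" "f \<notin> P" for f
    proof
      assume fI: "?\<phi> f \<in> I"
      have "f * Delta n \<notin> P" using Pprime[OF f(1) Delta_in_polys_in] f(2) P(3) by blast
      then obtain y :: "coord \<Rightarrow> 'k alg_closure" where y: "\<forall>p\<in>P. poly_eval to_ac y p = 0"
        "poly_eval to_ac y (f * Delta n) \<noteq> 0"
        using nullstellensatz[OF finite_Xvars P(1) X.C_mult[OF f(1) Delta_in_polys_in]] by blast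
      define \<eta> where "\<eta> i j l = y (Xc i j l)" for i j l
      have ev: "evalX to_ac \<eta> p = poly_eval to_ac y p" if "p \<in> ?X" for p
        unfolding evalX_eq by (rule poly_eval_cong_polys_in[OF that]) (auto simp: Xvars_def \<eta>_def)
      have "evalX to_ac \<eta> ` (assoc_eqs n \<union> comm_eqs n) \<subseteq> {0}"
        using ev y(1) P(2) Comm_ideal_gens[where 'a = 'k and n = n] eqs_in_polys_in[where 'a = 'k and n = n] by (auto simp: subset_iff image_subset_iff)
      then have \<eta>e: "eqs_mod n {0} \<eta>" unfolding eval_eqs[OF to_ac_hom] .
      have "disc n \<eta> = poly_eval to_ac y (Delta n)"
        using ev[OF Delta_in_polys_in] evalX_Delta[OF to_ac_hom, of \<eta> n] by simp
      then have d\<eta>: "disc n \<eta> \<noteq> 0" and yf: "poly_eval to_ac y f \<noteq> 0"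
        using y(2) by (auto simp: h.poly_eval_mult)
      have "eqs_mod n {0} ?tx" by (rule eqs_mod_hom[OF to_ac_hom xe]) simp
      from split_structures_conjugate[OF split_structure_poly[OF this dtx] split_structure_poly[OF \<eta>e d\<eta>]]
      obtain G H where GH: "\<forall>i<n. \<forall>j<n. (\<Sum>l<n. G i l * H l j) = (if i = j then 1 else 0)"
        "\<forall>i<n. \<forall>j<n. (\<Sum>l<n. H i l * G l j) = (if i = j then 1 else 0)"
        "\<forall>i<n. \<forall>j<n. \<forall>l<n. \<eta> i j l = (\<Sum>a<n. \<Sum>b<n. \<Sum>c<n. G l c * ?tx a b c * H a i * H b j)" by blast
      define z where "z v = (case v of Xc _ _ _ \<Rightarrow> 0 | Gc i j \<Rightarrow> G i j | Hc i j \<Rightarrow> H i j)" for v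
      have z: "z (Gc i j) = G i j" "z (Hc i j) = H i j" for i j by (simp_all add: z_def)
      have ev_z: "poly_eval to_ac z (?\<phi> p) = poly_eval to_ac y p" if "p \<in> ?X" for p
        unfolding poly_eval_orb_map[OF to_ac_hom] z ev[OF that, symmetric]
        by (rule evalX_cong[OF that]) (simp add: act_def GH(3))
      have "GL.is_ideal {g \<in> ?GL. poly_eval to_ac z g \<in> {0}}"
        by (rule hom_preimage_ideal[OF h.poly_eval_hom GL.csubring_axioms csubring_UNIV _ zero_ideal_UNIV]) simp
      moreover have "GL_eqs n \<union> ?\<phi> ` P \<subseteq> {g \<in> ?GL. poly_eval to_ac z g \<in> {0}}"
      proof -
        have "poly_eval to_ac z ` GL_eqs n \<subseteq> {0}"
          unfolding poly_eval_GL_eqs[OF to_ac_hom] z using GH(1,2) by blast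
        moreover have "poly_eval to_ac z (?\<phi> p) = 0" if "p \<in> P" for p
          using ev_z y(1) PX that by auto
        ultimately show ?thesis using gens by blast
      qed
      ultimately have "I \<subseteq> {g \<in> ?GL. poly_eval to_ac z g \<in> {0}}"
        unfolding I_def by (rule GL.Idl_minimal)
      then have "poly_eval to_ac z (?\<phi> f) = 0" using fI by auto
      then show False using ev_z[OF f(1)] yf by simp
    qed
    have "\<exists>Q. GL.is_prime Q \<and> I \<subseteq> Q \<and> Q \<inter> M = {}"
    proof (rule GL.prime_avoiding[OF Iid])
      show "M \<subseteq> ?GL" unfolding M_def using orb_map_closed by blast
      show "1 \<in> M" unfolding M_def using P1 X.C_1 by (intro rev_image_eqI[of 1]) auto
      show "I \<inter> M = {}" unfolding M_def using dis by blast
      fix a b assume "a \<in> M" "b \<in> M"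
      then obtain a' b' where ab: "a = ?\<phi> a'" "b = ?\<phi> b'" "a' \<in> ?X - P" "b' \<in> ?X - P" unfolding M_def by blast
      then have "a' * b' \<in> ?X - P" using Pprime[of a' b'] X.C_mult by blast
      then show "a * b \<in> M" unfolding M_def ab by (intro rev_image_eqI[of "a' * b'"]) (auto simp: \<phi>.hom_mult)
    qed
    then obtain Q where Q: "GL.is_prime Q" "I \<subseteq> Q" "Q \<inter> M = {}" by blast
    have "P = {f \<in> ?X. ?\<phi> f \<in> Q}"
    proof (intro equalityI subsetI)
      fix f assume "f \<in> P"
      then show "f \<in> {f \<in> ?X. ?\<phi> f \<in> Q}" using PX Isub Q(2) by blast
    next
      fix f assume "f \<in> {f \<in> ?X. ?\<phi> f \<in> Q}"
      then show "f \<in> P" using Q(3) unfolding M_def by blast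
    qed
    then show ?thesis using Q Isub by blast
  qed
  show ?thesis
  proof (intro equalityI subsetI)
    fix P assume "P \<in> orbit n x"
    then obtain Q where "GL.is_prime Q" "GL_eqs n \<subseteq> Q" "P = {f \<in> ?X. ?\<phi> f \<in> Q}" unfolding orb by blast
    then show "P \<in> {P \<in> closed_subscheme (poly_ring (Xvars n)) (Comm_ideal n). \<not> {Delta n} \<subseteq> P}"
      unfolding cs using fwd[of Q] by simp
  next
    fix P :: "'k cpoly set" assume "P \<in> {P \<in> closed_subscheme (poly_ring (Xvars n)) (Comm_ideal n). \<not> {Delta n} \<subseteq> P}"
    then have "X.is_prime P" "Comm_ideal n \<subseteq> P" "Delta n \<notin> P" unfolding cs by auto
    then obtain Q where "GL.is_prime Q" "GL_eqs n \<subseteq> Q" "P = {f \<in> ?X. ?\<phi> f \<in> Q}" using bwd by blast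
    then show "P \<in> orbit n x" unfolding orb by blast
  qed
qed

section \<open>Tangent spaces\<close>

text \<open>The Casimir contraction in degree 2, applied to the bilinear map with structure
  constants \<open>v\<close>: this cocycle is the coboundary of \<open>\<xi>\<close>, and
  \<open>D\<close> is the matrix of \<open>\<xi>\<close>.\<close>

lemma (in etale_structure) deformation_trivial:
  assumes cocycle: "\<And>i j k m. \<lbrakk>i < n; j < n; k < n; m < n\<rbrakk> \<Longrightarrow>
      (\<Sum>l<n. x i j l * v l k m + v i j l * x l k m) = (\<Sum>l<n. x j k l * v i l m + v j k l * x i l m)"
  shows "\<exists>D. \<forall>i<n. \<forall>j<n. \<forall>l<n. v i j l = (\<Sum>a<n. D a j * x i a l) - (\<Sum>c<n. D l c * x i j c) + (\<Sum>a<n. D a i * x a j l)"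
proof -
  let ?\<nu> = "alg_mult scale n e v"
  let ?P = "\<lambda>a b c. \<mu> a (?\<nu> b c) + ?\<nu> a (\<mu> b c)" and ?Q = "\<lambda>a b c. ?\<nu> (\<mu> a b) c + \<mu> (?\<nu> a b) c"
  note bil = alg_mult_add alg_mult_scale span_add span_scale scale_right_distrib
  have sums: "alg_mult scale n e y (\<Sum>l<n. scale (c l) (e l)) b = (\<Sum>l<n. scale (c l) (alg_mult scale n e y (e l) b))"
    "alg_mult scale n e y b (\<Sum>l<n. scale (c l) (e l)) = (\<Sum>l<n. scale (c l) (alg_mult scale n e y b (e l)))" for y c b
  proof -
    have z: "alg_mult scale n e y 0 b = 0" "alg_mult scale n e y b 0 = 0"
      using alg_mult_scale[where b = 0 and r = 0 and a = b and y = y] by (simp_all add: span_zero)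
    have "alg_mult scale n e y (\<Sum>l\<in>J. scale (c l) (e l)) b = (\<Sum>l\<in>J. scale (c l) (alg_mult scale n e y (e l) b)) \<and>
       alg_mult scale n e y b (\<Sum>l\<in>J. scale (c l) (e l)) = (\<Sum>l\<in>J. scale (c l) (alg_mult scale n e y b (e l)))"
      if "J \<subseteq> {..<n}" for J
      using finite_subset[OF that finite_lessThan] that
      by (induction J rule: finite_induct) (auto simp: z alg_mult_add alg_mult_scale span_sum span_scale subset_iff)
    then show "alg_mult scale n e y (\<Sum>l<n. scale (c l) (e l)) b = (\<Sum>l<n. scale (c l) (alg_mult scale n e y (e l) b))"
      "alg_mult scale n e y b (\<Sum>l<n. scale (c l) (e l)) = (\<Sum>l<n. scale (c l) (alg_mult scale n e y b (e l)))" by auto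
  qed
  have co_sum_e: "m < n \<Longrightarrow> co (\<Sum>l<n. scale (c l) (\<Sum>m<n. scale (y l m) (e m))) m = (\<Sum>l<n. c l * y l m)" for c y m
    by (subst co_sum) (auto simp: span_scale lincomb_in_A co_scale co_lincomb)
  have co_assoc_e: "co (alg_mult scale n e y (e i) (alg_mult scale n e z (e j) (e k))) m = (\<Sum>l<n. z j k l * y i l m)"
    "co (alg_mult scale n e y (alg_mult scale n e z (e i) (e j)) (e k)) m = (\<Sum>l<n. z i j l * y l k m)"
    if "i < n" "j < n" "k < n" "m < n" for y z i j k m
  proof -
    have "alg_mult scale n e y (e i) (alg_mult scale n e z (e j) (e k)) = (\<Sum>l<n. scale (z j k l) (\<Sum>m<n. scale (y i l m) (e m)))"
      unfolding alg_mult_e[OF that(2,3)] sums by (intro sum.cong refl) (simp add: alg_mult_e that)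
    then show "co (alg_mult scale n e y (e i) (alg_mult scale n e z (e j) (e k))) m = (\<Sum>l<n. z j k l * y i l m)"
      by (simp only: co_sum_e[OF that(4)])
    have "alg_mult scale n e y (alg_mult scale n e z (e i) (e j)) (e k) = (\<Sum>l<n. scale (z i j l) (\<Sum>m<n. scale (y l k m) (e m)))"
      unfolding alg_mult_e[OF that(1,2)] sums by (intro sum.cong refl) (simp add: alg_mult_e that)
    then show "co (alg_mult scale n e y (alg_mult scale n e z (e i) (e j)) (e k)) m = (\<Sum>l<n. z i j l * y l k m)"
      by (simp only: co_sum_e[OF that(4)])
  qed
  have PQe: "?P (e i) (e j) (e k) = ?Q (e i) (e j) (e k)" if ijk: "i < n" "j < n" "k < n" for i j k
  proof (rule A_eqI)
    fix m assume m: "m < n"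
    have "co (?P (e i) (e j) (e k)) m = (\<Sum>l<n. v j k l * x i l m) + (\<Sum>l<n. x j k l * v i l m)"
      by (subst co_add) (simp_all only: alg_mult_closed co_assoc_e[OF ijk m])
    also have "\<dots> = (\<Sum>l<n. x j k l * v i l m + v j k l * x i l m)"
      unfolding sum.distrib by (rule add.commute)
    also have "\<dots> = (\<Sum>l<n. x i j l * v l k m + v i j l * x l k m)" by (rule cocycle[OF ijk m, symmetric])
    also have "\<dots> = co (?Q (e i) (e j) (e k)) m"
      unfolding sum.distrib by (subst co_add) (simp_all only: alg_mult_closed co_assoc_e[OF ijk m])
    finally show "co (?P (e i) (e j) (e k)) m = co (?Q (e i) (e j) (e k)) m" .
  qed (simp_all add: span_add)
  have PQ: "?P a b c = ?Q a b c" if abc: "a \<in> A" "b \<in> A" "c \<in> A" for a b c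
  proof -
    have 1: "?P (e i) (e j) c = ?Q (e i) (e j) c" if "i < n" "j < n" for i j
      using abc(3) by (rule linear_ext[where sc = scale and S = "\<lambda>c. ?P (e i) (e j) c" and T = "\<lambda>c. ?Q (e i) (e j) c"])
        (simp_all add: PQe that, simp_all add: bil add_ac)
    have 2: "?P (e i) b c = ?Q (e i) b c" if "i < n" for i
      using abc(2) by (rule linear_ext[where sc = scale and S = "\<lambda>b. ?P (e i) b c" and T = "\<lambda>b. ?Q (e i) b c"])
        (simp_all add: 1 that, simp_all add: bil add_ac)
    show ?thesis
      using abc(1) by (rule linear_ext[where sc = scale and S = "\<lambda>a. ?P a b c" and T = "\<lambda>a. ?Q a b c"])
        (simp_all add: 2, simp_all add: bil add_ac)
  qed
  define \<xi> where "\<xi> a = (\<Sum>i<n. \<mu> (e i) (?\<nu> (d i) a))" for a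
  have \<xi>A: "\<xi> a \<in> A" for a unfolding \<xi>_def by (intro span_sum) simp
  \<comment> \<open>The cocycle identity for \<open>d i\<close>, \<open>a\<close>, \<open>b\<close>
    is multiplied by \<open>e i\<close> and summed; the properties of the Casimir element then solve
    it for the cocycle.\<close>
  have \<nu>_eq: "?\<nu> a b = \<mu> a (\<xi> b) - \<xi> (\<mu> a b) + \<mu> (\<xi> a) b" if ab: "a \<in> A" "b \<in> A" for a b
  proof -
    have "\<mu> (e i) (\<mu> (d i) (?\<nu> a b)) + \<mu> (e i) (?\<nu> (d i) (\<mu> a b)) = \<mu> (e i) (?\<nu> (\<mu> (d i) a) b) + \<mu> (\<mu> (e i) (?\<nu> (d i) a)) b" if "i < n" for i
    proof -
      have "\<mu> (e i) (?P (d i) a b) = \<mu> (e i) (?Q (d i) a b)" using PQ[of "d i" a b] ab by simp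
      then show ?thesis using that ab by (simp add: mult_add_right mult_assoc)
    qed
    then have "(\<Sum>i<n. \<mu> (e i) (\<mu> (d i) (?\<nu> a b))) + \<xi> (\<mu> a b) = (\<Sum>i<n. \<mu> (e i) (?\<nu> (\<mu> (d i) a) b)) + (\<Sum>i<n. \<mu> (\<mu> (e i) (?\<nu> (d i) a)) b)"
      unfolding \<xi>_def sum.distrib[symmetric] by (intro sum.cong) auto
    also have "(\<Sum>i<n. \<mu> (e i) (\<mu> (d i) (?\<nu> a b))) = ?\<nu> a b" by (rule casimir_unit) simp
    also have "(\<Sum>i<n. \<mu> (e i) (?\<nu> (\<mu> (d i) a) b)) = \<mu> a (\<xi> b)"
      unfolding \<xi>_def using ab(1) by (rule casimir_move) (simp_all add: alg_mult_add alg_mult_scale)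
    also have "(\<Sum>i<n. \<mu> (\<mu> (e i) (?\<nu> (d i) a)) b) = \<mu> (\<xi> a) b"
      unfolding \<xi>_def by (rule mult_sum_left[symmetric]) simp
    finally show ?thesis by (simp add: algebra_simps)
  qed
  have \<xi>_add: "\<xi> (a + b) = \<xi> a + \<xi> b" if "a \<in> A" "b \<in> A" for a b
    using that by (simp add: \<xi>_def alg_mult_add sum.distrib)
  have \<xi>_scale: "\<xi> (scale r a) = scale r (\<xi> a)" if "a \<in> A" for r a
    using that by (simp add: \<xi>_def alg_mult_scale scale_sum_right)
  have \<xi>_sum: "\<xi> (\<Sum>c<n. scale (g c) (e c)) = (\<Sum>c<n. scale (g c) (\<xi> (e c)))" for g
  proof -
    have z: "\<xi> 0 = 0" using \<xi>_scale[of 0 0] by (simp add: span_zero)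
    have "\<xi> (\<Sum>c\<in>J. scale (g c) (e c)) = (\<Sum>c\<in>J. scale (g c) (\<xi> (e c)))" if "J \<subseteq> {..<n}" for J
      using finite_subset[OF that finite_lessThan] that
      by (induction J rule: finite_induct) (auto simp: z \<xi>_add \<xi>_scale span_sum span_scale subset_iff)
    then show ?thesis by simp
  qed
  define D where "D a j = co (\<xi> (e j)) a" for a j
  have "v i j l = (\<Sum>a<n. D a j * x i a l) - (\<Sum>c<n. D l c * x i j c) + (\<Sum>a<n. D a i * x a j l)"
    if ijl: "i < n" "j < n" "l < n" for i j l
  proof -
    have one: "(\<Sum>a<n. (if a = k then 1 else 0) * f a) = f k" if "k < n" for k and f :: "nat \<Rightarrow> 'k"
      using that by (simp add: if_distrib[of "\<lambda>u. u * _"] cong: if_cong)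
    have "v i j l = co (?\<nu> (e i) (e j)) l" using ijl by (simp add: alg_mult_e co_lincomb)
    also have "\<dots> = co (\<mu> (e i) (\<xi> (e j))) l - co (\<xi> (\<mu> (e i) (e j))) l + co (\<mu> (\<xi> (e i)) (e j)) l"
      using ijl \<xi>A by (simp add: \<nu>_eq co_add co_diff span_diff)
    also have "co (\<mu> (e i) (\<xi> (e j))) l = (\<Sum>a<n. D a j * x i a l)"
    proof -
      have "co (\<mu> (e i) (\<xi> (e j))) l = (\<Sum>a<n. (if a = i then 1 else 0) * (\<Sum>b<n. D b j * x a b l))"
        using ijl by (simp add: co_mult co_e D_def sum_distrib_left mult.assoc)
      then show ?thesis using one[OF ijl(1)] by simp
    qed
    also have "co (\<xi> (\<mu> (e i) (e j))) l = (\<Sum>c<n. D l c * x i j c)"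
      using ijl by (simp add: mult_e \<xi>_sum co_sum \<xi>A span_scale co_scale D_def mult.commute)
    also have "co (\<mu> (\<xi> (e i)) (e j)) l = (\<Sum>a<n. D a i * x a j l)"
    proof -
      have "co (\<mu> (\<xi> (e i)) (e j)) l = (\<Sum>a<n. D a i * (\<Sum>b<n. (if b = j then 1 else 0) * x a b l))"
        using ijl by (simp add: co_mult co_e D_def sum_distrib_left mult.assoc)
      then show ?thesis using one[OF ijl(2)] by simp
    qed
    finally show ?thesis .
  qed
  then show ?thesis by blast
qed

section \<open>The tangent space of Comm(V) over the dual numbers\<close>

definition dual_ideal :: "'k::field poly set" where "dual_ideal = {p. [:0, 0, 1:] dvd p}"

lemma dual_ideal_iff: "p \<in> dual_ideal \<longleftrightarrow> Polynomial.coeff p 0 = 0 \<and> Polynomial.coeff p 1 = 0"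
proof -
  have "[:0, 0, 1:] = (Polynomial.monom 1 2 :: 'a poly)" by (simp add: monom_altdef power2_eq_square)
  then show ?thesis unfolding dual_ideal_def
    by (auto simp: monom_1_dvd_iff' less_2_cases_iff)
qed

lemma const_poly_hom: "comm_ring_hom (\<lambda>c::'k::field. [:c:])"
  by unfold_locales (simp_all add: one_pCons)

lemma tangent_Comm_iff:
  "v \<in> tangent_space n (Comm_ideal n) x \<longleftrightarrow> v \<in> V21 n \<and> eqs_mod n dual_ideal (\<lambda>i j l. [:x i j l, v i j l:])"
proof -
  interpret U: csubring "UNIV :: 'a poly set" by (rule csubring_UNIV)
  have id: "U.is_ideal (dual_ideal :: 'a poly set)"
    unfolding U.is_ideal_def dual_ideal_def by (auto intro: dvd_add dvd_mult)
  show ?thesis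
    unfolding tangent_space_def
    using eval_Comm_ideal[OF const_poly_hom csubring_UNIV _ _ id, of n "\<lambda>i j l. [:x i j l, v i j l:]"]
      eval_eqs[OF const_poly_hom, of "\<lambda>i j l. [:x i j l, v i j l:]" n dual_ideal] Comm_ideal_gens[of n]
    by (fastforce simp: dual_ideal_def)
qed

text \<open>The constant coefficients vanish because \<open>x\<close> lies in \<open>Comm n\<close>.
  The coefficients of t say that \<open>v\<close> is a symmetric Hochschild 2-cocycle.\<close>

lemma tangent_Comm_eqs:
  assumes "x \<in> Comm n"
  shows "v \<in> tangent_space n (Comm_ideal n) x \<longleftrightarrow> v \<in> V21 n \<and>
    (\<forall>i<n. \<forall>j<n. \<forall>l<n. v i j l = v j i l) \<and>
    (\<forall>i<n. \<forall>j<n. \<forall>k<n. \<forall>m<n. (\<Sum>l<n. x i j l * v l k m + v i j l * x l k m) = (\<Sum>l<n. x j k l * v i l m + v j k l * x i l m))"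
proof -
  note xe = Comm_eqs[OF assms, unfolded eqs_mod_def singleton_iff right_minus_eq]
  have 1: "[:x i j l, v i j l:] - [:x j i l, v j i l:] \<in> dual_ideal \<longleftrightarrow> v i j l = v j i l"
    if "i < n" "j < n" "l < n" for i j l
  proof -
    have "x i j l = x j i l" using xe that by blast
    then show ?thesis by (simp add: dual_ideal_iff)
  qed
  have 2: "(\<Sum>l<n. [:x i j l, v i j l:] * [:x l k m, v l k m:]) - (\<Sum>l<n. [:x j k l, v j k l:] * [:x i l m, v i l m:]) \<in> dual_ideal
     \<longleftrightarrow> (\<Sum>l<n. x i j l * v l k m + v i j l * x l k m) = (\<Sum>l<n. x j k l * v i l m + v j k l * x i l m)"
    if "i < n" "j < n" "k < n" "m < n" for i j k m
  proof -
    have "(\<Sum>l<n. x i j l * x l k m) = (\<Sum>l<n. x j k l * x i l m)" using xe that by blast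
    moreover have c: "Polynomial.coeff ([:a, b:] * [:c, d:]) 0 = a * c" "Polynomial.coeff ([:a, b:] * [:c, d:]) 1 = a * d + b * c"
      for a b c d :: 'a by simp_all
    ultimately show ?thesis unfolding dual_ideal_iff coeff_diff coeff_sum c by simp
  qed
  show ?thesis unfolding tangent_Comm_iff eqs_mod_def by (intro conj_cong refl all_cong 1 2)
qed

lemma tangent_Comm_diff:
  assumes "x \<in> Comm n" "v \<in> tangent_space n (Comm_ideal n) x" "w \<in> tangent_space n (Comm_ideal n) x"
  shows "v - w \<in> tangent_space n (Comm_ideal n) x"
  unfolding tangent_Comm_eqs[OF assms(1)]
proof (intro conjI allI impI)
  note v = assms(2)[unfolded tangent_Comm_eqs[OF assms(1)]] and w = assms(3)[unfolded tangent_Comm_eqs[OF assms(1)]]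
  note vs = v[THEN conjunct2, THEN conjunct1, rule_format] v[THEN conjunct2, THEN conjunct2, rule_format]
  note ws = w[THEN conjunct2, THEN conjunct1, rule_format] w[THEN conjunct2, THEN conjunct2, rule_format]
  have "v \<in> V21 n" "w \<in> V21 n" by (rule v[THEN conjunct1], rule w[THEN conjunct1])
  then show "v - w \<in> V21 n" by (simp add: V21_def)
  show "(v - w) i j l = (v - w) j i l" if "i < n" "j < n" "l < n" for i j l
  proof -
    have "v i j l = v j i l" "w i j l = w j i l" by (rule vs(1)[OF that], rule ws(1)[OF that])
    then show ?thesis by simp
  qed
  show "(\<Sum>l<n. x i j l * (v - w) l k m + (v - w) i j l * x l k m) = (\<Sum>l<n. x j k l * (v - w) i l m + (v - w) j k l * x i l m)"
    if ijkm: "i < n" "j < n" "k < n" "m < n" for i j k m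
  proof -
    have "(\<Sum>l<n. x i j l * (v - w) l k m + (v - w) i j l * x l k m)
      = (\<Sum>l<n. x i j l * v l k m + v i j l * x l k m) - (\<Sum>l<n. x i j l * w l k m + w i j l * x l k m)"
      by (simp add: sum_subtractf[symmetric] algebra_simps)
    also have "(\<Sum>l<n. x i j l * v l k m + v i j l * x l k m) = (\<Sum>l<n. x j k l * v i l m + v j k l * x i l m)"
      by (rule vs(2)[OF ijkm])
    also have "(\<Sum>l<n. x i j l * w l k m + w i j l * x l k m) = (\<Sum>l<n. x j k l * w i l m + w j k l * x i l m)"
      by (rule ws(2)[OF ijkm])
    also have "(\<Sum>l<n. x j k l * v i l m + v j k l * x i l m) - (\<Sum>l<n. x j k l * w i l m + w j k l * x i l m)
      = (\<Sum>l<n. x j k l * (v - w) i l m + (v - w) j k l * x i l m)"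
      by (simp add: sum_subtractf[symmetric] algebra_simps)
    finally show ?thesis .
  qed
qed

lemma zero_in_tangent_Comm: "x \<in> Comm n \<Longrightarrow> (\<lambda>_ _ _. 0) \<in> tangent_space n (Comm_ideal n) x"
  unfolding tangent_Comm_eqs by (simp add: V21_def)

section \<open>A formal curve in the orbit\<close>

lemma hom_poly_eval:
  assumes "comm_ring_hom \<phi>"
  shows "\<phi> (poly_eval h y f) = poly_eval (\<lambda>c. \<phi> (h c)) (\<lambda>v. \<phi> (y v)) f"
proof -
  interpret \<phi>: comm_ring_hom \<phi> by fact
  show ?thesis unfolding poly_eval_def by (simp add: \<phi>.hom_sum \<phi>.hom_mult \<phi>.hom_prod \<phi>.hom_power)
qed

lemma fps_const_hom: "comm_ring_hom (fps_const :: 'k::field \<Rightarrow> 'k fps)"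
  by unfold_locales simp_all

lemma fps_of_poly_hom: "comm_ring_hom (fps_of_poly :: 'k::field poly \<Rightarrow> 'k fps)"
  by unfold_locales (simp_all add: fps_of_poly_add fps_of_poly_mult)

text \<open>The coefficients of the geometric series that inverts \<open>1 - t D\<close>.\<close>

fun mat_power :: "nat \<Rightarrow> (nat \<Rightarrow> nat \<Rightarrow> 'k::comm_ring_1) \<Rightarrow> nat \<Rightarrow> nat \<Rightarrow> nat \<Rightarrow> 'k" where
  "mat_power n D 0 i j = (if i = j then 1 else 0)"
| "mat_power n D (Suc k) i j = (\<Sum>l<n. D i l * mat_power n D k l j)"

lemma mat_power_commute: "i < n \<Longrightarrow> j < n \<Longrightarrow> mat_power n D (Suc k) i j = (\<Sum>l<n. mat_power n D k i l * D l j)"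
proof (induction k arbitrary: i j)
  case 0
  then show ?case by (simp add: if_distrib[of "\<lambda>u. _ * u"] if_distrib[of "\<lambda>u. u * _"] cong: if_cong)
next
  case (Suc k)
  have "mat_power n D (Suc (Suc k)) i j = (\<Sum>l<n. D i l * mat_power n D (Suc k) l j)" by simp
  also have "\<dots> = (\<Sum>l<n. \<Sum>b<n. D i l * mat_power n D k l b * D b j)"
    using Suc by (intro sum.cong refl) (simp add: sum_distrib_left mult.assoc del: mat_power.simps(2))
  also have "\<dots> = (\<Sum>b<n. \<Sum>l<n. D i l * mat_power n D k l b * D b j)" by (rule sum.swap)
  also have "\<dots> = (\<Sum>b<n. mat_power n D (Suc k) i b * D b j)" by (simp add: sum_distrib_right)
  finally show ?case .
qed

text \<open>The one-parameter group \<open>1 - t D\<close> over \<open>k[[t]]\<close>, whose coordinate ring is a domain: the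
  kernel of evaluation at it is a point of \<open>GL(V)\<close>.\<close>

definition curve_G :: "(nat \<Rightarrow> nat \<Rightarrow> 'k::field) \<Rightarrow> nat \<Rightarrow> nat \<Rightarrow> 'k fps" where
  "curve_G D i j = fps_const (if i = j then 1 else 0) - fps_X * fps_const (D i j)"

definition curve_H :: "nat \<Rightarrow> (nat \<Rightarrow> nat \<Rightarrow> 'k::field) \<Rightarrow> nat \<Rightarrow> nat \<Rightarrow> 'k fps" where
  "curve_H n D i j = Abs_fps (\<lambda>k. mat_power n D k i j)"

lemma curve_inverse:
  assumes "i < n" "j < n"
  shows "(\<Sum>l<n. curve_G D i l * curve_H n D l j) = (if i = j then 1 else 0)"
    "(\<Sum>l<n. curve_H n D i l * curve_G D l j) = (if i = j then 1 else 0)"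
proof -
  have delta: "(\<Sum>l<n. fps_const (if i = l then 1 else 0) * f l) = f i" "(\<Sum>l<n. f l * fps_const (if l = j then 1 else 0)) = f j"
    for f :: "nat \<Rightarrow> 'a fps"
    using assms by (simp_all add: if_distrib[of fps_const] if_distrib[of "\<lambda>u. _ * u"] if_distrib[of "\<lambda>u. u * _"] cong: if_cong)
  have "(\<Sum>l<n. curve_G D i l * curve_H n D l j) = curve_H n D i j - fps_X * (\<Sum>l<n. fps_const (D i l) * curve_H n D l j)"
    unfolding curve_G_def left_diff_distrib sum_subtractf delta(1) by (simp add: sum_distrib_left mult.assoc)
  also have "\<dots> = (if i = j then 1 else 0)"
  proof (rule fps_ext)
    fix k show "fps_nth (curve_H n D i j - fps_X * (\<Sum>l<n. fps_const (D i l) * curve_H n D l j)) k = fps_nth (if i = j then 1 else 0) k"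
      by (cases k) (simp_all add: curve_H_def fps_sum_nth)
  qed
  finally show "(\<Sum>l<n. curve_G D i l * curve_H n D l j) = (if i = j then 1 else 0)" .
  have "(\<Sum>l<n. curve_H n D i l * curve_G D l j) = curve_H n D i j - fps_X * (\<Sum>l<n. curve_H n D i l * fps_const (D l j))"
    unfolding curve_G_def right_diff_distrib sum_subtractf delta(2) by (simp add: sum_distrib_left algebra_simps)
  also have "\<dots> = (if i = j then 1 else 0)"
  proof (rule fps_ext)
    fix k show "fps_nth (curve_H n D i j - fps_X * (\<Sum>l<n. curve_H n D i l * fps_const (D l j))) k = fps_nth (if i = j then 1 else 0) k"
      using mat_power_commute[OF assms, of D] by (cases k) (simp_all add: curve_H_def fps_sum_nth del: mat_power.simps(2))
  qed
  finally show "(\<Sum>l<n. curve_H n D i l * curve_G D l j) = (if i = j then 1 else 0)" .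
qed

text \<open>To first order the inverse of \<open>1 - t D\<close> is \<open>1 + t D\<close>, so the
  velocity at 0 is the coboundary of \<open>D\<close> in the form produced by
  \<open>deformation_trivial\<close>. This is the reason for the minus sign in the curve.\<close>

lemma act_curve:
  assumes "i < n" "j < n" "l < n"
  shows "fps_nth (act n (curve_G D) (curve_H n D) (\<lambda>a b c. fps_const (x a b c)) i j l) 0 = x i j l"
    "fps_nth (act n (curve_G D) (curve_H n D) (\<lambda>a b c. fps_const (x a b c)) i j l) 1
      = (\<Sum>a<n. D a j * x i a l) - (\<Sum>c<n. D l c * x i j c) + (\<Sum>a<n. D a i * x a j l)"
proof -
  let ?\<delta> = "\<lambda>i j. (if i = j then 1 else 0) :: 'a"
  have G: "fps_nth (curve_G D i j) 0 = ?\<delta> i j" "fps_nth (curve_G D i j) 1 = - D i j" for i j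
    by (simp_all add: curve_G_def)
  have H: "fps_nth (curve_H n D i j) 0 = ?\<delta> i j" "i < n \<Longrightarrow> j < n \<Longrightarrow> fps_nth (curve_H n D i j) 1 = D i j" for i j
    by (simp_all add: curve_H_def if_distrib[of "\<lambda>u. _ * u"] cong: if_cong)
  have dl: "(\<Sum>c<n. ?\<delta> l c * f c) = f l" if "l < n" for l and f :: "nat \<Rightarrow> 'a"
    using that by (simp add: if_distrib[of "\<lambda>u. u * _"] cong: if_cong)
  have dr: "(\<Sum>a<n. f a * ?\<delta> a i) = f i" if "i < n" for i and f :: "nat \<Rightarrow> 'a"
    using that by (simp add: if_distrib[of "\<lambda>u. _ * u"] cong: if_cong)
  have "fps_nth (act n (curve_G D) (curve_H n D) (\<lambda>a b c. fps_const (x a b c)) i j l) 0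
    = (\<Sum>a<n. (\<Sum>b<n. (\<Sum>c<n. ?\<delta> l c * x a b c) * ?\<delta> b j) * ?\<delta> a i)"
    unfolding act_def fps_sum_nth by (simp add: G H sum_distrib_left sum_distrib_right mult.assoc mult.commute mult.left_commute)
  then show "fps_nth (act n (curve_G D) (curve_H n D) (\<lambda>a b c. fps_const (x a b c)) i j l) 0 = x i j l"
    using assms by (simp only: dl dr)
  have "fps_nth (curve_G D l c * fps_const (x a b c) * curve_H n D a i * curve_H n D b j) 1
     = ?\<delta> l c * x a b c * ?\<delta> a i * D b j - D l c * x a b c * ?\<delta> a i * ?\<delta> b j + ?\<delta> l c * x a b c * D a i * ?\<delta> b j"
    if "a < n" "b < n" "c < n" for a b c
    using that assms G H by (simp only: fps_mult_nth_1 fps_mult_nth_0 fps_nth_fps_const) (simp add: algebra_simps)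
  then have "fps_nth (act n (curve_G D) (curve_H n D) (\<lambda>a b c. fps_const (x a b c)) i j l) 1
     = (\<Sum>a<n. \<Sum>b<n. \<Sum>c<n. ?\<delta> l c * x a b c * ?\<delta> a i * D b j - D l c * x a b c * ?\<delta> a i * ?\<delta> b j + ?\<delta> l c * x a b c * D a i * ?\<delta> b j)"
    unfolding act_def fps_sum_nth by (intro sum.cong refl) simp
  also have "\<dots> = (\<Sum>a<n. (\<Sum>b<n. (\<Sum>c<n. ?\<delta> l c * x a b c) * D b j) * ?\<delta> a i)
     - (\<Sum>a<n. (\<Sum>b<n. (\<Sum>c<n. D l c * x a b c) * ?\<delta> b j) * ?\<delta> a i)
     + (\<Sum>a<n. (\<Sum>b<n. (\<Sum>c<n. ?\<delta> l c * x a b c) * ?\<delta> b j) * D a i)"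
    by (simp only: sum.distrib sum_subtractf sum_distrib_right) (simp only: ac_simps)
  also have "\<dots> = (\<Sum>a<n. D a j * x i a l) - (\<Sum>c<n. D l c * x i j c) + (\<Sum>a<n. D a i * x a j l)"
    using assms by (simp only: dl dr) (simp only: mult.commute)
  finally show "fps_nth (act n (curve_G D) (curve_H n D) (\<lambda>a b c. fps_const (x a b c)) i j l) 1 = \<dots>" .
qed

text \<open>One inclusion holds because the ideal of Comm(V) lies in every prime of the orbit. For
  the other, a function that vanishes on the orbit vanishes along the curve, in particular to first
  order, and the first-order part of the curve is the given tangent vector.\<close>

lemma tangent_eq:
  fixes x :: "nat \<Rightarrow> nat \<Rightarrow> nat \<Rightarrow> 'k::field_char_0"
  assumes E: "etale_structure scale n e x" and x: "x \<in> Comm n" and dx: "disc n x \<noteq> 0"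
  shows "tangent_space n (Comm_ideal n) x = orbit_tangent_space n x"
proof (intro equalityI subsetI)
  fix v assume "v \<in> orbit_tangent_space n x"
  moreover have "Comm_ideal n \<subseteq> \<Inter> (orbit n x)"
    unfolding orbit_eq[OF x dx] closed_subscheme_def by blast
  ultimately show "v \<in> tangent_space n (Comm_ideal n) x"
    unfolding orbit_tangent_space_def tangent_space_def by blast
next
  fix v assume v: "v \<in> tangent_space n (Comm_ideal n) x"
  let ?X = "polys_in (Xvars n) :: 'k cpoly set" and ?GL = "polys_in (GLvars n) :: 'k cpoly set"
  interpret X: csubring ?X by (rule csubring_polys_in)
  interpret GL: csubring ?GL by (rule csubring_polys_in)
  interpret U: csubring "UNIV :: 'k fps set" by (rule csubring_UNIV)
  interpret h: comm_ring_hom "fps_const :: 'k \<Rightarrow> 'k fps" by (rule fps_const_hom)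
  obtain D where D: "\<forall>i<n. \<forall>j<n. \<forall>l<n. v i j l = (\<Sum>a<n. D a j * x i a l) - (\<Sum>c<n. D l c * x i j c) + (\<Sum>a<n. D a i * x a j l)"
    using etale_structure.deformation_trivial[OF E, of v] v unfolding tangent_Comm_eqs[OF x] by blast
  define z where "z w = (case w of Xc _ _ _ \<Rightarrow> 0 | Gc i j \<Rightarrow> curve_G D i j | Hc i j \<Rightarrow> curve_H n D i j)" for w
  have z: "z (Gc i j) = curve_G D i j" "z (Hc i j) = curve_H n D i j" for i j by (simp_all add: z_def)
  let ?ev = "poly_eval fps_const z"
  define Q where "Q = {q \<in> ?GL. ?ev q \<in> {0}}"
  have Q: "GL.is_prime Q" unfolding Q_def
    by (rule hom_preimage_prime[OF h.poly_eval_hom GL.csubring_axioms csubring_UNIV _ zero_prime_UNIV]) simp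
  have "?ev ` GL_eqs n \<subseteq> {0}"
    unfolding poly_eval_GL_eqs[OF fps_const_hom] z using curve_inverse by blast
  then have "GL_eqs n \<subseteq> Q" unfolding Q_def using GL_eqs_in_polys_in by blast
  then have orb: "{f \<in> ?X. orb_map n x f \<in> Q} \<in> orbit n x"
    using Q unfolding orbit_def closed_subscheme_def orb_map_def poly_ring_eq GL.prime_iff by auto
  \<comment> \<open>The power series divisible by t^2; modulo these the curve is
    \<open>x + t v\<close>.\<close>
  let ?J = "{F :: 'k fps. fps_nth F 0 = 0 \<and> fps_nth F 1 = 0}"
  have J: "U.is_ideal ?J" unfolding U.is_ideal_def by (auto simp: fps_mult_nth_1)
  let ?Y = "act n (curve_G D) (curve_H n D) (\<lambda>a b c. fps_const (x a b c))"
  have "[:0, 0, 1:] dvd evalX (\<lambda>c. [:c:]) (\<lambda>i j l. [:x i j l, v i j l:]) f" if f: "f \<in> \<Inter> (orbit n x)" for f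
  proof -
    have fX: "f \<in> ?X" and "orb_map n x f \<in> Q" using f orb by auto
    then have "evalX fps_const ?Y f = 0"
      using poly_eval_orb_map[OF fps_const_hom, of z n x f] by (simp add: Q_def z)
    moreover have "evalX fps_const ?Y f - evalX fps_const (\<lambda>i j l. fps_of_poly [:x i j l, v i j l:]) f \<in> ?J"
      unfolding evalX_eq
    proof (rule poly_eval_cong_mod[OF fps_const_hom J _ fX])
      fix w assume "w \<in> Xvars n"
      then obtain i j l where w: "w = Xc i j l" "i < n" "j < n" "l < n" by (auto simp: Xvars_def)
      show "Xval ?Y w - Xval (\<lambda>i j l. fps_of_poly [:x i j l, v i j l:]) w \<in> ?J"
        using act_curve[OF w(2-4), of D x] D w(2-4) by (simp add: w(1))
    qed
    moreover have "evalX fps_const (\<lambda>i j l. fps_of_poly [:x i j l, v i j l:]) f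
       = fps_of_poly (evalX (\<lambda>c. [:c:]) (\<lambda>i j l. [:x i j l, v i j l:]) f)"
    proof -
      have 1: "(\<lambda>w. fps_of_poly (Xval (\<lambda>i j l. [:x i j l, v i j l:]) w)) = Xval (\<lambda>i j l. fps_of_poly [:x i j l, v i j l:])"
        by (rule HOL.ext) (simp add: Xval_def split: coord.splits)
      have 2: "(\<lambda>c::'k. fps_of_poly [:c:]) = fps_const" by (rule HOL.ext) (simp add: fps_of_poly_const)
      show ?thesis unfolding evalX_eq hom_poly_eval[OF fps_of_poly_hom] 1 2 ..
    qed
    ultimately have "evalX (\<lambda>c. [:c:]) (\<lambda>i j l. [:x i j l, v i j l:]) f \<in> dual_ideal"
      unfolding dual_ideal_iff by simp
    then show ?thesis by (simp add: dual_ideal_def)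
  qed
  then show "v \<in> orbit_tangent_space n x"
    using v unfolding orbit_tangent_space_def tangent_space_def by blast
qed

section \<open>Invariants\<close>

lemma monom_val_pvar: "monom_val pvar m = (Poly_Mapping.single m 1 :: 'k::comm_ring_1 cpoly)"
proof -
  have "(\<Prod>v\<in>S. Poly_Mapping.single (g v) 1) = (Poly_Mapping.single (sum g S) 1 :: 'k cpoly)"
    if "finite S" for S :: "coord set" and g
    using that by (induction S rule: finite_induct) (simp_all add: mult_single)
  then have "monom_val pvar m = (Poly_Mapping.single (\<Sum>v\<in>Poly_Mapping.keys m. Poly_Mapping.single v (Poly_Mapping.lookup m v)) 1 :: 'k cpoly)"
    unfolding monom_val_def pvar_power by simp
  also have "(\<Sum>v\<in>Poly_Mapping.keys m. Poly_Mapping.single v (Poly_Mapping.lookup m v)) = m"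
    by (rule poly_mapping_eqI) (auto simp: lookup_sum lookup_single when_def in_keys_iff)
  finally show ?thesis .
qed

lemma single_eq_const_mult: "Poly_Mapping.single m c = const c * monom_val pvar m" for c :: "'k::comm_ring_1"
  by (simp add: monom_val_pvar const_def mult_single)

lemma poly_eval_pvar_id: "poly_eval const pvar f = (f :: 'k::comm_ring_1 cpoly)"
proof -
  have "poly_eval const pvar f = (\<Sum>m\<in>Poly_Mapping.keys f. Poly_Mapping.single m (Poly_Mapping.lookup f m))"
    unfolding poly_eval_def monom_val_def[symmetric] single_eq_const_mult ..
  then show ?thesis by (simp add: cpoly_expand[symmetric])
qed

definition mdeg :: "(coord \<Rightarrow>\<^sub>0 nat) \<Rightarrow> nat" where
  "mdeg m = (\<Sum>v\<in>Poly_Mapping.keys m. Poly_Mapping.lookup m v)"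

lemma monom_val_dilate: "monom_val (\<lambda>v. c * y v) m = c ^ mdeg m * monom_val y m"
  by (simp add: monom_val_def mdeg_def power_mult_distrib prod.distrib power_sum)

lemma mdeg_eq_0: "mdeg m = 0 \<longleftrightarrow> m = 0"
  by (auto simp: mdeg_def in_keys_iff intro!: poly_mapping_eqI)

text \<open>\<open>g d\<close> is the homogeneous component of degree \<open>d\<close>.\<close>

lemma poly_eval_dilate:
  fixes f :: "'k::field cpoly"
  shows "\<exists>N g. g 0 = const (Poly_Mapping.lookup f 0) \<and>
    (\<forall>b. poly_eval const (\<lambda>v. const b * pvar v) f = (\<Sum>d\<le>N. const (b ^ d) * g d))"
proof -
  interpret c: comm_ring_hom "const :: 'k \<Rightarrow> 'k cpoly" by (rule const_hom)
  define K where "K = Poly_Mapping.keys f"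
  define N where "N = (\<Sum>m\<in>K. mdeg m)"
  define g where "g d = (\<Sum>m\<in>{m \<in> K. mdeg m = d}. Poly_Mapping.single m (Poly_Mapping.lookup f m))" for d
  have fin: "finite K" by (simp add: K_def)
  have le: "mdeg m \<le> N" if "m \<in> K" for m
    unfolding N_def by (rule member_le_sum) (use that fin in auto)
  have "g 0 = const (Poly_Mapping.lookup f 0)"
  proof -
    have "g 0 = (\<Sum>m\<in>{m \<in> K. m = 0}. Poly_Mapping.single m (Poly_Mapping.lookup f m))"
      by (simp add: g_def mdeg_eq_0)
    also have "\<dots> = (\<Sum>m\<in>{0}. Poly_Mapping.single m (Poly_Mapping.lookup f m))"
      by (rule sum.mono_neutral_left) (auto simp: K_def in_keys_iff)
    finally show ?thesis by (simp add: const_def)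
  qed
  moreover have "poly_eval const (\<lambda>v. const b * pvar v) f = (\<Sum>d\<le>N. const (b ^ d) * g d)" for b
  proof -
    have "poly_eval const (\<lambda>v. const b * pvar v) f
        = (\<Sum>m\<in>K. const (b ^ mdeg m) * Poly_Mapping.single m (Poly_Mapping.lookup f m))"
      unfolding poly_eval_def monom_val_def[symmetric] monom_val_dilate single_eq_const_mult K_def
      by (simp add: c.hom_power mult.left_commute)
    also have "\<dots> = (\<Sum>d\<le>N. \<Sum>m\<in>{m \<in> K. mdeg m = d}. const (b ^ mdeg m) * Poly_Mapping.single m (Poly_Mapping.lookup f m))"
      by (rule sum.group[symmetric]) (use fin le in auto)
    also have "\<dots> = (\<Sum>d\<le>N. const (b ^ d) * g d)"
      by (simp add: g_def sum_distrib_left)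
    finally show ?thesis .
  qed
  ultimately show ?thesis by blast
qed

text \<open>Replacing \<open>b\<close> by \<open>2 b\<close> and subtracting \<open>2\<^sup>N\<close> times the original eliminates the top term.\<close>

lemma dilation_constant_term:
  fixes I :: "'k::field_char_0 cpoly set"
  assumes add: "\<And>f g. f \<in> I \<Longrightarrow> g \<in> I \<Longrightarrow> f + g \<in> I" and scale: "\<And>c f. f \<in> I \<Longrightarrow> const c * f \<in> I"
    and g: "\<And>b. b \<noteq> 0 \<Longrightarrow> (\<Sum>d\<le>N. const (b ^ d) * g d) \<in> I"
  shows "g 0 \<in> I"
  using g
proof (induction N arbitrary: g)
  case 0
  then show ?case using "0.prems"[of 1] comm_ring_hom.axioms const_hom[where 'k = 'k]
    by (simp add: const_def)
next
  case (Suc N)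
  interpret c: comm_ring_hom "const :: 'k \<Rightarrow> 'k cpoly" by (rule const_hom)
  define g' where "g' d = const (2 ^ d - 2 ^ Suc N) * g d" for d
  have "(\<Sum>d\<le>N. const (b ^ d) * g' d) \<in> I" if b: "b \<noteq> 0" for b
  proof -
    have "(\<Sum>d\<le>Suc N. const ((2 * b) ^ d) * g d) + const (- (2 ^ Suc N)) * (\<Sum>d\<le>Suc N. const (b ^ d) * g d)
       = (\<Sum>d\<le>Suc N. const ((2 * b) ^ d) * g d + const (- (2 ^ Suc N)) * (const (b ^ d) * g d))"
      unfolding sum_distrib_left sum.distrib ..
    also have "\<dots> = (\<Sum>d\<le>Suc N. const (b ^ d) * g' d)"
    proof (intro sum.cong refl)
      fix d
      have "const ((2 * b) ^ d) * g d + const (- (2 ^ Suc N)) * (const (b ^ d) * g d)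
         = const ((2 * b) ^ d + - (2 ^ Suc N) * b ^ d) * g d"
        unfolding c.hom_add c.hom_mult by (simp only: distrib_right mult.assoc)
      also have "(2 * b) ^ d + - (2 ^ Suc N) * b ^ d = b ^ d * (2 ^ d - 2 ^ Suc N)"
        by (simp add: power_mult_distrib algebra_simps)
      finally show "const ((2 * b) ^ d) * g d + const (- (2 ^ Suc N)) * (const (b ^ d) * g d) = const (b ^ d) * g' d"
        unfolding g'_def c.hom_mult by (simp only: mult.assoc)
    qed
    also have "\<dots> = (\<Sum>d\<le>N. const (b ^ d) * g' d)" by (simp add: g'_def)
    finally show ?thesis
      by (rule subst[where P = "\<lambda>h. h \<in> I"]) (rule add[OF Suc.prems scale[OF Suc.prems[OF b]]], simp add: b)
  qed
  then have "g' 0 \<in> I" by (rule Suc.IH)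
  then have "const (inverse (1 - 2 ^ Suc N)) * g' 0 \<in> I" by (rule scale)
  \<comment> \<open>\<open>g' 0\<close> is \<open>g 0\<close> times \<open>1 - 2 ^ Suc N\<close>,
    which is nonzero in characteristic 0, so \<open>g 0\<close> can be recovered.\<close>
  moreover have "(2::'k) ^ Suc N \<noteq> 1"
  proof -
    have "(2::nat) ^ Suc N \<noteq> 1" by simp
    then have "(of_nat (2 ^ Suc N) :: 'k) \<noteq> of_nat 1" unfolding of_nat_eq_iff .
    then show ?thesis by simp
  qed
  then have "(inverse (1 - 2 ^ Suc N)) * (2 ^ 0 - 2 ^ Suc N) = (1::'k)" by simp
  then have "const (inverse (1 - 2 ^ Suc N)) * g' 0 = g 0"
    unfolding g'_def mult.assoc[symmetric] c.hom_mult[symmetric] by (simp only: c.hom_one mult_1_left)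
  ultimately show ?case by simp
qed

section \<open>The coaction and the ring of invariants\<close>

definition coaction :: "nat \<Rightarrow> 'k::field cpoly \<Rightarrow> 'k cpoly" where
  "coaction n = evalX const (generic_act n (\<lambda>i j l. pvar (Xc i j l)))"

text \<open>The ideal of the product of GL(V) and Comm(V).\<close>

definition GLComm_ideal :: "nat \<Rightarrow> 'k::field cpoly set" where
  "GLComm_ideal n = Idl\<^bsub>poly_ring (Xvars n \<union> GLvars n)\<^esub> (GL_eqs n \<union> assoc_eqs n \<union> comm_eqs n)"

lemma coaction_hom: "comm_ring_hom (coaction n)"
  unfolding coaction_def by (rule evalX_hom, rule const_hom)

lemma coaction_closed: "f \<in> polys_in (Xvars n) \<Longrightarrow> coaction n f \<in> polys_in (Xvars n \<union> GLvars n)"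
  unfolding coaction_def by (rule evalX_closed[OF csubring_polys_in]) (auto intro!: generic_act_closed)

lemma carrier_invariants: "carrier (invariants n) = {f \<in> polys_in (Xvars n). coaction n f - f \<in> GLComm_ideal n}"
  by (simp add: invariants_def coaction_def GLComm_ideal_def)

lemma invariants_eq: "invariants n = type_ring\<lparr>carrier := carrier (invariants n)\<rparr>"
  by (simp add: invariants_def poly_ring_def)

lemma GLComm_gens: "GL_eqs n \<union> assoc_eqs n \<union> comm_eqs n \<subseteq> polys_in (Xvars n \<union> GLvars n)"
  using GL_eqs_in_polys_in eqs_in_polys_in polys_in_mono[of "Xvars n" "Xvars n \<union> GLvars n"] polys_in_mono[of "GLvars n" "Xvars n \<union> GLvars n"]
  by blast

lemma GLComm_ideal_is_ideal: "csubring.is_ideal (polys_in (Xvars n \<union> GLvars n)) (GLComm_ideal n :: 'k::field cpoly set)"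
  and GLComm_ideal_gens: "GL_eqs n \<union> assoc_eqs n \<union> comm_eqs n \<subseteq> (GLComm_ideal n :: 'k cpoly set)"
proof -
  interpret csubring "polys_in (Xvars n \<union> GLvars n) :: 'k cpoly set" by (rule csubring_polys_in)
  show "is_ideal (GLComm_ideal n :: 'k cpoly set)" "GL_eqs n \<union> assoc_eqs n \<union> comm_eqs n \<subseteq> (GLComm_ideal n :: 'k cpoly set)"
    unfolding GLComm_ideal_def poly_ring_eq using Idl_ideal[OF GLComm_gens] Idl_self[OF GLComm_gens] by auto
qed

lemma Comm_ideal_subset_GLComm: "Comm_ideal n \<subseteq> (GLComm_ideal n :: 'k::field cpoly set)"
proof -
  let ?X = "polys_in (Xvars n) :: 'k cpoly set" and ?XG = "polys_in (Xvars n \<union> GLvars n) :: 'k cpoly set"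
  interpret X: csubring ?X by (rule csubring_polys_in)
  interpret XG: csubring ?XG by (rule csubring_polys_in)
  have "X.is_ideal {f \<in> ?X. f \<in> GLComm_ideal n}"
    by (rule hom_preimage_ideal[OF id_hom X.csubring_axioms XG.csubring_axioms _ GLComm_ideal_is_ideal])
      (use polys_in_mono[of "Xvars n" "Xvars n \<union> GLvars n"] in auto)
  moreover have "assoc_eqs n \<union> comm_eqs n \<subseteq> {f \<in> ?X. f \<in> GLComm_ideal n}"
    using GLComm_ideal_gens[where 'k = 'k and n = n] eqs_in_polys_in[where 'a = 'k and n = n] by blast
  ultimately have "Comm_ideal n \<subseteq> {f \<in> ?X. f \<in> GLComm_ideal n}"
    unfolding Comm_ideal_def poly_ring_eq by (rule X.Idl_minimal)
  then show ?thesis by blast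
qed

lemma csubring_invariants: "csubring (carrier (invariants n) :: 'k::field cpoly set)"
proof -
  let ?X = "polys_in (Xvars n) :: 'k cpoly set" and ?XG = "polys_in (Xvars n \<union> GLvars n) :: 'k cpoly set"
  interpret X: csubring ?X by (rule csubring_polys_in)
  interpret XG: csubring ?XG by (rule csubring_polys_in)
  interpret co: comm_ring_hom "coaction n :: 'k cpoly \<Rightarrow> 'k cpoly" by (rule coaction_hom)
  note J = GLComm_ideal_is_ideal[where 'k = 'k and n = n]
  have XXG: "f \<in> ?XG" if "f \<in> ?X" for f using that polys_in_mono[of "Xvars n" "Xvars n \<union> GLvars n"] by blast
  show ?thesis
  proof
    show "(1 :: 'k cpoly) \<in> carrier (invariants n)" using J by (simp add: carrier_invariants X.C_1 XG.is_ideal_def)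
    fix a assume "a \<in> (carrier (invariants n) :: 'k cpoly set)"
    then have a: "a \<in> ?X" "coaction n a - a \<in> GLComm_ideal n" by (simp_all add: carrier_invariants)
    have "- (coaction n a - a) \<in> GLComm_ideal n" by (rule XG.ideal_neg[OF J a(2)])
    then show "- a \<in> carrier (invariants n)" using a X.C_neg by (simp add: carrier_invariants co.hom_uminus)
    fix b assume "b \<in> (carrier (invariants n) :: 'k cpoly set)"
    then have b: "b \<in> ?X" "coaction n b - b \<in> GLComm_ideal n" by (simp_all add: carrier_invariants)
    have "(coaction n a - a) + (coaction n b - b) \<in> GLComm_ideal n" by (rule XG.ideal_add[OF J a(2) b(2)])
    then show "a + b \<in> carrier (invariants n)" using a b X.C_add by (simp add: carrier_invariants co.hom_add algebra_simps)
    \<comment> \<open>The deviation of \<open>a * b\<close> from invariance, written through those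
      of \<open>a\<close> and \<open>b\<close>.\<close>
    have "coaction n a * (coaction n b - b) + b * (coaction n a - a) \<in> GLComm_ideal n"
      by (intro XG.ideal_add[OF J] XG.ideal_mult(1)[OF J] a b coaction_closed XXG)
    then show "a * b \<in> carrier (invariants n)" using a b X.C_mult by (simp add: carrier_invariants co.hom_mult algebra_simps)
  qed
qed

lemma const_invariant: "const c \<in> carrier (invariants n :: 'k::field cpoly ring)"
proof -
  interpret XG: csubring "polys_in (Xvars n \<union> GLvars n) :: 'k cpoly set" by (rule csubring_polys_in)
  have "coaction n (const c) = const c"
    unfolding coaction_def evalX_eq by (rule comm_ring_hom.poly_eval_const[OF const_hom])
  then show ?thesis using GLComm_ideal_is_ideal[where 'k = 'k and n = n] by (simp add: carrier_invariants XG.is_ideal_def)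
qed

text \<open>The action preserves Comm(V), so the coaction sends its equations into the ideal of the
  product; both terms of the difference that defines invariance are then zero there.\<close>

lemma Comm_ideal_invariant: "Comm_ideal n \<subseteq> carrier (invariants n :: 'k::field cpoly ring)"
proof
  let ?X = "polys_in (Xvars n) :: 'k cpoly set" and ?XG = "polys_in (Xvars n \<union> GLvars n) :: 'k cpoly set"
  interpret X: csubring ?X by (rule csubring_polys_in)
  interpret XG: csubring ?XG by (rule csubring_polys_in)
  note J = GLComm_ideal_is_ideal[where 'k = 'k and n = n]
  fix f :: "'k cpoly" assume f: "f \<in> Comm_ideal n"
  have fX: "f \<in> ?X" using f Comm_ideal_is_ideal[where 'a = 'k and n = n] unfolding X.is_ideal_def by blast
  have gen: "g \<in> GLComm_ideal n" if "g \<in> GL_eqs n \<or> g \<in> assoc_eqs n \<or> g \<in> comm_eqs n" for g :: "'k cpoly"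
    using that GLComm_ideal_gens[where 'k = 'k and n = n] by blast
  have "eqs_mod n (GLComm_ideal n) (\<lambda>i j l. pvar (Xc i j l) :: 'k cpoly)"
    unfolding eqs_mod_def by (intro conjI allI impI gen) (unfold assoc_eqs_def comm_eqs_def, blast+)
  then have "eqs_mod n (GLComm_ideal n) (act n (\<lambda>i j. pvar (Gc i j)) (\<lambda>i j. pvar (Hc i j)) (\<lambda>i j l. pvar (Xc i j l) :: 'k cpoly))"
  proof (rule act_eqs[OF XG.csubring_axioms J, rotated 4])
    show "(\<Sum>l<n. pvar (Hc a l) * pvar (Gc l c)) - (if a = c then 1 else 0) \<in> (GLComm_ideal n :: 'k cpoly set)"
      if "a < n" "c < n" for a c
      using that by (intro gen) (unfold GL_eqs_def, blast)
  qed auto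
  then have "coaction n f \<in> GLComm_ideal n"
    unfolding coaction_def
    by (intro eval_Comm_ideal[OF const_hom XG.csubring_axioms _ _ J _ f])
      (auto simp: generic_act_eq[symmetric] intro!: generic_act_closed)
  then have "coaction n f - f \<in> GLComm_ideal n"
    using f Comm_ideal_subset_GLComm by (blast intro: XG.ideal_diff[OF J])
  then show "f \<in> carrier (invariants n)" using fX by (simp add: carrier_invariants)
qed

text \<open>The homothety by \<open>1 / b\<close> multiplies all structure constants by \<open>b\<close>.\<close>

lemma invariant_dilate:
  assumes f: "f \<in> carrier (invariants n :: 'k::field cpoly ring)" and b: "b \<noteq> 0"
  shows "poly_eval const (\<lambda>v. const b * pvar v) f - f \<in> Comm_ideal n"
proof -
  let ?X = "polys_in (Xvars n) :: 'k cpoly set" and ?XG = "polys_in (Xvars n \<union> GLvars n) :: 'k cpoly set"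
  interpret X: csubring ?X by (rule csubring_polys_in)
  interpret XG: csubring ?XG by (rule csubring_polys_in)
  interpret c: comm_ring_hom "const :: 'k \<Rightarrow> 'k cpoly" by (rule const_hom)
  have fX: "f \<in> ?X" and fJ: "coaction n f - f \<in> GLComm_ideal n" using f by (simp_all add: carrier_invariants)
  \<comment> \<open>Specialises the generic matrix to the homothety by \<open>inverse b\<close> and
    leaves the structure constants untouched.\<close>
  define z where "z v = (case v of Xc i j l \<Rightarrow> pvar (Xc i j l)
     | Gc i j \<Rightarrow> (if i = j then const (inverse b) else 0) | Hc i j \<Rightarrow> (if i = j then const b else 0))" for v
  have z: "z (Xc i j l) = pvar (Xc i j l)" "z (Gc i j) = (if i = j then const (inverse b) else 0)"
    "z (Hc i j) = (if i = j then const b else 0)" for i j l by (simp_all add: z_def)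
  interpret \<rho>: comm_ring_hom "poly_eval const z" by (rule c.poly_eval_hom)
  have bb: "const b * const (inverse b) = 1" "const (inverse b) * const b = 1"
    using b by (simp_all add: c.hom_mult[symmetric])
  have \<rho>X: "poly_eval const z g = g" if "g \<in> ?X" for g
  proof -
    have "poly_eval const z g = poly_eval const pvar g"
      using that by (rule poly_eval_cong_polys_in) (auto simp: Xvars_def z)
    then show ?thesis by (simp add: poly_eval_pvar_id)
  qed
  have "z v \<in> ?X" if "v \<in> Xvars n \<union> GLvars n" for v
    using that X.C_0 by (cases v) (auto simp: GLvars_def z)
  then have closed: "poly_eval const z ` ?XG \<subseteq> ?X"
    by (intro image_subsetI poly_eval_closed[OF X.csubring_axioms const_in_polys_in])
  have C0: "0 \<in> (Comm_ideal n :: 'k cpoly set)" using Comm_ideal_is_ideal[where 'a = 'k and n = n] unfolding X.is_ideal_def by blast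
  have "poly_eval const z ` GL_eqs n \<subseteq> {0}"
    unfolding poly_eval_GL_eqs[OF const_hom] z
    by (auto simp: if_distrib[of "\<lambda>u. _ * u"] if_distrib[of "\<lambda>u. u * _"] bb cong: if_cong)
  then have "GL_eqs n \<union> assoc_eqs n \<union> comm_eqs n \<subseteq> {g \<in> ?XG. poly_eval const z g \<in> Comm_ideal n}"
    using C0 GLComm_gens[where 'a = 'k and n = n] \<rho>X eqs_in_polys_in[where 'a = 'k and n = n] Comm_ideal_gens[where 'a = 'k and n = n]
    by (auto simp: subset_iff image_subset_iff)
  moreover have "XG.is_ideal {g \<in> ?XG. poly_eval const z g \<in> Comm_ideal n}"
    by (rule hom_preimage_ideal[OF \<rho>.comm_ring_hom_axioms XG.csubring_axioms X.csubring_axioms closed Comm_ideal_is_ideal])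
  ultimately have "GLComm_ideal n \<subseteq> {g \<in> ?XG. poly_eval const z g \<in> Comm_ideal n}"
    unfolding GLComm_ideal_def poly_ring_eq by (intro XG.Idl_minimal)
  then have "poly_eval const z (coaction n f - f) \<in> Comm_ideal n" using fJ by blast
  moreover have "poly_eval const z (coaction n f) = poly_eval const (\<lambda>v. const b * pvar v) f"
  proof -
    have s1: "(\<Sum>c<n. (if l = c then K else 0) * f c * w * w') = K * f l * w * w'" if "l < n" for l K w w' and f :: "nat \<Rightarrow> 'k cpoly"
      using that by (simp add: if_distrib[of "\<lambda>u. u * _"] cong: if_cong)
    have s2: "(\<Sum>a<n. K * f a * w a * (if a = i then B else 0)) = K * f i * w i * B" if "i < n" for i K w B and f :: "nat \<Rightarrow> 'k cpoly"
      using that by (simp add: if_distrib[of "\<lambda>u. _ * u"] cong: if_cong)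
    have s3: "(\<Sum>a<n. K * f a * (if a = i then B else 0) * B') = K * f i * B * B'" if "i < n" for i K B B' and f :: "nat \<Rightarrow> 'k cpoly"
      using that by (simp add: if_distrib[of "\<lambda>u. _ * u"] if_distrib[of "\<lambda>u. u * _"] cong: if_cong)
    have "act n (\<lambda>i j. z (Gc i j)) (\<lambda>i j. z (Hc i j)) (\<lambda>a b c. pvar (Xc a b c)) i j l = const b * pvar (Xc i j l)"
      if "i < n" "j < n" "l < n" for i j l
    proof -
      \<comment> \<open>Each of the two inverse matrices contributes \<open>b\<close> and the matrix
        itself \<open>inverse b\<close>, so one factor \<open>b\<close> remains.\<close>
      have "act n (\<lambda>i j. z (Gc i j)) (\<lambda>i j. z (Hc i j)) (\<lambda>a b c. pvar (Xc a b c)) i j l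
        = const (inverse b) * pvar (Xc i j l) * const b * const b"
        unfolding act_def z(2,3) s1[OF that(3)] s2[OF that(2), where w = "\<lambda>_. _"] s3[OF that(1)] ..
      also have "\<dots> = (const (inverse b) * const b) * const b * pvar (Xc i j l)" by (simp only: ac_simps)
      finally show ?thesis by (simp add: bb)
    qed
    then show ?thesis
      unfolding coaction_def poly_eval_evalX[OF const_hom] poly_eval_generic_act[OF const_hom] c.poly_eval_pvar z(1)
      unfolding evalX_eq
      using fX by (intro poly_eval_cong_polys_in) (auto simp: Xvars_def)
  qed
  ultimately show ?thesis by (simp add: \<rho>.hom_minus \<rho>X[OF fX])
qed

text \<open>Modulo the ideal an invariant equals all its dilates, so only its homogeneous component
  of degree 0 survives.\<close>

lemma invariant_decompose:
  assumes f: "f \<in> carrier (invariants n :: 'k::field_char_0 cpoly ring)"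
  shows "\<exists>c. f - const c \<in> Comm_ideal n"
proof -
  let ?X = "polys_in (Xvars n) :: 'k cpoly set"
  interpret X: csubring ?X by (rule csubring_polys_in)
  note I = Comm_ideal_is_ideal[where 'a = 'k and n = n]
  obtain N g where g: "g 0 = const (Poly_Mapping.lookup f 0)"
    "\<And>b. poly_eval const (\<lambda>v. const b * pvar v) f = (\<Sum>d\<le>N. const (b ^ d) * g d)"
    using poly_eval_dilate[of f] by blast
  \<comment> \<open>Putting \<open>f\<close> into the component of degree 0 makes the difference
    between a dilate and \<open>f\<close> a polynomial in \<open>b\<close> whose values at nonzero
    \<open>b\<close> lie in the ideal.\<close>
  let ?g = "\<lambda>d. g d - (if d = 0 then f else 0)"
  have c1: "const 1 = (1 :: 'k cpoly)" by (simp add: const_def)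
  have "?g 0 \<in> Comm_ideal n"
  proof (rule dilation_constant_term[where g = ?g and N = N])
    fix b :: 'k assume "b \<noteq> 0"
    have "(\<Sum>d\<le>N. const (b ^ d) * ?g d) = (\<Sum>d\<le>N. const (b ^ d) * g d) - f"
      by (simp add: right_diff_distrib sum_subtractf if_distrib[of "\<lambda>u. _ * u"] c1 cong: if_cong)
    then show "(\<Sum>d\<le>N. const (b ^ d) * ?g d) \<in> Comm_ideal n"
      using invariant_dilate[OF f \<open>b \<noteq> 0\<close>] g(2) by simp
  qed (use X.ideal_add[OF I] X.ideal_mult(1)[OF I] in auto)
  then have "- ?g 0 \<in> Comm_ideal n" by (rule X.ideal_neg[OF I])
  then show ?thesis using g(1) by auto
qed

text \<open>Modulo the ideal every invariant is a constant, and a nonzero constant is a unit, which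
  no prime contains.\<close>

lemma invariants_prime:
  assumes P: "csubring.is_prime (carrier (invariants n)) (P :: 'k::field_char_0 cpoly set)" "Comm_ideal n \<subseteq> P"
  shows "P = Comm_ideal n"
proof
  interpret Inv: csubring "carrier (invariants n) :: 'k cpoly set" by (rule csubring_invariants)
  have Pid: "Inv.is_ideal P" and P1: "1 \<notin> P" using P(1) by (auto simp: Inv.is_prime_def)
  show "P \<subseteq> Comm_ideal n"
  proof
    fix f assume f: "f \<in> P"
    then have "f \<in> carrier (invariants n)" using Pid unfolding Inv.is_ideal_def by blast
    then obtain c where c: "f - const c \<in> Comm_ideal n" using invariant_decompose by blast
    have "f - (f - const c) \<in> P" using f c P(2) by (blast intro: Inv.ideal_diff[OF Pid])
    then have "const (inverse c) * const c \<in> P"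
      by (intro Inv.ideal_mult(1)[OF Pid]) (simp_all add: const_invariant)
    moreover have "const (inverse c) * const c = 1" if "c \<noteq> 0"
      using that by (simp add: const_def mult_single)
    ultimately have "c = 0" using P1 by metis
    then show "f \<in> Comm_ideal n" using c by (simp add: const_def)
  qed
qed (rule P(2))

text \<open>Evaluation at \<open>x\<close> supplies a prime, and by \<open>invariants_prime\<close>
  there is at most one.\<close>

lemma moduli_closed_subscheme:
  fixes x :: "nat \<Rightarrow> nat \<Rightarrow> nat \<Rightarrow> 'k::field_char_0"
  assumes x: "x \<in> Comm n"
  shows "closed_subscheme (invariants n) (Comm_ideal n) = {moduli_point n x}"
proof -
  interpret Inv: csubring "carrier (invariants n) :: 'k cpoly set" by (rule csubring_invariants)
  have prime: "primeideal P (invariants n) \<longleftrightarrow> Inv.is_prime P" for P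
    by (subst invariants_eq) (rule Inv.prime_iff)
  have "Inv.is_prime {f \<in> carrier (invariants n). evalX (\<lambda>c. c) x f \<in> {0}}"
    by (rule hom_preimage_prime[OF evalX_hom[OF id_hom] Inv.csubring_axioms csubring_UNIV _ zero_prime_UNIV]) simp
  then have "Inv.is_prime (moduli_point n x)" by (simp add: moduli_point_def)
  moreover have "Comm_ideal n \<subseteq> moduli_point n x"
    using x Comm_ideal_invariant[where 'k = 'k and n = n] by (auto simp: moduli_point_def Comm_def)
  ultimately show ?thesis
    unfolding closed_subscheme_def prime using invariants_prime[of n] by blast
qed

theorem theorem1p11:
  fixes scale :: "'k::field_char_0 \<Rightarrow> 'v::ab_group_add \<Rightarrow> 'v"
    and n :: nat
    and e :: "nat \<Rightarrow> 'v"
    and x :: "nat \<Rightarrow> nat \<Rightarrow> nat \<Rightarrow> 'k"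
  assumes "vector_space scale"
    and "is_basis scale n e"
    and "x \<in> U_Comm scale n e"
  shows "finite_etale scale (alg_mult scale n e x) \<and>
    (\<forall>m>0. HH scale (alg_mult scale n e x) m =
             {coboundaries scale (alg_mult scale n e x) (cochains scale) m}) \<and>
    (\<forall>m>0. Harr scale (alg_mult scale n e x) m =
             {coboundaries scale (alg_mult scale n e x) (harrison_cochains scale) m}) \<and>
    tangent_space n (Comm_ideal n) x = orbit_tangent_space n x \<and>
    stack_tangent_space n x = {orbit_tangent_space n x} \<and>
    zariski_open (poly_ring (Xvars n)) (Comm_ideal n) (orbit n x) \<and>
    zariski_open (invariants n) (Comm_ideal n) {moduli_point n x}"
proof -
  interpret vector_space scale by fact
  have x: "x \<in> Comm n" and discr: "discr scale n e x \<noteq> 0" using assms(3) by (auto simp: U_Comm_def)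
  note xe = Comm_eqs[OF x, unfolded eqs_mod_def singleton_iff right_minus_eq]
  interpret etale_structure_char_0 scale n e x
    using assms(2) discr
    by unfold_locales
      (simp_all only: is_basis_def xe[THEN conjunct1, rule_format] xe[THEN conjunct2, rule_format] not_False_eq_True simp_thms)
  have A: "A = UNIV" using assms(2) by (simp add: is_basis_def)
  have AI: "a \<in> A" for a using A by simp
  have dx: "disc n x \<noteq> 0" using discr discr_eq_disc by simp
  interpret sp: char_0_space scale by unfold_locales
  \<comment> \<open>With \<open>A\<close> the whole type, the laws relative to \<open>A\<close>
    become those of the cohomological part. The Casimir element is formed from \<open>e\<close> and
    its dual basis \<open>d\<close>.\<close>
  interpret S: separable_algebra scale "alg_mult scale n e x" "{..<n}" e d
  proof
    show "\<mu> a (b + c) = \<mu> a b + \<mu> a c" "\<mu> a b = \<mu> b a" "\<mu> a (scale r b) = scale r (\<mu> a b)"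
      "\<mu> (\<mu> a b) c = \<mu> a (\<mu> b c)" "(\<Sum>i<n. \<mu> (e i) (\<mu> (d i) b)) = b" for a b c r
      by (rule mult_add_right[OF AI AI] mult_commute mult_scale_right[OF AI] mult_assoc[OF AI AI AI] casimir_unit[OF AI])+
    show "(\<Sum>i<n. \<mu> (e i) (\<phi> (\<mu> (d i) a))) = \<mu> a (\<Sum>i<n. \<mu> (e i) (\<phi> (d i)))"
      if "sp.lin \<phi>" for \<phi> a
      by (rule casimir_move) (use that AI in \<open>simp_all add: sp.lin_def\<close>)
  qed
  have T: "tangent_space n (Comm_ideal n) x = orbit_tangent_space n x"
    by (rule tangent_eq[OF etale_structure_axioms x dx])
  \<comment> \<open>The tangent space of Comm(V) divided by itself has only one coset.\<close>
  have "stack_tangent_space n x = {tangent_space n (Comm_ideal n) x}"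
    unfolding stack_tangent_space_def T[symmetric]
    using zero_in_tangent_Comm[OF x] tangent_Comm_diff[OF x] by (intro quotient_space_trivial) auto
  moreover have "zariski_open (poly_ring (Xvars n)) (Comm_ideal n) (orbit n x)"
    unfolding zariski_open_def orbit_eq[OF x dx] by (rule exI[of _ "{Delta n}"]) (simp add: Delta_in_polys_in)
  moreover have "zariski_open (invariants n) (Comm_ideal n) {moduli_point n x}"
    unfolding zariski_open_def moduli_closed_subscheme[OF x, symmetric]
  \<comment> \<open>The moduli point is the whole space, which is open as the locus where 1 does not
    vanish.\<close>
  proof (intro exI[of _ "{1}"] conjI)
    show "{1} \<subseteq> carrier (invariants n :: 'k cpoly ring)"
      using csubring.C_1[OF csubring_invariants] by simp
    have "1 \<notin> P" if "primeideal P (invariants n)" for P :: "'k cpoly set"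
      using that csubring.prime_iff[OF csubring_invariants[where 'k = 'k and n = n], of P]
      by (subst (asm) invariants_eq) (simp add: csubring.is_prime_def[OF csubring_invariants])
    then show "closed_subscheme (invariants n) (Comm_ideal n)
      = {P \<in> closed_subscheme (invariants n) (Comm_ideal n). \<not> {1 :: 'k cpoly} \<subseteq> P}"
      by (auto simp: closed_subscheme_def)
  qed
  ultimately show ?thesis using finite_etale[OF A] S.cohomology_trivial T by simp
qed

end
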